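(* Let $\Delta$ be a split polar space of rank $n\ge 4$ over a field $\mathbb{K}$. Let $\theta$ be a point-domestic collineation of $\Delta$ with no fixed points. Then $n$ is even, and $\Delta$ is either a symplectic polar space (type $\mathsf{C}_n$) or a hyperbolic polar space (type $\mathsf{D}_n$), and $\theta$ has opposition diagram $\mathsf{C}_{n;n/2}^2$ or $\mathsf{D}_{n;n/2}^2$, respectively. Moreover, the fixed element structure of $\theta$ is either (1) a symplectic polar space over a quadratic extension of $\mathbb{K}$, or (2) a minimal Hermitian polar space, or a mixed polar space, respectively. In each case, the points of the fixed element structure are the lines of $\Delta$ that are fixed by $\theta$.
   Context: Split polar spaces of rank $n$ over a commutative field $\mathbb K$ are: parabolic (quadric $X_{-n}X_n+\cdots+X_{-1}X_1=X_0^2$ in $\mathrm{PG}(2n,\mathbb K)$), symplectic (all points of $\mathrm{PG}(2n-1,\mathbb K)$, singular subspaces totally isotropic for a nondegenerate alternating form), and hyperbolic (quadric $X_{-n}X_n+\cdots+X_{-1}X_1=0$ in $\mathrm{PG}(2n-1,\mathbb K)$). Points are opposite iff non-collinear; singular subspaces $X,Y$ are opposite iff they have the same projective dimension and every point of $X$ is opposite some point of $Y$. A collineation is point-domestic if it maps no point to an opposite point. $\mathrm{Diag}(\theta)=\mathsf X_{n;n/2}^2$ means that for $k\in\{1,\dots,n\}$, $\theta$ maps some singular subspace of projective dimension $k-1$ to an opposite one if and only if $k$ is even. The fixed element structure of $\theta$ is the geometry consisting of all singular subspaces of $\Delta$ fixed by $\theta$, with fixed lines as points and each fixed singular subspace regarded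 as the set of fixed lines in it. A Hermitian polar space of rank $m$ (from a nondegenerate $\sigma$-Hermitian form, $\sigma$ a field involution) is minimal if its ambient projective space has dimension $2m-1$. A mixed polar space of rank $m$ is a polar space of rank $m$ which is a proper subspace of a symplectic polar space of rank $m$ (characteristic 2). Quadratic extensions need not be separable. *)

theory Defs
  imports "HOL-Algebra.Embedded_Algebras" "HOL-Algebra.QuotRing" "HOL-Algebra.Module"
begin

section \<open>Point-line geometries and polar spaces\<close>

text \<open>
  The blocks of a geometry are its lines, except for the geometries \<open>singular_geometry\<close> and
  \<open>fixed_structure\<close> below, whose blocks are all singular subspaces.
\<close>

record 'p geometry =
  points :: "'p set"
  blocks :: "'p set set"

definition geometry_iso :: "('p \<Rightarrow> 'q) \<Rightarrow> 'p geometry \<Rightarrow> 'q geometry \<Rightarrow> bool" where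
  "geometry_iso \<phi> G H \<longleftrightarrow>
     bij_betw \<phi> (points G) (points H) \<and> (\<lambda>b. \<phi> ` b) ` blocks G = blocks H"

definition isomorphic :: "'p geometry \<Rightarrow> 'q geometry \<Rightarrow> bool" where
  "isomorphic G H \<longleftrightarrow> blocks G \<subseteq> Pow (points G) \<and> (\<exists>\<phi>. geometry_iso \<phi> G H)"

definition collineation :: "'p geometry \<Rightarrow> ('p \<Rightarrow> 'p) \<Rightarrow> bool" where
  "collineation G \<theta> \<longleftrightarrow> geometry_iso \<theta> G G"

definition collinear :: "'p geometry \<Rightarrow> 'p \<Rightarrow> 'p \<Rightarrow> bool" where
  "collinear G x y \<longleftrightarrow> x = y \<or> (\<exists>l\<in>blocks G. x \<in> l \<and> y \<in> l)"

definition geom_subspace :: "'p geometry \<Rightarrow> 'p set \<Rightarrow> bool" where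
  "geom_subspace G S \<longleftrightarrow> S \<subseteq> points G \<and>
     (\<forall>l\<in>blocks G. (\<exists>x\<in>l \<inter> S. \<exists>y\<in>l \<inter> S. x \<noteq> y) \<longrightarrow> l \<subseteq> S)"

definition singular_subspace :: "'p geometry \<Rightarrow> 'p set \<Rightarrow> bool" where
  "singular_subspace G S \<longleftrightarrow> geom_subspace G S \<and> (\<forall>x\<in>S. \<forall>y\<in>S. collinear G x y)"

definition generated :: "'p geometry \<Rightarrow> 'p set \<Rightarrow> 'p set" where
  "generated G A = \<Inter> {S. geom_subspace G S \<and> A \<subseteq> S}"

definition finitely_generated :: "'p geometry \<Rightarrow> 'p set \<Rightarrow> bool" where
  "finitely_generated G S \<longleftrightarrow> (\<exists>A\<subseteq>S. finite A \<and> generated G A = S)"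

text \<open>Only meaningful for finitely generated \<open>S\<close>; the empty subspace has dimension \<open>-1\<close>.\<close>

definition proj_dim :: "'p geometry \<Rightarrow> 'p set \<Rightarrow> int" where
  "proj_dim G S = int (LEAST k. \<exists>A\<subseteq>S. finite A \<and> card A = k \<and> generated G A = S) - 1"

text \<open>The Buekenhout--Shult axioms, in rank \<open>m \<ge> 2\<close>; finiteness of the rank is expressed by the
  bound on the dimension of singular subspaces.\<close>

definition polar_space :: "nat \<Rightarrow> 'p geometry \<Rightarrow> bool" where
  "polar_space m G \<longleftrightarrow>
     (\<forall>l\<in>blocks G. l \<subseteq> points G \<and> (\<exists>x\<in>l. \<exists>y\<in>l. \<exists>z\<in>l. x \<noteq> y \<and> y \<noteq> z \<and> x \<noteq> z)) \<and>
     (\<forall>x\<in>points G. \<exists>y\<in>points G. \<not> collinear G x y) \<and>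
     (\<forall>x\<in>points G. \<forall>l\<in>blocks G. x \<notin> l \<longrightarrow>
        (\<exists>!y. y \<in> l \<and> collinear G x y) \<or> (\<forall>y\<in>l. collinear G x y)) \<and>
     (\<forall>S. singular_subspace G S \<longrightarrow> finitely_generated G S \<and> proj_dim G S \<le> int m - 1) \<and>
     (\<exists>S. singular_subspace G S \<and> proj_dim G S = int m - 1)"

definition induced_geometry :: "'p geometry \<Rightarrow> 'p set \<Rightarrow> 'p geometry" where
  "induced_geometry G S = \<lparr>points = S, blocks = {l \<in> blocks G. l \<subseteq> S}\<rparr>"

definition singular_geometry :: "'p geometry \<Rightarrow> 'p geometry" where
  "singular_geometry G = \<lparr>points = points G, blocks = {S. singular_subspace G S}\<rparr>"

section \<open>Opposition and fixed elements\<close>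

definition opposite_points :: "'p geometry \<Rightarrow> 'p \<Rightarrow> 'p \<Rightarrow> bool" where
  "opposite_points G x y \<longleftrightarrow> \<not> collinear G x y"

definition opposite_subspaces :: "'p geometry \<Rightarrow> 'p set \<Rightarrow> 'p set \<Rightarrow> bool" where
  "opposite_subspaces G X Y \<longleftrightarrow>
     proj_dim G X = proj_dim G Y \<and> (\<forall>x\<in>X. \<exists>y\<in>Y. opposite_points G x y)"

definition point_domestic :: "'p geometry \<Rightarrow> ('p \<Rightarrow> 'p) \<Rightarrow> bool" where
  "point_domestic G \<theta> \<longleftrightarrow> (\<forall>x\<in>points G. \<not> opposite_points G x (\<theta> x))"

text \<open>
  The diagram \<open>X\<^sup>2\<close> with indices \<open>n\<close> and \<open>n/2\<close>, where \<open>X\<close> is the type (\<open>C\<close> or \<open>D\<close>)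
  of the polar space \<open>G\<close> of rank \<open>n\<close>.
\<close>

definition opposition_diagram_2 :: "nat \<Rightarrow> 'p geometry \<Rightarrow> ('p \<Rightarrow> 'p) \<Rightarrow> bool" where
  "opposition_diagram_2 n G \<theta> \<longleftrightarrow>
     (\<forall>k\<in>{1..n}.
        (\<exists>X. singular_subspace G X \<and> proj_dim G X = int k - 1 \<and> opposite_subspaces G X (\<theta> ` X))
        \<longleftrightarrow> even k)"

definition fixed_lines :: "'p geometry \<Rightarrow> ('p \<Rightarrow> 'p) \<Rightarrow> 'p set set" where
  "fixed_lines G \<theta> = {l \<in> blocks G. \<theta> ` l = l}"

definition fixed_structure :: "'p geometry \<Rightarrow> ('p \<Rightarrow> 'p) \<Rightarrow> 'p set geometry" where
  "fixed_structure G \<theta> =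
     \<lparr>points = fixed_lines G \<theta>,
      blocks = {{l \<in> fixed_lines G \<theta>. l \<subseteq> X} | X. singular_subspace G X \<and> \<theta> ` X = X}\<rparr>"

section \<open>Projective spaces with coordinates\<close>

text \<open>\<open>coord_space R I\<close> is the module of \<open>I\<close>-indexed tuples; the fields \<open>mult\<close> and \<open>one\<close>
  of a module record are irrelevant.\<close>

definition coord_space :: "('a, 'b) ring_scheme \<Rightarrow> int set \<Rightarrow> ('a, int \<Rightarrow> 'a) module" where
  "coord_space R I =
     \<lparr>carrier = I \<rightarrow>\<^sub>E carrier R, mult = undefined, one = undefined,
      zero = (\<lambda>i\<in>I. \<zero>\<^bsub>R\<^esub>), add = (\<lambda>u v. \<lambda>i\<in>I. u i \<oplus>\<^bsub>R\<^esub> v i),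
      smult = (\<lambda>c v. \<lambda>i\<in>I. c \<otimes>\<^bsub>R\<^esub> v i)\<rparr>"

lemma coord_space_module:
  assumes "cring R"
  shows "module R (coord_space R I)"
proof -
  interpret cring R by fact
  show ?thesis
  proof (rule moduleI)
    show "abelian_group (coord_space R I)"
    proof (rule abelian_groupI)
      fix x assume x: "x \<in> carrier (coord_space R I)"
      show "\<exists>y\<in>carrier (coord_space R I). y \<oplus>\<^bsub>coord_space R I\<^esub> x = \<zero>\<^bsub>coord_space R I\<^esub>"
        by (rule bexI[of _ "\<lambda>i\<in>I. \<ominus>\<^bsub>R\<^esub> x i"])
          (use x in \<open>auto simp: coord_space_def fun_eq_iff PiE_iff l_neg\<close>)
    qed (auto simp: coord_space_def fun_eq_iff PiE_iff extensional_def a_ac)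
  qed (auto simp: coord_space_def fun_eq_iff PiE_iff extensional_def m_assoc l_distr r_distr
        intro: is_cring assms)
qed

text \<open>Points of the projective space are the one-dimensional subspaces.\<close>

definition pspan :: "('a, 'b) ring_scheme \<Rightarrow> ('a, 'v, 'c) module_scheme \<Rightarrow> 'v \<Rightarrow> 'v set" where
  "pspan R M v = {c \<odot>\<^bsub>M\<^esub> v | c. c \<in> carrier R}"

definition pg_points :: "('a, 'b) ring_scheme \<Rightarrow> ('a, 'v, 'c) module_scheme \<Rightarrow> 'v set set" where
  "pg_points R M = pspan R M ` (carrier M - {\<zero>\<^bsub>M\<^esub>})"

definition pg_lines :: "('a, 'b) ring_scheme \<Rightarrow> ('a, 'v, 'c) module_scheme \<Rightarrow> 'v set set set" where
  "pg_lines R M = {{p \<in> pg_points R M. p \<subseteq> x <+>\<^bsub>M\<^esub> y} | x y.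
     x \<in> pg_points R M \<and> y \<in> pg_points R M \<and> x \<noteq> y}"

definition quadric ::
  "('a, 'b) ring_scheme \<Rightarrow> ('a, 'v, 'c) module_scheme \<Rightarrow> ('v \<Rightarrow> 'a) \<Rightarrow> 'v set geometry" where
  "quadric R M q = induced_geometry \<lparr>points = pg_points R M, blocks = pg_lines R M\<rparr>
     {pspan R M v | v. v \<in> carrier M - {\<zero>\<^bsub>M\<^esub>} \<and> q v = \<zero>\<^bsub>R\<^esub>}"

definition isotropic_geometry ::
  "('a, 'b) ring_scheme \<Rightarrow> ('a, 'v, 'c) module_scheme \<Rightarrow> ('v \<Rightarrow> 'v \<Rightarrow> 'a) \<Rightarrow> 'v set geometry" where
  "isotropic_geometry R M f =
     \<lparr>points = {x \<in> pg_points R M. \<forall>u\<in>x. \<forall>v\<in>x. f u v = \<zero>\<^bsub>R\<^esub>},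
      blocks = {l \<in> pg_lines R M. \<forall>u\<in>\<Union>l. \<forall>v\<in>\<Union>l. f u v = \<zero>\<^bsub>R\<^esub>}\<rparr>"

definition sesquilinear_form ::
  "('a, 'b) ring_scheme \<Rightarrow> ('a, 'v, 'c) module_scheme \<Rightarrow> ('a \<Rightarrow> 'a) \<Rightarrow> ('v \<Rightarrow> 'v \<Rightarrow> 'a) \<Rightarrow> bool" where
  "sesquilinear_form R M \<sigma> f \<longleftrightarrow>
     (\<forall>u\<in>carrier M. \<forall>v\<in>carrier M. f u v \<in> carrier R) \<and>
     (\<forall>u\<in>carrier M. \<forall>v\<in>carrier M. \<forall>w\<in>carrier M.
        f (u \<oplus>\<^bsub>M\<^esub> v) w = f u w \<oplus>\<^bsub>R\<^esub> f v w \<and> f u (v \<oplus>\<^bsub>M\<^esub> w) = f u v \<oplus>\<^bsub>R\<^esub> f u w) \<and>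
     (\<forall>c\<in>carrier R. \<forall>u\<in>carrier M. \<forall>v\<in>carrier M.
        f (c \<odot>\<^bsub>M\<^esub> u) v = c \<otimes>\<^bsub>R\<^esub> f u v \<and> f u (c \<odot>\<^bsub>M\<^esub> v) = \<sigma> c \<otimes>\<^bsub>R\<^esub> f u v)"

definition alternating_form ::
  "('a, 'b) ring_scheme \<Rightarrow> ('a, 'v, 'c) module_scheme \<Rightarrow> ('v \<Rightarrow> 'v \<Rightarrow> 'a) \<Rightarrow> bool" where
  "alternating_form R M f \<longleftrightarrow>
     sesquilinear_form R M (\<lambda>c. c) f \<and> (\<forall>v\<in>carrier M. f v v = \<zero>\<^bsub>R\<^esub>)"

definition field_involution :: "('a, 'b) ring_scheme \<Rightarrow> ('a \<Rightarrow> 'a) \<Rightarrow> bool" where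
  "field_involution R \<sigma> \<longleftrightarrow> \<sigma> \<in> ring_iso R R \<and>
     (\<forall>a\<in>carrier R. \<sigma> (\<sigma> a) = a) \<and> (\<exists>a\<in>carrier R. \<sigma> a \<noteq> a)"

definition hermitian_form ::
  "('a, 'b) ring_scheme \<Rightarrow> ('a, 'v, 'c) module_scheme \<Rightarrow> ('a \<Rightarrow> 'a) \<Rightarrow> ('v \<Rightarrow> 'v \<Rightarrow> 'a) \<Rightarrow> bool" where
  "hermitian_form R M \<sigma> f \<longleftrightarrow> sesquilinear_form R M \<sigma> f \<and>
     (\<forall>u\<in>carrier M. \<forall>v\<in>carrier M. f v u = \<sigma> (f u v))"

definition nondegenerate ::
  "('a, 'b) ring_scheme \<Rightarrow> ('a, 'v, 'c) module_scheme \<Rightarrow> ('v \<Rightarrow> 'v \<Rightarrow> 'a) \<Rightarrow> bool" where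
  "nondegenerate R M f \<longleftrightarrow>
     (\<forall>u\<in>carrier M. (\<forall>v\<in>carrier M. f u v = \<zero>\<^bsub>R\<^esub>) \<longrightarrow> u = \<zero>\<^bsub>M\<^esub>)"

section \<open>Families of polar spaces, up to isomorphism\<close>

definition hyperbolic_polar_space :: "('a, 'b) ring_scheme \<Rightarrow> nat \<Rightarrow> 'p geometry \<Rightarrow> bool" where
  "hyperbolic_polar_space K n G \<longleftrightarrow>
     isomorphic G (quadric K (coord_space K ({- int n..int n} - {0}))
       (\<lambda>v. \<Oplus>\<^bsub>K\<^esub>i\<in>{1..int n}. v (- i) \<otimes>\<^bsub>K\<^esub> v i))"

definition parabolic_polar_space :: "('a, 'b) ring_scheme \<Rightarrow> nat \<Rightarrow> 'p geometry \<Rightarrow> bool" where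
  "parabolic_polar_space K n G \<longleftrightarrow>
     isomorphic G (quadric K (coord_space K {- int n..int n})
       (\<lambda>v. (\<Oplus>\<^bsub>K\<^esub>i\<in>{1..int n}. v (- i) \<otimes>\<^bsub>K\<^esub> v i) \<ominus>\<^bsub>K\<^esub> v 0 \<otimes>\<^bsub>K\<^esub> v 0))"

definition symplectic_polar_space :: "('a, 'b) ring_scheme \<Rightarrow> nat \<Rightarrow> 'p geometry \<Rightarrow> bool" where
  "symplectic_polar_space K n G \<longleftrightarrow>
     (let V = coord_space K {1..2 * int n} in
      \<exists>f. alternating_form K V f \<and> nondegenerate K V f \<and> isomorphic G (isotropic_geometry K V f))"

definition split_polar_space :: "('a, 'b) ring_scheme \<Rightarrow> nat \<Rightarrow> 'p geometry \<Rightarrow> bool" where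
  "split_polar_space K n G \<longleftrightarrow>
     parabolic_polar_space K n G \<or> symplectic_polar_space K n G \<or> hyperbolic_polar_space K n G"

text \<open>A Hermitian polar space of rank \<open>m\<close> whose ambient projective space has dimension \<open>d\<close>.\<close>

definition hermitian_polar_space ::
  "('a, 'b) ring_scheme \<Rightarrow> nat \<Rightarrow> int \<Rightarrow> 'p geometry \<Rightarrow> bool" where
  "hermitian_polar_space F m d G \<longleftrightarrow> polar_space m G \<and>
     (let V = coord_space F {0..d} in
      \<exists>\<sigma> f. field_involution F \<sigma> \<and> hermitian_form F V \<sigma> f \<and> nondegenerate F V f \<and>
        isomorphic G (isotropic_geometry F V f))"

definition minimal_hermitian_polar_space ::
  "('a, 'b) ring_scheme \<Rightarrow> nat \<Rightarrow> 'p geometry \<Rightarrow> bool" where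
  "minimal_hermitian_polar_space F m G \<longleftrightarrow> hermitian_polar_space F m (2 * int m - 1) G"

definition mixed_polar_space :: "('a, 'b) ring_scheme \<Rightarrow> nat \<Rightarrow> 'p geometry \<Rightarrow> bool" where
  "mixed_polar_space F m G \<longleftrightarrow> polar_space m G \<and> \<one>\<^bsub>F\<^esub> \<oplus>\<^bsub>F\<^esub> \<one>\<^bsub>F\<^esub> = \<zero>\<^bsub>F\<^esub> \<and>
     (\<exists>(W :: (int \<Rightarrow> 'a) set geometry) S. symplectic_polar_space F m W \<and>
        geom_subspace W S \<and> S \<noteq> points W \<and> isomorphic G (induced_geometry W S))"

text \<open>
  Every quadratic extension of \<open>K :: ('a, 'b) ring_scheme\<close> has an isomorphic copy of type
  \<open>('a \<times> 'a) ring\<close>. Separability is not required.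
\<close>

definition quadratic_extension :: "('a, 'b) ring_scheme \<Rightarrow> ('c, 'd) ring_scheme \<Rightarrow> bool" where
  "quadratic_extension K L \<longleftrightarrow> field L \<and>
     (\<exists>h\<in>ring_hom K L. ring.dimension L 2 (h ` carrier K) (carrier L))"

end

theory Submission imports Defs begin

text \<open>
  Work with vectors, and let \<open>t v\<close> span the image of the point of \<open>v\<close>. Domesticity, \<open>v \<perp> t v\<close>,
  polarises to \<open>u \<perp> t v \<longleftrightarrow> v \<perp> t u\<close>, and in rank at least 4 this forces \<open>t (t v)\<close> onto the line
  joining \<open>v\<close> and \<open>t v\<close>. So that line is fixed, and since there are no fixed points, the fixed lines
  partition the points. Consequently subspaces opposite their images have even dimension and can be
  enlarged two dimensions at a time, up to a maximal singular subspace \<open>X\<close>; hence \<open>n\<close> is even and the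
  diagram is as claimed. The sum \<open>X + t X\<close> has dimension \<open>2 n\<close>, which excludes the parabolic spaces:
  it would be an invariant hyperplane, and would meet a fixed line outside it in a fixed point.

  Otherwise \<open>V = X \<oplus> t X\<close>, and \<open>t\<close> lifts to a linear map \<open>g\<close> with \<open>g\<^sup>2 = \<mu> g + \<kappa>\<close>, an
  irreducible relation because an eigenvector would give a fixed point. Thus \<open>V\<close> is a vector space of
  dimension \<open>n\<close> over the quadratic extension \<open>L = K[g]\<close>, whose points in the polar space are
  the fixed lines. Orthogonality over \<open>L\<close> is given by the form with components \<open>f u v\<close>
  and \<open>f u (g v)\<close>. In the symplectic case \<open>\<mu> = 0\<close> and \<open>g\<close> is self-adjoint, so the form is alternating. In the
  hyperbolic case it is skew-Hermitian for the conjugation of \<open>L\<close>, except when the characteristic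
  is 2 and \<open>\<mu> = 0\<close>: then \<open>L\<close> is inseparable, the form is alternating, and the singular vectors
  give a proper subspace of its symplectic polar space, which is a mixed polar space.
\<close>

section \<open>Vector spaces over a field given as a record\<close>

text \<open>A collineation yields only a map of points, semilinear at best, while the conclusion
  needs a linear operator. Domesticity removes the field automorphism: evaluating the form at
  \<open>e + c v0\<close> and its image ties the scalar in the image to \<open>c\<close> itself. In
  the symplectic case every vector is singular, and the fundamental theorem applies to the whole
  space. In the hyperbolic case \<open>t\<close> lives on singular vectors only. It is therefore
  linearised on one maximal singular subspace \<open>X\<close> opposite its image, and the two
  halves of the space are glued by two scalars: if \<open>h\<close> is the lift on \<open>X\<close>,
  then \<open>t (h y)\<close> lies in the point of \<open>y + \<gamma> h y\<close>, and
  \<open>x + h y\<close> goes to \<open>h x + k (y + \<gamma> h y)\<close>. This is the origin of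
  \<open>\<kappa> = k\<close> and \<open>\<mu> = k \<gamma>\<close>. The locale \<open>pol\<close>
  axiomatises an orthogonality relation and not a form. So one theory of singular subspaces,
  dimensions and points is instantiated twice, over the given field with \<open>orth\<close> and
  over the quadratic extension with \<open>orthL\<close>, where the second instance needs only the
  operator \<open>g\<close>.\<close>

locale vspace = R?: field R + module R M for R (structure) and M (structure)
begin

abbreviation vadd (infixl \<open>\<^bold>+\<close> 65) where "u \<^bold>+ v \<equiv> u \<oplus>\<^bsub>M\<^esub> v"
abbreviation vscale (infixr \<open>\<^bold>*\<close> 70) where "a \<^bold>* v \<equiv> a \<odot>\<^bsub>M\<^esub> v"
abbreviation vzero (\<open>\<^bold>0\<close>) where "\<^bold>0 \<equiv> \<zero>\<^bsub>M\<^esub>"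

lemmas vec_simps = smult_l_distr smult_r_distr smult_assoc1[symmetric] M.a_ac

lemma smult_minus_one [simp]: "v \<in> carrier M \<Longrightarrow> \<ominus> \<one> \<^bold>* v = \<ominus>\<^bsub>M\<^esub> v"
  by (simp add: smult_l_minus)

lemma smult_cancel [simp]:
  "a \<in> carrier R \<Longrightarrow> a \<noteq> \<zero> \<Longrightarrow> v \<in> carrier M \<Longrightarrow> inv a \<^bold>* (a \<^bold>* v) = v"
  "a \<in> carrier R \<Longrightarrow> a \<noteq> \<zero> \<Longrightarrow> v \<in> carrier M \<Longrightarrow> a \<^bold>* (inv a \<^bold>* v) = v"
  by (simp_all add: smult_assoc1[symmetric] field_Units)

lemma inv_closed' [simp, intro]: "a \<in> carrier R \<Longrightarrow> a \<noteq> \<zero> \<Longrightarrow> inv a \<in> carrier R"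
  by (simp add: field_Units)

lemma inv_nonzero [simp]: "a \<in> carrier R \<Longrightarrow> a \<noteq> \<zero> \<Longrightarrow> inv a \<noteq> \<zero>"
  using field_Units Units_inv_Units by auto

lemma inv_mult [simp]: "a \<in> carrier R \<Longrightarrow> a \<noteq> \<zero> \<Longrightarrow> inv a \<otimes> a = \<one>"
  "a \<in> carrier R \<Longrightarrow> a \<noteq> \<zero> \<Longrightarrow> a \<otimes> inv a = \<one>"
  by (simp_all add: field_Units)

lemma minus_nonzero [simp]: "a \<in> carrier R \<Longrightarrow> (\<ominus> a = \<zero>) = (a = \<zero>)"
  by (metis R.minus_minus R.minus_zero)

lemma smult_eq_zero [simp]:
  assumes "a \<in> carrier R" "v \<in> carrier M" shows "a \<^bold>* v = \<^bold>0 \<longleftrightarrow> a = \<zero> \<or> v = \<^bold>0"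
  using assms by (metis smult_cancel(1) smult_l_null smult_r_null inv_closed')

section \<open>Subspaces and their extension by one vector\<close>

definition subsp :: "'c set \<Rightarrow> bool" where
  "subsp W \<longleftrightarrow> W \<subseteq> carrier M \<and> \<^bold>0 \<in> W \<and> (\<forall>u\<in>W. \<forall>v\<in>W. u \<^bold>+ v \<in> W) \<and>
     (\<forall>a\<in>carrier R. \<forall>u\<in>W. a \<^bold>* u \<in> W)"

lemma subspI:
  assumes "W \<subseteq> carrier M" "\<^bold>0 \<in> W" "\<And>u v. u \<in> W \<Longrightarrow> v \<in> W \<Longrightarrow> u \<^bold>+ v \<in> W"
    "\<And>a u. a \<in> carrier R \<Longrightarrow> u \<in> W \<Longrightarrow> a \<^bold>* u \<in> W"
  shows "subsp W"
  using assms by (auto simp: subsp_def)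

lemma subspD:
  assumes "subsp W"
  shows "W \<subseteq> carrier M" "u \<in> W \<Longrightarrow> u \<in> carrier M" "\<^bold>0 \<in> W"
    "u \<in> W \<Longrightarrow> v \<in> W \<Longrightarrow> u \<^bold>+ v \<in> W" "a \<in> carrier R \<Longrightarrow> u \<in> W \<Longrightarrow> a \<^bold>* u \<in> W"
    "u \<in> W \<Longrightarrow> \<ominus>\<^bsub>M\<^esub> u \<in> W"
proof -
  show "u \<in> W \<Longrightarrow> \<ominus>\<^bsub>M\<^esub> u \<in> W"
    using assms smult_minus_one[of u] unfolding subsp_def by (metis R.a_inv_closed R.one_closed subsetD)
qed (use assms in \<open>auto simp: subsp_def\<close>)

lemma subsp_zero: "subsp {\<^bold>0}" and subsp_carrier: "subsp (carrier M)"
  by (auto simp: subsp_def)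

lemma subsp_Int: "subsp U \<Longrightarrow> subsp W \<Longrightarrow> subsp (U \<inter> W)"
  by (auto simp: subsp_def)

lemma subsp_smult_iff:
  assumes "subsp W" "a \<in> carrier R" "a \<noteq> \<zero>" "v \<in> carrier M"
  shows "a \<^bold>* v \<in> W \<longleftrightarrow> v \<in> W"
  using assms subspD(5)[OF assms(1), of "inv a" "a \<^bold>* v"] by (auto intro: subspD)

lemma subsp_add_iff:
  assumes "subsp W" "w \<in> W" "v \<in> carrier M"
  shows "w \<^bold>+ v \<in> W \<longleftrightarrow> v \<in> W" "v \<^bold>+ w \<in> W \<longleftrightarrow> v \<in> W"
proof -
  have w: "w \<in> carrier M" using assms subspD by blast
  have "v = \<ominus>\<^bsub>M\<^esub> w \<^bold>+ (w \<^bold>+ v)" using w assms(3) by (simp add: M.r_neg1)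
  then show 1: "w \<^bold>+ v \<in> W \<longleftrightarrow> v \<in> W"
    using assms subspD by metis
  show "v \<^bold>+ w \<in> W \<longleftrightarrow> v \<in> W" using 1 w assms(3) by (simp add: M.a_comm)
qed

definition ext :: "'c set \<Rightarrow> 'c \<Rightarrow> 'c set" where
  "ext W v = {w \<^bold>+ a \<^bold>* v | w a. w \<in> W \<and> a \<in> carrier R}"

lemma extI: "w \<in> W \<Longrightarrow> a \<in> carrier R \<Longrightarrow> w \<^bold>+ a \<^bold>* v \<in> ext W v"
  by (auto simp: ext_def)

lemma extE: assumes "x \<in> ext W v" obtains w a where "w \<in> W" "a \<in> carrier R" "x = w \<^bold>+ a \<^bold>* v"
  using assms by (auto simp: ext_def)

lemma subsp_ext [intro]:
  assumes W: "subsp W" and v: "v \<in> carrier M" shows "subsp (ext W v)"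
proof (rule subspI)
  show "ext W v \<subseteq> carrier M" using subspD[OF W] v by (auto simp: ext_def)
  show "\<^bold>0 \<in> ext W v" using extI[of "\<^bold>0" W \<zero> v] subspD[OF W] v by simp
next
  fix x y assume "x \<in> ext W v" "y \<in> ext W v"
  then obtain w a w' b where *: "w \<in> W" "a \<in> carrier R" "x = w \<^bold>+ a \<^bold>* v"
    "w' \<in> W" "b \<in> carrier R" "y = w' \<^bold>+ b \<^bold>* v" by (meson extE)
  note c = subspD(2)[OF W *(1)] subspD(2)[OF W *(4)]
  have "x \<^bold>+ y = (w \<^bold>+ w') \<^bold>+ (a \<oplus> b) \<^bold>* v" using * c v by (simp add: vec_simps)
  then show "x \<^bold>+ y \<in> ext W v" using * subspD[OF W] by (metis extI R.a_closed)
next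
  fix c x assume "c \<in> carrier R" "x \<in> ext W v"
  then obtain w a where *: "w \<in> W" "a \<in> carrier R" "x = w \<^bold>+ a \<^bold>* v" by (meson extE)
  have "c \<^bold>* x = c \<^bold>* w \<^bold>+ (c \<otimes> a) \<^bold>* v"
    using * subspD(2)[OF W *(1)] v \<open>c \<in> carrier R\<close> by (simp add: vec_simps)
  then show "c \<^bold>* x \<in> ext W v" using * subspD[OF W] \<open>c \<in> carrier R\<close> by (metis extI R.m_closed)
qed

lemma ext_base: "subsp W \<Longrightarrow> v \<in> carrier M \<Longrightarrow> w \<in> W \<Longrightarrow> w \<in> ext W v"
  using extI[of w W \<zero> v] subspD(2) by simp

lemma ext_gen: "subsp W \<Longrightarrow> v \<in> carrier M \<Longrightarrow> v \<in> ext W v"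
  using extI[of "\<^bold>0" W \<one> v] subspD(3) by simp

lemma ext_least: "subsp U \<Longrightarrow> W \<subseteq> U \<Longrightarrow> v \<in> U \<Longrightarrow> ext W v \<subseteq> U"
  by (auto simp: ext_def intro!: subspD)

lemma ext_absorb: "subsp W \<Longrightarrow> v \<in> W \<Longrightarrow> ext W v = W"
  using ext_least[of W W v] ext_base[of W v] subspD(2) by blast

lemma ext_exchange:
  assumes W: "subsp W" and v: "v \<in> carrier M" and x: "x \<in> ext W v" "x \<notin> W"
  shows "ext W x = ext W v"
proof
  have xc: "x \<in> carrier M" using x subsp_ext[OF W v] subspD(2) by blast
  show "ext W x \<subseteq> ext W v" using ext_least ext_base x W v by (metis subsp_ext subsetI)
  obtain w a where *: "w \<in> W" "a \<in> carrier R" "x = w \<^bold>+ a \<^bold>* v" using x by (meson extE)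
  have wc: "w \<in> carrier M" using * subspD[OF W] by blast
  have "a \<noteq> \<zero>" using * x wc v by auto
  have s: "subsp (ext W x)" using W xc by blast
  have "w \<in> ext W x" using * ext_base W xc by blast
  moreover have "x \<in> ext W x" using ext_gen W xc by blast
  ultimately have "a \<^bold>* v \<in> ext W x" using *(3) subsp_add_iff(1)[OF s, of w "a \<^bold>* v"] v * by simp
  then have "v \<in> ext W x" using subsp_smult_iff s * \<open>a \<noteq> \<zero>\<close> v by blast
  then show "ext W v \<subseteq> ext W x" using ext_least[OF s] ext_base W xc by blast
qed

lemma ext_commute:
  assumes "subsp W" "u \<in> carrier M" "v \<in> carrier M"
  shows "ext (ext W u) v = ext (ext W v) u"
proof -
  have "ext (ext W u) v \<subseteq> ext (ext W v) u" if "u \<in> carrier M" "v \<in> carrier M" for u v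
    using that assms(1)
    by (intro ext_least subsp_ext) (auto intro: ext_base ext_gen)
  then show ?thesis using assms by blast
qed

subsection \<open>Relative dimension\<close>

text \<open>The dimension of \<open>W\<close> over \<open>W0\<close>, as the length of a chain in
  which every step adjoins one new vector. The relative form replaces bases and quotients: chains
  concatenate (\<open>dimx_trans\<close>) and can be cut at an intermediate subspace
  (\<open>dimx_split\<close>).\<close>

inductive dimx :: "'c set \<Rightarrow> nat \<Rightarrow> 'c set \<Rightarrow> bool" for W0 where
  dimx_0: "dimx W0 0 W0"
| dimx_Suc: "dimx W0 k W \<Longrightarrow> v \<in> carrier M \<Longrightarrow> v \<notin> W \<Longrightarrow> dimx W0 (Suc k) (ext W v)"

lemma dimx_subsp: "dimx W0 k W \<Longrightarrow> subsp W0 \<Longrightarrow> subsp W"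
  by (induction rule: dimx.induct) auto

lemma dimx_subset: "dimx W0 k W \<Longrightarrow> subsp W0 \<Longrightarrow> W0 \<subseteq> W"
  by (induction rule: dimx.induct) (auto intro: ext_base dest: dimx_subsp)

text \<open>The modular law for a hyperplane: subtracting a suitable multiple of \<open>u\<close>
  from a vector of \<open>U\<close> leads into \<open>W\<close>, and the difference stays in
  \<open>U\<close>.\<close>

lemma subset_ext_eq:
  assumes W: "subsp W" and U: "subsp U" and v: "v \<in> carrier M" and sub: "U \<subseteq> ext W v"
    and u: "u \<in> U" "u \<notin> W"
  shows "U = ext (U \<inter> W) u"
proof
  have uc: "u \<in> carrier M" using u U subspD by blast
  show "ext (U \<inter> W) u \<subseteq> U" using ext_least[OF U] u by blast
  show "U \<subseteq> ext (U \<inter> W) u"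
  proof
    fix x assume x: "x \<in> U"
    have "x \<in> ext W u" using x sub ext_exchange[OF W v, of u] u by blast
    then obtain w a where *: "w \<in> W" "a \<in> carrier R" "x = w \<^bold>+ a \<^bold>* u" by (meson extE)
    have "a \<^bold>* u \<in> U" "w \<in> carrier M" using subspD(5)[OF U *(2) u(1)] subspD(2)[OF W *(1)] .
    then have "w \<in> U" using subsp_add_iff(2)[OF U, of "a \<^bold>* u" w] * x by simp
    then show "x \<in> ext (U \<inter> W) u" using * by (auto intro: extI)
  qed
qed

text \<open>The chain to \<open>W\<close> is intersected with \<open>U\<close>; each step then
  either disappears or still adjoins a single vector, by \<open>subset_ext_eq\<close>.\<close>

lemma dimx_mono:
  assumes "dimx W0 k W" "subsp W0" "subsp U" "W0 \<subseteq> U" "U \<subseteq> W"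
  shows "\<exists>k'\<le>k. dimx W0 k' U"
  using assms
proof (induction arbitrary: U rule: dimx.induct)
  case dimx_0 then show ?case using dimx.dimx_0 by (metis le_refl subset_antisym)
next
  case (dimx_Suc k W v)
  have W: "subsp W" "W0 \<subseteq> W"
    using dimx_subsp[OF dimx_Suc.hyps(1)] dimx_subset[OF dimx_Suc.hyps(1)] dimx_Suc.prems(1) by auto
  obtain k' where k': "k' \<le> k" "dimx W0 k' (U \<inter> W)"
    using dimx_Suc.IH[of "U \<inter> W"] W dimx_Suc.prems by (auto intro: subsp_Int)
  show ?case
  proof (cases "U \<subseteq> W")
    case True then show ?thesis using k' by (metis Int_absorb2 le_SucI)
  next
    case False
    then obtain u where u: "u \<in> U" "u \<notin> W" by blast
    have "U = ext (U \<inter> W) u" using subset_ext_eq W u dimx_Suc by blast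
    then show ?thesis using dimx.dimx_Suc[OF k'(2), of u] u k'(1) subspD(2)[OF dimx_Suc.prems(2)]
      by (metis IntD2 Suc_le_mono)
  qed
qed

lemma dimx_0_iff [simp]: "dimx W0 0 W \<longleftrightarrow> W = W0"
  by (auto elim: dimx.cases intro: dimx.intros)

text \<open>In the manner of Jordan and Hoelder: the last members \<open>W1\<close> and
  \<open>W2\<close> of two chains are hyperplanes of \<open>W\<close>. If they differ, neither
  contains the other, and both are one-vector extensions of \<open>W1 \<inter> W2\<close>, so the
  induction hypothesis applies to each of them.\<close>

lemma dimx_unique:
  assumes "dimx W0 k W" "dimx W0 l W" "subsp W0"
  shows "k = l"
  using assms
proof (induction k arbitrary: W l)
  case 0
  then have "W = W0" by simp
  show ?case using 0(2)
  proof (cases rule: dimx.cases)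
    case (dimx_Suc k W' v)
    then have "subsp W'" "W0 \<subseteq> W'" using dimx_subsp dimx_subset 0(3) by auto
    then show ?thesis using dimx_Suc ext_gen[of W' v] \<open>W = W0\<close> by auto
  qed simp
next
  case (Suc k)
  obtain W1 v1 where 1: "dimx W0 k W1" "v1 \<in> carrier M" "v1 \<notin> W1" "W = ext W1 v1"
    using Suc.prems(1) by (auto elim: dimx.cases)
  have W1: "subsp W1" "W0 \<subseteq> W1" using dimx_subsp[OF 1(1)] dimx_subset[OF 1(1)] Suc.prems(3) by auto
  have ne: "W \<noteq> W0" using 1 W1 ext_gen by blast
  obtain l' W2 v2 where 2: "l = Suc l'" "dimx W0 l' W2" "v2 \<in> carrier M" "v2 \<notin> W2" "W = ext W2 v2"
    using Suc.prems(2) by (cases rule: dimx.cases) (use ne in auto)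
  have W2: "subsp W2" "W0 \<subseteq> W2" using dimx_subsp[OF 2(2)] dimx_subset[OF 2(2)] Suc.prems(3) by auto
  have incl: "W1 \<subseteq> W" "W2 \<subseteq> W" using 1 2 W1 W2 ext_base by blast+
  show ?case
  proof (cases "W1 = W2")
    case True then show ?thesis using 1 2 Suc.IH Suc.prems by blast
  next
    case False
    have "\<not> W1 \<subset> W2"
    proof
      assume "W1 \<subset> W2"
      then obtain x where "x \<in> W2" "x \<notin> W1" by blast
      then have "W \<subseteq> W2" using ext_exchange[OF W1(1) 1(2), of x] incl 1(4) ext_least[OF W2(1)] \<open>W1 \<subset> W2\<close>
        by blast
      then show False using 2 W2 ext_gen by blast
    qed
    moreover have "\<not> W2 \<subset> W1"
    proof
      assume "W2 \<subset> W1"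
      then obtain x where "x \<in> W1" "x \<notin> W2" by blast
      then have "W \<subseteq> W1" using ext_exchange[OF W2(1) 2(3), of x] incl 2(5) ext_least[OF W1(1)] \<open>W2 \<subset> W1\<close>
        by blast
      then show False using 1 W1 ext_gen by blast
    qed
    ultimately obtain x1 x2 where x: "x1 \<in> W1" "x1 \<notin> W2" "x2 \<in> W2" "x2 \<notin> W1" using False by blast
    let ?Y = "W1 \<inter> W2"
    obtain y where y: "dimx W0 y ?Y"
      using dimx_mono[OF 1(1) Suc.prems(3), of ?Y] W1 W2 subsp_Int by blast
    have xc: "x1 \<in> carrier M" "x2 \<in> carrier M" using x W1 W2 subspD by blast+
    have e: "W1 = ext ?Y x1" "W2 = ext ?Y x2"
      using subset_ext_eq[OF W2(1) W1(1) 2(3) _ x(1,2)] subset_ext_eq[OF W1(1) W2(1) 1(2) _ x(3,4)]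
        incl 1(4) 2(5) by (simp_all add: Int_commute)
    have d: "dimx W0 (Suc y) W1" "dimx W0 (Suc y) W2"
      using dimx.dimx_Suc[OF y xc(1)] dimx.dimx_Suc[OF y xc(2)] x e by auto
    have "k = Suc y" using Suc.IH[OF 1(1) d(1)] Suc.prems by blast
    then show ?thesis using Suc.IH[of W2 l'] d 2 Suc.prems by blast
  qed
qed

lemma dimx_trans: "dimx B l C \<Longrightarrow> dimx A k B \<Longrightarrow> dimx A (k + l) C"
  by (induction rule: dimx.induct) (auto intro: dimx.intros)

lemma dimx_shift:
  assumes "dimx P l Q" "subsp P" "v \<in> carrier M" "v \<notin> Q"
  shows "dimx (ext P v) l (ext Q v)"
  using assms
proof (induction rule: dimx.induct)
  case (dimx_Suc k W x)
  have W: "subsp W" using dimx_Suc dimx_subsp by blast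
  have v: "v \<notin> W" using dimx_Suc.prems ext_base[OF W] dimx_Suc.hyps by blast
  have "x \<notin> ext W v"
    using ext_exchange[OF W, of v x] ext_gen[OF W, of v] dimx_Suc.prems dimx_Suc.hyps by blast
  then have "dimx (ext P v) (Suc k) (ext (ext W v) x)"
    using dimx.dimx_Suc dimx_Suc v by blast
  then show ?case using ext_commute W dimx_Suc by metis
qed simp

text \<open>Induction along the chain to \<open>U\<close>. If \<open>A\<close> lies inside the
  previous member, the last step lengthens the chain above \<open>A\<close>. Otherwise its vector
  can be taken in \<open>A\<close>, and \<open>dimx_shift\<close> adds this vector to the whole
  chain above \<open>A \<inter> W\<close>.\<close>

lemma dimx_split:
  assumes "dimx W0 d U" "subsp W0" "subsp A" "W0 \<subseteq> A" "A \<subseteq> U"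
  shows "\<exists>a l. dimx W0 a A \<and> dimx A l U \<and> a + l = d"
  using assms
proof (induction arbitrary: A rule: dimx.induct)
  case dimx_0 then have "A = W0" by blast then show ?case by auto
next
  case (dimx_Suc k W v)
  have W: "subsp W" "W0 \<subseteq> W"
    using dimx_subsp[OF dimx_Suc.hyps(1)] dimx_subset[OF dimx_Suc.hyps(1)] dimx_Suc.prems(1) by auto
  obtain a l where al: "dimx W0 a (A \<inter> W)" "dimx (A \<inter> W) l W" "a + l = k"
    using dimx_Suc.IH[of "A \<inter> W"] W dimx_Suc.prems by (auto intro: subsp_Int)
  show ?case
  proof (cases "A \<subseteq> W")
    case True
    then have "A \<inter> W = A" by blast
    then show ?thesis using al dimx.dimx_Suc[of A l W v] dimx_Suc.hyps by (metis add_Suc_right)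
  next
    case False
    then obtain u where u: "u \<in> A" "u \<notin> W" by blast
    have A: "A = ext (A \<inter> W) u" using subset_ext_eq W u dimx_Suc by blast
    have uc: "u \<in> carrier M" using u dimx_Suc.prems subspD by blast
    have U: "ext W v = ext W u" using ext_exchange[OF W(1), of v u] u dimx_Suc by blast
    have "dimx W0 (Suc a) A" using dimx.dimx_Suc[OF al(1) uc] u A by auto
    moreover have "dimx A l (ext W v)"
      using dimx_shift[OF al(2) _ uc] u A U W subsp_Int dimx_Suc.prems by metis
    ultimately show ?thesis using al by (metis add_Suc)
  qed
qed

lemma dimx_eq:
  assumes "dimx W0 k U" "dimx W0 k W" "U \<subseteq> W" "subsp W0" shows "U = W"
proof -
  obtain a l where "dimx W0 a U" "dimx U l W" "a + l = k"
    using dimx_split[OF assms(2,4) dimx_subsp[OF assms(1,4)] dimx_subset[OF assms(1,4)] assms(3)] by blast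
  then show ?thesis using dimx_unique[OF assms(1) _ assms(4)] by fastforce
qed

abbreviation dim where "dim k W \<equiv> dimx {\<^bold>0} k W"

lemma dim_subsp: "dim k W \<Longrightarrow> subsp W" using dimx_subsp subsp_zero by blast

lemma dim_mono: "dim k W \<Longrightarrow> subsp U \<Longrightarrow> U \<subseteq> W \<Longrightarrow> \<exists>k'\<le>k. dim k' U"
  using dimx_mono[of "{\<^bold>0}" k W U] subsp_zero subspD(3) by blast

lemma dim_unique: "dim k W \<Longrightarrow> dim l W \<Longrightarrow> k = l"
  using dimx_unique subsp_zero by blast

lemma dim_le: "dim k W \<Longrightarrow> dim l U \<Longrightarrow> U \<subseteq> W \<Longrightarrow> l \<le> k"
  using dim_mono[of k W U] dim_subsp dim_unique by metis

lemma dim_eq: "dim k U \<Longrightarrow> dim k W \<Longrightarrow> U \<subseteq> W \<Longrightarrow> U = W"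
  using dimx_eq subsp_zero by blast

lemma dim_less: assumes "dim k U" "dim l W" "k < l" shows "\<exists>w\<in>W. w \<notin> U"
  using dim_le[OF assms(1,2)] assms(3) by auto

lemma subsp_sum: assumes "subsp U" "subsp W" shows "subsp (U <+>\<^bsub>M\<^esub> W)"
proof (rule subspI)
  show "U <+>\<^bsub>M\<^esub> W \<subseteq> carrier M" using assms subspD by (fastforce simp: set_add_def')
  show "\<^bold>0 \<in> U <+>\<^bsub>M\<^esub> W" using assms subspD(3) by (force simp: set_add_def')
next
  fix x y assume "x \<in> U <+>\<^bsub>M\<^esub> W" "y \<in> U <+>\<^bsub>M\<^esub> W"
  then obtain u w u' w' where *: "u \<in> U" "w \<in> W" "x = u \<^bold>+ w" "u' \<in> U" "w' \<in> W" "y = u' \<^bold>+ w'"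
    by (auto simp: set_add_def')
  have "x \<^bold>+ y = (u \<^bold>+ u') \<^bold>+ (w \<^bold>+ w')"
    using * subspD(2)[OF assms(1)] subspD(2)[OF assms(2)] by (simp add: M.a_ac)
  moreover have "u \<^bold>+ u' \<in> U" "w \<^bold>+ w' \<in> W" using * assms subspD(4) by simp_all
  ultimately show "x \<^bold>+ y \<in> U <+>\<^bsub>M\<^esub> W" unfolding set_add_def' by blast
next
  fix a x assume "a \<in> carrier R" "x \<in> U <+>\<^bsub>M\<^esub> W"
  then obtain u w where *: "u \<in> U" "w \<in> W" "x = u \<^bold>+ w" by (auto simp: set_add_def')
  have "a \<^bold>* x = a \<^bold>* u \<^bold>+ a \<^bold>* w"
    using * subspD(2)[OF assms(1)] subspD(2)[OF assms(2)] \<open>a \<in> carrier R\<close> by (simp add: smult_r_distr)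
  moreover have "a \<^bold>* u \<in> U" "a \<^bold>* w \<in> W" using * assms subspD(5) \<open>a \<in> carrier R\<close> by simp_all
  ultimately show "a \<^bold>* x \<in> U <+>\<^bsub>M\<^esub> W" unfolding set_add_def' by blast
qed

subsection \<open>Points and lines\<close>

lemma pspan_iff: "x \<in> pspan R M v \<longleftrightarrow> (\<exists>c\<in>carrier R. x = c \<^bold>* v)"
  by (auto simp: pspan_def)

lemma pspan_ext: "v \<in> carrier M \<Longrightarrow> pspan R M v = ext {\<^bold>0} v"
  by (auto simp: pspan_def ext_def) (metis M.l_zero smult_closed)+

lemma subsp_pspan [intro]: "v \<in> carrier M \<Longrightarrow> subsp (pspan R M v)"
  using pspan_ext subsp_ext subsp_zero by metis

lemma pspan_self [simp, intro]: "v \<in> carrier M \<Longrightarrow> v \<in> pspan R M v"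
  using pspan_ext ext_gen subsp_zero by metis

lemma pspan_subset: "subsp U \<Longrightarrow> v \<in> U \<Longrightarrow> pspan R M v \<subseteq> U"
  by (auto simp: pspan_def intro: subspD)

lemma pspan_smult [simp]:
  assumes "c \<in> carrier R" "c \<noteq> \<zero>" "v \<in> carrier M" shows "pspan R M (c \<^bold>* v) = pspan R M v"
proof
  show "pspan R M (c \<^bold>* v) \<subseteq> pspan R M v" using assms by (intro pspan_subset) (auto simp: pspan_iff)
  have "v \<in> pspan R M (c \<^bold>* v)" using assms by (auto simp: pspan_iff intro!: bexI[of _ "inv c"])
  then show "pspan R M v \<subseteq> pspan R M (c \<^bold>* v)" using assms by (intro pspan_subset) auto
qed

lemma pspan_eq:
  assumes "u \<in> pspan R M v" "u \<noteq> \<^bold>0" "v \<in> carrier M" shows "pspan R M u = pspan R M v"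
  using assms by (auto simp: pspan_iff)

lemma pspan_sym:
  assumes "u \<in> pspan R M v" "u \<noteq> \<^bold>0" "v \<in> carrier M" shows "v \<in> pspan R M u"
  using pspan_eq assms pspan_self by metis

lemma pspan_trans:
  assumes "u \<in> pspan R M v" "v \<in> pspan R M w" "w \<in> carrier M" shows "u \<in> pspan R M w"
  using assms pspan_subset[of "pspan R M w" v] by blast

lemma dim_pspan: "v \<in> carrier M \<Longrightarrow> v \<noteq> \<^bold>0 \<Longrightarrow> dim 1 (pspan R M v)"
  using dimx_Suc[OF dimx_0, of v "{\<^bold>0}"] by (simp add: pspan_ext)

definition span2 where "span2 u v = ext (pspan R M u) v"

lemma span2_iff: "x \<in> span2 u v \<longleftrightarrow> (\<exists>a\<in>carrier R. \<exists>b\<in>carrier R. x = a \<^bold>* u \<^bold>+ b \<^bold>* v)"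
  by (auto simp: span2_def ext_def pspan_def)

lemma span2I:
  assumes "u \<in> carrier M" "v \<in> carrier M" "a \<in> carrier R"
  shows "u \<^bold>+ a \<^bold>* v \<in> span2 u v" "a \<^bold>* u \<^bold>+ v \<in> span2 u v"
    "b \<in> carrier R \<Longrightarrow> a \<^bold>* u \<^bold>+ b \<^bold>* v \<in> span2 u v"
proof -
  show "b \<in> carrier R \<Longrightarrow> a \<^bold>* u \<^bold>+ b \<^bold>* v \<in> span2 u v" for b using assms by (auto simp: span2_iff)
  from this[of \<one>] show "a \<^bold>* u \<^bold>+ v \<in> span2 u v" using assms by simp
  have "\<one> \<^bold>* u \<^bold>+ a \<^bold>* v \<in> span2 u v" unfolding span2_iff using assms R.one_closed by blast
  then show "u \<^bold>+ a \<^bold>* v \<in> span2 u v" using assms by simp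
qed

lemma span2_commute: "u \<in> carrier M \<Longrightarrow> v \<in> carrier M \<Longrightarrow> span2 u v = span2 v u"
  unfolding span2_def pspan_ext[of u] pspan_ext[of v] using ext_commute subsp_zero pspan_ext by metis

lemma subsp_span2 [intro]: "u \<in> carrier M \<Longrightarrow> v \<in> carrier M \<Longrightarrow> subsp (span2 u v)"
  by (auto simp: span2_def)

lemma span2_gen:
  assumes "u \<in> carrier M" "v \<in> carrier M" shows "u \<in> span2 u v" "v \<in> span2 u v"
  using assms by (auto simp: span2_def intro: ext_gen ext_base)

lemma span2_least: "subsp U \<Longrightarrow> u \<in> U \<Longrightarrow> v \<in> U \<Longrightarrow> span2 u v \<subseteq> U"
  unfolding span2_def by (intro ext_least pspan_subset)

lemma dim_span2:
  "u \<in> carrier M \<Longrightarrow> v \<in> carrier M \<Longrightarrow> u \<noteq> \<^bold>0 \<Longrightarrow> v \<notin> pspan R M u \<Longrightarrow> dim 2 (span2 u v)"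
  using dimx_Suc[OF dim_pspan] by (simp add: span2_def numeral_2_eq_2)

lemma dim_1E:
  assumes "dim 1 U" obtains u where "u \<in> carrier M" "u \<noteq> \<^bold>0" "U = pspan R M u"
proof -
  obtain u where "u \<in> carrier M" "u \<notin> {\<^bold>0}" "U = ext {\<^bold>0} u"
    using assms unfolding One_nat_def by (cases rule: dimx.cases) simp
  then show ?thesis using that pspan_ext by simp
qed

lemma dim_2E:
  assumes "dim 2 U" obtains u v where "u \<in> carrier M" "v \<in> carrier M" "u \<noteq> \<^bold>0" "v \<notin> pspan R M u" "U = span2 u v"
proof -
  obtain W v where *: "dim 1 W" "v \<in> carrier M" "v \<notin> W" "U = ext W v"
    using assms unfolding numeral_2_eq_2 One_nat_def by (cases rule: dimx.cases) simp
  obtain u where "u \<in> carrier M" "u \<noteq> \<^bold>0" "W = pspan R M u" using dim_1E[OF *(1)] .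
  then show ?thesis using that[of u v] * by (simp add: span2_def)
qed

lemma dim_2_span2:
  assumes "dim 2 U" "u \<in> U" "v \<in> U" "u \<noteq> \<^bold>0" "v \<notin> pspan R M u"
  shows "U = span2 u v"
  using dim_eq[OF _ assms(1), of "span2 u v"] dim_span2 span2_least dim_subsp[OF assms(1)] assms subspD
  by metis

lemma indep2:
  assumes "u \<in> carrier M" "v \<in> carrier M" "u \<noteq> \<^bold>0" "v \<notin> pspan R M u"
    "a \<in> carrier R" "b \<in> carrier R" "c \<in> carrier R" "d \<in> carrier R"
    "a \<^bold>* u \<^bold>+ b \<^bold>* v = c \<^bold>* u \<^bold>+ d \<^bold>* v"
  shows "a = c \<and> b = d"
proof -
  have "a \<^bold>* u \<^bold>+ b \<^bold>* v \<^bold>+ (\<ominus> d \<^bold>* v \<^bold>+ \<ominus> c \<^bold>* u) = c \<^bold>* u \<^bold>+ d \<^bold>* v \<^bold>+ (\<ominus> d \<^bold>* v \<^bold>+ \<ominus> c \<^bold>* u)" using assms(9) by simp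
  moreover have "a \<^bold>* u \<^bold>+ b \<^bold>* v \<^bold>+ (\<ominus> d \<^bold>* v \<^bold>+ \<ominus> c \<^bold>* u) = (a \<ominus> c) \<^bold>* u \<^bold>+ (b \<ominus> d) \<^bold>* v"
    unfolding a_minus_def using assms(1,2,5-8) by (simp add: vec_simps)
  moreover have "c \<^bold>* u \<^bold>+ d \<^bold>* v \<^bold>+ (\<ominus> d \<^bold>* v \<^bold>+ \<ominus> c \<^bold>* u) = (c \<ominus> c) \<^bold>* u \<^bold>+ (d \<ominus> d) \<^bold>* v"
    unfolding a_minus_def using assms(1,2,5-8) by (simp add: vec_simps del: R.r_neg R.minus_eq)
  ultimately have *: "(a \<ominus> c) \<^bold>* u \<^bold>+ (b \<ominus> d) \<^bold>* v = \<^bold>0" using assms(1,2,5-8)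
    by (simp add: R.r_right_minus_eq[THEN iffD2])
  have "b \<ominus> d = \<zero>"
  proof (rule ccontr)
    assume n: "b \<ominus> d \<noteq> \<zero>"
    have s: "subsp (pspan R M u)" using assms by blast
    have "(b \<ominus> d) \<^bold>* v \<in> pspan R M u"
      using subsp_add_iff(1)[OF s, of "(a \<ominus> c) \<^bold>* u" "(b \<ominus> d) \<^bold>* v"] * assms subspD(3)[OF s]
      by (auto simp: pspan_iff)
    then show False using subsp_smult_iff[OF s _ n] assms by simp
  qed
  then have "b = d" using assms by simp
  moreover have "(a \<ominus> c) \<^bold>* u = \<^bold>0" using * \<open>b \<ominus> d = \<zero>\<close> assms by simp
  then have "a = c" using assms by simp
  ultimately show ?thesis by simp
qed

end

section \<open>Polar spaces from an orthogonality relation\<close>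

lemma generated_subset: "geom_subspace G T \<Longrightarrow> A \<subseteq> T \<Longrightarrow> generated G A \<subseteq> T"
  by (auto simp: generated_def)

text \<open>\<open>S\<close> is the set of singular vectors, zero included.
  \<open>orth_solve\<close> says that the perp of a vector has codimension at most one.
  \<open>S_lift\<close> takes the place of a quadratic form: a vector not orthogonal to a singular
  \<open>u\<close> becomes singular after adding a multiple of \<open>u\<close>.
  \<open>S_rad\<close> keeps only nonzero singular vectors out of the radical, because in
  characteristic 2 a parabolic quadric has a radical of nonsingular vectors.\<close>

locale pol = vspace +
  fixes S :: "'c set" and orth :: "'c \<Rightarrow> 'c \<Rightarrow> bool" (infix \<open>\<perp>\<close> 50)
  assumes S_sub: "S \<subseteq> carrier M"
    and S_zero [simp]: "\<^bold>0 \<in> S"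
    and S_smult: "a \<in> carrier R \<Longrightarrow> v \<in> S \<Longrightarrow> a \<^bold>* v \<in> S"
    and S_add: "u \<in> S \<Longrightarrow> v \<in> S \<Longrightarrow> u \<perp> v \<Longrightarrow> u \<^bold>+ v \<in> S"
    and S_self: "v \<in> S \<Longrightarrow> v \<perp> v"
    and S_lift: "u \<in> S \<Longrightarrow> z \<in> carrier M \<Longrightarrow> \<not> u \<perp> z \<Longrightarrow> \<exists>c\<in>carrier R. z \<^bold>+ c \<^bold>* u \<in> S"
    and S_rad: "v \<in> S \<Longrightarrow> (\<And>w. w \<in> carrier M \<Longrightarrow> v \<perp> w) \<Longrightarrow> v = \<^bold>0"
    and orth_sym: "u \<in> carrier M \<Longrightarrow> v \<in> carrier M \<Longrightarrow> u \<perp> v \<Longrightarrow> v \<perp> u"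
    and orth_add: "u \<in> carrier M \<Longrightarrow> v \<in> carrier M \<Longrightarrow> w \<in> carrier M \<Longrightarrow> u \<perp> v \<Longrightarrow> u \<perp> w \<Longrightarrow> u \<perp> v \<^bold>+ w"
    and orth_smult: "a \<in> carrier R \<Longrightarrow> u \<in> carrier M \<Longrightarrow> v \<in> carrier M \<Longrightarrow> u \<perp> v \<Longrightarrow> u \<perp> a \<^bold>* v"
    and orth_solve: "u \<in> carrier M \<Longrightarrow> v \<in> carrier M \<Longrightarrow> x \<in> carrier M \<Longrightarrow> \<not> x \<perp> v \<Longrightarrow>
      \<exists>c\<in>carrier R. x \<perp> u \<^bold>+ c \<^bold>* v"
begin

lemma S_carrier [simp]: "v \<in> S \<Longrightarrow> v \<in> carrier M" using S_sub by blast

lemma orth_zero [simp]: "u \<in> carrier M \<Longrightarrow> u \<perp> \<^bold>0" "u \<in> carrier M \<Longrightarrow> \<^bold>0 \<perp> u"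
proof -
  have *: "u \<perp> \<^bold>0" if u: "u \<in> carrier M" for u
  proof (rule ccontr)
    assume "\<not> u \<perp> \<^bold>0"
    then show False using orth_solve[OF M.zero_closed M.zero_closed u] u by auto
  qed
  show "u \<in> carrier M \<Longrightarrow> u \<perp> \<^bold>0" "u \<in> carrier M \<Longrightarrow> \<^bold>0 \<perp> u" using * orth_sym by auto
qed

lemma orth_commute: "u \<in> carrier M \<Longrightarrow> v \<in> carrier M \<Longrightarrow> u \<perp> v \<longleftrightarrow> v \<perp> u"
  using orth_sym by blast

section \<open>Perps and their dimensions\<close>

definition perp :: "'c set \<Rightarrow> 'c set" where
  "perp X = {v \<in> carrier M. \<forall>x\<in>X. x \<perp> v}"

lemma subsp_perp: "X \<subseteq> carrier M \<Longrightarrow> subsp (perp X)"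
  by (rule subspI) (auto simp: perp_def orth_add orth_smult subset_iff)

lemma orth_span2:
  assumes "x \<in> carrier M" "u \<in> carrier M" "v \<in> carrier M" "x \<perp> u" "x \<perp> v" "w \<in> span2 u v"
  shows "x \<perp> w" "w \<perp> x"
proof -
  have "span2 u v \<subseteq> perp {x}" using span2_least[OF subsp_perp, of "{x}" u v] assms by (simp add: perp_def)
  then show "x \<perp> w" using assms(6) by (auto simp: perp_def)
  then show "w \<perp> x" using orth_sym assms subspD(2)[OF subsp_span2] by blast
qed

lemma orth_pspan:
  assumes "x \<in> carrier M" "u \<in> carrier M" "x \<perp> u" "w \<in> pspan R M u"
  shows "x \<perp> w" "w \<perp> x"
  using assms by (auto simp: pspan_iff orth_smult orth_sym)

lemma orth_pspan_iff:
  assumes "x \<in> carrier M" "u \<in> carrier M" "w \<in> pspan R M u" "w \<noteq> \<^bold>0"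
  shows "x \<perp> w \<longleftrightarrow> x \<perp> u" "w \<perp> x \<longleftrightarrow> u \<perp> x"
proof -
  have w: "w \<in> carrier M" using assms subspD(2)[OF subsp_pspan] by blast
  show 1: "x \<perp> w \<longleftrightarrow> x \<perp> u"
    using orth_pspan(1)[OF assms(1,2) _ assms(3)] orth_pspan(1)[OF assms(1) w _ pspan_sym[OF assms(3,4,2)]] by blast
  show "w \<perp> x \<longleftrightarrow> u \<perp> x" using 1 orth_sym w assms by blast
qed

lemma orth_ext:
  assumes "subsp U" "v \<in> carrier M" "x \<in> carrier M"
  shows "(\<forall>y\<in>ext U v. y \<perp> x) \<longleftrightarrow> (\<forall>y\<in>U. y \<perp> x) \<and> v \<perp> x"
proof
  assume *: "(\<forall>y\<in>U. y \<perp> x) \<and> v \<perp> x"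
  have "ext U v \<subseteq> perp {x}"
    by (intro ext_least subsp_perp) (use * assms subspD(2)[OF assms(1)] orth_sym in \<open>auto simp: perp_def\<close>)
  then show "\<forall>y\<in>ext U v. y \<perp> x" using orth_sym assms by (auto simp: perp_def)
qed (use ext_base[OF assms(1,2)] ext_gen[OF assms(1,2)] in blast)

lemma perp_ext: "subsp U \<Longrightarrow> v \<in> carrier M \<Longrightarrow> perp (ext U v) = perp U \<inter> perp {v}"
  unfolding perp_def using orth_ext[of U v] by auto

text \<open>Induction on \<open>X\<close>. If \<open>v\<close> is not already orthogonal to
  \<open>perp X\<close>, take \<open>z0\<close> in \<open>perp X\<close> that is not orthogonal to
  \<open>v\<close>, and correct \<open>w\<close> by a multiple of \<open>v\<close> to make it
  orthogonal to \<open>z0\<close>. Any \<open>z\<close> in \<open>perp X\<close> lies in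
  \<open>perp (ext X v)\<close> up to a multiple of \<open>z0\<close>, so the corrected vector is
  orthogonal to all of \<open>perp X\<close>.\<close>

lemma perp_perp:
  assumes "dim k X" "w \<in> carrier M" "\<And>z. z \<in> perp X \<Longrightarrow> w \<perp> z"
  shows "\<exists>x\<in>X. \<exists>r\<in>carrier M. w = x \<^bold>+ r \<and> (\<forall>z\<in>carrier M. r \<perp> z)"
  using assms
proof (induction arbitrary: w rule: dimx.induct)
  case dimx_0
  then show ?case by (auto simp: perp_def intro!: bexI[of _ w])
next
  case (dimx_Suc k X v)
  have X: "subsp X" using dimx_Suc dim_subsp by blast
  show ?case
  proof (cases "\<forall>z\<in>perp X. v \<perp> z")
    case True
    then have "perp (ext X v) = perp X" using perp_ext[OF X] dimx_Suc by (auto simp: perp_def)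
    then show ?thesis using dimx_Suc.IH[OF dimx_Suc.prems(1)] dimx_Suc.prems ext_base[OF X dimx_Suc.hyps(2)] by metis
  next
    case False
    then obtain z0 where z0: "z0 \<in> perp X" "\<not> v \<perp> z0" by blast
    have z0c: "z0 \<in> carrier M" using z0 by (simp add: perp_def)
    note v = dimx_Suc.hyps(2) and w = dimx_Suc.prems(1)
    have "\<not> z0 \<perp> v" using z0 z0c v orth_sym by blast
    then obtain c where c: "c \<in> carrier R" "z0 \<perp> w \<^bold>+ c \<^bold>* v" using orth_solve z0c v w by blast
    let ?w = "w \<^bold>+ c \<^bold>* v"
    have wc: "?w \<in> carrier M" using w v c by simp
    have "?w \<perp> z" if z: "z \<in> perp X" for z
    proof -
      have zc: "z \<in> carrier M" using z by (simp add: perp_def)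
      obtain d where d: "d \<in> carrier R" "v \<perp> z \<^bold>+ d \<^bold>* z0" using orth_solve z0 z0c v zc by blast
      let ?z = "z \<^bold>+ d \<^bold>* z0"
      have X': "?z \<in> perp X" using z z0 d subspD[OF subsp_perp[OF subspD(1)[OF X]]] by blast
      then have "?z \<in> perp (ext X v)" using d perp_ext[OF X v] by (auto simp: perp_def)
      then have "w \<perp> ?z" using dimx_Suc.prems by blast
      then have "?z \<perp> ?w" using orth_add orth_smult orth_sym d zc z0c v w c by simp
      then have "?z \<in> perp {?w}" using orth_sym wc X' by (auto simp: perp_def)
      moreover have "d \<^bold>* z0 \<in> perp {?w}" using c(2) orth_sym wc z0c d by (auto simp: perp_def orth_smult)
      ultimately have "z \<in> perp {?w}" using subsp_add_iff(2)[OF subsp_perp[of "{?w}"]] wc zc by blast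
      then show ?thesis by (simp add: perp_def)
    qed
    then obtain x r where xr: "x \<in> X" "r \<in> carrier M" "?w = x \<^bold>+ r" "\<forall>z\<in>carrier M. r \<perp> z"
      using dimx_Suc.IH[OF wc] by blast
    have xc: "x \<in> carrier M" using xr subspD[OF X] by blast
    have "w = ?w \<^bold>+ \<ominus> c \<^bold>* v" using w v c
      by (simp add: M.a_assoc smult_l_distr[symmetric] R.r_neg)
    also have "\<dots> = (x \<^bold>+ \<ominus> c \<^bold>* v) \<^bold>+ r" unfolding xr(3) using xc xr v c by (simp add: M.a_ac)
    finally show ?thesis using xr c extI[of x X "\<ominus> c" v] by blast
  qed
qed

text \<open>By \<open>orth_solve\<close>, a fixed vector \<open>y0\<close> of \<open>Y\<close>
  outside \<open>perp {u}\<close> spans \<open>Y\<close> together with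
  \<open>Y \<inter> perp {u}\<close>, so at most one dimension is lost.\<close>

lemma dim_perp1:
  assumes "dim k Y" "u \<in> carrier M"
  shows "\<exists>k'. dim k' (Y \<inter> perp {u}) \<and> k \<le> Suc k'"
proof (cases "Y \<subseteq> perp {u}")
  case True then show ?thesis using assms by (metis Int_absorb2 le_SucI le_refl)
next
  case False
  have Y: "subsp Y" and s: "subsp (perp {u})" using dim_subsp[OF assms(1)] subsp_perp assms by auto
  obtain y0 where y0: "y0 \<in> Y" "y0 \<notin> perp {u}" using False by blast
  have c: "y0 \<in> carrier M" "\<not> u \<perp> y0" using y0 subspD[OF Y] by (auto simp: perp_def)
  have "Y \<subseteq> ext (perp {u}) y0"
  proof
    fix y assume y: "y \<in> Y"
    then have yc: "y \<in> carrier M" using subspD[OF Y] by blast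
    obtain d where d: "d \<in> carrier R" "u \<perp> y \<^bold>+ d \<^bold>* y0" using orth_solve[OF yc c(1) assms(2) c(2)] by blast
    have "y = (y \<^bold>+ d \<^bold>* y0) \<^bold>+ \<ominus> d \<^bold>* y0"
      using yc c d by (simp add: M.a_assoc smult_l_distr[symmetric] R.r_neg)
    moreover have "y \<^bold>+ d \<^bold>* y0 \<in> perp {u}" using d yc c by (simp add: perp_def)
    ultimately show "y \<in> ext (perp {u}) y0" using d extI by (metis R.a_inv_closed)
  qed
  then have e: "Y = ext (Y \<inter> perp {u}) y0" using subset_ext_eq[OF s Y c(1) _ y0] by blast
  obtain k' where k': "dim k' (Y \<inter> perp {u})" using dim_mono[OF assms(1) subsp_Int[OF Y s]] by blast
  have "dim (Suc k') Y" using dimx_Suc[OF k' c(1)] y0 e by auto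
  then show ?thesis using k' dim_unique[OF assms(1)] by blast
qed

text \<open>Each of the \<open>l\<close> vectors that lead from \<open>A\<close> to \<open>U\<close>
  costs \<open>W\<close> at most one dimension.\<close>

lemma dim_perp:
  assumes "dimx A l U" "subsp A" "dim w W" "W \<subseteq> perp A"
  shows "\<exists>e. dim e (W \<inter> perp U) \<and> w \<le> e + l"
  using assms
proof (induction rule: dimx.induct)
  case dimx_0 then show ?case by (metis Int_absorb2 add_0_right le_refl)
next
  case (dimx_Suc k U v)
  obtain e where e: "dim e (W \<inter> perp U)" "w \<le> e + k" using dimx_Suc by blast
  obtain k' where k': "dim k' (W \<inter> perp U \<inter> perp {v})" "e \<le> Suc k'" using dim_perp1[OF e(1)] dimx_Suc by blast
  have "W \<inter> perp U \<inter> perp {v} = W \<inter> perp (ext U v)"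
    using perp_ext dimx_subsp dimx_Suc by blast
  then show ?case using k' e by (metis add_Suc_right add_Suc le_trans add_le_mono1)
qed

section \<open>Totally singular subspaces\<close>

definition tsub :: "'c set \<Rightarrow> bool" where
  "tsub U \<longleftrightarrow> subsp U \<and> U \<subseteq> S \<and> (\<forall>u\<in>U. \<forall>v\<in>U. u \<perp> v)"

definition maxtsub :: "'c set \<Rightarrow> bool" where
  "maxtsub U \<longleftrightarrow> tsub U \<and> (\<forall>v\<in>S. (\<forall>u\<in>U. u \<perp> v) \<longrightarrow> v \<in> U)"

lemma tsubD: assumes "tsub U" shows "subsp U" "u \<in> U \<Longrightarrow> u \<in> S" "u \<in> U \<Longrightarrow> v \<in> U \<Longrightarrow> u \<perp> v"
    "u \<in> U \<Longrightarrow> u \<in> carrier M"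
  using assms unfolding tsub_def by (auto dest: subspD(2))

lemma tsub_zero: "tsub {\<^bold>0}" by (simp add: tsub_def subsp_zero)

lemma tsub_mono: "tsub U \<Longrightarrow> subsp W \<Longrightarrow> W \<subseteq> U \<Longrightarrow> tsub W"
  by (auto simp: tsub_def)

lemma tsub_ext:
  assumes U: "tsub U" and v: "v \<in> S" "\<And>u. u \<in> U \<Longrightarrow> u \<perp> v"
  shows "tsub (ext U v)"
  unfolding tsub_def
proof (intro conjI ballI)
  have vc: "v \<in> carrier M" using v by simp
  show s: "subsp (ext U v)" using tsubD(1)[OF U] vc by blast
  show "ext U v \<subseteq> S"
  proof
    fix x assume "x \<in> ext U v"
    then obtain u a where *: "u \<in> U" "a \<in> carrier R" "x = u \<^bold>+ a \<^bold>* v" by (meson extE)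
    then show "x \<in> S" using S_add[of u "a \<^bold>* v"] S_smult tsubD[OF U] v orth_smult vc by simp
  qed
  fix x y assume x: "x \<in> ext U v" and y: "y \<in> ext U v"
  have xc: "x \<in> carrier M" using subspD(2)[OF s x] .
  have 1: "\<forall>y\<in>ext U v. y \<perp> u" if "u \<in> U" for u
    using orth_ext[OF tsubD(1)[OF U] vc, of u] that tsubD(3,4)[OF U] v(2) orth_commute[OF vc, of u] by auto
  have 2: "\<forall>y\<in>ext U v. y \<perp> v" using orth_ext[OF tsubD(1)[OF U] vc vc] v S_self by blast
  have "\<forall>y\<in>ext U v. y \<perp> x"
    unfolding orth_ext[OF tsubD(1)[OF U] vc xc]
    using 1 2 x xc orth_sym tsubD(4)[OF U] vc by auto
  then show "x \<perp> y" using y orth_sym xc subspD(2)[OF s] by blast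
qed

lemma tsub_pspan: "u \<in> S \<Longrightarrow> tsub (pspan R M u)"
  using tsub_ext[OF tsub_zero, of u] by (simp add: pspan_ext)

lemma tsub_span2: "u \<in> S \<Longrightarrow> v \<in> S \<Longrightarrow> u \<perp> v \<Longrightarrow> tsub (span2 u v)"
  unfolding span2_def using tsub_ext[OF tsub_pspan, of u v] orth_pspan(2)[of v u] orth_commute[of u v] by simp

text \<open>With \<open>A = U \<inter> W\<close>, the part of \<open>W\<close> orthogonal to
  \<open>U\<close> has codimension at most \<open>dim U - dim A\<close> in \<open>W\<close> by
  \<open>dim_perp\<close>, and it lies in \<open>A\<close> because \<open>U\<close> is maximal. By
  symmetry all maximal singular subspaces have the same dimension.\<close>

lemma maxtsub_dim_le:
  assumes "maxtsub U" "maxtsub W" "dim d U" "dim w W"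
  shows "w \<le> d"
proof -
  note U = assms(1)[unfolded maxtsub_def] and W = assms(2)[unfolded maxtsub_def]
  let ?A = "U \<inter> W"
  have A: "subsp ?A" using U W subsp_Int[OF tsubD(1) tsubD(1), of U W] by simp
  obtain a l where al: "dim a ?A" "dimx ?A l U" "a + l = d"
    using dimx_split[OF assms(3) subsp_zero A] subspD(3)[OF A] by auto
  have "W \<subseteq> perp ?A" using W by (auto simp: perp_def tsub_def dest: subspD(2))
  then obtain e where e: "dim e (W \<inter> perp U)" "w \<le> e + l"
    using dim_perp[OF al(2) A assms(4)] by blast
  have "W \<inter> perp U \<subseteq> ?A" using U W by (auto simp: perp_def tsub_def)
  then have "e \<le> a" using dim_le al(1) e(1) by blast
  then show ?thesis using e al by linarith
qed

lemma maxtsub_extend: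
  assumes "dim N (carrier M)" "tsub U"
  shows "\<exists>W. maxtsub W \<and> U \<subseteq> W"
proof -
  obtain k where "dim k U" using dim_mono[OF assms(1)] tsubD[OF assms(2)] by blast
  then show ?thesis using assms(2)
  proof (induction "N - k" arbitrary: k U rule: less_induct)
    case less
    show ?case
    proof (cases "maxtsub U")
      case False
      then obtain v where v: "v \<in> S" "\<And>u. u \<in> U \<Longrightarrow> u \<perp> v" "v \<notin> U"
        using less.prems by (auto simp: maxtsub_def)
      have t: "tsub (ext U v)" using tsub_ext less.prems v by blast
      have d: "dim (Suc k) (ext U v)" using dimx_Suc less.prems v by simp
      have "Suc k \<le> N" using dim_le[OF assms(1) d] subspD(1)[OF tsubD(1)[OF t]] .
      then have "N - Suc k < N - k" by linarith
      then obtain W where "maxtsub W" "ext U v \<subseteq> W" using less.hyps[OF _ d t] by blast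
      then show ?thesis using ext_base[OF tsubD(1)[OF less.prems(2)] S_carrier[OF v(1)]] by blast
    qed auto
  qed
qed

text \<open>Adding a multiple of \<open>x\<close> stays within \<open>W\<close> and does not change
  the relation to \<open>x\<close>, since \<open>x\<close> is orthogonal to itself. This produces
  singular vectors inside perps.\<close>

lemma S_lift_in:
  assumes "subsp W" "x \<in> W" "x \<in> S" "z \<in> W" "\<not> x \<perp> z"
  shows "\<exists>y\<in>W. y \<in> S \<and> \<not> x \<perp> y \<and> y \<in> span2 x z"
proof -
  have zc: "z \<in> carrier M" and xc: "x \<in> carrier M" using assms subspD by blast+
  obtain c where c: "c \<in> carrier R" "z \<^bold>+ c \<^bold>* x \<in> S" using S_lift assms zc by blast
  have "z \<^bold>+ c \<^bold>* x \<in> W" using subspD[OF assms(1)] assms c by blast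
  moreover have "\<not> x \<perp> z \<^bold>+ c \<^bold>* x"
    using subsp_add_iff(2)[OF subsp_perp[of "{x}"], of "c \<^bold>* x" z] xc zc assms c S_self orth_smult
    by (auto simp: perp_def)
  moreover have "z \<^bold>+ c \<^bold>* x \<in> span2 x z"
    using span2I(2)[OF xc zc c(1)] c xc zc by (simp add: M.a_comm)
  ultimately show ?thesis using c by blast
qed

section \<open>Points, lines and singular subspaces as a geometry\<close>

definition pts :: "'c set \<Rightarrow> 'c set set" where
  "pts U = pspan R M ` (U - {\<^bold>0})"

lemma pts_iff: "subsp U \<Longrightarrow> v \<in> carrier M \<Longrightarrow> v \<noteq> \<^bold>0 \<Longrightarrow> pspan R M v \<in> pts U \<longleftrightarrow> v \<in> U"
  using pspan_subset[of U] pspan_self[of v] by (fastforce simp: pts_def)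

text \<open>\<open>S\<close> is not a subspace in general, so \<open>pts_iff\<close> does not apply;
  closure under scalars suffices.\<close>

lemma pts_S_iff: "v \<in> carrier M \<Longrightarrow> v \<noteq> \<^bold>0 \<Longrightarrow> pspan R M v \<in> pts S \<longleftrightarrow> v \<in> S"
proof -
  assume *: "v \<in> carrier M" "v \<noteq> \<^bold>0"
  have "v \<in> S" if "pspan R M v = pspan R M u" "u \<in> S" for u
    using pspan_self[OF *(1)] that S_smult by (auto simp: pspan_iff)
  then show ?thesis using * by (auto simp: pts_def)
qed

lemma pts_mono: "U \<subseteq> W \<Longrightarrow> pts U \<subseteq> pts W" by (auto simp: pts_def)

lemma pts_subset_iff:
  assumes U: "subsp U" and W: "subsp W" shows "pts U \<subseteq> pts W \<longleftrightarrow> U \<subseteq> W"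
proof
  assume *: "pts U \<subseteq> pts W"
  show "U \<subseteq> W"
  proof
    fix v assume v: "v \<in> U"
    show "v \<in> W"
    proof (cases "v = \<^bold>0")
      case False
      then have "pspan R M v \<in> pts W" using * v by (auto simp: pts_def)
      then show ?thesis using pts_iff[OF W subspD(2)[OF U v] False] by simp
    qed (use subspD(3)[OF W] in simp)
  qed
qed (rule pts_mono)

definition geo :: "'c set geometry" where
  "geo = \<lparr>points = pts S, blocks = {pts U | U. tsub U \<and> dim 2 U}\<rparr>"

lemma geo_simps: "points geo = pts S" "blocks geo = {pts U | U. tsub U \<and> dim 2 U}"
  by (simp_all add: geo_def)

lemma blocks_geo: "blocks geo \<subseteq> Pow (points geo)"
  by (auto simp: geo_simps pts_def tsub_def)

lemma block_span2:
  "u \<in> S \<Longrightarrow> v \<in> S \<Longrightarrow> u \<perp> v \<Longrightarrow> u \<noteq> \<^bold>0 \<Longrightarrow> v \<notin> pspan R M u \<Longrightarrow> pts (span2 u v) \<in> blocks geo"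
  using tsub_span2[of u v] dim_span2[of u v] by (auto simp: geo_simps)

lemma collinear_geo:
  assumes "u \<in> S" "v \<in> S" "u \<noteq> \<^bold>0" "v \<noteq> \<^bold>0"
  shows "collinear geo (pspan R M u) (pspan R M v) \<longleftrightarrow> u \<perp> v"
proof
  assume "collinear geo (pspan R M u) (pspan R M v)"
  then consider "pspan R M u = pspan R M v"
    | U where "tsub U" "pspan R M u \<in> pts U" "pspan R M v \<in> pts U"
    by (auto simp: collinear_def geo_simps)
  then show "u \<perp> v"
  proof cases
    case 1 then show ?thesis
      using orth_pspan(1)[of u u v] S_self[OF assms(1)] pspan_self[of v] assms by simp
  next
    case 2
    then have "u \<in> U" "v \<in> U" using pts_iff[OF tsubD(1)[OF 2(1)]] assms S_carrier by auto
    then show ?thesis using tsubD(3)[OF 2(1)] by simp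
  qed
next
  assume "u \<perp> v"
  show "collinear geo (pspan R M u) (pspan R M v)"
  proof (cases "v \<in> pspan R M u")
    case True then show ?thesis using pspan_eq assms by (simp add: collinear_def)
  next
    case False
    have "pspan R M u \<in> pts (span2 u v)" "pspan R M v \<in> pts (span2 u v)"
      using span2_gen[of u v] assms by (auto simp: pts_def)
    then show ?thesis
      using block_span2[OF assms(1,2) \<open>u \<perp> v\<close> assms(3) False] unfolding collinear_def by blast
  qed
qed

lemma geom_subspace_pts: assumes W: "subsp W" shows "geom_subspace geo (pts (W \<inter> S))"
  unfolding geom_subspace_def
proof (intro conjI ballI impI)
  show "pts (W \<inter> S) \<subseteq> points geo" by (simp add: geo_simps pts_mono)
  fix l assume l: "l \<in> blocks geo" "\<exists>x\<in>l \<inter> pts (W \<inter> S). \<exists>y\<in>l \<inter> pts (W \<inter> S). x \<noteq> y"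
  then obtain U where U: "tsub U" "dim 2 U" "l = pts U" by (auto simp: geo_simps)
  obtain u v where uv: "pspan R M u \<in> l" "pspan R M v \<in> l" "u \<in> W" "v \<in> W" "u \<noteq> \<^bold>0" "v \<noteq> \<^bold>0"
    "pspan R M u \<noteq> pspan R M v" using l(2) by (auto simp: pts_def)
  have c: "u \<in> carrier M" "v \<in> carrier M" using uv subspD[OF W] by blast+
  have "u \<in> U" "v \<in> U" using uv U pts_iff[OF tsubD(1)] c by blast+
  moreover have "v \<notin> pspan R M u" using uv pspan_eq c by blast
  ultimately have "U = span2 u v" using dim_2_span2[OF U(2)] uv by blast
  then have "U \<subseteq> W \<inter> S" using span2_least[OF W] uv tsubD(2)[OF U(1)] by blast
  then show "l \<subseteq> pts (W \<inter> S)" using U pts_mono by blast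
qed

lemma geom_subspace_tsub: "tsub U \<Longrightarrow> geom_subspace geo (pts U)"
  using geom_subspace_pts[of U] by (simp add: tsub_def Int_absorb2)

text \<open>For the direction from left to right, the vectors whose points lie in \<open>X\<close>
  are closed under addition: the sum of two independent ones lies on the line joining their points,
  and \<open>X\<close> contains that line.\<close>

lemma singular_geo: "singular_subspace geo X \<longleftrightarrow> (\<exists>U. tsub U \<and> X = pts U)"
proof
  assume "\<exists>U. tsub U \<and> X = pts U"
  then obtain U where U: "tsub U" "X = pts U" by blast
  have "collinear geo x y" if xy: "x \<in> pts U" "y \<in> pts U" for x y
  proof -
    obtain u v where "x = pspan R M u" "y = pspan R M v" "u \<in> U" "v \<in> U" "u \<noteq> \<^bold>0" "v \<noteq> \<^bold>0"
      using xy by (auto simp: pts_def)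
    then show ?thesis using collinear_geo[of u v] tsubD(2,3)[OF U(1)] by simp
  qed
  then show "singular_subspace geo X" using geom_subspace_tsub U by (simp add: singular_subspace_def)
next
  assume X: "singular_subspace geo X"
  let ?U = "{v \<in> S. v = \<^bold>0 \<or> pspan R M v \<in> X}"
  have sub: "X \<subseteq> pts S" using X by (simp add: singular_subspace_def geom_subspace_def geo_simps)
  have XU: "X = pts ?U" using sub by (auto simp: pts_def)
  have col: "u \<perp> v" if "u \<in> ?U" "v \<in> ?U" for u v
  proof (cases "u = \<^bold>0 \<or> v = \<^bold>0")
    case True then show ?thesis using that by auto
  next
    case False
    then have "collinear geo (pspan R M u) (pspan R M v)" using X that by (simp add: singular_subspace_def)
    then show ?thesis using collinear_geo[of u v] False that by simp
  qed
  have "subsp ?U"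
  proof (rule subspI)
    show "?U \<subseteq> carrier M" "\<^bold>0 \<in> ?U" by auto
    show "a \<^bold>* u \<in> ?U" if "a \<in> carrier R" "u \<in> ?U" for a u
      using that pspan_smult[of a u] S_smult by auto
    fix u v assume uv: "u \<in> ?U" "v \<in> ?U"
    have c: "u \<in> carrier M" "v \<in> carrier M" using uv by auto
    have S: "u \<^bold>+ v \<in> S" using S_add col uv by blast
    have "pspan R M (u \<^bold>+ v) \<in> X" if nz: "u \<^bold>+ v \<noteq> \<^bold>0"
    proof (cases "u = \<^bold>0 \<or> v = \<^bold>0")
      case True then show ?thesis using uv nz c by auto
    next
      case False
      show ?thesis
      proof (cases "v \<in> pspan R M u")
        case True
        then have "u \<^bold>+ v \<in> pspan R M u" using subspD(4)[OF subsp_pspan[OF c(1)] _ True] c by blast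
        then show ?thesis using pspan_eq[OF _ nz c(1)] uv False by auto
      next
        case ne: False
        let ?l = "pts (span2 u v)"
        have "?l \<in> blocks geo" using block_span2 col uv False ne by blast
        moreover have "pspan R M u \<in> ?l" "pspan R M v \<in> ?l"
          using span2_gen[OF c] False by (auto simp: pts_def)
        moreover have "pspan R M u \<noteq> pspan R M v" using ne pspan_self[OF c(2)] by blast
        ultimately have "?l \<subseteq> X" using X uv False
          unfolding singular_subspace_def geom_subspace_def by blast
        moreover have "pspan R M (u \<^bold>+ v) \<in> ?l"
          using pts_iff[OF subsp_span2[OF c], of "u \<^bold>+ v"] nz c subspD(4)[OF subsp_span2[OF c] span2_gen[OF c]] by simp
        ultimately show ?thesis by blast
      qed
    qed
    then show "u \<^bold>+ v \<in> ?U" using S by blast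
  qed
  then have "tsub ?U" using col by (auto simp: tsub_def)
  then show "\<exists>U. tsub U \<and> X = pts U" using XU by blast
qed

text \<open>A chain of \<open>k\<close> extensions supplies \<open>k\<close> points. A point of
  \<open>ext U v\<close> is the point of \<open>v\<close> or lies on a line joining that point to a
  point of \<open>U\<close>, so a geometric subspace through the chosen points contains everything.
  Together with \<open>generated_lower\<close> this identifies the least size of a generating set
  with the vector dimension.\<close>

lemma generated_upper:
  assumes "dim k U" "tsub U"
  shows "\<exists>A\<subseteq>pts U. finite A \<and> card A = k \<and> (\<forall>T. geom_subspace geo T \<longrightarrow> A \<subseteq> T \<longrightarrow> pts U \<subseteq> T)"
  using assms
proof (induction rule: dimx.induct)
  case dimx_0 show ?case by (rule exI[of _ "{}"]) (auto simp: pts_def)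
next
  case (dimx_Suc k U v)
  have U: "subsp U" using dimx_Suc dim_subsp by blast
  have UE: "U \<subseteq> ext U v" "v \<in> ext U v" using ext_base[OF U] ext_gen[OF U] dimx_Suc by blast+
  have tU: "tsub U" using tsub_mono[OF dimx_Suc.prems U UE(1)] .
  obtain A where A: "A \<subseteq> pts U" "finite A" "card A = k"
    "\<And>T. geom_subspace geo T \<Longrightarrow> A \<subseteq> T \<Longrightarrow> pts U \<subseteq> T" using dimx_Suc.IH[OF tU] by blast
  have v0: "v \<noteq> \<^bold>0" using dimx_Suc subspD(3)[OF U] by blast
  have vA: "pspan R M v \<notin> pts U" using pts_iff[OF U] dimx_Suc v0 by blast
  have vE: "pspan R M v \<in> pts (ext U v)" using UE v0 by (auto simp: pts_def)
  have T: "pts (ext U v) \<subseteq> T" if T: "geom_subspace geo T" "insert (pspan R M v) A \<subseteq> T" for T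
  proof
    fix x assume "x \<in> pts (ext U v)"
    then obtain w where w: "w \<in> ext U v" "w \<noteq> \<^bold>0" "x = pspan R M w" by (auto simp: pts_def)
    then obtain u a where u: "u \<in> U" "a \<in> carrier R" "w = u \<^bold>+ a \<^bold>* v" by (meson extE)
    have uc: "u \<in> carrier M" using u subspD[OF U] by blast
    show "x \<in> T"
    proof (cases "u = \<^bold>0")
      case True
      then have "x = pspan R M v" using w u pspan_smult[of a v] dimx_Suc by auto
      then show ?thesis using T by blast
    next
      case False
      have vn: "v \<notin> pspan R M u" using pspan_subset[OF U u(1)] dimx_Suc by blast
      let ?l = "pts (span2 u v)"
      have uv: "u \<in> S" "v \<in> S" "u \<perp> v" using tsubD[OF dimx_Suc.prems] u UE by blast+
      have "?l \<in> blocks geo" using block_span2[OF uv False vn] .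
      moreover have "pspan R M u \<in> ?l" "pspan R M v \<in> ?l"
        using span2_gen[OF uc dimx_Suc.hyps(2)] False v0 by (auto simp: pts_def)
      moreover have "pspan R M u \<noteq> pspan R M v" using vn dimx_Suc pspan_self by blast
      moreover have "pspan R M u \<in> T" using A(4)[OF T(1)] T(2) u False by (auto simp: pts_def)
      ultimately have "?l \<subseteq> T" using T unfolding geom_subspace_def by blast
      moreover have "w \<in> span2 u v" using span2I(1)[of u v a] u uc dimx_Suc.hyps(2) by simp
      ultimately show ?thesis using w by (auto simp: pts_def)
    qed
  qed
  have "card (insert (pspan R M v) A) = Suc k" using A vA by (metis card_insert_disjoint subsetD)
  then show ?case
    using A vE T pts_mono[OF UE(1)] by (intro exI[of _ "insert (pspan R M v) A"]) auto
qed

text \<open>Each further point raises the dimension of the spanned subspace by at most one.\<close>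

lemma generated_lower:
  assumes "finite A" "A \<subseteq> pts U" "tsub U"
  shows "\<exists>W k. dim k W \<and> W \<subseteq> U \<and> k \<le> card A \<and> A \<subseteq> pts W"
  using assms
proof (induction rule: finite_induct)
  case empty then show ?case using subspD(3)[OF tsubD(1)] by (fastforce simp: pts_def)
next
  case (insert x A)
  then obtain W k where W: "dim k W" "W \<subseteq> U" "k \<le> card A" "A \<subseteq> pts W" by auto
  obtain v where v: "v \<in> U" "v \<noteq> \<^bold>0" "x = pspan R M v" using insert.prems by (auto simp: pts_def)
  have vc: "v \<in> carrier M" using v tsubD[OF insert.prems(2)] by blast
  show ?case
  proof (cases "v \<in> W")
    case True
    then show ?thesis using W v insert by (metis card_insert_disjoint insert_subset le_SucI pts_iff vc dim_subsp)
  next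
    case False
    have W': "subsp W" using W dim_subsp by blast
    have "dim (Suc k) (ext W v)" using dimx_Suc W vc False by blast
    moreover have "ext W v \<subseteq> U" using ext_least tsubD(1) insert.prems W v by blast
    moreover have "W \<subseteq> ext W v" "v \<in> ext W v" using ext_base[OF W' vc] ext_gen[OF W' vc] by blast+
    then have "insert x A \<subseteq> pts (ext W v)" using W(4) v pts_mono[of W "ext W v"] by (auto simp: pts_def)
    ultimately show ?thesis using W insert by (metis Suc_le_mono card_insert_disjoint)
  qed
qed

lemma generated_tsub:
  assumes "tsub U" "A \<subseteq> pts U" "\<And>T. geom_subspace geo T \<Longrightarrow> A \<subseteq> T \<Longrightarrow> pts U \<subseteq> T"
  shows "generated geo A = pts U"
  using assms geom_subspace_tsub[OF assms(1)] by (auto simp: generated_def)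

lemma proj_dim_geo:
  assumes "tsub U" "dim k U"
  shows "proj_dim geo (pts U) = int k - 1" "finitely_generated geo (pts U)"
proof -
  let ?P = "\<lambda>k. \<exists>A\<subseteq>pts U. finite A \<and> card A = k \<and> generated geo A = pts U"
  obtain A where A: "A \<subseteq> pts U" "finite A" "card A = k"
    "\<And>T. geom_subspace geo T \<Longrightarrow> A \<subseteq> T \<Longrightarrow> pts U \<subseteq> T" using generated_upper[OF assms(2,1)] by blast
  have g: "generated geo A = pts U" using generated_tsub[OF assms(1) A(1,4)] .
  then show "finitely_generated geo (pts U)" using A by (auto simp: finitely_generated_def)
  have "k \<le> l" if "?P l" for l
  proof -
    obtain A where A: "A \<subseteq> pts U" "finite A" "card A = l" "generated geo A = pts U" using \<open>?P l\<close> by blast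
    obtain W k' where W: "dim k' W" "W \<subseteq> U" "k' \<le> card A" "A \<subseteq> pts W"
      using generated_lower[OF A(2,1) assms(1)] by blast
    have "tsub W" using tsub_mono[OF assms(1)] W dim_subsp by blast
    then have "pts U \<subseteq> pts W" using A generated_subset geom_subspace_tsub W by metis
    then have "U \<subseteq> W" using pts_subset_iff tsubD(1) assms(1) \<open>tsub W\<close> by blast
    then show ?thesis using dim_le[OF W(1) assms(2)] W A by linarith
  qed
  then have "(LEAST l. ?P l) = k" using A g by (intro Least_equality) blast+
  then show "proj_dim geo (pts U) = int k - 1" by (simp add: proj_dim_def)
qed

lemma polar_space_geo:
  assumes fin: "dim N (carrier M)" and bound: "\<And>U k. tsub U \<Longrightarrow> dim k U \<Longrightarrow> k \<le> m"
    and ex: "tsub U0" "dim m U0"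
  shows "polar_space m geo"
  unfolding polar_space_def
proof (intro conjI ballI impI allI)
  fix l assume "l \<in> blocks geo"
  then obtain U where U: "tsub U" "dim 2 U" "l = pts U" by (auto simp: geo_simps)
  show "l \<subseteq> points geo" using \<open>l \<in> blocks geo\<close> blocks_geo by blast
  obtain u v where uv: "u \<in> carrier M" "v \<in> carrier M" "u \<noteq> \<^bold>0" "v \<notin> pspan R M u" "U = span2 u v"
    using dim_2E[OF U(2)] .
  have s: "subsp (pspan R M u)" "subsp (span2 u v)" using uv by auto
  have v0: "v \<noteq> \<^bold>0" using uv subspD(3)[OF s(1)] by blast
  have w: "u \<^bold>+ v \<notin> pspan R M u" using subsp_add_iff(1)[OF s(1)] uv by simp
  then have w0: "u \<^bold>+ v \<noteq> \<^bold>0" using subspD(3)[OF s(1)] by metis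
  have "u \<^bold>+ v \<notin> pspan R M v"
    using subsp_add_iff(2)[OF subsp_pspan[OF uv(2)], of v u] uv pspan_sym[of u v] by auto
  then have "pspan R M u \<noteq> pspan R M v" "pspan R M v \<noteq> pspan R M (u \<^bold>+ v)" "pspan R M u \<noteq> pspan R M (u \<^bold>+ v)"
    using uv w pspan_self[of v] pspan_self[of "u \<^bold>+ v"] by auto
  moreover have "pspan R M u \<in> l" "pspan R M v \<in> l" "pspan R M (u \<^bold>+ v) \<in> l"
    using uv U v0 w0 span2_gen[OF uv(1,2)] subspD(4)[OF s(2)] by (auto simp: pts_def)
  ultimately show "\<exists>x\<in>l. \<exists>y\<in>l. \<exists>z\<in>l. x \<noteq> y \<and> y \<noteq> z \<and> x \<noteq> z" by blast
next
  fix x assume "x \<in> points geo"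
  then obtain u where u: "u \<in> S" "u \<noteq> \<^bold>0" "x = pspan R M u" by (auto simp: geo_simps pts_def)
  obtain z where z: "z \<in> carrier M" "\<not> u \<perp> z" using S_rad u by blast
  obtain y where y: "y \<in> S" "\<not> u \<perp> y" using S_lift_in[OF subsp_carrier, of u z] u z by auto
  have "y \<noteq> \<^bold>0" using y u by auto
  then show "\<exists>y\<in>points geo. \<not> collinear geo x y"
    using collinear_geo[of u y] u y by (auto simp: geo_simps pts_def intro!: bexI[of _ "pspan R M y"])
next
  fix x l assume x: "x \<in> points geo" and l: "l \<in> blocks geo" and xl: "x \<notin> l"
  obtain z where z: "z \<in> S" "z \<noteq> \<^bold>0" "x = pspan R M z" using x by (auto simp: geo_simps pts_def)
  obtain U where U: "tsub U" "dim 2 U" "l = pts U" using l by (auto simp: geo_simps)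
  have col: "collinear geo x (pspan R M u) \<longleftrightarrow> z \<perp> u" if "u \<in> U" "u \<noteq> \<^bold>0" for u
    using collinear_geo[of z u] z that tsubD(2)[OF U(1)] by simp
  show "(\<exists>!y. y \<in> l \<and> collinear geo x y) \<or> (\<forall>y\<in>l. collinear geo x y)"
  proof (cases "\<forall>u\<in>U. z \<perp> u")
    case True then show ?thesis using col U by (auto simp: pts_def)
  next
    case False
    then obtain u where u: "u \<in> U" "\<not> z \<perp> u" by blast
    have zc: "z \<in> carrier M" and uc: "u \<in> carrier M" using z u tsubD[OF U(1)] by auto
    \<comment> \<open>By dimension, the perp of \<open>z\<close> meets the two-dimensional
      \<open>U\<close> in at least a point; as it misses \<open>u\<close>, it meets it in exactly
      one.\<close>
    obtain k where k: "dim k (U \<inter> perp {z})" "2 \<le> Suc k" using dim_perp1[OF U(2) zc] by blast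
    then obtain w where w: "w \<in> U" "z \<perp> w" "w \<notin> {\<^bold>0}"
      using dim_less[of 0 "{\<^bold>0}" k] by (auto simp: perp_def)
    have wc: "w \<in> carrier M" using w tsubD[OF U(1)] by blast
    have "u \<notin> pspan R M w" using orth_pspan[of z w u] zc wc u w by blast
    then have Ue: "U = span2 w u" using dim_2_span2[OF U(2)] u w by blast
    have uniq: "y = pspan R M w" if y: "y \<in> l" "collinear geo x y" for y
    proof -
      obtain v where v: "v \<in> U" "v \<noteq> \<^bold>0" "y = pspan R M v" using y U by (auto simp: pts_def)
      then have zv: "z \<perp> v" using col y by blast
      obtain a b where ab: "a \<in> carrier R" "b \<in> carrier R" "v = a \<^bold>* w \<^bold>+ b \<^bold>* u" using v Ue by (auto simp: span2_iff)
      have "z \<perp> b \<^bold>* u"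
        using subsp_add_iff(1)[OF subsp_perp[of "{z}"], of "a \<^bold>* w" "b \<^bold>* u"] zv ab w wc uc zc orth_smult
        by (auto simp: perp_def)
      then have "b = \<zero>" using subsp_smult_iff[OF subsp_perp[of "{z}"], of b u] ab zc uc u by (auto simp: perp_def)
      then have "v \<in> pspan R M w" using ab wc uc by (auto simp: pspan_iff)
      then show ?thesis using pspan_eq v wc by blast
    qed
    have "pspan R M w \<in> l \<and> collinear geo x (pspan R M w)" using col w U by (auto simp: pts_def)
    then show ?thesis using uniq by blast
  qed
next
  fix X assume "singular_subspace geo X"
  then obtain U where U: "tsub U" "X = pts U" using singular_geo by blast
  obtain k where k: "dim k U" using dim_mono[OF fin] tsubD[OF U(1)] by blast
  show "finitely_generated geo X" "proj_dim geo X \<le> int m - 1"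
    using proj_dim_geo[OF U(1) k] U bound[OF U(1) k] by auto
next
  show "\<exists>X. singular_subspace geo X \<and> proj_dim geo X = int m - 1"
    using singular_geo proj_dim_geo(1)[OF ex] ex by blast
qed

end

section \<open>Transport along isomorphisms of geometries\<close>

locale giso =
  fixes \<phi> :: "'p \<Rightarrow> 'q" and G H
  assumes iso: "geometry_iso \<phi> G H" and blocks_sub: "blocks G \<subseteq> Pow (points G)"
begin

lemma bij: "bij_betw \<phi> (points G) (points H)" and blocks_image: "(\<lambda>b. \<phi> ` b) ` blocks G = blocks H"
  using iso by (auto simp: geometry_iso_def)

lemma inj: "inj_on \<phi> (points G)" and points_image: "\<phi> ` points G = points H"
  using bij by (auto simp: bij_betw_def)

lemma image_eq_iff: "X \<subseteq> points G \<Longrightarrow> Y \<subseteq> points G \<Longrightarrow> \<phi> ` X = \<phi> ` Y \<longleftrightarrow> X = Y"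
  using inj by (rule inj_on_image_eq_iff)

lemma image_subset_iff': "X \<subseteq> points G \<Longrightarrow> Y \<subseteq> points G \<Longrightarrow> \<phi> ` X \<subseteq> \<phi> ` Y \<longleftrightarrow> X \<subseteq> Y"
  using inj_onD[OF inj] by blast

lemma mem_image_iff: "x \<in> points G \<Longrightarrow> Y \<subseteq> points G \<Longrightarrow> \<phi> x \<in> \<phi> ` Y \<longleftrightarrow> x \<in> Y"
  using inj by (auto dest: inj_onD)

lemma surjE: assumes "Y \<subseteq> points H" obtains X where "X \<subseteq> points G" "Y = \<phi> ` X"
  using assms points_image by (metis subset_imageE)

lemma block_iff: "l \<subseteq> points G \<Longrightarrow> \<phi> ` l \<in> blocks H \<longleftrightarrow> l \<in> blocks G"
  unfolding blocks_image[symmetric] using image_eq_iff blocks_sub by (auto simp: image_iff)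

lemma collinear_iff: "x \<in> points G \<Longrightarrow> y \<in> points G \<Longrightarrow> collinear H (\<phi> x) (\<phi> y) \<longleftrightarrow> collinear G x y"
  unfolding collinear_def blocks_image[symmetric]
  using blocks_sub mem_image_iff inj by (auto simp: subset_iff inj_on_eq_iff)

lemma geom_subspace_iff:
  assumes X: "X \<subseteq> points G" shows "geom_subspace H (\<phi> ` X) \<longleftrightarrow> geom_subspace G X"
proof -
  have "(\<exists>x\<in>\<phi> ` l \<inter> \<phi> ` X. \<exists>y\<in>\<phi> ` l \<inter> \<phi> ` X. x \<noteq> y) \<longleftrightarrow> (\<exists>x\<in>l \<inter> X. \<exists>y\<in>l \<inter> X. x \<noteq> y)"
    if "l \<subseteq> points G" for l
  proof -
    have "\<phi> ` l \<inter> \<phi> ` X = \<phi> ` (l \<inter> X)" using inj_on_image_Int[OF inj that X] by simp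
    moreover have "\<phi> x \<noteq> \<phi> y \<longleftrightarrow> x \<noteq> y" if "x \<in> l \<inter> X" "y \<in> l \<inter> X" for x y
      using inj_on_eq_iff[OF inj, of x y] that X by blast
    ultimately show ?thesis by auto
  qed
  moreover have "\<phi> ` l \<subseteq> \<phi> ` X \<longleftrightarrow> l \<subseteq> X" if "l \<subseteq> points G" for l using image_subset_iff' that X .
  ultimately show ?thesis
    unfolding geom_subspace_def blocks_image[symmetric] points_image[symmetric]
    using blocks_sub X by (auto simp: Pow_def subset_iff)
qed

lemma singular_iff:
  assumes X: "X \<subseteq> points G" shows "singular_subspace H (\<phi> ` X) \<longleftrightarrow> singular_subspace G X"
proof -
  have "collinear H (\<phi> x) (\<phi> y) \<longleftrightarrow> collinear G x y" if "x \<in> X" "y \<in> X" for x y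
    using collinear_iff that X by blast
  then show ?thesis using geom_subspace_iff[OF X] by (simp add: singular_subspace_def)
qed

lemma generated_image:
  assumes A: "A \<subseteq> points G" shows "generated H (\<phi> ` A) = \<phi> ` generated G A"
proof -
  let ?\<F> = "{S. geom_subspace G S \<and> A \<subseteq> S}"
  \<comment> \<open>The family is nonempty, so the image under an injective map commutes with its
    intersection.\<close>
  have ne: "points G \<in> ?\<F>" using A blocks_sub by (auto simp: geom_subspace_def)
  have sub: "S \<subseteq> points G" if "S \<in> ?\<F>" for S using that by (simp add: geom_subspace_def)
  have "{T. geom_subspace H T \<and> \<phi> ` A \<subseteq> T} = (\<lambda>S. \<phi> ` S) ` ?\<F>"
  proof (intro equalityI subsetI)
    fix T assume T: "T \<in> {T. geom_subspace H T \<and> \<phi> ` A \<subseteq> T}"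
    then have "T \<subseteq> points H" by (simp add: geom_subspace_def)
    then obtain S where S: "S \<subseteq> points G" "T = \<phi> ` S" by (rule surjE)
    then have "S \<in> ?\<F>" using T geom_subspace_iff[OF S(1)] image_subset_iff'[OF A S(1)] by simp
    then show "T \<in> (\<lambda>S. \<phi> ` S) ` ?\<F>" using S by blast
  next
    fix T assume "T \<in> (\<lambda>S. \<phi> ` S) ` ?\<F>"
    then show "T \<in> {T. geom_subspace H T \<and> \<phi> ` A \<subseteq> T}" using geom_subspace_iff sub by auto
  qed
  moreover have "\<phi> ` (\<Inter>S\<in>?\<F>. S) = (\<Inter>S\<in>?\<F>. \<phi> ` S)"
    by (rule image_INT[OF inj _ ne]) (use sub in blast)
  then have "\<phi> ` \<Inter> ?\<F> = (\<Inter>S\<in>?\<F>. \<phi> ` S)" by (simp only: image_ident)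
  ultimately show ?thesis by (simp add: generated_def)
qed

text \<open>The predicate \<open>P\<close> serves two purposes: equality with \<open>k\<close>
  yields the projective dimension, and \<open>True\<close> yields finite generation.\<close>

lemma generated_by_iff:
  assumes X: "X \<subseteq> points G"
  shows "(\<exists>A\<subseteq>\<phi> ` X. finite A \<and> P (card A) \<and> generated H A = \<phi> ` X) \<longleftrightarrow>
    (\<exists>A\<subseteq>X. finite A \<and> P (card A) \<and> generated G A = X)"
proof
  assume "\<exists>A\<subseteq>X. finite A \<and> P (card A) \<and> generated G A = X"
  then obtain A where A: "A \<subseteq> X" "finite A" "P (card A)" "generated G A = X" by blast
  have "card (\<phi> ` A) = card A" using A X inj by (meson card_image inj_on_subset)
  then show "\<exists>A\<subseteq>\<phi> ` X. finite A \<and> P (card A) \<and> generated H A = \<phi> ` X"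
    using A X generated_image[of A] by (intro exI[of _ "\<phi> ` A"]) auto
next
  assume "\<exists>A\<subseteq>\<phi> ` X. finite A \<and> P (card A) \<and> generated H A = \<phi> ` X"
  then obtain A where A: "A \<subseteq> \<phi> ` X" "finite A" "P (card A)" "generated H A = \<phi> ` X" by blast
  obtain B where B: "B \<subseteq> X" "A = \<phi> ` B" using A(1) by (meson subset_imageE)
  have BG: "B \<subseteq> points G" using B X by blast
  have c: "inj_on \<phi> B" using inj_on_subset[OF inj BG] .
  have "geom_subspace G (points G)" using blocks_sub by (auto simp: geom_subspace_def)
  then have gsub: "generated G B \<subseteq> points G" using generated_subset BG by metis
  have "generated G B = X" using A B generated_image[OF BG] image_eq_iff[OF gsub X] by simp
  moreover have "finite B" "card B = card A" using A(2) B(2) finite_image_iff[OF c] card_image[OF c] by simp_all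
  ultimately show "\<exists>A\<subseteq>X. finite A \<and> P (card A) \<and> generated G A = X" using A B by metis
qed

lemma proj_dim_image: "X \<subseteq> points G \<Longrightarrow> proj_dim H (\<phi> ` X) = proj_dim G X"
  unfolding proj_dim_def using generated_by_iff[of X "\<lambda>c. c = k" for k] by simp

lemma finitely_generated_iff: "X \<subseteq> points G \<Longrightarrow> finitely_generated H (\<phi> ` X) \<longleftrightarrow> finitely_generated G X"
  unfolding finitely_generated_def using generated_by_iff[of X "\<lambda>_. True"] by simp

lemma polar_space_transport:
  assumes "polar_space m H" shows "polar_space m G"
  unfolding polar_space_def
proof (intro conjI ballI impI allI)
  note H = assms[unfolded polar_space_def]
  fix l assume l: "l \<in> blocks G"
  show "l \<subseteq> points G" using l blocks_sub by blast
  have "\<phi> ` l \<in> blocks H" using l blocks_image by blast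
  then have "\<exists>x\<in>\<phi> ` l. \<exists>y\<in>\<phi> ` l. \<exists>z\<in>\<phi> ` l. x \<noteq> y \<and> y \<noteq> z \<and> x \<noteq> z" using H by blast
  then show "\<exists>x\<in>l. \<exists>y\<in>l. \<exists>z\<in>l. x \<noteq> y \<and> y \<noteq> z \<and> x \<noteq> z" by (auto, metis)
next
  note H = assms[unfolded polar_space_def]
  fix x assume x: "x \<in> points G"
  then have "\<phi> x \<in> points H" using points_image by blast
  then obtain y where "y \<in> points H" "\<not> collinear H (\<phi> x) y" using H by blast
  then show "\<exists>y\<in>points G. \<not> collinear G x y" using collinear_iff x points_image by (metis imageE)
next
  note H = assms[unfolded polar_space_def]
  fix x l assume x: "x \<in> points G" and l: "l \<in> blocks G" and xl: "x \<notin> l"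
  have lG: "l \<subseteq> points G" using l blocks_sub by blast
  have px: "\<phi> x \<in> points H" using x points_image by blast
  have pl: "\<phi> ` l \<in> blocks H" using l blocks_image by blast
  have pxl: "\<phi> x \<notin> \<phi> ` l" using xl mem_image_iff[OF x lG] by blast
  have "\<forall>x\<in>points H. \<forall>l\<in>blocks H. x \<notin> l \<longrightarrow>
      (\<exists>!y. y \<in> l \<and> collinear H x y) \<or> (\<forall>y\<in>l. collinear H x y)" using H by argo
  from bspec[OF bspec[OF this px] pl, rule_format, OF pxl]
  have "(\<exists>!y. y \<in> \<phi> ` l \<and> collinear H (\<phi> x) y) \<or> (\<forall>y\<in>\<phi> ` l. collinear H (\<phi> x) y)" .
  then show "(\<exists>!y. y \<in> l \<and> collinear G x y) \<or> (\<forall>y\<in>l. collinear G x y)"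
  proof
    assume "\<exists>!y. y \<in> \<phi> ` l \<and> collinear H (\<phi> x) y"
    then obtain y where y: "y \<in> l" "collinear H (\<phi> x) (\<phi> y)"
      "\<And>z. z \<in> l \<Longrightarrow> collinear H (\<phi> x) (\<phi> z) \<Longrightarrow> \<phi> z = \<phi> y" by blast
    have "z = y" if "z \<in> l" "collinear G x z" for z
      using y(3)[of z] that collinear_iff[OF x, of z] lG y(1) inj_onD[OF inj, of z y] by blast
    then show ?thesis using y collinear_iff[OF x, of y] lG by blast
  next
    assume "\<forall>y\<in>\<phi> ` l. collinear H (\<phi> x) y"
    then show ?thesis using collinear_iff[OF x] lG by blast
  qed
next
  note H = assms[unfolded polar_space_def]
  fix X assume X: "singular_subspace G X"
  then have sub: "X \<subseteq> points G" by (simp add: singular_subspace_def geom_subspace_def)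
  then have "singular_subspace H (\<phi> ` X)" using X singular_iff by blast
  then have "finitely_generated H (\<phi> ` X)" "proj_dim H (\<phi> ` X) \<le> int m - 1" using H by blast+
  then show "finitely_generated G X" "proj_dim G X \<le> int m - 1"
    using finitely_generated_iff proj_dim_image sub by auto
next
  note H = assms[unfolded polar_space_def]
  obtain Y where Y: "singular_subspace H Y" "proj_dim H Y = int m - 1" using H by blast
  then have "Y \<subseteq> points H" by (simp add: singular_subspace_def geom_subspace_def)
  then obtain X where "X \<subseteq> points G" "Y = \<phi> ` X" by (rule surjE)
  then show "\<exists>X. singular_subspace G X \<and> proj_dim G X = int m - 1"
    using Y singular_iff proj_dim_image by metis
qed

end

lemma geometry_iso_comp:
  assumes "geometry_iso \<phi> G H" "geometry_iso \<psi> H J" shows "geometry_iso (\<psi> \<circ> \<phi>) G J"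
proof -
  have "(\<lambda>b. (\<psi> \<circ> \<phi>) ` b) ` blocks G = (\<lambda>b. \<psi> ` b) ` (\<lambda>b. \<phi> ` b) ` blocks G"
    by (simp add: image_comp)
  then show ?thesis using assms bij_betw_trans unfolding geometry_iso_def by metis
qed

section \<open>Direct sums of subspaces\<close>

context vspace begin

lemma minus_cancel: "u \<in> carrier M \<Longrightarrow> v \<in> carrier M \<Longrightarrow> c \<in> carrier R \<Longrightarrow> (u \<^bold>+ c \<^bold>* v) \<^bold>+ \<ominus> c \<^bold>* v = u"
  by (simp add: M.a_assoc smult_l_distr[symmetric] R.r_neg)

lemma set_add_mem: "x \<in> U <+>\<^bsub>M\<^esub> W \<longleftrightarrow> (\<exists>u\<in>U. \<exists>w\<in>W. x = u \<^bold>+ w)"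
  by (auto simp: set_add_def')

lemma sum_base:
  assumes "subsp U" "subsp W" shows "U \<subseteq> U <+>\<^bsub>M\<^esub> W" "W \<subseteq> U <+>\<^bsub>M\<^esub> W"
proof
  fix x assume x: "x \<in> U"
  then have "x = x \<^bold>+ \<^bold>0" using subspD(2)[OF assms(1)] by simp
  then show "x \<in> U <+>\<^bsub>M\<^esub> W" using x subspD(3)[OF assms(2)] unfolding set_add_mem by blast
next
  show "W \<subseteq> U <+>\<^bsub>M\<^esub> W"
  proof
    fix x assume x: "x \<in> W"
    then have "x = \<^bold>0 \<^bold>+ x" using subspD(2)[OF assms(2)] by simp
    then show "x \<in> U <+>\<^bsub>M\<^esub> W" using x subspD(3)[OF assms(1)] unfolding set_add_mem by blast
  qed
qed

lemma dimx_sum_direct: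
  assumes "dim k Y" "subsp X" "X \<inter> Y \<subseteq> {\<^bold>0}"
  shows "dimx X k (X <+>\<^bsub>M\<^esub> Y)"
  using assms
proof (induction rule: dimx.induct)
  case dimx_0
  have "X <+>\<^bsub>M\<^esub> {\<^bold>0} = X" using subspD(2)[OF dimx_0(1)] by (auto simp: set_add_mem)
  then show ?case by simp
next
  case (dimx_Suc k Y v)
  have Y: "subsp Y" using dim_subsp dimx_Suc.hyps(1) .
  note v = dimx_Suc.hyps(2) and X = dimx_Suc.prems(1)
  have YE: "Y \<subseteq> ext Y v" using ext_base[OF Y v] by blast
  then have IH: "dimx X k (X <+>\<^bsub>M\<^esub> Y)" using dimx_Suc by blast
  have nv: "v \<notin> X <+>\<^bsub>M\<^esub> Y"
  proof
    assume "v \<in> X <+>\<^bsub>M\<^esub> Y"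
    then obtain x y where xy: "x \<in> X" "y \<in> Y" "v = x \<^bold>+ y" by (auto simp: set_add_mem)
    have c: "x \<in> carrier M" "y \<in> carrier M" using xy subspD(2) X Y by blast+
    have "x \<^bold>+ y \<in> ext Y v" using ext_gen[OF Y v] xy by simp
    moreover have "y \<in> ext Y v" using YE xy by blast
    ultimately have "x \<in> ext Y v" using subsp_add_iff(2)[OF subsp_ext[OF Y v] _ c(1), of y] by simp
    then have "x = \<^bold>0" using dimx_Suc.prems xy by blast
    then show False using xy dimx_Suc.hyps c by simp
  qed
  have "X <+>\<^bsub>M\<^esub> ext Y v = ext (X <+>\<^bsub>M\<^esub> Y) v"
  proof (intro equalityI subsetI)
    fix z assume "z \<in> X <+>\<^bsub>M\<^esub> ext Y v"
    then obtain x y a where *: "x \<in> X" "y \<in> Y" "a \<in> carrier R" "z = x \<^bold>+ (y \<^bold>+ a \<^bold>* v)"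
      unfolding set_add_mem ext_def by blast
    have "z = (x \<^bold>+ y) \<^bold>+ a \<^bold>* v" using * subspD(2)[OF X] subspD(2)[OF Y] v by (simp add: M.a_assoc)
    moreover have "x \<^bold>+ y \<in> X <+>\<^bsub>M\<^esub> Y" using * set_add_mem by blast
    ultimately show "z \<in> ext (X <+>\<^bsub>M\<^esub> Y) v" using *(3) extI by simp
  next
    fix z assume "z \<in> ext (X <+>\<^bsub>M\<^esub> Y) v"
    then obtain x y a where *: "x \<in> X" "y \<in> Y" "a \<in> carrier R" "z = (x \<^bold>+ y) \<^bold>+ a \<^bold>* v"
      unfolding set_add_mem ext_def by blast
    have "z = x \<^bold>+ (y \<^bold>+ a \<^bold>* v)" using * subspD(2)[OF X] subspD(2)[OF Y] v by (simp add: M.a_assoc)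
    moreover have "y \<^bold>+ a \<^bold>* v \<in> ext Y v" using * extI by simp
    ultimately show "z \<in> X <+>\<^bsub>M\<^esub> ext Y v" using *(1) set_add_mem by blast
  qed
  then show ?case using dimx.dimx_Suc[OF IH v nv] by simp
qed

end

section \<open>Polar spaces of finite rank\<close>

locale polr = pol +
  fixes N n :: nat and M0 :: "'c set"
  assumes finV: "dim N (carrier M)" and M0: "maxtsub M0" "dim n M0"
begin

lemma fin_dim: assumes "subsp U" obtains k where "dim k U"
  using dim_mono[OF finV assms subspD(1)[OF assms]] by blast

lemma maxtsub_dim: assumes "maxtsub U" shows "dim n U"
proof -
  obtain k where k: "dim k U" using fin_dim assms tsubD(1) unfolding maxtsub_def by metis
  then have "k = n" using maxtsub_dim_le[OF assms M0(1) k M0(2)] maxtsub_dim_le[OF M0(1) assms M0(2) k] by simp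
  then show ?thesis using k by simp
qed

lemma tsub_extend: assumes "tsub U" obtains W where "tsub W" "dim n W" "U \<subseteq> W"
  using maxtsub_extend[OF finV assms] maxtsub_dim unfolding maxtsub_def by blast

lemma tsub_dim_le: assumes "tsub U" "dim k U" shows "k \<le> n"
proof -
  obtain W where "dim n W" "U \<subseteq> W" using tsub_extend[OF assms(1)] by blast
  then show ?thesis using dim_le assms(2) by blast
qed

text \<open>The difference \<open>r\<close> of two orthogonal singular vectors is singular, and a
  singular vector in the radical vanishes.\<close>

lemma rad_zero:
  assumes "u \<in> S" "p \<in> S" "u \<perp> p" "r \<in> carrier M" "u = p \<^bold>+ r" "\<And>z. z \<in> carrier M \<Longrightarrow> r \<perp> z"
  shows "u = p"
proof -
  have c: "u \<in> carrier M" "p \<in> carrier M" using assms by simp_all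
  have "r = u \<^bold>+ \<ominus> \<one> \<^bold>* p" using minus_cancel[of r p \<one>] c assms(4,5)
    by (simp add: M.a_comm)
  moreover have "u \<^bold>+ \<ominus> \<one> \<^bold>* p \<in> S" 
    by (intro S_add S_smult orth_smult assms(1,2,3) c) simp_all
  ultimately have "r = \<^bold>0" using S_rad[of r] assms(6) by simp
  then show ?thesis using assms c by simp
qed

text \<open>The singular vectors in the perp of a singular subspace of non-maximal dimension span
  that perp.\<close>

lemma S_perp_spans:
  assumes U: "tsub U" "dim k U" "k < n" and w: "w \<in> S"
    and orth: "\<And>y. y \<in> S \<Longrightarrow> (\<And>u. u \<in> U \<Longrightarrow> u \<perp> y) \<Longrightarrow> w \<perp> y"
  shows "w \<in> U"
proof -
  have wc: "w \<in> carrier M" using w by simp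
  have Uc: "U \<subseteq> carrier M" and Us: "subsp U" and UP: "U \<subseteq> perp U"
    using tsubD[OF U(1)] by (auto simp: perp_def)
  have P: "subsp (perp U)" using subsp_perp Uc by blast
  have orth': "w \<perp> y" if "y \<in> S" "y \<in> perp U" for y using orth that by (auto simp: perp_def)
  obtain M' where M': "tsub M'" "dim n M'" "U \<subseteq> M'" using tsub_extend U(1) by blast
  \<comment> \<open>This is where \<open>k < n\<close> enters: a maximal singular subspace on
    \<open>U\<close> contains a vector outside \<open>U\<close>.\<close>
  obtain y0 where y0: "y0 \<in> M'" "y0 \<notin> U" using dim_less[OF U(2) M'(2) U(3)] by blast
  have y0S: "y0 \<in> S" "y0 \<in> carrier M" and y0P: "y0 \<in> perp U"
    using tsubD[OF M'(1)] M'(3) y0 by (auto simp: perp_def)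
  have "\<exists>z0\<in>perp U. \<not> y0 \<perp> z0"
  proof (rule ccontr)
    assume "\<not> ?thesis"
    then obtain x r where xr: "x \<in> U" "r \<in> carrier M" "y0 = x \<^bold>+ r" "\<forall>z\<in>carrier M. r \<perp> z"
      using perp_perp[OF U(2) y0S(2)] by blast
    have "y0 \<perp> x" "x \<in> S" using tsubD(3)[OF M'(1) y0(1), of x] M'(3) xr(1) tsubD(2)[OF U(1)] by blast+
    then have "y0 = x" using rad_zero[of y0 x r] xr y0S by blast
    then show False using y0 xr by simp
  qed
  then obtain z0 where z0: "z0 \<in> perp U" "\<not> y0 \<perp> z0" by blast
  obtain y1 where y1: "y1 \<in> perp U" "y1 \<in> S" "\<not> y0 \<perp> y1"
    using S_lift_in[OF P y0P y0S(1) z0] by blast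
  have W: "subsp (perp {w})" using subsp_perp[of "{w}"] wc by simp
  have mem: "w \<perp> z \<longleftrightarrow> z \<in> perp {w}" if "z \<in> carrier M" for z using that by (simp add: perp_def)
  \<comment> \<open>A vector \<open>z\<close> not orthogonal to \<open>y0\<close> is the difference
    of the singular vectors \<open>z + c y0\<close> and \<open>c y0\<close> of
    \<open>perp U\<close>, and \<open>w\<close> is orthogonal to both of them.\<close>
  have A: "w \<perp> z" if z: "z \<in> perp U" "\<not> y0 \<perp> z" for z
  proof -
    have zc: "z \<in> carrier M" using z by (simp add: perp_def)
    obtain c where c: "c \<in> carrier R" "z \<^bold>+ c \<^bold>* y0 \<in> S" using S_lift[OF y0S(1) zc z(2)] by blast
    have cy: "c \<^bold>* y0 \<in> perp U" using subspD(5)[OF P c(1) y0P] .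
    have "c \<^bold>* y0 \<in> perp {w}" using mem[of "c \<^bold>* y0"] orth'[OF S_smult[OF c(1) y0S(1)] cy] c y0S by simp
    moreover have "z \<^bold>+ c \<^bold>* y0 \<in> perp {w}"
      using mem[OF S_carrier[OF c(2)]] orth'[OF c(2)] subspD(4)[OF P z(1) cy] by simp
    ultimately show ?thesis using subsp_add_iff(2)[OF W _ zc] mem[OF zc] by simp
  qed
  \<comment> \<open>If \<open>z\<close> is orthogonal to \<open>y0\<close>, then
    \<open>z + y1\<close> is not, and \<open>z\<close> is the difference of \<open>z + y1\<close>
    and \<open>y1\<close>.\<close>
  have "w \<perp> z" if z: "z \<in> perp U" for z
  proof (cases "y0 \<perp> z")
    case True
    have c: "z \<in> carrier M" "y1 \<in> carrier M" using z y1 by (simp_all add: perp_def)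
    have "\<not> y0 \<perp> z \<^bold>+ y1"
      using subsp_add_iff(1)[OF subsp_perp[of "{y0}"], of z y1] True y1 c y0S by (simp add: perp_def)
    then have "z \<^bold>+ y1 \<in> perp {w}" using A[OF subspD(4)[OF P z y1(1)]] mem c by simp
    moreover have "y1 \<in> perp {w}" using A[OF y1(1,3)] mem c by simp
    ultimately show ?thesis using subsp_add_iff(2)[OF W _ c(1)] mem[OF c(1)] by simp
  qed (use A z in blast)
  then obtain x r where xr: "x \<in> U" "r \<in> carrier M" "w = x \<^bold>+ r" "\<forall>z\<in>carrier M. r \<perp> z"
    using perp_perp[OF U(2) wc] by blast
  have x: "x \<in> S" "x \<in> perp U" using xr tsubD(2)[OF U(1)] UP by blast+
  have "w = x" using rad_zero[OF w x(1) orth'[OF x] xr(2,3)] xr(4) by blast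
  then show ?thesis using xr by simp
qed

text \<open>The argument of \<open>S_perp_spans\<close> with the zero subspace for \<open>U\<close>:
  vectors not orthogonal to \<open>y0\<close> are differences of singular vectors, and the others
  become such after adding \<open>y1\<close>.\<close>

lemma S_spans:
  assumes W: "subsp W" "S \<subseteq> W" and n: "n > 0" shows "W = carrier M"
proof
  obtain y0 where y0: "y0 \<in> M0" "y0 \<notin> {\<^bold>0}" using dim_less[of 0 "{\<^bold>0}" n M0] M0 n by auto
  have y0S: "y0 \<in> S" "y0 \<in> carrier M" using tsubD(2)[of M0 y0] M0 y0 by (simp_all add: maxtsub_def)
  obtain z0 where z0: "z0 \<in> carrier M" "\<not> y0 \<perp> z0" using S_rad y0S y0 by blast
  obtain y1 where y1: "y1 \<in> S" "\<not> y0 \<perp> y1" using S_lift_in[OF subsp_carrier y0S(2,1) z0] by blast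
  have A: "z \<in> W" if z: "z \<in> carrier M" "\<not> y0 \<perp> z" for z
  proof -
    obtain c where c: "c \<in> carrier R" "z \<^bold>+ c \<^bold>* y0 \<in> S" using S_lift[OF y0S(1) z] by blast
    have "c \<^bold>* y0 \<in> W" using S_smult[OF c(1) y0S(1)] W(2) by blast
    then show ?thesis using subsp_add_iff(2)[OF W(1) _ z(1)] c(2) W(2) by blast
  qed
  show "carrier M \<subseteq> W"
  proof
    fix z assume z: "z \<in> carrier M"
    show "z \<in> W"
    proof (cases "y0 \<perp> z")
      case True
      then have "\<not> y0 \<perp> z \<^bold>+ y1"
        using subsp_add_iff(1)[OF subsp_perp[of "{y0}"], of z y1] y1 z y0S by (simp add: perp_def)
      then show ?thesis using A[of "z \<^bold>+ y1"] subsp_add_iff(2)[OF W(1) _ z, of y1] W(2) y1 z by auto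
    qed (use A z in blast)
  qed
qed (use subspD W in blast)

end

section \<open>Point-domestic collineations without fixed points\<close>

text \<open>The collineation is given by a choice \<open>t v\<close> of a vector in the image of the point of \<open>v\<close>.\<close>

locale dom = polr +
  fixes t :: "'c \<Rightarrow> 'c"
  assumes t_S: "v \<in> S \<Longrightarrow> v \<noteq> \<^bold>0 \<Longrightarrow> t v \<in> S"
    and t_nz: "v \<in> S \<Longrightarrow> v \<noteq> \<^bold>0 \<Longrightarrow> t v \<noteq> \<^bold>0"
    and t_smult: "v \<in> S \<Longrightarrow> v \<noteq> \<^bold>0 \<Longrightarrow> a \<in> carrier R \<Longrightarrow> a \<noteq> \<zero> \<Longrightarrow> t (a \<^bold>* v) \<in> pspan R M (t v)"
    and t_orth: "u \<in> S \<Longrightarrow> v \<in> S \<Longrightarrow> u \<noteq> \<^bold>0 \<Longrightarrow> v \<noteq> \<^bold>0 \<Longrightarrow> t u \<perp> t v \<longleftrightarrow> u \<perp> v"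
    and t_line: "u \<in> S \<Longrightarrow> v \<in> S \<Longrightarrow> u \<noteq> \<^bold>0 \<Longrightarrow> v \<noteq> \<^bold>0 \<Longrightarrow> u \<perp> v \<Longrightarrow> w \<in> span2 u v \<Longrightarrow> w \<noteq> \<^bold>0 \<Longrightarrow>
      t w \<in> span2 (t u) (t v)"
    and t_onto: "u \<in> S \<Longrightarrow> v \<in> S \<Longrightarrow> u \<noteq> \<^bold>0 \<Longrightarrow> v \<noteq> \<^bold>0 \<Longrightarrow> u \<perp> v \<Longrightarrow> w \<in> span2 (t u) (t v) \<Longrightarrow> w \<noteq> \<^bold>0 \<Longrightarrow>
      \<exists>x\<in>span2 u v. x \<noteq> \<^bold>0 \<and> w \<in> pspan R M (t x)"
    and t_inj: "u \<in> S \<Longrightarrow> v \<in> S \<Longrightarrow> u \<noteq> \<^bold>0 \<Longrightarrow> v \<noteq> \<^bold>0 \<Longrightarrow> t v \<in> pspan R M (t u) \<Longrightarrow> v \<in> pspan R M u"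
    and dmst: "v \<in> S \<Longrightarrow> v \<noteq> \<^bold>0 \<Longrightarrow> v \<perp> t v"
    and nofix: "v \<in> S \<Longrightarrow> v \<noteq> \<^bold>0 \<Longrightarrow> t v \<notin> pspan R M v"
    and rank: "n \<ge> 4"
begin

section \<open>Polarised domesticity and fixed lines\<close>

lemma t_carrier [simp]: "v \<in> S \<Longrightarrow> v \<noteq> \<^bold>0 \<Longrightarrow> t v \<in> carrier M"
  using t_S by simp

lemma t_pspan: "v \<in> S \<Longrightarrow> v \<noteq> \<^bold>0 \<Longrightarrow> u \<in> pspan R M v \<Longrightarrow> u \<noteq> \<^bold>0 \<Longrightarrow> t u \<in> pspan R M (t v)"
  using t_smult by (auto simp: pspan_iff)

text \<open>Since \<open>u\<close> and \<open>v\<close> are orthogonal, \<open>u + v\<close> is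
  singular and \<open>t (u + v) = a t u + b t v\<close>. Both images are orthogonal to
  \<open>u\<close>, so domesticity of \<open>u + v\<close> makes \<open>v\<close> orthogonal to
  \<open>t (u + v)\<close>. As \<open>v\<close> is also orthogonal to \<open>t v\<close>, it is
  orthogonal to \<open>a t u\<close>, and \<open>a\<close> is nonzero because \<open>u + v\<close>
  and \<open>v\<close> span different points.\<close>

lemma orth_t_sym:
  assumes u: "u \<in> S" "u \<noteq> \<^bold>0" and v: "v \<in> S" "v \<noteq> \<^bold>0" and uv: "u \<perp> v" "u \<perp> t v"
  shows "v \<perp> t u"
proof (cases "v \<in> pspan R M u")
  case True
  then show ?thesis using orth_pspan(2)[of "t u" u v] dmst u orth_sym by simp
next
  case False
  have c: "u \<in> carrier M" "v \<in> carrier M" using u v by auto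
  let ?w = "u \<^bold>+ v"
  have wS: "?w \<in> S" using S_add u v uv by blast
  have w1: "?w \<notin> pspan R M u" using subsp_add_iff(1)[OF subsp_pspan[OF c(1)] _ c(2), of u] c False by simp
  then have w0: "?w \<noteq> \<^bold>0" using subspD(3)[OF subsp_pspan[OF c(1)]] by metis
  have w2: "?w \<notin> pspan R M v"
    using subsp_add_iff(2)[OF subsp_pspan[OF c(2)] _ c(1), of v] c False pspan_sym[of u v] u by auto
  have "?w \<in> span2 u v" using span2_gen[OF c] subspD(4)[OF subsp_span2[OF c]] by blast
  then have "t ?w \<in> span2 (t u) (t v)" using t_line u v uv w0 by blast
  then obtain a b where ab: "a \<in> carrier R" "b \<in> carrier R" "t ?w = a \<^bold>* t u \<^bold>+ b \<^bold>* t v"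
    by (auto simp: span2_iff)
  have a0: "a \<noteq> \<zero>"
  proof
    assume "a = \<zero>"
    then have "t ?w \<in> pspan R M (t v)" using ab u v by (auto simp: pspan_iff)
    then show False using t_inj[OF v(1) wS v(2) w0] w2 by blast
  qed
  have u_tw: "u \<perp> t ?w" using orth_span2(1)[of u "t u" "t v"] \<open>t ?w \<in> span2 (t u) (t v)\<close> dmst u v uv c by simp
  have "t ?w \<perp> ?w" using dmst[OF wS w0] orth_commute wS w0 by simp
  moreover have "t ?w \<perp> u" using u_tw orth_commute wS w0 c by simp
  ultimately have "t ?w \<perp> v"
    using subsp_add_iff(1)[OF subsp_perp[of "{t ?w}"], of u v] c wS w0 by (simp add: perp_def)
  then have "v \<perp> t ?w" using orth_commute[of "t ?w" v] wS w0 c by simp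
  then have "v \<perp> a \<^bold>* t u \<^bold>+ b \<^bold>* t v" using ab by simp
  then have "v \<perp> a \<^bold>* t u"
    using subsp_add_iff(2)[OF subsp_perp[of "{v}"], of "b \<^bold>* t v" "a \<^bold>* t u"] c u v ab dmst[OF v] orth_smult
    by (simp add: perp_def)
  then show ?thesis using subsp_smult_iff[OF subsp_perp[of "{v}"], of a "t u"] a0 ab c u by (simp add: perp_def)
qed

lemma orth_t_iff:
  assumes "u \<in> S" "u \<noteq> \<^bold>0" "v \<in> S" "v \<noteq> \<^bold>0" "u \<perp> v" shows "u \<perp> t v \<longleftrightarrow> v \<perp> t u"
  using orth_t_sym assms orth_commute by (metis S_carrier)

text \<open>The line joining a point to its image is fixed.\<close>

lemma t_t:
  assumes x: "x \<in> S" "x \<noteq> \<^bold>0" shows "t (t x) \<in> span2 x (t x)"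
proof -
  let ?y = "t x" and ?z = "t (t x)"
  have y: "?y \<in> S" "?y \<noteq> \<^bold>0" using t_S t_nz x by blast+
  have z: "?z \<in> S" "?z \<noteq> \<^bold>0" using t_S t_nz y by blast+
  have c: "x \<in> carrier M" "?y \<in> carrier M" "?z \<in> carrier M" using x y z by auto
  let ?U = "span2 ?y ?z"
  have U: "tsub ?U" using tsub_span2 y z dmst by blast
  have "dim 2 ?U" using dim_span2 c y nofix by blast
  then have "x \<in> ?U"
  proof (rule S_perp_spans[OF U _ _ x(1)])
    show "2 < n" using rank by simp
    \<comment> \<open>If \<open>w\<close> is orthogonal to \<open>t x\<close> and
      \<open>t (t x)\<close>, symmetry makes \<open>t x\<close> orthogonal to \<open>t w\<close>,
      which means that \<open>x\<close> is orthogonal to \<open>w\<close>.\<close>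
    fix w assume w: "w \<in> S" "\<And>u. u \<in> ?U \<Longrightarrow> u \<perp> w"
    show "x \<perp> w"
    proof (cases "w = \<^bold>0")
      case False
      have "?y \<perp> w" "?z \<perp> w" using w span2_gen[OF c(2,3)] by blast+
      then have "w \<perp> ?y" "w \<perp> t ?y" using orth_commute w c by simp_all
      then have "?y \<perp> t w" using orth_t_iff[of w ?y] w False y by simp
      then show ?thesis using t_orth x w False by simp
    qed (use x in simp)
  qed
  moreover have "x \<notin> pspan R M ?y" using nofix[OF x] pspan_sym[of x ?y] x c by blast
  ultimately have "ext (pspan R M ?y) x = ?U"
    unfolding span2_def using ext_exchange[OF subsp_pspan[OF c(2)] c(3)] by blast
  then have "?z \<in> span2 ?y x" using span2_gen[OF c(2,3)] by (simp add: span2_def)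
  then show ?thesis using span2_commute c by blast
qed

text \<open>\<open>t\<close> picks just one vector in each image point, so its plain image is not
  closed under the vector operations. Taking all multiples gives a subspace when \<open>X\<close> is
  singular (\<open>subsp_tim\<close>).\<close>

definition tim :: "'c set \<Rightarrow> 'c set" where
  "tim X = {v. v = \<^bold>0 \<or> (\<exists>x\<in>X. x \<noteq> \<^bold>0 \<and> v \<in> pspan R M (t x))}"

lemma timI: "x \<in> X \<Longrightarrow> x \<noteq> \<^bold>0 \<Longrightarrow> x \<in> S \<Longrightarrow> t x \<in> tim X"
  by (auto simp: tim_def)

lemma tim_mono: "X \<subseteq> Y \<Longrightarrow> tim X \<subseteq> tim Y" by (auto simp: tim_def)

lemma subsp_tim: assumes X: "tsub X" shows "subsp (tim X)"
proof (rule subspI)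
  have *: "pspan R M (t x) \<subseteq> carrier M" if "x \<in> X" "x \<noteq> \<^bold>0" for x
    using subspD(1)[OF subsp_pspan] that tsubD[OF X] by simp
  then show "tim X \<subseteq> carrier M" by (auto simp: tim_def)
  show "\<^bold>0 \<in> tim X" by (simp add: tim_def)
  show "a \<^bold>* u \<in> tim X" if au: "a \<in> carrier R" "u \<in> tim X" for a u
  proof (cases "u = \<^bold>0")
    case False
    then obtain x where x: "x \<in> X" "x \<noteq> \<^bold>0" "u \<in> pspan R M (t x)" using au by (auto simp: tim_def)
    then have "a \<^bold>* u \<in> pspan R M (t x)" using subspD(5)[OF subsp_pspan] au tsubD[OF X] by simp
    then show ?thesis using x by (auto simp: tim_def)
  qed (use au in \<open>simp add: tim_def\<close>)
  fix u v assume uv: "u \<in> tim X" "v \<in> tim X"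
  have c: "u \<in> carrier M" "v \<in> carrier M" using uv * by (auto simp: tim_def)
  show "u \<^bold>+ v \<in> tim X"
  proof (cases "u = \<^bold>0 \<or> v = \<^bold>0 \<or> u \<^bold>+ v = \<^bold>0")
    case True then show ?thesis using uv c by (auto simp: tim_def)
  next
    case False
    then obtain x y where x: "x \<in> X" "x \<noteq> \<^bold>0" "u \<in> pspan R M (t x)" and y: "y \<in> X" "y \<noteq> \<^bold>0" "v \<in> pspan R M (t y)"
      using uv by (auto simp: tim_def)
    have S: "x \<in> S" "y \<in> S" "x \<perp> y" using tsubD[OF X] x y by blast+
    have tc: "t x \<in> carrier M" "t y \<in> carrier M" using S x y by auto
    have "u \<in> span2 (t x) (t y)" "v \<in> span2 (t x) (t y)"
      using x(3) y(3) pspan_subset[OF subsp_span2[OF tc]] span2_gen[OF tc] by blast+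
    then have "u \<^bold>+ v \<in> span2 (t x) (t y)" using subspD(4)[OF subsp_span2[OF tc]] by blast
    then obtain z where z: "z \<in> span2 x y" "z \<noteq> \<^bold>0" "u \<^bold>+ v \<in> pspan R M (t z)"
      using t_onto[OF S(1,2) x(2) y(2) S(3)] False by blast
    have "z \<in> X" using span2_least[OF tsubD(1)[OF X] x(1) y(1)] z by blast
    then show ?thesis using z by (auto simp: tim_def)
  qed
qed

lemma orth_tim_iff:
  assumes X: "tsub X" and v: "v \<in> carrier M"
  shows "(\<forall>w\<in>tim X. v \<perp> w) \<longleftrightarrow> (\<forall>x\<in>X. x \<noteq> \<^bold>0 \<longrightarrow> v \<perp> t x)"
proof
  assume *: "\<forall>x\<in>X. x \<noteq> \<^bold>0 \<longrightarrow> v \<perp> t x"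
  show "\<forall>w\<in>tim X. v \<perp> w"
  proof
    fix w assume "w \<in> tim X"
    then consider "w = \<^bold>0" | x where "x \<in> X" "x \<noteq> \<^bold>0" "w \<in> pspan R M (t x)" by (auto simp: tim_def)
    then show "v \<perp> w"
    proof cases
      case 2 then show ?thesis using orth_pspan(1)[OF v, of "t x" w] * tsubD(2)[OF X] by simp
    qed (use v in simp)
  qed
next
  assume *: "\<forall>w\<in>tim X. v \<perp> w"
  show "\<forall>x\<in>X. x \<noteq> \<^bold>0 \<longrightarrow> v \<perp> t x" using * timI tsubD(2)[OF X] by blast
qed

lemma tsub_tim: assumes X: "tsub X" shows "tsub (tim X)"
  unfolding tsub_def
proof (intro conjI ballI)
  show s: "subsp (tim X)" using subsp_tim[OF X] .
  show "tim X \<subseteq> S" using t_S tsubD(2)[OF X] S_smult by (auto simp: tim_def pspan_iff)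
  fix u v assume u: "u \<in> tim X" and v: "v \<in> tim X"
  have c: "u \<in> carrier M" "v \<in> carrier M" using subspD(2)[OF s] u v by blast+
  have "t y \<perp> u" if y: "y \<in> X" "y \<noteq> \<^bold>0" for y
  proof -
    have "\<forall>w\<in>tim X. t y \<perp> w"
      by (subst orth_tim_iff[OF X]) (use y t_orth tsubD[OF X] in auto)
    then show ?thesis using u by blast
  qed
  then have "\<forall>x\<in>X. x \<noteq> \<^bold>0 \<longrightarrow> u \<perp> t x" using orth_commute c tsubD(2)[OF X] by simp
  then have "\<forall>w\<in>tim X. u \<perp> w" using orth_tim_iff[OF X c(1)] by blast
  then show "u \<perp> v" using v by blast
qed

text \<open>A one-vector extension goes to a one-vector extension by \<open>t_line\<close>, and
  \<open>t_inj\<close> keeps the new vector outside.\<close>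

lemma dim_tim:
  assumes "dim k X" "tsub X" shows "dim k (tim X)"
  using assms
proof (induction rule: dimx.induct)
  case dimx_0
  then show ?case by (simp add: tim_def)
next
  case (dimx_Suc k X v)
  have X: "subsp X" using dim_subsp dimx_Suc.hyps(1) .
  note v = dimx_Suc.hyps(2)
  have XE: "X \<subseteq> ext X v" "v \<in> ext X v" using ext_base[OF X v] ext_gen[OF X v] by blast+
  have tX: "tsub X" using tsub_mono[OF dimx_Suc.prems X XE(1)] .
  have IH: "dim k (tim X)" using dimx_Suc.IH tX .
  note E = tsubD[OF dimx_Suc.prems]
  have v0: "v \<noteq> \<^bold>0" using dimx_Suc.hyps subspD(3)[OF X] by blast
  have vS: "v \<in> S" using E XE by blast
  have tv: "t v \<in> carrier M" using vS v0 by simp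
  have sT: "subsp (tim X)" and sTE: "subsp (tim (ext X v))" using subsp_tim tX dimx_Suc.prems by blast+
  have nt: "t v \<notin> tim X"
  proof
    assume "t v \<in> tim X"
    then obtain x where x: "x \<in> X" "x \<noteq> \<^bold>0" "t v \<in> pspan R M (t x)" using t_nz vS v0 by (auto simp: tim_def)
    then have "v \<in> pspan R M x" using t_inj[of x v] vS v0 tsubD[OF tX] by blast
    then show False using pspan_subset[OF X x(1)] dimx_Suc.hyps by blast
  qed
  have "tim (ext X v) = ext (tim X) (t v)"
  proof
    show "ext (tim X) (t v) \<subseteq> tim (ext X v)"
      using ext_least[OF sTE tim_mono[OF XE(1)] timI[OF XE(2) v0 vS]] .
    have sE: "subsp (ext (tim X) (t v))" using sT tv by blast
    have base: "tim X \<subseteq> ext (tim X) (t v)" "t v \<in> ext (tim X) (t v)"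
      using ext_base[OF sT tv] ext_gen[OF sT tv] by blast+
    show "tim (ext X v) \<subseteq> ext (tim X) (t v)"
    proof
      fix w assume w: "w \<in> tim (ext X v)"
      show "w \<in> ext (tim X) (t v)"
      proof (cases "w = \<^bold>0")
        case True then show ?thesis using subspD(3)[OF sE] by simp
      next
        case False
        then obtain z where z: "z \<in> ext X v" "z \<noteq> \<^bold>0" "w \<in> pspan R M (t z)" using w by (auto simp: tim_def)
        obtain x a where xa: "x \<in> X" "a \<in> carrier R" "z = x \<^bold>+ a \<^bold>* v" using z by (meson extE)
        have xS: "x \<in> S" "x \<perp> v" "x \<in> carrier M" using E XE xa by blast+
        have "t z \<in> ext (tim X) (t v)"
        proof (cases "x = \<^bold>0")
          case True
          then have "z = a \<^bold>* v" "a \<noteq> \<zero>" using xa z v by auto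
          then have "t z \<in> pspan R M (t v)" using t_smult vS v0 xa by simp
          then show ?thesis using pspan_subset[OF sE base(2)] by blast
        next
          case x0: False
          have "z \<in> span2 x v" using span2I(1)[OF xS(3) v xa(2)] xa by simp
          then have "t z \<in> span2 (t x) (t v)" using t_line xS vS x0 v0 z by blast
          moreover have "t x \<in> ext (tim X) (t v)" using base timI[OF xa(1) x0 xS(1)] by blast
          ultimately show ?thesis using span2_least[OF sE _ base(2)] by blast
        qed
        then show ?thesis using pspan_subset[OF sE] z(3) by blast
      qed
    qed
  qed
  then show ?case using dimx.dimx_Suc[OF IH tv nt] by simp
qed

text \<open>\<open>opp X\<close> says that the singular subspace \<open>X\<close> is opposite its image.\<close>

definition opp :: "'c set \<Rightarrow> bool" where
  "opp X \<longleftrightarrow> (\<forall>v\<in>X. (\<forall>x\<in>X. x \<noteq> \<^bold>0 \<longrightarrow> v \<perp> t x) \<longrightarrow> v = \<^bold>0)"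

text \<open>If no such vector existed, \<open>perp_perp\<close> would write \<open>t x\<close>, up
  to the radical, as \<open>a + b + c x\<close> with \<open>a\<close> in \<open>X\<close> and
  \<open>b\<close> in \<open>tim X\<close>. Testing against \<open>X\<close> gives
  \<open>b = 0\<close>, and testing against the images of \<open>X\<close> gives
  \<open>a = 0\<close>, both because \<open>X\<close> is opposite its image. Then \<open>t x\<close>
  is a multiple of \<open>x\<close>, a fixed point.\<close>

lemma opp_extend_vector:
  assumes X: "tsub X" "opp X" and x: "x \<in> S" "x \<noteq> \<^bold>0" "\<And>y. y \<in> X \<Longrightarrow> y \<perp> x"
    "\<And>y. y \<in> X \<Longrightarrow> y \<noteq> \<^bold>0 \<Longrightarrow> x \<perp> t y"
  shows "\<exists>z\<in>S. (\<forall>y\<in>X. y \<perp> z) \<and> (\<forall>y\<in>X. y \<noteq> \<^bold>0 \<longrightarrow> z \<perp> t y) \<and> x \<perp> z \<and> \<not> z \<perp> t x"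
proof -
  have xc: "x \<in> carrier M" "t x \<in> carrier M" "t x \<in> S" using x t_S by auto
  note Xs = tsubD(1)[OF X(1)] and Ts = subsp_tim[OF X(1)]
  let ?Q = "ext (X <+>\<^bsub>M\<^esub> tim X) x"
  have sXT: "subsp (X <+>\<^bsub>M\<^esub> tim X)" using subsp_sum Xs Ts .
  have sQ: "subsp ?Q" using sXT xc by blast
  have Qin: "X \<subseteq> ?Q" "tim X \<subseteq> ?Q" "x \<in> ?Q"
    using sum_base[OF Xs Ts] ext_base[OF sXT xc(1)] ext_gen[OF sXT xc(1)] by blast+
  have tx_X: "y \<perp> t x" if "y \<in> X" for y
    using that x orth_t_iff[of y x] tsubD[OF X(1)] xc by (cases "y = \<^bold>0") auto
  have tx_tX: "t x \<perp> t y" if "y \<in> X" "y \<noteq> \<^bold>0" for y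
    using that x t_orth[of x y] tsubD(2)[OF X(1)] orth_commute[of y x] by simp
  have ex: "\<exists>z\<in>perp ?Q. \<not> t x \<perp> z"
  proof (rule ccontr)
    assume neg: "\<not> ?thesis"
    obtain q where "dim q ?Q" using fin_dim[OF sQ] .
    then obtain p r where p: "p \<in> ?Q" "r \<in> carrier M" "t x = p \<^bold>+ r" "\<forall>z\<in>carrier M. r \<perp> z"
      using perp_perp[of q ?Q "t x"] neg xc by blast
    then obtain a b c where abc: "a \<in> X" "b \<in> tim X" "c \<in> carrier R" "p = (a \<^bold>+ b) \<^bold>+ c \<^bold>* x"
      unfolding ext_def set_add_mem by blast
    have ac: "a \<in> carrier M" "b \<in> carrier M" using abc subspD(2) Xs Ts by blast+
    have pc: "p \<in> carrier M" using abc ac xc by simp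
    have p_orth: "y \<perp> p \<longleftrightarrow> y \<perp> t x" if "y \<in> carrier M" for y
      using subsp_add_iff(2)[OF subsp_perp[of "{y}"], of r p] p pc that orth_commute[OF that p(2)] xc
      by (simp add: perp_def)
    have b_orth: "y \<perp> b" if y: "y \<in> X" for y
    proof -
      have yc: "y \<in> carrier M" using y tsubD[OF X(1)] by blast
      have "y \<perp> (a \<^bold>+ b) \<^bold>+ c \<^bold>* x" using p_orth[OF yc] tx_X[OF y] abc by simp
      moreover have "y \<perp> c \<^bold>* x" using orth_smult x(3)[OF y] abc yc xc by blast
      ultimately have "y \<perp> a \<^bold>+ b"
        using subsp_add_iff(2)[OF subsp_perp[of "{y}"], of "c \<^bold>* x" "a \<^bold>+ b"] abc ac yc xc by (simp add: perp_def)
      then show ?thesis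
        using subsp_add_iff(1)[OF subsp_perp[of "{y}"], of a b] tsubD(3)[OF X(1) y abc(1)] ac yc by (simp add: perp_def)
    qed
    have b0: "b = \<^bold>0"
    proof (rule ccontr)
      assume "b \<noteq> \<^bold>0"
      then obtain y' where y': "y' \<in> X" "y' \<noteq> \<^bold>0" "b \<in> pspan R M (t y')" using abc(2) by (auto simp: tim_def)
      have S': "y' \<in> S" using y' tsubD[OF X(1)] by blast
      have "y' \<perp> t y" if y: "y \<in> X" "y \<noteq> \<^bold>0" for y
      proof -
        have "y \<perp> t y'" using orth_pspan_iff(1)[of y "t y'" b] b_orth[OF y(1)] y' S' tsubD(4)[OF X(1) y(1)] \<open>b \<noteq> \<^bold>0\<close> by simp
        then show ?thesis using orth_t_iff[of y y'] y y' S' tsubD[OF X(1)] by blast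
      qed
      then show False using X(2) y' unfolding opp_def by blast
    qed
    have a0: "a = \<^bold>0"
    proof -
      have "a \<perp> t y" if y: "y \<in> X" "y \<noteq> \<^bold>0" for y
      proof -
        have yc: "t y \<in> carrier M" using y tsubD[OF X(1)] by simp
        have "t y \<perp> t x" using tx_tX[OF y] orth_commute yc xc by blast
        then have "t y \<perp> a \<^bold>+ c \<^bold>* x" using p_orth[OF yc] abc b0 ac by simp
        moreover have "t y \<perp> c \<^bold>* x" using x(4)[OF y] orth_commute[OF yc xc(1)] orth_smult abc yc xc by blast
        ultimately have "t y \<perp> a"
          using subsp_add_iff(2)[OF subsp_perp[of "{t y}"], of "c \<^bold>* x" a] abc ac yc xc by (simp add: perp_def)
        then show ?thesis using orth_commute yc ac by blast
      qed
      then show ?thesis using X(2) abc(1) unfolding opp_def by blast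
    qed
    have p': "p = c \<^bold>* x" using abc a0 b0 xc by simp
    have "t x = p"
    proof (rule rad_zero[OF xc(3)])
      show "p \<in> S" using p' S_smult abc x by simp
      show "t x \<perp> p" using p' dmst[OF x(1,2)] orth_commute xc orth_smult abc by simp
    qed (use p in auto)
    then show False using nofix[OF x(1,2)] p' abc by (auto simp: pspan_iff)
  qed
  then obtain z0 where z0: "z0 \<in> perp ?Q" "\<not> t x \<perp> z0" by blast
  have sP: "subsp (perp ?Q)" using subsp_perp subspD(1)[OF sQ] .
  \<comment> \<open>\<open>S_lift_in\<close> corrects \<open>z0\<close> by a multiple of
    \<open>t x\<close>, so \<open>t x\<close> itself must lie in \<open>perp ?Q\<close>.\<close>
  have "t x \<in> perp ?Q"
  proof -
    have "\<forall>y\<in>?Q. y \<perp> t x"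
    proof -
      have "X <+>\<^bsub>M\<^esub> tim X \<subseteq> perp {t x}"
      proof
        fix w assume "w \<in> X <+>\<^bsub>M\<^esub> tim X"
        then obtain a b where ab: "a \<in> X" "b \<in> tim X" "w = a \<^bold>+ b" by (auto simp: set_add_mem)
        have "a \<in> perp {t x}" using tx_X ab orth_commute xc tsubD(4)[OF X(1)] by (auto simp: perp_def)
        moreover have "\<forall>w\<in>tim X. t x \<perp> w" using orth_tim_iff[OF X(1) xc(2)] tx_tX by blast
        then have "b \<in> perp {t x}" using ab subspD(2)[OF Ts] by (simp add: perp_def)
        ultimately show "w \<in> perp {t x}" using subspD(4)[OF subsp_perp[of "{t x}"]] ab xc by simp
      qed
      then have "\<forall>y\<in>X <+>\<^bsub>M\<^esub> tim X. y \<perp> t x" using orth_commute xc by (auto simp: perp_def subset_iff)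
      then show ?thesis using orth_ext[OF sXT xc(1,2)] dmst x by blast
    qed
    then show ?thesis using xc by (simp add: perp_def)
  qed
  from S_lift_in[OF sP this xc(3) z0] obtain z where z: "z \<in> perp ?Q" "z \<in> S" "\<not> t x \<perp> z" by blast
  have zQ: "y \<perp> z" if "y \<in> ?Q" for y using z that by (auto simp: perp_def)
  have "z \<perp> t y" if "y \<in> X" "y \<noteq> \<^bold>0" for y
    using zQ[of "t y"] Qin timI[OF that] that tsubD[OF X(1)] orth_commute z(2) by (auto simp: subset_iff)
  then show ?thesis using z zQ Qin orth_commute xc by (intro bexI[of _ z]) (auto simp: subset_iff)
qed

text \<open>A maximal singular subspace on \<open>X\<close> meets \<open>perp (tim X)\<close> in
  dimension at least \<open>n - k\<close>, which gives \<open>x\<close>; a partner \<open>z\<close>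
  comes from \<open>opp_extend_vector\<close>. By domesticity \<open>x\<close> is orthogonal to
  \<open>t x\<close> and \<open>z\<close> to \<open>t z\<close>, while \<open>z\<close> is not
  orthogonal to \<open>t x\<close>: with respect to the images, \<open>x\<close> and
  \<open>z\<close> behave like a hyperbolic pair of an alternating form. The case
  \<open>k = n - 1\<close> is included on purpose and yields the contradiction in
  \<open>even_rank\<close>.\<close>

lemma opp_extend:
  assumes X: "tsub X" "dim k X" "opp X" and k: "k < n"
  shows "\<exists>X'. tsub X' \<and> dim (k + 2) X' \<and> opp X'"
proof -
  note Xs = tsubD(1)[OF X(1)]
  obtain M' where M': "tsub M'" "dim n M'" "X \<subseteq> M'" using tsub_extend[OF X(1)] .
  have "\<exists>e. dim e (M' \<inter> perp (tim X)) \<and> n \<le> e + k"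
    by (rule dim_perp[OF dim_tim[OF X(2,1)] subsp_zero M'(2)]) (use tsubD(4)[OF M'(1)] in \<open>auto simp: perp_def\<close>)
  then obtain e where e: "dim e (M' \<inter> perp (tim X))" "n \<le> e + k" by blast
  then obtain x where x: "x \<in> M'" "x \<in> perp (tim X)" "x \<notin> {\<^bold>0}" using dim_less[of 0 "{\<^bold>0}" e] k by auto
  have xS: "x \<in> S" "x \<noteq> \<^bold>0" "x \<in> carrier M" using x tsubD[OF M'(1)] by auto
  have xX: "y \<perp> x" if "y \<in> X" for y using that M' x tsubD(3)[OF M'(1)] by blast
  have xt: "x \<perp> t y" if "y \<in> X" "y \<noteq> \<^bold>0" for y
    using x(2) timI[OF that] that tsubD(2)[OF X(1)] orth_commute xS by (auto simp: perp_def)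
  obtain z where z: "z \<in> S" "\<And>y. y \<in> X \<Longrightarrow> y \<perp> z" "\<And>y. y \<in> X \<Longrightarrow> y \<noteq> \<^bold>0 \<Longrightarrow> z \<perp> t y" "x \<perp> z" "\<not> z \<perp> t x"
    using opp_extend_vector[OF X(1,3) xS(1,2) xX xt] by blast
  have zc: "z \<in> carrier M" "z \<noteq> \<^bold>0" and txc: "t x \<in> carrier M" using z xS t_carrier by auto
  have x_tz: "\<not> x \<perp> t z" using orth_t_iff[OF xS(1,2) z(1) zc(2) z(4)] z(5) by blast
  have Xtx: "y \<perp> t x" if "y \<in> X" for y
    using orth_t_iff[of y x] that xX xt tsubD[OF X(1)] xS by (cases "y = \<^bold>0") auto
  have Xtz: "y \<perp> t z" if "y \<in> X" for y
    using orth_t_iff[of y z] that z tsubD[OF X(1)] zc by (cases "y = \<^bold>0") auto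
  have xnX: "x \<notin> X" using X(3) xS xt unfolding opp_def by blast
  let ?X1 = "ext X x" and ?X2 = "ext (ext X x) z"
  have t1: "tsub ?X1" using tsub_ext[OF X(1) xS(1) xX] .
  note s1 = tsubD(1)[OF t1]
  have t2: "tsub ?X2" using tsub_ext[OF t1 z(1)] orth_ext[OF Xs xS(3) zc(1)] z by blast
  have X1tx: "\<forall>y\<in>?X1. y \<perp> t x" using orth_ext[OF Xs xS(3) txc] Xtx dmst[OF xS(1,2)] by blast
  have "z \<notin> ?X1" using X1tx z(5) by blast
  then have d2: "dim (k + 2) ?X2" using dimx_Suc[OF dimx_Suc[OF X(2) xS(3) xnX] zc(1)] by simp
  have X1: "X \<subseteq> ?X1" "x \<in> ?X1" using ext_base[OF Xs xS(3)] ext_gen[OF Xs xS(3)] by blast+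
  have X2: "?X1 \<subseteq> ?X2" "z \<in> ?X2" using ext_base[OF s1 zc(1)] ext_gen[OF s1 zc(1)] by blast+
  have "opp ?X2"
    unfolding opp_def
  proof (intro ballI impI)
    fix v assume v: "v \<in> ?X2" and vt: "\<forall>x\<in>?X2. x \<noteq> \<^bold>0 \<longrightarrow> v \<perp> t x"
    \<comment> \<open>For \<open>v = y + a x + b z\<close>, orthogonality to \<open>t x\<close>
      isolates \<open>b\<close>, and then orthogonality to \<open>t z\<close> isolates
      \<open>a\<close>; the remaining \<open>y\<close> vanishes because \<open>X\<close> is opposite
      its image.\<close>
    obtain w b where w: "w \<in> ?X1" "b \<in> carrier R" "v = w \<^bold>+ b \<^bold>* z" using v by (meson extE)
    obtain y a where y: "y \<in> X" "a \<in> carrier R" "w = y \<^bold>+ a \<^bold>* x" using w(1) by (meson extE)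
    have c: "w \<in> carrier M" "y \<in> carrier M" using w y subspD(2) s1 Xs by blast+
    have P: "subsp (perp {u})" if "u \<in> carrier M" for u using subsp_perp[of "{u}"] that by simp
    have "t x \<perp> w \<^bold>+ b \<^bold>* z" using vt X1 X2 xS w orth_commute[of v "t x"] c zc txc by auto
    moreover have "t x \<perp> w" using X1tx w orth_commute c txc by blast
    ultimately have "t x \<perp> b \<^bold>* z"
      using subsp_add_iff(1)[OF P[OF txc], of w "b \<^bold>* z"] c zc w by (simp add: perp_def)
    then have b0: "b = \<zero>"
      using subsp_smult_iff[OF P[OF txc], of b z] w zc z(5) orth_commute[of z "t x"] txc by (auto simp: perp_def)
    then have vw: "v = w" using w c zc by simp
    have tz: "t z \<in> carrier M" using z zc by simp
    have "t z \<perp> y \<^bold>+ a \<^bold>* x" using vt X2 zc vw y orth_commute[of v "t z"] c tz xS by auto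
    moreover have "t z \<perp> y" using Xtz y orth_commute c tz by blast
    ultimately have "t z \<perp> a \<^bold>* x"
      using subsp_add_iff(1)[OF P[OF tz], of y "a \<^bold>* x"] c xS y by (simp add: perp_def)
    then have "a = \<zero>"
      using subsp_smult_iff[OF P[OF tz], of a x] y xS x_tz orth_commute[of x "t z"] tz by (auto simp: perp_def)
    then have "v = y" using vw y xS c by simp
    then show "v = \<^bold>0" using X(3) y(1) vt X1 X2 unfolding opp_def by blast
  qed
  then show ?thesis using t2 d2 by blast
qed

lemma ex_opp: "2 * j \<le> n \<Longrightarrow> \<exists>X. tsub X \<and> dim (2 * j) X \<and> opp X"
proof (induction j)
  case 0 show ?case by (rule exI[of _ "{\<^bold>0}"]) (simp add: tsub_zero opp_def)
next
  case (Suc j)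
  then obtain X where "tsub X" "dim (2 * j) X" "opp X" by auto
  then show ?case using opp_extend[of X "2 * j"] Suc.prems by simp
qed

text \<open>For odd \<open>n\<close>, a subspace of dimension \<open>n - 1\<close> opposite its
  image would extend to a singular subspace of dimension \<open>n + 1\<close>.\<close>

lemma even_rank: "even n"
proof (rule ccontr)
  assume "odd n"
  then obtain j where j: "n = Suc (2 * j)" by (metis oddE Suc_eq_plus1)
  then obtain X where "tsub X" "dim (2 * j) X" "opp X" using ex_opp[of j] by auto
  then obtain X' where "tsub X'" "dim (2 * j + 2) X'" using opp_extend[of X "2 * j"] j by auto
  then show False using tsub_dim_le[of X' "2 * j + 2"] j by simp
qed

lemma ex_opp_max: obtains X where "tsub X" "dim n X" "opp X"
proof -
  obtain j where "n = 2 * j" using even_rank by blast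
  then show ?thesis using that ex_opp[of j] by auto
qed

text \<open>On \<open>X\<close> the relation between \<open>u\<close> and \<open>t v\<close> behaves
  like a nondegenerate alternating form. A vector \<open>x\<close> and a partner \<open>y\<close>
  span a hyperbolic plane; its complement \<open>?Y\<close>, cut out by \<open>t x\<close> and
  \<open>t y\<close>, has dimension \<open>k - 2\<close> and is again opposite its image.\<close>

lemma opp_even: "tsub X \<Longrightarrow> dim k X \<Longrightarrow> opp X \<Longrightarrow> even k"
proof (induction k arbitrary: X rule: less_induct)
  case (less k)
  note X = less.prems
  show ?case
  proof (cases "k = 0")
    case False
    then obtain x where x: "x \<in> X" "x \<noteq> \<^bold>0" using dim_less[of 0 "{\<^bold>0}" k X] X by auto
    obtain y where y: "y \<in> X" "y \<noteq> \<^bold>0" "\<not> x \<perp> t y" using X(3) x unfolding opp_def by blast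
    note XD = tsubD[OF X(1)]
    have c: "x \<in> carrier M" "y \<in> carrier M" "t x \<in> carrier M" "t y \<in> carrier M" using x y XD by auto
    have ytx: "\<not> y \<perp> t x" using orth_t_iff[of x y] XD x y by blast
    have o: "\<not> t y \<perp> x" "\<not> t x \<perp> y" "t x \<perp> x" "t y \<perp> y"
      using y(3) ytx dmst[of x] dmst[of y] XD(2) x y orth_commute[of "t y" x] orth_commute[of "t x" y]
        orth_commute[of "t x" x] orth_commute[of "t y" y] c by simp_all
    have P: "subsp (perp {u})" if "u \<in> carrier M" for u using subsp_perp[of "{u}"] that by simp
    let ?Y = "X \<inter> (perp {t x} \<inter> perp {t y})"
    have sY: "subsp ?Y" using subsp_Int[OF XD(1) subsp_Int[OF P[OF c(3)] P[OF c(4)]]] .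
    have tY: "tsub ?Y" using tsub_mono[OF X(1) sY] by blast
    obtain l where l: "dim l ?Y" using fin_dim[OF sY] .
    have xY: "x \<notin> ?Y" using o by (simp add: perp_def)
    have sYx: "subsp (ext ?Y x)" using sY c by blast
    have "\<forall>z\<in>ext ?Y x. z \<perp> t x"
      using orth_ext[OF sY c(1,3)] orth_commute[OF c(3)] o(3) c(1) XD(4) by (auto simp: perp_def)
    then have yY: "y \<notin> ext ?Y x" using ytx by blast
    have "X = ext (ext ?Y x) y"
    proof
      have "ext ?Y x \<subseteq> X" by (rule ext_least[OF XD(1) _ x(1)]) blast
      then show "ext (ext ?Y x) y \<subseteq> X" by (rule ext_least[OF XD(1) _ y(1)])
      show "X \<subseteq> ext (ext ?Y x) y"
      proof
        fix v assume v: "v \<in> X"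
        then have vc: "v \<in> carrier M" using XD by blast
        obtain b where b: "b \<in> carrier R" "t x \<perp> v \<^bold>+ b \<^bold>* y" using orth_solve[OF vc c(2,3) o(2)] by blast
        let ?v = "v \<^bold>+ b \<^bold>* y"
        have v'c: "?v \<in> carrier M" using vc b c by simp
        obtain a where a: "a \<in> carrier R" "t y \<perp> ?v \<^bold>+ a \<^bold>* x" using orth_solve[OF v'c c(1,4) o(1)] by blast
        let ?w = "?v \<^bold>+ a \<^bold>* x"
        have "?w \<in> X" by (intro subspD(4)[OF XD(1)] subspD(5)[OF XD(1)] v x(1) y(1) a(1) b(1))
        moreover have "t x \<perp> ?w" using orth_add orth_smult a b o c v'c by simp
        ultimately have w: "?w \<in> ?Y" using a v'c c by (simp add: perp_def)
        have "?v \<in> ext ?Y x" using minus_cancel[OF v'c c(1) a(1)] extI[OF w, of "\<ominus> a" x] a by simp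
        then show "v \<in> ext (ext ?Y x) y" using minus_cancel[OF vc c(2) b(1)] extI[of ?v "ext ?Y x" "\<ominus> b" y] b by simp
      qed
    qed
    then have "dim (Suc (Suc l)) X" using dimx_Suc[OF dimx_Suc[OF l c(1) xY] c(2) yY] by simp
    then have k: "k = Suc (Suc l)" using dim_unique X by blast
    have "opp ?Y"
      unfolding opp_def
    proof (intro ballI impI)
      fix v assume v: "v \<in> ?Y" and vt: "\<forall>x\<in>?Y. x \<noteq> \<^bold>0 \<longrightarrow> v \<perp> t x"
      have vc: "v \<in> carrier M" using v XD by blast
      have tv: "\<forall>w\<in>tim ?Y. v \<perp> w" using orth_tim_iff[OF tY vc] vt by blast
      \<comment> \<open>A vector of \<open>?Y\<close> orthogonal to the images of \<open>?Y\<close>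
        is also orthogonal to \<open>t x\<close> and \<open>t y\<close>, hence to the image of every
        vector of \<open>X\<close>, because \<open>t\<close> maps lines to lines.\<close>
      have tX: "v \<perp> t z" if z: "z \<in> X" "z \<noteq> \<^bold>0" for z
      proof -
        obtain w b where w: "w \<in> ext ?Y x" "b \<in> carrier R" "z = w \<^bold>+ b \<^bold>* y"
          using z \<open>X = ext (ext ?Y x) y\<close> by (metis extE)
        obtain u a where u: "u \<in> ?Y" "a \<in> carrier R" "w = u \<^bold>+ a \<^bold>* x" using w(1) by (meson extE)
        have vx: "v \<perp> t x" "v \<perp> t y" using v orth_commute[OF vc] c by (auto simp: perp_def)
        have "u \<in> X" using u by blast
        then have wX: "w \<in> X" unfolding u(3) by (intro subspD(4)[OF XD(1)] subspD(5)[OF XD(1)] x(1) u(2))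
        have vw: "v \<perp> t w" if w0: "w \<noteq> \<^bold>0"
        proof (cases "u = \<^bold>0")
          case True
          then have "w \<in> pspan R M x" using u c by (auto simp: pspan_iff)
          then have "t w \<in> pspan R M (t x)" using t_pspan x w0 XD by blast
          then show ?thesis using orth_pspan(1)[OF vc c(3) vx(1)] by blast
        next
          case False
          have "w \<in> span2 u x" using span2I(1)[of u x a] u c XD by simp
          then have "t w \<in> span2 (t u) (t x)" using t_line[of u x w] u False x w0 XD by blast
          moreover have "t u \<in> carrier M" using u False XD by simp
          ultimately show ?thesis using orth_span2(1)[OF vc, of "t u" "t x"] vt u False vx c by blast
        qed
        show ?thesis
        proof (cases "w = \<^bold>0")
          case True
          then have "z \<in> pspan R M y" using w c by (auto simp: pspan_iff)
          then have "t z \<in> pspan R M (t y)" using t_pspan y z XD by blast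
          then show ?thesis using orth_pspan(1)[OF vc c(4) vx(2)] by blast
        next
          case False
          have "z \<in> span2 w y" using span2I(1)[of w y b] w c XD wX by simp
          then have "t z \<in> span2 (t w) (t y)" using t_line[of w y z] wX False y z XD by blast
          moreover have "t w \<in> carrier M" using wX False XD by simp
          ultimately show ?thesis using orth_span2(1)[OF vc, of "t w" "t y"] vw False vx c by blast
        qed
      qed
      then show "v = \<^bold>0" using X(3) v unfolding opp_def by blast
    qed
    then have "even l" using less.IH[OF _ tY l] k by simp
    then show ?thesis using k by simp
  qed simp
qed

lemma opp_inter_tim: assumes X: "tsub X" "opp X" shows "X \<inter> tim X \<subseteq> {\<^bold>0}"
proof
  fix v assume v: "v \<in> X \<inter> tim X"
  then have "\<forall>w\<in>tim X. v \<perp> w" using tsubD(3)[OF tsub_tim[OF X(1)]] by blast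
  then have "\<forall>x\<in>X. x \<noteq> \<^bold>0 \<longrightarrow> v \<perp> t x" using orth_tim_iff[OF X(1)] v tsubD(4)[OF X(1)] by blast
  then show "v \<in> {\<^bold>0}" using X(2) v unfolding opp_def by blast
qed

lemma opp_sum_dim: assumes X: "tsub X" "dim k X" "opp X" shows "dim (2 * k) (X <+>\<^bsub>M\<^esub> tim X)"
  using dimx_trans[OF dimx_sum_direct[OF dim_tim[OF X(2,1)] tsubD(1)[OF X(1)] opp_inter_tim[OF X(1,3)]] X(2)]
  by (simp add: mult_2)

text \<open>In odd dimension the hyperplane spanned by a maximal subspace opposite its image would be
  invariant, and would meet the fixed lines not contained in it in fixed points.\<close>

lemma odd_dim_impossible:
  assumes V: "dim (2 * n + 1) (carrier M)"
    and S_sum: "\<And>u v. u \<in> S \<Longrightarrow> v \<in> S \<Longrightarrow> u \<^bold>+ v \<in> S \<Longrightarrow> u \<perp> v"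
  shows False
proof -
  obtain X where X: "tsub X" "dim n X" "opp X" using ex_opp_max .
  note XD = tsubD[OF X(1)] and TD = tsubD[OF tsub_tim[OF X(1)]]
  let ?W = "X <+>\<^bsub>M\<^esub> tim X"
  have W: "dim (2 * n) ?W" using opp_sum_dim[OF X] .
  have sW: "subsp ?W" using dim_subsp[OF W] .
  have XW: "X \<subseteq> ?W" "tim X \<subseteq> ?W" using sum_base XD(1) TD(1) by blast+
  have "?W \<noteq> carrier M" using dim_unique[OF V] W by force
  then obtain p where p: "p \<in> S" "p \<notin> ?W" using S_spans[OF sW] rank by fastforce
  have p0: "p \<noteq> \<^bold>0" using p subspD(3)[OF sW] by blast
  have pc: "p \<in> carrier M" "t p \<in> carrier M" using p p0 by auto
  have "ext ?W p = carrier M"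
  proof (rule dim_eq[OF _ V])
    show "dim (2 * n + 1) (ext ?W p)" using dimx_Suc[OF W pc(1) p(2)] by simp
    show "ext ?W p \<subseteq> carrier M" using subspD(1)[OF subsp_ext[OF sW pc(1)]] .
  qed
  \<comment> \<open>\<open>?W\<close> is a hyperplane missing \<open>p\<close>, so the line through
    \<open>p\<close> and \<open>t p\<close> meets it in the point of \<open>w\<close>.\<close>
  then obtain w c where w: "w \<in> ?W" "c \<in> carrier R" "t p = w \<^bold>+ c \<^bold>* p" using pc(2) by (metis extE)
  have wc: "w \<in> carrier M" using w subspD[OF sW] by blast
  let ?U = "span2 p (t p)"
  have U: "tsub ?U" "dim 2 ?U" using tsub_span2 dmst[OF p(1) p0] p t_S[OF p(1) p0] dim_span2 pc p0 nofix[OF p(1) p0] by blast+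
  have "w = \<ominus> c \<^bold>* p \<^bold>+ t p" unfolding w(3) using minus_cancel[OF wc pc(1) w(2)] wc pc w(2) by (simp add: M.a_comm)
  then have wU: "w \<in> ?U" using span2I(2)[OF pc, of "\<ominus> c"] w(2) by (metis R.a_inv_closed)
  have w0: "w \<noteq> \<^bold>0" using w nofix[OF p(1) p0] pc by (auto simp: pspan_iff)
  have wS: "w \<in> S" using wU U tsubD by blast
  have tw_U: "t w \<in> ?U"
  proof -
    have tS: "t p \<in> S" "t p \<noteq> \<^bold>0" using t_S t_nz p p0 by blast+
    have "t w \<in> span2 (t p) (t (t p))" using t_line[OF p(1) tS(1) p0 tS(2) dmst[OF p(1) p0] wU w0] .
    then show ?thesis using span2_least[OF tsubD(1)[OF U(1)] _ t_t[OF p(1) p0]] span2_gen[OF pc] by blast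
  qed
  \<comment> \<open>By \<open>t_t\<close> the image of \<open>tim X\<close> stays within
    \<open>?W\<close>: the point of \<open>t (t x)\<close> lies on the line of \<open>x\<close> and
    \<open>t x\<close>.\<close>
  have tt: "t y \<in> ?W" if y: "y \<in> tim X" "y \<noteq> \<^bold>0" for y
  proof -
    obtain x where x: "x \<in> X" "x \<noteq> \<^bold>0" "y \<in> pspan R M (t x)" using y by (auto simp: tim_def)
    have xS: "x \<in> S" using x XD by blast
    have tx: "t x \<in> S" "t x \<noteq> \<^bold>0" using t_S t_nz xS x by blast+
    have "t y \<in> pspan R M (t (t x))" using t_pspan[OF tx] x y by blast
    moreover have "span2 x (t x) \<subseteq> ?W" using span2_least[OF sW] XW x(1) timI[OF x(1,2) xS] by blast
    then have "t (t x) \<in> ?W" using t_t[OF xS x(2)] by blast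
    ultimately show ?thesis using pspan_subset[OF sW] by blast
  qed
  have tw_W: "t w \<in> ?W"
  proof -
    obtain x y where xy: "x \<in> X" "y \<in> tim X" "w = x \<^bold>+ y" using w(1) by (auto simp: set_add_mem)
    have c: "x \<in> carrier M" "y \<in> carrier M" using xy XD TD by blast+
    have S: "x \<in> S" "y \<in> S" using xy XD TD by blast+
    consider "x = \<^bold>0" | "y = \<^bold>0" | "x \<noteq> \<^bold>0" "y \<noteq> \<^bold>0" by blast
    then show ?thesis
    proof cases
      case 1 then show ?thesis using xy c w0 tt by simp
    next
      case 2 then show ?thesis using xy c w0 timI[of x X] S XW by auto
    next
      case 3
      have "w \<in> span2 x y" using xy span2_gen[OF c] subspD(4)[OF subsp_span2[OF c]] by blast
      \<comment> \<open>A singular sum of two singular vectors forces them to be orthogonal, so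
        \<open>t_line\<close> applies.\<close>
      then have "t w \<in> span2 (t x) (t y)" using t_line[OF S 3 S_sum[OF S]] wS xy(3) w0 by blast
      then show ?thesis using span2_least[OF sW _ tt[OF xy(2) 3(2)]] timI[OF xy(1) 3(1) S(1)] XW by blast
    qed
  qed
  \<comment> \<open>Both \<open>w\<close> and its image lie on the line and in the hyperplane. They
    are different points, so the whole line lies in the hyperplane, contrary to the choice of
    \<open>p\<close>.\<close>
  have "?U = span2 w (t w)" using dim_2_span2[OF U(2) wU tw_U w0 nofix[OF wS w0]] .
  then have "?U \<subseteq> ?W" using span2_least[OF sW w(1) tw_W] by simp
  then show False using p span2_gen[OF pc] by blast
qed

end

section \<open>Linear maps inducing line-preserving maps\<close>

context vspace begin

lemma ext_unique:
  assumes U: "subsp U" and w: "w \<in> carrier M" "w \<notin> U" and x: "x \<in> U" "x' \<in> U"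
    and c: "c \<in> carrier R" "c' \<in> carrier R" and eq: "x \<^bold>+ c \<^bold>* w = x' \<^bold>+ c' \<^bold>* w"
  shows "x = x' \<and> c = c'"
proof -
  have xc: "x \<in> carrier M" "x' \<in> carrier M" using x subspD[OF U] by blast+
  have "x \<^bold>+ (c \<ominus> c') \<^bold>* w = (x \<^bold>+ c \<^bold>* w) \<^bold>+ \<ominus> c' \<^bold>* w"
    using xc w c by (simp add: a_minus_def smult_l_distr M.a_assoc)
  also have "\<dots> = x'" unfolding eq using minus_cancel xc w c by simp
  finally have "(c \<ominus> c') \<^bold>* w \<in> U" using subsp_add_iff(1)[OF U x(1), of "(c \<ominus> c') \<^bold>* w"] x c w by simp
  then have "c \<ominus> c' = \<zero>" using subsp_smult_iff[OF U, of "c \<ominus> c'" w] w c by auto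
  then have "c = c'" using c by simp
  then show ?thesis using eq xc w c by simp
qed

lemma span2_self: "u \<in> carrier M \<Longrightarrow> span2 u u = pspan R M u"
  unfolding span2_def by (rule ext_absorb) auto

lemma span2_cong:
  assumes "u \<in> pspan R M u'" "v \<in> pspan R M v'" "u' \<in> carrier M" "v' \<in> carrier M"
  shows "span2 u v \<subseteq> span2 u' v'"
proof (rule span2_least)
  show "subsp (span2 u' v')" using assms by blast
  then show "u \<in> span2 u' v'" "v \<in> span2 u' v'"
    using pspan_subset[of "span2 u' v'"] span2_gen[OF assms(3,4)] assms by blast+
qed

definition indep3 where
  "indep3 u v w \<longleftrightarrow> u \<in> carrier M \<and> v \<in> carrier M \<and> w \<in> carrier M \<and> u \<noteq> \<^bold>0 \<and> v \<notin> pspan R M u \<and> w \<notin> span2 u v"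

lemma indep3_eq:
  assumes i: "indep3 u v w"
    and c: "a \<in> carrier R" "b \<in> carrier R" "c \<in> carrier R" "a' \<in> carrier R" "b' \<in> carrier R" "c' \<in> carrier R"
    and eq: "(a \<^bold>* u \<^bold>+ b \<^bold>* v) \<^bold>+ c \<^bold>* w = (a' \<^bold>* u \<^bold>+ b' \<^bold>* v) \<^bold>+ c' \<^bold>* w"
  shows "a = a' \<and> b = b' \<and> c = c'"
proof -
  note i' = i[unfolded indep3_def]
  have "a \<^bold>* u \<^bold>+ b \<^bold>* v = a' \<^bold>* u \<^bold>+ b' \<^bold>* v \<and> c = c'"
  proof (rule ext_unique[OF subsp_span2[of u v] _ _ _ _ c(3,6) eq])
    show "a \<^bold>* u \<^bold>+ b \<^bold>* v \<in> span2 u v" "a' \<^bold>* u \<^bold>+ b' \<^bold>* v \<in> span2 u v"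
      using span2I(3)[of u v] i' c by blast+
  qed (use i' in auto)
  then show ?thesis using indep2[of u v a b a' b'] i' c by blast
qed

lemma indep3_swap: assumes i: "indep3 u v w" shows "indep3 u w v"
proof -
  note i' = i[unfolded indep3_def]
  have c: "u \<in> carrier M" "v \<in> carrier M" "w \<in> carrier M" using i' by auto
  have "w \<notin> pspan R M u" using i' pspan_subset[OF subsp_span2[OF c(1,2)] span2_gen(1)[OF c(1,2)]] by blast
  moreover have "v \<notin> span2 u w"
  proof
    assume "v \<in> span2 u w"
    then have "ext (pspan R M u) v = span2 u w"
      unfolding span2_def using ext_exchange[OF subsp_pspan[OF c(1)] c(3)] i' by (metis span2_def)
    then show False using i' span2_gen(2)[OF c(1,3)] unfolding span2_def by blast
  qed
  ultimately show ?thesis using i' unfolding indep3_def by blast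
qed

lemma smult_pspan_unique:
  assumes "v \<in> carrier M" "v \<noteq> \<^bold>0" "a \<in> carrier R" "b \<in> carrier R" "a \<^bold>* v = b \<^bold>* v" shows "a = b"
  using ext_unique[OF subsp_zero, of v "\<^bold>0" "\<^bold>0" a b] assms by simp

end

text \<open>The usual proof of the fundamental theorem: normalise the image of \<open>v\<close> through the image
  of \<open>e + v\<close>. The last assumption forces the companion automorphism to be trivial.\<close>

locale line_map = vspace +
  fixes X Y :: "'c set" and e v0 :: 'c and t :: "'c \<Rightarrow> 'c"
  assumes X: "subsp X" and Y: "subsp Y" "X = ext Y e" "e \<notin> Y" and e: "e \<in> X"
    and t_carrier: "u \<in> X \<Longrightarrow> u \<noteq> \<^bold>0 \<Longrightarrow> t u \<in> carrier M" "u \<in> X \<Longrightarrow> u \<noteq> \<^bold>0 \<Longrightarrow> t u \<noteq> \<^bold>0"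
    and t_span: "u \<in> X \<Longrightarrow> v \<in> X \<Longrightarrow> w \<in> X \<Longrightarrow> u \<noteq> \<^bold>0 \<Longrightarrow> v \<noteq> \<^bold>0 \<Longrightarrow> w \<noteq> \<^bold>0 \<Longrightarrow>
      t w \<in> span2 (t u) (t v) \<longleftrightarrow> w \<in> span2 u v"
    and dim3: "u \<in> X \<Longrightarrow> v \<in> X \<Longrightarrow> \<exists>w\<in>X. w \<notin> span2 u v"
    and v0: "v0 \<in> X" "v0 \<notin> pspan R M e"
    and linear: "c \<in> carrier R \<Longrightarrow> c \<noteq> \<zero> \<Longrightarrow> s \<in> carrier R \<Longrightarrow> w \<in> pspan R M (t v0) \<Longrightarrow>
      t (e \<^bold>+ v0) \<in> pspan R M (t e \<^bold>+ w) \<Longrightarrow> t (e \<^bold>+ c \<^bold>* v0) \<in> pspan R M (t e \<^bold>+ s \<^bold>* w) \<Longrightarrow> s = c"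
begin

lemma X_carrier [simp]: "v \<in> X \<Longrightarrow> v \<in> carrier M" using subspD(2)[OF X] .

lemma e_nz: "e \<noteq> \<^bold>0" using Y subspD(3)[OF Y(1)] by blast

lemma e_carrier [simp]: "e \<in> carrier M" using e by simp

lemma te [simp]: "t e \<in> carrier M" "t e \<noteq> \<^bold>0" using t_carrier e e_nz by auto

lemma nz: "v \<notin> pspan R M e \<Longrightarrow> v \<noteq> \<^bold>0" using subspD(3)[OF subsp_pspan[OF e_carrier]] by blast

lemma t_pspan_iff:
  assumes "u \<in> X" "v \<in> X" "u \<noteq> \<^bold>0" "v \<noteq> \<^bold>0" shows "t v \<in> pspan R M (t u) \<longleftrightarrow> v \<in> pspan R M u"
  using t_span[OF assms(1,1,2,3,3,4)] span2_self t_carrier assms by simp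

text \<open>Meaningful only for \<open>v\<close> outside the span of \<open>e\<close>, where
  \<open>g_ex1\<close> shows existence and uniqueness; \<open>G\<close> extends it to all of
  \<open>X\<close>.\<close>

definition g :: "'c \<Rightarrow> 'c" where
  "g v = (THE w. w \<in> pspan R M (t v) \<and> t (e \<^bold>+ v) \<in> pspan R M (t e \<^bold>+ w))"

lemma ev: assumes "v \<in> X" "v \<notin> pspan R M e"
  shows "e \<^bold>+ v \<in> X" "e \<^bold>+ v \<noteq> \<^bold>0" "e \<^bold>+ v \<notin> pspan R M e" "e \<^bold>+ v \<notin> pspan R M v" "e \<^bold>+ v \<in> span2 e v"
proof -
  have c: "v \<in> carrier M" using assms by simp
  show "e \<^bold>+ v \<in> X" using subspD(4)[OF X] e assms by blast
  show 1: "e \<^bold>+ v \<notin> pspan R M e" using subsp_add_iff(1)[OF subsp_pspan[OF e_carrier] _ c, of e] assms by simp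
  then show "e \<^bold>+ v \<noteq> \<^bold>0" using nz by blast
  show "e \<^bold>+ v \<notin> pspan R M v"
    using subsp_add_iff(2)[OF subsp_pspan[OF c] _ e_carrier, of v] pspan_sym[of e v] assms e_nz c by auto
  show "e \<^bold>+ v \<in> span2 e v" using span2_gen[OF e_carrier c] subspD(4)[OF subsp_span2[OF e_carrier c]] by blast
qed

lemma g_ex1:
  assumes v: "v \<in> X" "v \<notin> pspan R M e"
  shows "\<exists>!w. w \<in> pspan R M (t v) \<and> t (e \<^bold>+ v) \<in> pspan R M (t e \<^bold>+ w)"
proof -
  have tv: "t v \<in> carrier M" "t v \<noteq> \<^bold>0" using t_carrier v nz by auto
  note E = ev[OF v]
  have "t (e \<^bold>+ v) \<in> span2 (t e) (t v)" using t_span e v nz e_nz E by blast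
  then obtain a b where ab: "a \<in> carrier R" "b \<in> carrier R" "t (e \<^bold>+ v) = a \<^bold>* t e \<^bold>+ b \<^bold>* t v"
    by (auto simp: span2_iff)
  have a0: "a \<noteq> \<zero>"
  proof
    assume "a = \<zero>"
    then have "t (e \<^bold>+ v) \<in> pspan R M (t v)" using ab tv by (auto simp: pspan_iff)
    then show False using t_pspan_iff[OF v(1) E(1) nz[OF v(2)] E(2)] E(4) by blast
  qed
  have ntv: "t v \<notin> pspan R M (t e)" using t_pspan_iff[OF e v(1) e_nz nz[OF v(2)]] v by blast
  let ?w = "(inv a \<otimes> b) \<^bold>* t v"
  show ?thesis
  proof (rule ex1I[of _ ?w])
    have "t (e \<^bold>+ v) = a \<^bold>* (t e \<^bold>+ ?w)"
      using ab a0 tv by (simp add: smult_r_distr smult_assoc1[symmetric] R.m_assoc[symmetric])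
    then show "?w \<in> pspan R M (t v) \<and> t (e \<^bold>+ v) \<in> pspan R M (t e \<^bold>+ ?w)"
      using ab a0 by (auto simp: pspan_iff)
  next
    fix w assume "w \<in> pspan R M (t v) \<and> t (e \<^bold>+ v) \<in> pspan R M (t e \<^bold>+ w)"
    then obtain k c where kc: "k \<in> carrier R" "w = k \<^bold>* t v" "c \<in> carrier R" "t (e \<^bold>+ v) = c \<^bold>* (t e \<^bold>+ w)"
      by (auto simp: pspan_iff)
    have "a \<^bold>* t e \<^bold>+ b \<^bold>* t v = c \<^bold>* t e \<^bold>+ (c \<otimes> k) \<^bold>* t v"
      using kc ab tv by (simp add: smult_r_distr smult_assoc1[symmetric])
    then have "a = c \<and> b = c \<otimes> k" 
      using indep2[OF te(1) tv(1) te(2) ntv ab(1,2) kc(3) R.m_closed[OF kc(3,1)]] by simp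
    then have "inv a \<otimes> b = k" using kc a0 by (simp add: R.m_assoc[symmetric])
    then show "w = ?w" using kc by simp
  qed
qed

lemma g_props:
  assumes v: "v \<in> X" "v \<notin> pspan R M e"
  shows "g v \<in> pspan R M (t v)" "t (e \<^bold>+ v) \<in> pspan R M (t e \<^bold>+ g v)" "g v \<in> carrier M" "g v \<noteq> \<^bold>0"
    "t v \<in> pspan R M (g v)" "t e \<^bold>+ g v \<in> pspan R M (t (e \<^bold>+ v))"
proof -
  have tv: "t v \<in> carrier M" "t v \<noteq> \<^bold>0" using t_carrier v nz by auto
  show 1: "g v \<in> pspan R M (t v)" "t (e \<^bold>+ v) \<in> pspan R M (t e \<^bold>+ g v)"
    using theI'[OF g_ex1[OF v]] unfolding g_def by blast+
  show 2: "g v \<in> carrier M" using 1 subspD(2)[OF subsp_pspan[OF tv(1)]] by blast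
  note E = ev[OF v]
  have tE: "t (e \<^bold>+ v) \<in> carrier M" "t (e \<^bold>+ v) \<noteq> \<^bold>0" using t_carrier E by auto
  show 3: "g v \<noteq> \<^bold>0"
  proof
    assume "g v = \<^bold>0"
    then have "t (e \<^bold>+ v) \<in> pspan R M (t e)" using 1 by simp
    then show False using t_pspan_iff[OF e E(1) e_nz E(2)] E(3) by blast
  qed
  show "t v \<in> pspan R M (g v)" using pspan_sym[OF 1(1) 3 tv(1)] .
  show "t e \<^bold>+ g v \<in> pspan R M (t (e \<^bold>+ v))" using pspan_sym[OF 1(2) tE(2)] 2 by simp
qed

lemma g_unique:
  assumes v: "v \<in> X" "v \<notin> pspan R M e" and w: "w \<in> pspan R M (t v)" "t (e \<^bold>+ v) \<in> pspan R M (t e \<^bold>+ w)"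
  shows "g v = w"
  using g_ex1[OF v] w g_props[OF v] by blast

lemma g_indep:
  assumes i: "indep3 e v w" "v \<in> X" "w \<in> X" shows "indep3 (t e) (g v) (g w)"
proof -
  have v: "v \<notin> pspan R M e" and w: "w \<notin> pspan R M e" "w \<notin> span2 e v"
    using i(1) indep3_swap[OF i(1)] by (auto simp: indep3_def)
  note gv = g_props[OF i(2) v] and gw = g_props[OF i(3) w(1)]
  have tv: "t v \<in> carrier M" "t w \<in> carrier M" using t_carrier i v w nz by blast+
  have "g v \<notin> pspan R M (t e)"
  proof
    assume "g v \<in> pspan R M (t e)"
    then have "t v \<in> pspan R M (t e)" using pspan_trans[OF gv(5)] by simp
    then show False using t_pspan_iff[OF e i(2) e_nz nz[OF v]] v by blast
  qed
  moreover have "g w \<notin> span2 (t e) (g v)"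
  proof
    assume *: "g w \<in> span2 (t e) (g v)"
    have "span2 (t e) (g v) \<subseteq> span2 (t e) (t v)" using span2_cong gv(1) te tv by auto
    then have "t w \<in> span2 (t e) (t v)"
      using * gw(5) pspan_subset[OF subsp_span2[OF te(1) tv(1)]] by blast
    then show False using t_span[OF e i(2,3) e_nz nz[OF v] nz[OF w(1)]] w by blast
  qed
  ultimately show ?thesis using gv gw by (simp add: indep3_def)
qed

text \<open>The point of \<open>e + v + w\<close> lies on the lines joining \<open>e + v\<close> to
  \<open>w\<close>, \<open>e + w\<close> to \<open>v\<close>, and \<open>e\<close> to
  \<open>v + w\<close>. Writing its image in these three ways and comparing coefficients in the
  independent vectors \<open>t e\<close>, \<open>g v\<close>, \<open>g w\<close> yields the
  normalised form \<open>t e + (g v + g w)\<close>.\<close>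

lemma g_add:
  assumes i: "indep3 e v w" "v \<in> X" "w \<in> X" shows "g (v \<^bold>+ w) = g v \<^bold>+ g w"
proof -
  have v: "v \<notin> pspan R M e" "v \<notin> span2 e w" and w: "w \<notin> pspan R M e" "w \<notin> span2 e v"
    using i(1) indep3_swap[OF i(1)] by (auto simp: indep3_def)
  note gv = g_props[OF i(2) v(1)] and gw = g_props[OF i(3) w(1)]
  have c: "v \<in> carrier M" "w \<in> carrier M" using i by auto
  have sE: "subsp (span2 e v)" "subsp (pspan R M e)" using c by auto
  have vw: "v \<^bold>+ w \<in> X" using subspD(4)[OF X] i by blast
  have nvw: "v \<^bold>+ w \<notin> pspan R M e"
    using subsp_add_iff(1)[OF sE(1), of v w] span2_gen[of e v] c w pspan_subset[OF sE(1), of e] by auto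
  note E = ev[OF vw nvw]
  have assoc: "e \<^bold>+ (v \<^bold>+ w) = (e \<^bold>+ v) \<^bold>+ w" "e \<^bold>+ (v \<^bold>+ w) = (e \<^bold>+ w) \<^bold>+ v" using c by (simp_all add: M.a_ac)
  note Ev = ev[OF i(2) v(1)] and Ew = ev[OF i(3) w(1)]
  let ?p = "t (e \<^bold>+ (v \<^bold>+ w))"
  have sp: "x \<^bold>+ y \<in> span2 x y" if "x \<in> carrier M" "y \<in> carrier M" for x y
    using that span2_gen[of x y] subspD(4)[OF subsp_span2] by blast
  have "?p \<in> span2 (t (e \<^bold>+ v)) (t w)"
    using t_span[OF Ev(1) i(3) E(1) Ev(2) nz[OF w(1)] E(2)] sp[of "e \<^bold>+ v" w] assoc c by simp
  also have "\<dots> \<subseteq> span2 (t e \<^bold>+ g v) (g w)" using span2_cong[OF gv(2) gw(5)] gv gw by simp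
  finally obtain a b where ab: "a \<in> carrier R" "b \<in> carrier R" "?p = a \<^bold>* (t e \<^bold>+ g v) \<^bold>+ b \<^bold>* g w" by (auto simp: span2_iff)
  have "?p \<in> span2 (t (e \<^bold>+ w)) (t v)"
    using t_span[OF Ew(1) i(2) E(1) Ew(2) nz[OF v(1)] E(2)] sp[of "e \<^bold>+ w" v] assoc c by simp
  also have "\<dots> \<subseteq> span2 (t e \<^bold>+ g w) (g v)" using span2_cong[OF gw(2) gv(5)] gv gw by simp
  finally obtain a' b' where ab': "a' \<in> carrier R" "b' \<in> carrier R" "?p = a' \<^bold>* (t e \<^bold>+ g w) \<^bold>+ b' \<^bold>* g v" by (auto simp: span2_iff)
  have p1: "?p = (a \<^bold>* t e \<^bold>+ a \<^bold>* g v) \<^bold>+ b \<^bold>* g w" using ab gv gw by (simp add: smult_r_distr)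
  have p2: "?p = (a' \<^bold>* t e \<^bold>+ b' \<^bold>* g v) \<^bold>+ a' \<^bold>* g w" using ab' gv gw by (simp add: smult_r_distr M.a_ac)
  have "a = a'" "a = b'" "b = a'"
    using indep3_eq[OF g_indep[OF i] ab(1,1,2) ab'(1,2,1) trans[OF p1[symmetric] p2]] by blast+
  then have p3: "?p = (a \<^bold>* t e \<^bold>+ a \<^bold>* g v) \<^bold>+ a \<^bold>* g w" using p1 by simp
  have p4: "?p = a \<^bold>* (t e \<^bold>+ (g v \<^bold>+ g w))" using p3 ab gv gw by (simp add: smult_r_distr M.a_assoc)
  have tp: "?p \<noteq> \<^bold>0" using t_carrier E by blast
  have a0: "a \<noteq> \<zero>" using p4 tp gv gw by auto
  have tvw: "t (v \<^bold>+ w) \<in> carrier M" using t_carrier vw nz[OF nvw] by blast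
  have "t (v \<^bold>+ w) \<in> span2 (t v) (t w)"
    using t_span[OF i(2,3) vw nz[OF v(1)] nz[OF w(1)] nz[OF nvw]] sp c by blast
  also have "\<dots> \<subseteq> span2 (g v) (g w)" using span2_cong[OF gv(5) gw(5)] gv gw by simp
  finally obtain k l where kl: "k \<in> carrier R" "l \<in> carrier R" "t (v \<^bold>+ w) = k \<^bold>* g v \<^bold>+ l \<^bold>* g w" by (auto simp: span2_iff)
  \<comment> \<open>The third line is what shows that \<open>g v + g w\<close> is a multiple of
    \<open>t (v + w)\<close>, as \<open>g_unique\<close> demands.\<close>
  have "?p \<in> span2 (t e) (t (v \<^bold>+ w))" using t_span[OF e vw E(1) e_nz nz[OF nvw] E(2)] E by blast
  then obtain m d where md: "m \<in> carrier R" "d \<in> carrier R" "?p = m \<^bold>* t e \<^bold>+ d \<^bold>* t (v \<^bold>+ w)" by (auto simp: span2_iff)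
  have "?p = (m \<^bold>* t e \<^bold>+ (d \<otimes> k) \<^bold>* g v) \<^bold>+ (d \<otimes> l) \<^bold>* g w"
    unfolding md(3) kl(3) using md kl gv gw by (simp add: smult_r_distr smult_assoc1 M.a_assoc)
  then have "a = d \<otimes> k" "a = d \<otimes> l" 
    using indep3_eq[OF g_indep[OF i] ab(1,1,1) md(1) R.m_closed[OF md(2) kl(1)] R.m_closed[OF md(2) kl(2)]
      trans[OF p3[symmetric]]] by blast+
  then have "a \<^bold>* (g v \<^bold>+ g w) = (d \<otimes> k) \<^bold>* g v \<^bold>+ (d \<otimes> l) \<^bold>* g w"
    using ab(1) gv(3) gw(3) by (simp add: smult_r_distr)
  then have "a \<^bold>* (g v \<^bold>+ g w) = d \<^bold>* t (v \<^bold>+ w)"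
    unfolding kl(3) using md(2) kl(1,2) gv(3) gw(3) by (simp add: smult_r_distr smult_assoc1)
  then have "g v \<^bold>+ g w = inv a \<^bold>* (d \<^bold>* t (v \<^bold>+ w))" using a0 ab gv gw by (metis smult_cancel(1) M.a_closed)
  then have "g v \<^bold>+ g w = (inv a \<otimes> d) \<^bold>* t (v \<^bold>+ w)" using a0 ab md tvw by (simp add: smult_assoc1)
  then have "g v \<^bold>+ g w \<in> pspan R M (t (v \<^bold>+ w))" using a0 ab md by (auto simp: pspan_iff)
  moreover have "?p \<in> pspan R M (t e \<^bold>+ (g v \<^bold>+ g w))" using p4 ab by (auto simp: pspan_iff)
  ultimately show ?thesis using g_unique[OF vw nvw] by blast
qed

lemma g_scale:
  assumes v: "v \<in> X" "v \<notin> pspan R M e" and c: "c \<in> carrier R" "c \<noteq> \<zero>"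
  shows "\<exists>s\<in>carrier R. g (c \<^bold>* v) = s \<^bold>* g v" "c \<^bold>* v \<in> X" "c \<^bold>* v \<notin> pspan R M e"
proof -
  show cX: "c \<^bold>* v \<in> X" using subspD(5)[OF X c(1) v(1)] .
  show cn: "c \<^bold>* v \<notin> pspan R M e" using subsp_smult_iff[OF subsp_pspan[OF e_carrier] c, of v] v by simp
  have "t (c \<^bold>* v) \<in> pspan R M (t v)"
    using t_pspan_iff[OF v(1) cX nz[OF v(2)] nz[OF cn]] c by (auto simp: pspan_iff)
  then have "g (c \<^bold>* v) \<in> pspan R M (g v)"
    using pspan_trans[OF g_props(1)[OF cX cn], of "t v"] pspan_trans[of "g (c \<^bold>* v)" "t v" "g v"]
      g_props[OF v] t_carrier[of v] v nz by blast
  then show "\<exists>s\<in>carrier R. g (c \<^bold>* v) = s \<^bold>* g v" by (auto simp: pspan_iff)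
qed

text \<open>Additivity on \<open>c v + c w\<close>, which is also \<open>c (v + w)\<close>, forces
  equal factors, so the companion of \<open>g\<close> depends on the scalar \<open>c\<close>
  only.\<close>

lemma g_scale_same:
  assumes i: "indep3 e v w" "v \<in> X" "w \<in> X" and c: "c \<in> carrier R" "c \<noteq> \<zero>"
    and s: "s \<in> carrier R" "g (c \<^bold>* v) = s \<^bold>* g v"
  shows "g (c \<^bold>* w) = s \<^bold>* g w"
proof -
  have v: "v \<notin> pspan R M e" "v \<notin> span2 e w" and w: "w \<notin> pspan R M e" "w \<notin> span2 e v"
    using i(1) indep3_swap[OF i(1)] by (auto simp: indep3_def)
  note gv = g_props[OF i(2) v(1)] and gw = g_props[OF i(3) w(1)]
  note cv = g_scale[OF i(2) v(1) c] and cw = g_scale[OF i(3) w(1) c]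
  have cc: "v \<in> carrier M" "w \<in> carrier M" using i by auto
  obtain s' where s': "s' \<in> carrier R" "g (c \<^bold>* w) = s' \<^bold>* g w" using cw by blast
  have vw: "v \<^bold>+ w \<in> X" using subspD(4)[OF X] i by blast
  have sE: "subsp (span2 e v)" using cc by auto
  have nvw: "v \<^bold>+ w \<notin> pspan R M e"
    using subsp_add_iff(1)[OF sE(1), of v w] span2_gen[of e v] cc w pspan_subset[OF sE(1), of e] by auto
  obtain r where r: "r \<in> carrier R" "g (c \<^bold>* (v \<^bold>+ w)) = r \<^bold>* g (v \<^bold>+ w)" using g_scale(1)[OF vw nvw c] by blast
  have "indep3 e (c \<^bold>* v) (c \<^bold>* w)"
  proof -
    have "span2 e (c \<^bold>* v) \<subseteq> span2 e v" 
      by (rule span2_cong[OF pspan_self _ e_carrier cc(1)]) (use c in \<open>auto simp: pspan_iff\<close>)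
    then have "c \<^bold>* w \<notin> span2 e (c \<^bold>* v)" using subsp_smult_iff[OF sE c, of w] w cc by blast
    then show ?thesis using cv e_nz c cc by (simp add: indep3_def)
  qed
  then have "g (c \<^bold>* v \<^bold>+ c \<^bold>* w) = s \<^bold>* g v \<^bold>+ s' \<^bold>* g w" using g_add cv cw s s' by simp
  moreover have "g (c \<^bold>* v \<^bold>+ c \<^bold>* w) = r \<^bold>* g v \<^bold>+ r \<^bold>* g w"
    using r g_add[OF i] c cc gv gw by (simp add: smult_r_distr)
  ultimately have "(\<zero> \<^bold>* t e \<^bold>+ s \<^bold>* g v) \<^bold>+ s' \<^bold>* g w = (\<zero> \<^bold>* t e \<^bold>+ r \<^bold>* g v) \<^bold>+ r \<^bold>* g w"
    using gv gw s s' r by simp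
  then have "s = r" "s' = r" using indep3_eq[OF g_indep[OF i] R.zero_closed s(1) s'(1) R.zero_closed r(1,1)] by simp_all
  then show ?thesis using s' by simp
qed

text \<open>The assumption \<open>linear\<close> determines the factor at \<open>v0\<close>, and
  \<open>g_scale_same\<close> carries it to vectors outside the span of \<open>e\<close> and
  \<open>v0\<close>. A vector inside that span is reached through such an outer vector
  \<open>x\<close>.\<close>

lemma g_smult:
  assumes w: "w \<in> X" "w \<notin> pspan R M e" and c: "c \<in> carrier R" "c \<noteq> \<zero>"
  shows "g (c \<^bold>* w) = c \<^bold>* g w"
proof -
  have v0g: "g (c \<^bold>* v0) = c \<^bold>* g v0"
  proof -
    note p = g_scale[OF v0 c]
    obtain s where s: "s \<in> carrier R" "g (c \<^bold>* v0) = s \<^bold>* g v0" using p by blast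
    have "s = c" using linear[OF c s(1) g_props(1,2)[OF v0]] g_props(2)[OF p(2,3)] s by simp
    then show ?thesis using s by simp
  qed
  have v0c: "v0 \<in> carrier M" using v0 by simp
  have step: "g (c \<^bold>* x) = c \<^bold>* g x" if "x \<in> X" "x \<notin> span2 e v0" for x
    using g_scale_same[of v0 x c c] that v0 v0c c e_nz v0g by (simp add: indep3_def)
  show ?thesis
  proof (cases "w \<in> span2 e v0")
    case True
    obtain x where x: "x \<in> X" "x \<notin> span2 e v0" using dim3 e v0 by blast
    have "ext (pspan R M e) w = span2 e v0"
      using ext_exchange[OF subsp_pspan[OF e_carrier] v0c, of w] True w unfolding span2_def by blast
    then have "x \<notin> span2 e w" using x by (simp add: span2_def)
    then have "indep3 e w x" using w x e_nz by (simp add: indep3_def)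
    then show ?thesis using g_scale_same[OF indep3_swap x(1) w(1) c c(1) step[OF x]] by blast
  qed (use step w in blast)
qed

text \<open>\<open>Y\<close> meets the span of \<open>e\<close> only in zero, so \<open>g\<close> is
  available on all nonzero vectors of \<open>Y\<close>; the vector \<open>e\<close> itself goes to
  \<open>t e\<close>. The chosen decomposition is unique by \<open>ext_unique\<close>.\<close>

definition G :: "'c \<Rightarrow> 'c" where
  "G x = (let (y, a) = (SOME (y, a). y \<in> Y \<and> a \<in> carrier R \<and> x = y \<^bold>+ a \<^bold>* e)
    in (if y = \<^bold>0 then \<^bold>0 else g y) \<^bold>+ a \<^bold>* t e)"

lemma Y_sub: "y \<in> Y \<Longrightarrow> y \<in> X" using ext_base[OF Y(1) e_carrier] Y(2) by blast

lemma Y_pspan: assumes "y \<in> Y" "y \<noteq> \<^bold>0" shows "y \<notin> pspan R M e"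
  using pspan_sym[of y e] pspan_subset[OF Y(1), of y] assms Y(3) by auto

lemma G_eq: assumes "y \<in> Y" "a \<in> carrier R"
  shows "G (y \<^bold>+ a \<^bold>* e) = (if y = \<^bold>0 then \<^bold>0 else g y) \<^bold>+ a \<^bold>* t e"
proof -
  have "(SOME (y', a'). y' \<in> Y \<and> a' \<in> carrier R \<and> y \<^bold>+ a \<^bold>* e = y' \<^bold>+ a' \<^bold>* e) = (y, a)"
  proof (rule some_equality)
    fix p assume "case p of (y', a') \<Rightarrow> y' \<in> Y \<and> a' \<in> carrier R \<and> y \<^bold>+ a \<^bold>* e = y' \<^bold>+ a' \<^bold>* e"
    then show "p = (y, a)" using ext_unique[OF Y(1) e_carrier Y(3) assms(1)] assms(2) by (cases p) auto
  qed (use assms in simp)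
  then show ?thesis by (simp add: G_def)
qed

abbreviation gY where "gY y \<equiv> (if y = \<^bold>0 then \<^bold>0 else g y)"

lemma gY_carrier: "y \<in> Y \<Longrightarrow> gY y \<in> carrier M" using g_props(3) Y_sub Y_pspan by simp

lemma gY_smult: assumes "y \<in> Y" "c \<in> carrier R" shows "gY (c \<^bold>* y) = c \<^bold>* gY y"
  using assms g_smult[OF Y_sub Y_pspan, of y c] Y_sub g_props(3)[OF Y_sub Y_pspan, of y] by (cases "c = \<zero>") auto

lemma gY_add: assumes y: "y \<in> Y" "z \<in> Y" shows "gY (y \<^bold>+ z) = gY y \<^bold>+ gY z"
proof (cases "y = \<^bold>0 \<or> z = \<^bold>0")
  case True
  then show ?thesis using gY_carrier[OF y(1)] gY_carrier[OF y(2)] Y_sub y by auto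
next
  case False
  have c: "y \<in> carrier M" "z \<in> carrier M" using y Y_sub by auto
  show ?thesis
  proof (cases "z \<in> pspan R M y")
    case True
    then obtain k where k: "k \<in> carrier R" "z = k \<^bold>* y" by (auto simp: pspan_iff)
    have "y \<^bold>+ z = (\<one> \<oplus> k) \<^bold>* y" using k c by (simp add: smult_l_distr)
    then have "gY (y \<^bold>+ z) = gY ((\<one> \<oplus> k) \<^bold>* y)" by (simp only:)
    also have "\<dots> = (\<one> \<oplus> k) \<^bold>* gY y" using gY_smult[OF y(1), of "\<one> \<oplus> k"] k by blast
    also have "\<dots> = gY y \<^bold>+ k \<^bold>* gY y" using gY_carrier[OF y(1)] k by (simp add: smult_l_distr)
    also have "k \<^bold>* gY y = gY z" using gY_smult[OF y(1) k(1)] k(2) by (simp only:)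
    finally show ?thesis .
  next
    case nz: False
    have "z \<notin> span2 e y"
    proof
      assume "z \<in> span2 e y"
      then obtain a b where ab: "a \<in> carrier R" "b \<in> carrier R" "z = a \<^bold>* e \<^bold>+ b \<^bold>* y" by (auto simp: span2_iff)
      have bY: "b \<^bold>* y \<in> Y" using subspD(5)[OF Y(1) ab(2) y(1)] .
      then have "a \<^bold>* e \<in> Y" using subsp_add_iff(2)[OF Y(1) bY, of "a \<^bold>* e"] ab y(2) by simp
      then have "a = \<zero>" using subsp_smult_iff[OF Y(1) ab(1), of e] Y(3) by auto
      then show False using nz ab c by (auto simp: pspan_iff)
    qed
    then have i: "indep3 e y z" using e_nz c Y_pspan[OF y(1)] False by (simp add: indep3_def)
    have "y \<^bold>+ z \<noteq> \<^bold>0"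
      using subsp_add_iff(1)[OF subsp_pspan[OF c(1)] pspan_self[OF c(1)] c(2)] nz subspD(3)[OF subsp_pspan[OF c(1)]] by auto
    then show ?thesis using g_add[OF i] y Y_sub False by simp
  qed
qed

lemma G_linear:
  shows "x \<in> X \<Longrightarrow> G x \<in> carrier M" "x \<in> X \<Longrightarrow> z \<in> X \<Longrightarrow> G (x \<^bold>+ z) = G x \<^bold>+ G z"
    "x \<in> X \<Longrightarrow> c \<in> carrier R \<Longrightarrow> G (c \<^bold>* x) = c \<^bold>* G x"
    "x \<in> X \<Longrightarrow> x \<noteq> \<^bold>0 \<Longrightarrow> t x \<in> pspan R M (G x)"
proof -
  have dec: "\<exists>y a. y \<in> Y \<and> a \<in> carrier R \<and> x = y \<^bold>+ a \<^bold>* e" if "x \<in> X" for x using that Y(2) by (auto simp: ext_def)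
  have Yc: "y \<in> carrier M" if "y \<in> Y" for y using that Y_sub by simp
  { fix x assume "x \<in> X"
    then obtain y a where x: "y \<in> Y" "a \<in> carrier R" "x = y \<^bold>+ a \<^bold>* e" using dec by blast
    then show "G x \<in> carrier M" using gY_carrier G_eq by simp
    { fix z assume "z \<in> X"
      then obtain y' b where z: "y' \<in> Y" "b \<in> carrier R" "z = y' \<^bold>+ b \<^bold>* e" using dec by blast
      have "x \<^bold>+ z = (y \<^bold>+ y') \<^bold>+ (a \<oplus> b) \<^bold>* e" using x z Yc by (simp add: smult_l_distr M.a_ac)
      then have "G (x \<^bold>+ z) = (gY y \<^bold>+ gY y') \<^bold>+ (a \<oplus> b) \<^bold>* t e"
        using G_eq[of "y \<^bold>+ y'" "a \<oplus> b"] gY_add x z subspD(4)[OF Y(1)] by simp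
      also have "\<dots> = G x \<^bold>+ G z"
        using G_eq x z gY_carrier[OF x(1)] gY_carrier[OF z(1)] by (simp add: smult_l_distr M.a_ac)
      finally show "G (x \<^bold>+ z) = G x \<^bold>+ G z" . }
    { fix c assume c: "c \<in> carrier R"
      have "c \<^bold>* x = c \<^bold>* y \<^bold>+ (c \<otimes> a) \<^bold>* e" using x Yc c by (simp add: smult_r_distr smult_assoc1)
      then have "G (c \<^bold>* x) = c \<^bold>* gY y \<^bold>+ (c \<otimes> a) \<^bold>* t e"
        using G_eq[of "c \<^bold>* y" "c \<otimes> a"] gY_smult x c subspD(5)[OF Y(1)] by simp
      also have "\<dots> = c \<^bold>* G x"
        using G_eq x c gY_carrier[OF x(1)] by (simp add: smult_r_distr smult_assoc1)
      finally show "G (c \<^bold>* x) = c \<^bold>* G x" . }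
    assume x0: "x \<noteq> \<^bold>0"
    have te': "t e \<in> pspan R M (t e)" by simp
    show "t x \<in> pspan R M (G x)"
    proof (cases "y = \<^bold>0 \<or> a = \<zero>")
      case True
      show ?thesis
      proof (cases "y = \<^bold>0")
        case True
        have xe: "x = a \<^bold>* e" using x True by simp
        then have "x \<in> pspan R M e" "a \<noteq> \<zero>" using x x0 by (auto simp: pspan_iff)
        then have "t x \<in> pspan R M (t e)" using t_pspan_iff[OF e \<open>x \<in> X\<close> e_nz x0] by blast
        moreover have "G x = a \<^bold>* t e" using G_eq[OF x(1,2)] x(2,3) True by simp
        ultimately show ?thesis using pspan_smult[OF x(2) \<open>a \<noteq> \<zero>\<close> te(1)] by simp
      next
        case False
        then have a: "a = \<zero>" using \<open>y = \<^bold>0 \<or> a = \<zero>\<close> by blast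
        have "x = y" "G x = g y" using G_eq[OF x(1,2)] x(3) Yc[OF x(1)] False gY_carrier[OF x(1)] unfolding a by auto
        moreover have "t y \<in> pspan R M (g y)" using g_props(5) Y_sub x(1) Y_pspan False by blast
        ultimately show ?thesis by simp
      qed
    next
      case False
      \<comment> \<open>Rescaling to \<open>e + y / a\<close> reduces the claim to the normalisation
        that defines \<open>g\<close>.\<close>
      let ?y = "inv a \<^bold>* y"
      have iy: "?y \<in> Y" using subspD(5)[OF Y(1)] x False by simp
      have xa: "x = a \<^bold>* (e \<^bold>+ ?y)" using x False Yc by (simp add: smult_r_distr M.a_comm)
      have iy0: "?y \<noteq> \<^bold>0" using False x Yc by simp
      note E = ev[OF Y_sub[OF iy] Y_pspan[OF iy iy0]] and gp = g_props[OF Y_sub[OF iy] Y_pspan[OF iy iy0]]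
      have "x \<in> pspan R M (e \<^bold>+ ?y)" using xa x by (auto simp: pspan_iff)
      then have "t x \<in> pspan R M (t (e \<^bold>+ ?y))" using t_pspan_iff[OF E(1) \<open>x \<in> X\<close> E(2) x0] by blast
      then have 1: "t x \<in> pspan R M (t e \<^bold>+ g ?y)" using pspan_trans[OF _ gp(2)] gp by simp
      have "g ?y = inv a \<^bold>* g y" using gY_smult[OF x(1), of "inv a"] iy0 False x by simp
      then have "a \<^bold>* (t e \<^bold>+ g ?y) = G x"
        using G_eq[OF x(1,2)] x False gY_carrier[OF x(1)] by (simp add: smult_r_distr M.a_comm)
      then show ?thesis using 1 pspan_smult[of a "t e \<^bold>+ g ?y"] x False gp by simp
    qed }
qed

end

section \<open>Linear lifts of the collineation\<close>

context vspace begin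

definition linear_on where
  "linear_on X g \<longleftrightarrow> (\<forall>x\<in>X. g x \<in> carrier M) \<and> (\<forall>x\<in>X. \<forall>y\<in>X. g (x \<^bold>+ y) = g x \<^bold>+ g y) \<and>
     (\<forall>c\<in>carrier R. \<forall>x\<in>X. g (c \<^bold>* x) = c \<^bold>* g x)"

lemma linear_onD:
  assumes "linear_on X g"
  shows "x \<in> X \<Longrightarrow> g x \<in> carrier M" "x \<in> X \<Longrightarrow> y \<in> X \<Longrightarrow> g (x \<^bold>+ y) = g x \<^bold>+ g y"
    "c \<in> carrier R \<Longrightarrow> x \<in> X \<Longrightarrow> g (c \<^bold>* x) = c \<^bold>* g x"
  using assms by (auto simp: linear_on_def)

lemma linear_on_zero: "linear_on X g \<Longrightarrow> subsp X \<Longrightarrow> g \<^bold>0 = \<^bold>0"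
  using linear_onD(1)[of X g "\<^bold>0"] linear_onD(3)[where X = X and g = g and c = \<zero> and x = "\<^bold>0"] subspD(3)[of X] by simp

text \<open>Eigenvalues of independent \<open>u\<close> and \<open>v\<close> agree, because
  \<open>u + v\<close> is an eigenvector too.\<close>

lemma scalar_map:
  assumes h: "linear_on (carrier M) h" and p: "\<And>v. v \<in> carrier M \<Longrightarrow> h v \<in> pspan R M v"
  shows "\<exists>c\<in>carrier R. \<forall>v\<in>carrier M. h v = c \<^bold>* v"
proof (cases "carrier M = {\<^bold>0}")
  case True then show ?thesis using p by (intro bexI[of _ \<zero>]) (auto simp: pspan_iff)
next
  case False
  then obtain u where u: "u \<in> carrier M" "u \<noteq> \<^bold>0" by auto
  obtain c where c: "c \<in> carrier R" "h u = c \<^bold>* u" using p[OF u(1)] by (auto simp: pspan_iff)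
  have "h v = c \<^bold>* v" if v: "v \<in> carrier M" for v
  proof (cases "v \<in> pspan R M u")
    case True
    then obtain a where a: "a \<in> carrier R" "v = a \<^bold>* u" by (auto simp: pspan_iff)
    then have "h v = a \<^bold>* (c \<^bold>* u)" using linear_onD(3)[OF h a(1) u(1)] c by simp
    then show ?thesis using a c u by (simp add: smult_assoc1[symmetric] R.m_comm)
  next
    case False
    obtain d where d: "d \<in> carrier R" "h v = d \<^bold>* v" using p[OF v] by (auto simp: pspan_iff)
    obtain b where b: "b \<in> carrier R" "h (u \<^bold>+ v) = b \<^bold>* (u \<^bold>+ v)" using p[of "u \<^bold>+ v"] u v by (auto simp: pspan_iff)
    have "c \<^bold>* u \<^bold>+ d \<^bold>* v = b \<^bold>* u \<^bold>+ b \<^bold>* v"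
      using b linear_onD(2)[OF h u(1) v] c d u v by (simp add: smult_r_distr)
    then have "c = d" using indep2[OF u(1) v u(2) False c(1) d(1) b(1,1)] by simp
    then show ?thesis using d by simp
  qed
  then show ?thesis using c by blast
qed

lemma dim_span2_le: assumes "u \<in> carrier M" "v \<in> carrier M" shows "\<exists>k\<le>2. dim k (span2 u v)"
proof -
  have A: "\<exists>k\<le>1. dim k (pspan R M u)"
  proof (cases "u = \<^bold>0")
    case True
    then have "pspan R M u = {\<^bold>0}" by (auto simp: pspan_iff intro: R.zero_closed)
    then show ?thesis using dimx_0 by auto
  qed (use dim_pspan assms in blast)
  then obtain k where k: "k \<le> 1" "dim k (pspan R M u)" by blast
  show ?thesis
  proof (cases "v \<in> pspan R M u")
    case True
    then show ?thesis using ext_absorb[OF subsp_pspan[OF assms(1)] True] k by (auto simp: span2_def intro!: exI[of _ k])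
  next
    case False
    then show ?thesis using dimx_Suc[OF k(2) assms(2)] k(1) by (auto simp: span2_def intro!: exI[of _ "Suc k"])
  qed
qed

lemma span2_proper:
  assumes "dim k X" "k \<ge> 3" "u \<in> carrier M" "v \<in> carrier M" shows "\<exists>w\<in>X. w \<notin> span2 u v"
proof -
  obtain l where "l \<le> 2" "dim l (span2 u v)" using dim_span2_le assms by blast
  then show ?thesis using dim_less[of l "span2 u v" k X] assms by simp
qed

end

locale fdom = dom +
  fixes f :: "'c \<Rightarrow> 'c \<Rightarrow> 'a"
  assumes f_closed [simp]: "u \<in> carrier M \<Longrightarrow> v \<in> carrier M \<Longrightarrow> f u v \<in> carrier R"
    and f_add_l: "u \<in> carrier M \<Longrightarrow> v \<in> carrier M \<Longrightarrow> w \<in> carrier M \<Longrightarrow> f (u \<^bold>+ v) w = f u w \<oplus> f v w"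
    and f_add_r: "u \<in> carrier M \<Longrightarrow> v \<in> carrier M \<Longrightarrow> w \<in> carrier M \<Longrightarrow> f u (v \<^bold>+ w) = f u v \<oplus> f u w"
    and f_smult_l: "c \<in> carrier R \<Longrightarrow> u \<in> carrier M \<Longrightarrow> v \<in> carrier M \<Longrightarrow> f (c \<^bold>* u) v = c \<otimes> f u v"
    and f_smult_r: "c \<in> carrier R \<Longrightarrow> u \<in> carrier M \<Longrightarrow> v \<in> carrier M \<Longrightarrow> f u (c \<^bold>* v) = c \<otimes> f u v"
    and orth_f: "u \<in> carrier M \<Longrightarrow> v \<in> carrier M \<Longrightarrow> u \<perp> v \<longleftrightarrow> f u v = \<zero>"
    and t_surj: "w \<in> S \<Longrightarrow> w \<noteq> \<^bold>0 \<Longrightarrow> \<exists>v\<in>S. v \<noteq> \<^bold>0 \<and> w \<in> pspan R M (t v)"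
    and finV2: "dim (2 * n) (carrier M)"
begin

lemma t_span_tsub:
  assumes X: "tsub X" and uvw: "u \<in> X" "v \<in> X" "w \<in> X" "u \<noteq> \<^bold>0" "v \<noteq> \<^bold>0" "w \<noteq> \<^bold>0"
  shows "t w \<in> span2 (t u) (t v) \<longleftrightarrow> w \<in> span2 u v"
proof
  note XD = tsubD[OF X]
  have S: "u \<in> S" "v \<in> S" "w \<in> S" "u \<perp> v" using XD uvw by blast+
  show "t w \<in> span2 (t u) (t v)" if "w \<in> span2 u v" using t_line S uvw that by blast
  assume "t w \<in> span2 (t u) (t v)"
  then obtain x where x: "x \<in> span2 u v" "x \<noteq> \<^bold>0" "t w \<in> pspan R M (t x)"
    using t_onto[OF S(1,2) uvw(4,5) S(4)] t_nz S uvw by blast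
  have "x \<in> S" using span2_least[OF XD(1) uvw(1,2)] x XD by blast
  then have "w \<in> pspan R M x" using t_inj x S uvw by blast
  then show "w \<in> span2 u v" using pspan_subset[OF subsp_span2 x(1)] S by auto
qed

text \<open>As \<open>e\<close> is not orthogonal to \<open>t v0\<close>, the perp of
  \<open>t v0\<close> cuts out a complement \<open>?Y\<close> of \<open>e\<close> in
  \<open>X\<close>, and domesticity along the vectors \<open>e + c v0\<close> supplies the
  assumption \<open>linear\<close> of \<open>line_map\<close>.\<close>

lemma induced_linear:
  assumes X: "subsp X" "X \<subseteq> S" and dim3: "dim k X" "k \<ge> 3"
    and span: "\<And>u v w. u \<in> X \<Longrightarrow> v \<in> X \<Longrightarrow> w \<in> X \<Longrightarrow> u \<noteq> \<^bold>0 \<Longrightarrow> v \<noteq> \<^bold>0 \<Longrightarrow> w \<noteq> \<^bold>0 \<Longrightarrow>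
      t w \<in> span2 (t u) (t v) \<longleftrightarrow> w \<in> span2 u v"
    and e: "e \<in> X" "v0 \<in> X" "v0 \<noteq> \<^bold>0" "\<not> e \<perp> t v0"
  obtains g where "linear_on X g" "\<And>x. x \<in> X \<Longrightarrow> x \<noteq> \<^bold>0 \<Longrightarrow> t x \<in> pspan R M (g x)"
proof -
  have eS: "e \<in> S" "v0 \<in> S" and ec: "e \<in> carrier M" "v0 \<in> carrier M" "t v0 \<in> carrier M" using X e by auto
  have e0: "e \<noteq> \<^bold>0" using e ec by auto
  let ?Y = "X \<inter> perp {t v0}"
  have sY: "subsp ?Y" using subsp_Int X subsp_perp ec by auto
  have eY: "\<not> t v0 \<perp> e" using e orth_commute ec by blast
  have v0e: "v0 \<notin> pspan R M e"
  proof
    assume "v0 \<in> pspan R M e"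
    then have "t v0 \<in> pspan R M (t e)" using t_pspan eS e e0 by blast
    then show False using orth_pspan(1)[OF ec(1) _ dmst[OF eS(1) e0]] t_carrier eS e0 e by blast
  qed
  interpret L: line_map R M X ?Y e v0 t
  proof unfold_locales
    show "X = ext ?Y e"
    proof
      show "ext ?Y e \<subseteq> X" by (rule ext_least[OF X(1) _ e(1)]) blast
      show "X \<subseteq> ext ?Y e"
      proof
        fix x assume x: "x \<in> X"
        then have xc: "x \<in> carrier M" using X by auto
        obtain c where c: "c \<in> carrier R" "t v0 \<perp> x \<^bold>+ c \<^bold>* e" using orth_solve[OF xc ec(1,3) eY] by blast
        have "x \<^bold>+ c \<^bold>* e \<in> ?Y" using c x e subspD[OF X(1)] xc ec by (auto simp: perp_def)
        then show "x \<in> ext ?Y e" using extI[of "x \<^bold>+ c \<^bold>* e" ?Y "\<ominus> c" e] minus_cancel[OF xc ec(1) c(1)] c by simp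
      qed
    qed
    show "e \<notin> ?Y" using eY by (simp add: perp_def)
    show "t u \<in> carrier M" "t u \<noteq> \<^bold>0" if "u \<in> X" "u \<noteq> \<^bold>0" for u using that X t_nz t_carrier by blast+
    show "\<exists>w\<in>X. w \<notin> span2 u v" if "u \<in> X" "v \<in> X" for u v
      using span2_proper[OF dim3, of u v] that subspD(2)[OF X(1)] by blast
  next
    fix c s w assume c: "c \<in> carrier R" "c \<noteq> \<zero>" and s: "s \<in> carrier R" and w: "w \<in> pspan R M (t v0)"
      and 1: "t (e \<^bold>+ v0) \<in> pspan R M (t e \<^bold>+ w)" and 2: "t (e \<^bold>+ c \<^bold>* v0) \<in> pspan R M (t e \<^bold>+ s \<^bold>* w)"
    have wc: "w \<in> carrier M" using w subspD(2)[OF subsp_pspan[OF ec(3)]] by blast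
    have te: "t e \<in> carrier M" "f e (t e) = \<zero>" using dmst[OF eS(1) e0] orth_f ec eS e0 by auto
    have v0w: "f v0 w = \<zero>" using w dmst[OF eS(2) e(3)] orth_f[OF ec(2,3)] ec by (auto simp: pspan_iff f_smult_r)
    \<comment> \<open>Domesticity of \<open>e + d v0\<close> reads
      \<open>r f e w + d f v0 (t e) = 0\<close>, since the two diagonal terms vanish. Comparing
      \<open>d = r = 1\<close> with the case of \<open>c\<close> and \<open>s\<close> gives
      \<open>s = c\<close>.\<close>
    have key: "d \<otimes> f v0 (t e) = \<ominus> (r \<otimes> f e w)"
      if d: "d \<in> carrier R" "d \<noteq> \<zero>" "r \<in> carrier R" "t (e \<^bold>+ d \<^bold>* v0) \<in> pspan R M (t e \<^bold>+ r \<^bold>* w)" for d r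
    proof -
      let ?x = "e \<^bold>+ d \<^bold>* v0"
      have xX: "?x \<in> X" using subspD(4)[OF X(1) e(1) subspD(5)[OF X(1) d(1) e(2)]] .
      have x0: "?x \<noteq> \<^bold>0"
      proof
        assume "?x = \<^bold>0"
        then have "?x \<in> pspan R M e" using subspD(3)[OF subsp_pspan[OF ec(1)]] by simp
        then have "d \<^bold>* v0 \<in> pspan R M e" using subsp_add_iff(1)[OF subsp_pspan[OF ec(1)] pspan_self[OF ec(1)]] d ec by simp
        then show False using subsp_smult_iff[OF subsp_pspan[OF ec(1)] d(1,2) ec(2)] v0e by simp
      qed
      have xS: "?x \<in> S" using xX X by blast
      have c': "?x \<in> carrier M" "t e \<^bold>+ r \<^bold>* w \<in> carrier M" using ec d wc te by auto
      have "t e \<^bold>+ r \<^bold>* w \<in> pspan R M (t ?x)" using pspan_sym[OF d(4) t_nz[OF xS x0] c'(2)] .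
      then have "?x \<perp> t e \<^bold>+ r \<^bold>* w" using orth_pspan(1)[OF c'(1) _ dmst[OF xS x0]] t_carrier xS x0 by blast
      then have "f ?x (t e \<^bold>+ r \<^bold>* w) = \<zero>" using orth_f c' by blast
      then have "r \<otimes> f e w \<oplus> d \<otimes> f v0 (t e) = \<zero>"
        using ec d wc te v0w by (simp add: f_add_l f_add_r f_smult_l f_smult_r R.a_comm)
      then show ?thesis using ec te wc d by (intro R.minus_equality[symmetric]) (simp_all add: R.a_comm)
    qed
    have "f e w \<noteq> \<zero>"
    proof -
      obtain k where k: "k \<in> carrier R" "w = k \<^bold>* t v0" using w by (auto simp: pspan_iff)
      have "k \<noteq> \<zero>"
      proof
        assume "k = \<zero>"
        then have "t (e \<^bold>+ v0) \<in> pspan R M (t e)" using 1 k ec te by simp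
        moreover have "e \<^bold>+ v0 \<in> X" using subspD(4)[OF X(1)] e by blast
        moreover have n: "e \<^bold>+ v0 \<notin> pspan R M e" using subsp_add_iff(1)[OF subsp_pspan[OF ec(1)] pspan_self[OF ec(1)] ec(2)] v0e by simp
        moreover have "e \<^bold>+ v0 \<noteq> \<^bold>0" using n subspD(3)[OF subsp_pspan[OF ec(1)]] by metis
        ultimately show False using t_inj[OF eS(1) _ e0] X by blast
      qed
      then show ?thesis using k e(4) orth_f ec by (simp add: f_smult_r R.integral_iff)
    qed
    moreover have "f v0 (t e) = \<ominus> (f e w)" using key[of \<one> \<one>] 1 ec wc te by simp
    then have "\<ominus> (c \<otimes> f e w) = \<ominus> (s \<otimes> f e w)" using key[OF c s 2] ec wc te c s by (simp add: R.r_minus)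
    then have "c \<otimes> f e w = s \<otimes> f e w" using ec(1) wc c(1) s by (metis R.minus_minus R.m_closed f_closed)
    ultimately show "s = c" using R.m_rcancel[of "f e w" c s] ec wc c s by simp
  qed (use X sY e v0e span in \<open>auto simp: subsp_def\<close>)
  have "linear_on X L.G" unfolding linear_on_def using L.G_linear by blast
  then show ?thesis using that L.G_linear(4) by blast
qed

text \<open>\<open>X\<close> and \<open>tim X\<close> meet trivially and have dimension
  \<open>n\<close> each, so they decompose the space of dimension \<open>2 n\<close>; every vector
  gets coordinates \<open>x + g y\<close> with \<open>x\<close> and \<open>y\<close> in
  \<open>X\<close>.\<close>

lemma opp_decomp:
  assumes X: "tsub X" "dim n X" "opp X" and g: "linear_on X g"
    and tg: "\<And>x. x \<in> X \<Longrightarrow> x \<noteq> \<^bold>0 \<Longrightarrow> t x \<in> pspan R M (g x)"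
  shows "\<And>x. x \<in> X \<Longrightarrow> g x \<in> tim X" "\<And>x. x \<in> X \<Longrightarrow> g x \<in> X \<Longrightarrow> x = \<^bold>0"
    "\<And>z. z \<in> carrier M \<Longrightarrow> \<exists>x\<in>X. \<exists>y\<in>X. z = x \<^bold>+ g y"
    "\<And>x. x \<in> X \<Longrightarrow> x \<noteq> \<^bold>0 \<Longrightarrow> g x \<in> pspan R M (t x)"
    "\<And>x. x \<in> X \<Longrightarrow> x \<noteq> \<^bold>0 \<Longrightarrow> g x \<noteq> \<^bold>0"
proof -
  note XD = tsubD[OF X(1)] and gD = linear_onD[OF g]
  have g0: "g \<^bold>0 = \<^bold>0" using linear_on_zero[OF g XD(1)] .
  have tx: "t x \<in> carrier M" "t x \<noteq> \<^bold>0" if "x \<in> X" "x \<noteq> \<^bold>0" for x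
    using that XD t_carrier t_nz by blast+
  show 1: "g x \<noteq> \<^bold>0" if "x \<in> X" "x \<noteq> \<^bold>0" for x using tg[OF that] tx[OF that] by (auto simp: pspan_iff)
  show 2: "g x \<in> pspan R M (t x)" if "x \<in> X" "x \<noteq> \<^bold>0" for x
    using pspan_sym[OF tg[OF that] tx(2)[OF that]] gD(1) that by blast
  show 3: "g x \<in> tim X" if "x \<in> X" for x
    using 2[OF that] that g0 by (cases "x = \<^bold>0") (auto simp: tim_def)
  show "x = \<^bold>0" if "x \<in> X" "g x \<in> X" for x using opp_inter_tim[OF X(1,3)] 3[OF that(1)] that 1 by blast
  fix z assume "z \<in> carrier M"
  moreover have "X <+>\<^bsub>M\<^esub> tim X = carrier M"
    using dim_eq[OF opp_sum_dim[OF X] finV2] subspD(1)[OF dim_subsp[OF opp_sum_dim[OF X]]] .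
  ultimately obtain x w where xw: "x \<in> X" "w \<in> tim X" "z = x \<^bold>+ w" using set_add_mem by metis
  have "\<exists>y\<in>X. w = g y"
  proof (cases "w = \<^bold>0")
    case True then show ?thesis using g0 subspD(3)[OF XD(1)] by metis
  next
    case False
    then obtain y where y: "y \<in> X" "y \<noteq> \<^bold>0" "w \<in> pspan R M (t y)" using xw(2) by (auto simp: tim_def)
    then have "w \<in> pspan R M (g y)" using pspan_trans[OF _ tg] gD(1) by blast
    then obtain c where "c \<in> carrier R" "w = c \<^bold>* g y" by (auto simp: pspan_iff)
    then show ?thesis using gD(3) y(1) subspD(5)[OF XD(1)] by metis
  qed
  then show "\<exists>x\<in>X. \<exists>y\<in>X. z = x \<^bold>+ g y" using xw by blast
qed

end

subsection \<open>Symplectic case\<close>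

locale symp = fdom +
  assumes S_all: "S = carrier M" and f_alt: "v \<in> carrier M \<Longrightarrow> f v v = \<zero>"
begin

lemma pspan_perp:
  assumes "v \<in> carrier M" "w \<in> carrier M" "v \<noteq> \<^bold>0" "\<And>z. z \<in> carrier M \<Longrightarrow> v \<perp> z \<Longrightarrow> w \<perp> z"
  shows "w \<in> pspan R M v"
proof -
  have "w \<perp> z" if "z \<in> perp (pspan R M v)" for z using that assms by (auto simp: perp_def)
  then obtain x r where "x \<in> pspan R M v" "r \<in> carrier M" "w = x \<^bold>+ r" "\<forall>z\<in>carrier M. r \<perp> z"
    using perp_perp[OF dim_pspan[OF assms(1,3)] assms(2)] by blast
  then show ?thesis using S_rad[of r] S_all subspD(2)[OF subsp_pspan[OF assms(1)]] by fastforce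
qed

lemma span2_perp:
  assumes "u \<in> carrier M" "v \<in> carrier M" "w \<in> carrier M"
  shows "w \<in> span2 u v \<longleftrightarrow> (\<forall>y\<in>carrier M. y \<perp> u \<longrightarrow> y \<perp> v \<longrightarrow> y \<perp> w)"
proof
  show "\<forall>y\<in>carrier M. y \<perp> u \<longrightarrow> y \<perp> v \<longrightarrow> y \<perp> w" if "w \<in> span2 u v"
    using orth_span2(1) assms that by blast
  assume *: "\<forall>y\<in>carrier M. y \<perp> u \<longrightarrow> y \<perp> v \<longrightarrow> y \<perp> w"
  obtain k where k: "dim k (span2 u v)" using dim_span2_le assms by blast
  have "w \<perp> z" if z: "z \<in> perp (span2 u v)" for z
  proof -
    have "z \<in> carrier M" "u \<perp> z" "v \<perp> z" using z span2_gen[OF assms(1,2)] by (auto simp: perp_def)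
    then show ?thesis using * orth_commute assms by blast
  qed
  then obtain x r where "x \<in> span2 u v" "r \<in> carrier M" "w = x \<^bold>+ r" "\<forall>z\<in>carrier M. r \<perp> z"
    using perp_perp[OF k assms(3)] by blast
  then show "w \<in> span2 u v" using S_rad[of r] S_all subspD(2)[OF subsp_span2[OF assms(1,2)]] by fastforce
qed

text \<open>The collineation is only known to respect totally isotropic lines. By
  \<open>span2_perp\<close> every line is a double perp, and \<open>t\<close> is onto points and
  preserves and reflects orthogonality, so the other lines are respected too.\<close>

lemma t_span_all:
  assumes c: "u \<in> carrier M" "v \<in> carrier M" "w \<in> carrier M" and nz: "u \<noteq> \<^bold>0" "v \<noteq> \<^bold>0" "w \<noteq> \<^bold>0"
  shows "t w \<in> span2 (t u) (t v) \<longleftrightarrow> w \<in> span2 u v"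
proof -
  have tc: "t u \<in> carrier M" "t v \<in> carrier M" "t w \<in> carrier M" using c nz S_all by auto
  have iff: "y \<perp> t x \<longleftrightarrow> z \<perp> x" if "z \<in> carrier M" "z \<noteq> \<^bold>0" "y \<in> pspan R M (t z)" "y \<noteq> \<^bold>0" "x \<in> carrier M" "x \<noteq> \<^bold>0" for x y z
    using orth_pspan_iff(2)[of "t x" "t z" y] t_orth[of z x] that S_all by simp
  have "(\<forall>y\<in>carrier M. y \<perp> t u \<longrightarrow> y \<perp> t v \<longrightarrow> y \<perp> t w) \<longleftrightarrow> (\<forall>y\<in>carrier M. y \<perp> u \<longrightarrow> y \<perp> v \<longrightarrow> y \<perp> w)"
  proof (intro iffI ballI impI)
    fix y assume *: "\<forall>y\<in>carrier M. y \<perp> t u \<longrightarrow> y \<perp> t v \<longrightarrow> y \<perp> t w" and y: "y \<in> carrier M" "y \<perp> u" "y \<perp> v"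
    show "y \<perp> w"
    proof (cases "y = \<^bold>0")
      case False
      have "t y \<in> carrier M" using y False S_all by simp
      moreover have "t y \<perp> t u" "t y \<perp> t v" using t_orth[of y u] t_orth[of y v] y c nz False S_all by auto
      ultimately have "t y \<perp> t w" using * by blast
      then show ?thesis using t_orth[of y w] y c nz False S_all by auto
    qed (use c in simp)
  next
    fix y assume *: "\<forall>y\<in>carrier M. y \<perp> u \<longrightarrow> y \<perp> v \<longrightarrow> y \<perp> w" and y: "y \<in> carrier M" "y \<perp> t u" "y \<perp> t v"
    show "y \<perp> t w"
    proof (cases "y = \<^bold>0")
      case False
      then obtain z where z: "z \<in> carrier M" "z \<noteq> \<^bold>0" "y \<in> pspan R M (t z)" using t_surj[of y] y S_all by blast
      have "z \<perp> u" "z \<perp> v" using iff[OF z False] y(2,3) c nz by auto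
      then have "z \<perp> w" using * z(1) by blast
      then show ?thesis using iff[OF z False c(3) nz(3)] by blast
    qed (use tc in simp)
  qed
  then show ?thesis using span2_perp c tc by simp
qed

lemma f_skew: assumes "u \<in> carrier M" "v \<in> carrier M" shows "f v u = \<ominus> f u v"
proof -
  have "f (u \<^bold>+ v) (u \<^bold>+ v) = f u u \<oplus> f v u \<oplus> (f u v \<oplus> f v v)" using assms by (simp add: f_add_l f_add_r)
  then have "f u v \<oplus> f v u = \<zero>" using f_alt assms by (simp add: R.a_comm)
  then show ?thesis using assms by (intro R.minus_equality[symmetric]) (simp_all add: R.a_comm)
qed

text \<open>Domesticity, \<open>f u (g u) = 0\<close>, polarises to self-adjointness because
  \<open>f\<close> is skew. For \<open>z\<close> orthogonal to \<open>v\<close>, preservation of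
  orthogonality then gives \<open>f (g (g v)) z = f (g v) (g z) = 0\<close>. So
  \<open>g (g v)\<close> is a multiple of \<open>v\<close>, with a constant factor by
  \<open>scalar_map\<close>.\<close>

lemma symplectic_lift:
  obtains g \<kappa> where "linear_on (carrier M) g" "\<kappa> \<in> carrier R"
    "\<And>z. z \<in> carrier M \<Longrightarrow> z \<noteq> \<^bold>0 \<Longrightarrow> t z \<in> pspan R M (g z)"
    "\<And>z. z \<in> carrier M \<Longrightarrow> g (g z) = \<kappa> \<^bold>* z"
    "\<And>u v. u \<in> carrier M \<Longrightarrow> v \<in> carrier M \<Longrightarrow> f u (g v) = f (g u) v"
proof -
  have "2 * n \<ge> 3" using rank by simp
  obtain v0 where v0: "v0 \<in> carrier M" "v0 \<noteq> \<^bold>0" using dim_less[of 0 "{\<^bold>0}" "2 * n" "carrier M"] finV2 rank by auto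
  have tv0: "t v0 \<in> carrier M" "t v0 \<noteq> \<^bold>0" using v0 S_all t_carrier t_nz by blast+
  obtain e where e: "e \<in> carrier M" "\<not> t v0 \<perp> e" using S_rad[of "t v0"] tv0 S_all by blast
  then have e': "\<not> e \<perp> t v0" using orth_commute tv0 by blast
  obtain g where g: "linear_on (carrier M) g" "\<And>x. x \<in> carrier M \<Longrightarrow> x \<noteq> \<^bold>0 \<Longrightarrow> t x \<in> pspan R M (g x)"
    using induced_linear[OF subsp_carrier _ finV2 \<open>2 * n \<ge> 3\<close> t_span_all e(1) v0 e'] S_all by auto
  note gD = linear_onD[OF g(1)]
  have g0: "g \<^bold>0 = \<^bold>0" using linear_on_zero g(1) subsp_carrier by blast
  have tc: "t v \<in> carrier M" "t v \<noteq> \<^bold>0" if "v \<in> carrier M" "v \<noteq> \<^bold>0" for v using that t_carrier t_nz S_all by blast+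
  have gt: "g v \<in> pspan R M (t v)" "g v \<noteq> \<^bold>0" if v: "v \<in> carrier M" "v \<noteq> \<^bold>0" for v
  proof -
    show "g v \<in> pspan R M (t v)" using pspan_sym[OF g(2)[OF v] tc(2)[OF v] gD(1)[OF v(1)]] .
    show "g v \<noteq> \<^bold>0" using g(2)[OF v] tc(2)[OF v] by (auto simp: pspan_iff)
  qed
  have ug: "f u (g u) = \<zero>" if u: "u \<in> carrier M" for u
  proof (cases "u = \<^bold>0")
    case False
    then have "u \<perp> g u" using orth_pspan(1)[OF u _ dmst gt(1)] tc u S_all by blast
    then show ?thesis using orth_f u gD(1) by blast
  qed (use g0 f_alt in simp)
  have sa: "f u (g v) = f (g u) v" if uv: "u \<in> carrier M" "v \<in> carrier M" for u v
  proof -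
    have "f (u \<^bold>+ v) (g (u \<^bold>+ v)) = \<zero>" using ug uv by simp
    then have "f u (g v) \<oplus> f v (g u) = \<zero>" using uv ug gD by (simp add: f_add_l f_add_r R.a_comm)
    then have "f u (g v) = \<ominus> f v (g u)" using uv gD(1) by (simp add: R.minus_equality[symmetric])
    then show ?thesis using f_skew[OF uv(2) gD(1)[OF uv(1)]] by simp
  qed
  have og: "g u \<perp> g v" if uv: "u \<in> carrier M" "v \<in> carrier M" "u \<perp> v" for u v
  proof (cases "u = \<^bold>0 \<or> v = \<^bold>0")
    case False
    have "t u \<perp> t v" using t_orth uv False S_all by blast
    then have "t u \<perp> g v" using orth_pspan(1)[of "t u" "t v" "g v"] tc uv False gt by blast
    then show ?thesis using orth_pspan(2)[of "g v" "t u" "g u"] tc uv False gt gD(1) orth_commute by metis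
  next
    case True
    then show ?thesis using g0 orth_zero(1)[OF gD(1)[OF uv(1)]] orth_zero(2)[OF gD(1)[OF uv(2)]] by metis
  qed
  have "g (g v) \<in> pspan R M v" if v: "v \<in> carrier M" for v
  proof (cases "v = \<^bold>0")
    case False
    show ?thesis
    proof (rule pspan_perp[OF v _ False])
      fix z assume z: "z \<in> carrier M" "v \<perp> z"
      have "f (g v) (g z) = \<zero>" using og[OF v z] orth_f gD(1) v z by blast
      then have "f (g (g v)) z = \<zero>" using sa[of "g v" z] gD(1) v z by simp
      then show "g (g v) \<perp> z" using orth_f gD(1) v z by blast
    qed (use gD(1) v in blast)
  qed (use g0 in simp)
  moreover have "linear_on (carrier M) (\<lambda>v. g (g v))" unfolding linear_on_def using gD by simp
  ultimately obtain \<kappa> where "\<kappa> \<in> carrier R" "\<forall>v\<in>carrier M. g (g v) = \<kappa> \<^bold>* v" using scalar_map by blast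
  then show ?thesis using that g sa by blast
qed

end

subsection \<open>Hyperbolic case\<close>

lemma (in vspace) pspan_normalize:
  assumes "u \<in> carrier M" "v \<in> carrier M" "a \<in> carrier R" "a \<noteq> \<zero>" "b \<in> carrier R"
  shows "a \<^bold>* u \<^bold>+ b \<^bold>* v \<in> pspan R M (u \<^bold>+ (inv a \<otimes> b) \<^bold>* v)"
proof -
  have "a \<^bold>* u \<^bold>+ b \<^bold>* v = a \<^bold>* (u \<^bold>+ (inv a \<otimes> b) \<^bold>* v)"
    using assms by (simp add: smult_r_distr smult_assoc1[symmetric] R.m_assoc[symmetric])
  then show ?thesis using assms by (auto simp: pspan_iff)
qed

locale hyp = fdom +
  fixes q :: "'c \<Rightarrow> 'a"
  assumes S_q: "S = {v \<in> carrier M. q v = \<zero>}"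
    and q_closed [simp]: "v \<in> carrier M \<Longrightarrow> q v \<in> carrier R"
    and q_add: "u \<in> carrier M \<Longrightarrow> v \<in> carrier M \<Longrightarrow> q (u \<^bold>+ v) = q u \<oplus> q v \<oplus> f u v"
    and f_sym: "u \<in> carrier M \<Longrightarrow> v \<in> carrier M \<Longrightarrow> f u v = f v u"

locale hyp_dec = hyp +
  fixes X :: "'c set" and h :: "'c \<Rightarrow> 'c"
  assumes X: "tsub X" "dim n X" "opp X" and h: "linear_on X h"
    and t_h: "x \<in> X \<Longrightarrow> x \<noteq> \<^bold>0 \<Longrightarrow> t x \<in> pspan R M (h x)"
begin

section \<open>Coordinates given by a maximal subspace and its image\<close>

lemmas XD = tsubD[OF X(1)] and TD = tsubD[OF tsub_tim[OF X(1)]] and hD = linear_onD[OF h]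
  and XS = subspD[OF tsubD(1)[OF X(1)]]

lemma dec:
  shows "x \<in> X \<Longrightarrow> h x \<in> tim X" "x \<in> X \<Longrightarrow> h x \<in> X \<Longrightarrow> x = \<^bold>0"
    "z \<in> carrier M \<Longrightarrow> \<exists>x\<in>X. \<exists>y\<in>X. z = x \<^bold>+ h y"
    "x \<in> X \<Longrightarrow> x \<noteq> \<^bold>0 \<Longrightarrow> h x \<in> pspan R M (t x)" "x \<in> X \<Longrightarrow> x \<noteq> \<^bold>0 \<Longrightarrow> h x \<noteq> \<^bold>0"
  using opp_decomp[OF X h t_h] by blast+

lemma h_S: "x \<in> X \<Longrightarrow> h x \<in> S" using TD(2) dec(1) by blast

lemma h_carrier [simp]: "x \<in> X \<Longrightarrow> h x \<in> carrier M" using h_S by simp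

lemma h_pspan: "x \<in> X \<Longrightarrow> x \<noteq> \<^bold>0 \<Longrightarrow> pspan R M (h x) = pspan R M (t x)"
  using pspan_eq[OF dec(4) dec(5)] XD by simp

lemma orth_h: "x \<in> X \<Longrightarrow> y \<in> X \<Longrightarrow> h x \<perp> h y" using TD(3) dec(1) by blast

lemma orth_h_iff: "x \<in> carrier M \<Longrightarrow> y \<in> X \<Longrightarrow> y \<noteq> \<^bold>0 \<Longrightarrow> x \<perp> h y \<longleftrightarrow> x \<perp> t y"
  using orth_pspan_iff(1)[OF _ _ dec(4) dec(5)] XD by simp

lemma orth_h_sym: assumes "x \<in> X" "y \<in> X" shows "x \<perp> h y \<longleftrightarrow> y \<perp> h x"
proof (cases "x = \<^bold>0 \<or> y = \<^bold>0")
  case True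
  have "h \<^bold>0 = \<^bold>0" using linear_on_zero[OF h XD(1)] .
  then show ?thesis using True assms XD(4) by auto
next
  case False
  then show ?thesis using orth_t_iff[of x y] orth_h_iff XD assms by simp
qed

lemma orth_h_self: "x \<in> X \<Longrightarrow> x \<perp> h x"
  using orth_h_iff[of x x] dmst[of x] XD linear_on_zero[OF h XD(1)] by (cases "x = \<^bold>0") auto

lemma dec_unique:
  assumes "x \<in> X" "y \<in> X" "x' \<in> X" "y' \<in> X" and eq: "x \<^bold>+ h y = x' \<^bold>+ h y'"
  shows "x = x' \<and> y = y'"
proof -
  have c: "x \<in> carrier M" "y \<in> carrier M" "x' \<in> carrier M" "y' \<in> carrier M" using assms XD by auto
  let ?w = "y' \<^bold>+ \<ominus> \<one> \<^bold>* y"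
  have wX: "?w \<in> X" by (intro XS(4) XS(5) assms) simp
  have hw: "h ?w = h y' \<^bold>+ \<ominus> \<one> \<^bold>* h y"
    using hD(2)[OF assms(4) XS(5), of "\<ominus> \<one>" y] hD(3)[OF _ assms(2), of "\<ominus> \<one>"] assms by (simp del: smult_minus_one)
  have "x = (x \<^bold>+ h y) \<^bold>+ \<ominus> \<one> \<^bold>* h y" using minus_cancel[of x "h y" \<one>] c assms by simp
  also have "\<dots> = x' \<^bold>+ h ?w" unfolding eq hw using c assms by (simp add: M.a_assoc)
  finally have x: "x = x' \<^bold>+ h ?w" .
  then have "h ?w \<in> X" using subsp_add_iff(1)[OF XD(1) assms(3), of "h ?w"] assms(1) wX by simp
  then have w0: "?w = \<^bold>0" using dec(2) wX by blast
  then have "x = x'" using x linear_on_zero[OF h XD(1)] c by simp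
  moreover have "y' = ?w \<^bold>+ \<one> \<^bold>* y" using minus_cancel[of y' y "\<ominus> \<one>"] c by simp
  then have "y' = y" using w0 c by simp
  ultimately show ?thesis by simp
qed

text \<open>The point of \<open>t (h y)\<close> lies on the fixed line of \<open>y\<close> and
  \<open>h y\<close> but is not the point of \<open>h y\<close>. Scaled to have coefficient 1 at
  \<open>y\<close>, its vector takes this form.\<close>

definition \<eta> where "\<eta> c y = y \<^bold>+ c \<^bold>* h y"

lemma \<eta>_carrier [simp]: "c \<in> carrier R \<Longrightarrow> y \<in> X \<Longrightarrow> \<eta> c y \<in> carrier M"
  using XD(4) by (simp add: \<eta>_def)

lemma t_h_ex:
  assumes x: "x \<in> X" "x \<noteq> \<^bold>0" shows "\<exists>c\<in>carrier R. t (h x) \<in> pspan R M (\<eta> c x)"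
proof -
  have c: "x \<in> carrier M" "t x \<in> carrier M" "h x \<in> carrier M" using x XD by auto
  have xS: "x \<in> S" using x XD by blast
  have tx: "t x \<in> S" "t x \<noteq> \<^bold>0" using t_S t_nz xS x by blast+
  have "t (h x) \<in> pspan R M (t (t x))" using t_pspan[OF tx dec(4)[OF x] dec(5)[OF x]] .
  moreover have "span2 x (t x) \<subseteq> span2 x (h x)" using span2_cong[OF pspan_self t_h[OF x]] c by simp
  then have "t (t x) \<in> span2 x (h x)" using t_t[OF xS x(2)] by blast
  ultimately have "t (h x) \<in> span2 x (h x)" using pspan_subset[OF subsp_span2] c by blast
  then obtain a b where ab: "a \<in> carrier R" "b \<in> carrier R" "t (h x) = a \<^bold>* x \<^bold>+ b \<^bold>* h x" by (auto simp: span2_iff)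
  have "a \<noteq> \<zero>"
  proof
    assume "a = \<zero>"
    then have "t (h x) \<in> pspan R M (h x)" using ab c by (auto simp: pspan_iff)
    then show False using nofix[OF h_S dec(5)] x by blast
  qed
  then have "t (h x) \<in> pspan R M (x \<^bold>+ (inv a \<otimes> b) \<^bold>* h x)" using pspan_normalize ab c by simp
  then show ?thesis using ab \<open>a \<noteq> \<zero>\<close> by (auto simp: \<eta>_def)
qed

lemma h_comb: "x \<in> X \<Longrightarrow> y \<in> X \<Longrightarrow> a \<in> carrier R \<Longrightarrow> b \<in> carrier R \<Longrightarrow>
    h (a \<^bold>* x \<^bold>+ b \<^bold>* y) = a \<^bold>* h x \<^bold>+ b \<^bold>* h y"
  using hD XS by simp

lemma comb_in: "x \<in> X \<Longrightarrow> y \<in> X \<Longrightarrow> a \<in> carrier R \<Longrightarrow> b \<in> carrier R \<Longrightarrow> a \<^bold>* x \<^bold>+ b \<^bold>* y \<in> X"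
  using XS by simp

text \<open>Comparing images of \<open>x\<close>, \<open>y\<close> and \<open>x + y\<close> shows that the ratio in \<open>t_h_ex\<close> does not
  depend on the point.\<close>

lemma ratio_eq_indep:
  assumes xy: "x \<in> X" "y \<in> X" "x \<noteq> \<^bold>0" "y \<notin> pspan R M x" and c: "c \<in> carrier R" "c' \<in> carrier R"
    and t: "t (h x) \<in> pspan R M (\<eta> c x)" "t (h y) \<in> pspan R M (\<eta> c' y)"
  shows "c = c'"
proof -
  have cc: "x \<in> carrier M" "y \<in> carrier M" using xy XD by auto
  have y0: "y \<noteq> \<^bold>0" using xy(4) subspD(3)[OF subsp_pspan[OF cc(1)]] by blast
  have xyX: "x \<^bold>+ y \<in> X" using XS xy by blast
  have s0: "x \<^bold>+ y \<noteq> \<^bold>0"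
    using subsp_add_iff(1)[OF subsp_pspan[OF cc(1)] pspan_self[OF cc(1)] cc(2)] xy(4) subspD(3)[OF subsp_pspan[OF cc(1)]] by auto
  obtain d where d: "d \<in> carrier R" "t (h (x \<^bold>+ y)) \<in> pspan R M (\<eta> d (x \<^bold>+ y))" using t_h_ex[OF xyX s0] by blast
  then obtain k where k: "k \<in> carrier R" "t (h (x \<^bold>+ y)) = k \<^bold>* \<eta> d (x \<^bold>+ y)" by (auto simp: pspan_iff)
  have k0: "k \<noteq> \<zero>" using k t_nz[OF h_S[OF xyX] dec(5)[OF xyX s0]] d xyX by auto
  have hs: "h (x \<^bold>+ y) \<in> span2 (h x) (h y)"
    using hD(2)[OF xy(1,2)] span2_gen[of "h x" "h y"] subspD(4)[OF subsp_span2, of "h x" "h y"] xy by simp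
  have "t (h (x \<^bold>+ y)) \<in> span2 (t (h x)) (t (h y))"
    using t_line[OF h_S[OF xy(1)] h_S[OF xy(2)] dec(5)[OF xy(1,3)] dec(5)[OF xy(2) y0] orth_h[OF xy(1,2)] hs dec(5)[OF xyX s0]] .
  also have "\<dots> \<subseteq> span2 (\<eta> c x) (\<eta> c' y)" using span2_cong[OF t] c xy by simp
  finally obtain a b where ab: "a \<in> carrier R" "b \<in> carrier R" "t (h (x \<^bold>+ y)) = a \<^bold>* \<eta> c x \<^bold>+ b \<^bold>* \<eta> c' y"
    by (auto simp: span2_iff)
  have "a \<^bold>* \<eta> c x \<^bold>+ b \<^bold>* \<eta> c' y = (a \<^bold>* x \<^bold>+ b \<^bold>* y) \<^bold>+ h ((a \<otimes> c) \<^bold>* x \<^bold>+ (b \<otimes> c') \<^bold>* y)"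
    unfolding \<eta>_def using h_comb[OF xy(1,2), of "a \<otimes> c" "b \<otimes> c'"] ab(1,2) c cc xy(1,2)
    by (simp add: smult_r_distr smult_assoc1 M.a_ac)
  moreover have "k \<^bold>* \<eta> d (x \<^bold>+ y) = (k \<^bold>* x \<^bold>+ k \<^bold>* y) \<^bold>+ h ((k \<otimes> d) \<^bold>* x \<^bold>+ (k \<otimes> d) \<^bold>* y)"
    unfolding \<eta>_def using h_comb[OF xy(1,2), of "k \<otimes> d" "k \<otimes> d"] k(1) d(1) cc xy(1,2)
    by (simp add: hD(2) smult_r_distr smult_assoc1 M.a_ac)
  ultimately have e: "a \<^bold>* x \<^bold>+ b \<^bold>* y = k \<^bold>* x \<^bold>+ k \<^bold>* y \<and> (a \<otimes> c) \<^bold>* x \<^bold>+ (b \<otimes> c') \<^bold>* y = (k \<otimes> d) \<^bold>* x \<^bold>+ (k \<otimes> d) \<^bold>* y"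
    using dec_unique[of "a \<^bold>* x \<^bold>+ b \<^bold>* y" "(a \<otimes> c) \<^bold>* x \<^bold>+ (b \<otimes> c') \<^bold>* y" "k \<^bold>* x \<^bold>+ k \<^bold>* y" "(k \<otimes> d) \<^bold>* x \<^bold>+ (k \<otimes> d) \<^bold>* y"]
      ab k d c xy comb_in by simp
  have "a = k \<and> b = k" using indep2[OF cc xy(3,4) ab(1,2) k(1,1)] e by blast
  moreover have "a \<otimes> c = k \<otimes> d \<and> b \<otimes> c' = k \<otimes> d"
    using indep2[OF cc xy(3,4)] e ab c k d by (meson R.m_closed)
  ultimately show ?thesis using R.m_lcancel[of k c c'] k k0 c d by simp
qed

lemma n3: "3 \<le> n" using rank by simp

text \<open>\<open>ratio_eq_indep\<close> needs independent vectors. A \<open>z\<close> outside the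
  span of \<open>e\<close> and \<open>x\<close> links the two, and it exists because
  \<open>X\<close> has dimension at least 3.\<close>

lemma ratio_ex: "\<exists>c\<in>carrier R. \<forall>x\<in>X. x \<noteq> \<^bold>0 \<longrightarrow> t (h x) \<in> pspan R M (\<eta> c x)"
proof -
  obtain e where e: "e \<in> X" "e \<noteq> \<^bold>0" using dim_less[of 0 "{\<^bold>0}" n X] X rank by auto
  obtain c where c: "c \<in> carrier R" "t (h e) \<in> pspan R M (\<eta> c e)" using t_h_ex[OF e] by blast
  have "t (h x) \<in> pspan R M (\<eta> c x)" if x: "x \<in> X" "x \<noteq> \<^bold>0" for x
  proof -
    obtain d where d: "d \<in> carrier R" "t (h x) \<in> pspan R M (\<eta> d x)" using t_h_ex[OF x] by blast
    have cc: "e \<in> carrier M" "x \<in> carrier M" using e x XD by auto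
    obtain z where z: "z \<in> X" "z \<notin> span2 e x" using span2_proper[OF X(2) n3 cc] by blast
    have nz: "z \<notin> pspan R M e" "z \<notin> pspan R M x"
      using z pspan_subset[OF subsp_span2[OF cc]] span2_gen[OF cc] by blast+
    have z0: "z \<noteq> \<^bold>0" using nz subspD(3)[OF subsp_pspan[OF cc(1)]] by blast
    obtain b where b: "b \<in> carrier R" "t (h z) \<in> pspan R M (\<eta> b z)" using t_h_ex[OF z(1) z0] by blast
    have "c = b" using ratio_eq_indep[OF e(1) z(1) e(2) nz(1) c(1) b(1) c(2) b(2)] .
    moreover have "d = b" using ratio_eq_indep[OF x(1) z(1) x(2) nz(2) d(1) b(1) d(2) b(2)] .
    ultimately show ?thesis using d by simp
  qed
  then show ?thesis using c by blast
qed

definition \<gamma> where "\<gamma> = (SOME c. c \<in> carrier R \<and> (\<forall>x\<in>X. x \<noteq> \<^bold>0 \<longrightarrow> t (h x) \<in> pspan R M (\<eta> c x)))"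

lemma \<gamma>: "\<gamma> \<in> carrier R" "x \<in> X \<Longrightarrow> x \<noteq> \<^bold>0 \<Longrightarrow> t (h x) \<in> pspan R M (\<eta> \<gamma> x)"
  using someI_ex[of "\<lambda>c. c \<in> carrier R \<and> (\<forall>x\<in>X. x \<noteq> \<^bold>0 \<longrightarrow> t (h x) \<in> pspan R M (\<eta> c x))"] ratio_ex
  unfolding \<gamma>_def by blast+

abbreviation H where "H \<equiv> \<eta> \<gamma>"

lemma H_carrier [simp]: "x \<in> X \<Longrightarrow> H x \<in> carrier M" using \<gamma> by simp

text \<open>\<open>k\<close> compares the image of \<open>x + h y\<close> with those of
  \<open>x\<close> and \<open>h y\<close>. The condition \<open>x \<perp> h y\<close> makes
  \<open>x + h y\<close> singular, as \<open>t\<close> is controlled on singular vectors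
  only.\<close>

definition scl where
  "scl x y k \<longleftrightarrow> x \<in> X \<and> y \<in> X \<and> x \<noteq> \<^bold>0 \<and> y \<noteq> \<^bold>0 \<and> x \<perp> h y \<and> k \<in> carrier R \<and>
     t (x \<^bold>+ h y) \<in> pspan R M (h x \<^bold>+ k \<^bold>* H y)"

lemma sum_S: assumes "x \<in> X" "y \<in> X" "x \<perp> h y" shows "x \<^bold>+ h y \<in> S"
  using S_add[OF XD(2)[OF assms(1)] h_S[OF assms(2)] assms(3)] .

lemma h0 [simp]: "h \<^bold>0 = \<^bold>0" using linear_on_zero[OF h XD(1)] .

lemma sum_nz: assumes "x \<in> X" "y \<in> X" "x \<noteq> \<^bold>0 \<or> y \<noteq> \<^bold>0" shows "x \<^bold>+ h y \<noteq> \<^bold>0"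
proof
  assume "x \<^bold>+ h y = \<^bold>0"
  then have "x \<^bold>+ h y = \<^bold>0 \<^bold>+ h \<^bold>0" by simp
  then show False using dec_unique[OF assms(1,2) XS(3) XS(3)] assms(3) by blast
qed

lemma scl_ex:
  assumes xy: "x \<in> X" "y \<in> X" "x \<noteq> \<^bold>0" "y \<noteq> \<^bold>0" "x \<perp> h y" shows "\<exists>k. scl x y k \<and> k \<noteq> \<zero>"
proof -
  have c: "x \<in> carrier M" "y \<in> carrier M" using xy XD by auto
  have S: "x \<in> S" "h y \<in> S" "x \<^bold>+ h y \<in> S" using xy XD h_S sum_S by auto
  have nz: "h y \<noteq> \<^bold>0" "x \<^bold>+ h y \<noteq> \<^bold>0" "h x \<noteq> \<^bold>0" using dec(5) sum_nz xy by auto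
  have "x \<^bold>+ h y \<in> span2 x (h y)" using span2_gen[of x "h y"] subspD(4)[OF subsp_span2] c xy by simp
  then have "t (x \<^bold>+ h y) \<in> span2 (t x) (t (h y))" using t_line[OF S(1,2) xy(3) nz(1) xy(5)] nz by blast
  also have "\<dots> \<subseteq> span2 (h x) (H y)" using span2_cong[OF t_h[OF xy(1,3)] \<gamma>(2)[OF xy(2,4)]] xy by simp
  finally obtain a b where ab: "a \<in> carrier R" "b \<in> carrier R" "t (x \<^bold>+ h y) = a \<^bold>* h x \<^bold>+ b \<^bold>* H y" by (auto simp: span2_iff)
  \<comment> \<open>If \<open>a\<close> vanished, \<open>x + h y\<close> and \<open>h y\<close>
    would have the same image point; if \<open>b\<close> vanished, \<open>x + h y\<close> and
    \<open>x\<close> would.\<close>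
  have a0: "a \<noteq> \<zero>"
  proof
    assume "a = \<zero>"
    then have "t (x \<^bold>+ h y) \<in> pspan R M (H y)" using ab xy by (auto simp: pspan_iff)
    moreover have "H y \<in> pspan R M (t (h y))" using pspan_sym[OF \<gamma>(2)[OF xy(2,4)]] t_nz[OF S(2) nz(1)] xy by simp
    ultimately have "t (x \<^bold>+ h y) \<in> pspan R M (t (h y))" using pspan_trans S(2) nz(1) by simp
    then have "x \<^bold>+ h y \<in> pspan R M (h y)" using t_inj[OF S(2,3) nz(1,2)] by blast
    then obtain k where k: "k \<in> carrier R" "x \<^bold>+ h y = k \<^bold>* h y" by (auto simp: pspan_iff)
    then have "x \<^bold>+ h y = \<^bold>0 \<^bold>+ h (k \<^bold>* y)" using hD(3)[OF k(1) xy(2)] xy by simp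
    then show False using dec_unique[OF xy(1,2) XS(3) XS(5)[OF k(1) xy(2)]] xy by blast
  qed
  have b0: "b \<noteq> \<zero>"
  proof
    assume "b = \<zero>"
    then have "t (x \<^bold>+ h y) \<in> pspan R M (h x)" using ab xy by (auto simp: pspan_iff)
    then have "t (x \<^bold>+ h y) \<in> pspan R M (t x)" using h_pspan xy by simp
    then have "x \<^bold>+ h y \<in> pspan R M x" using t_inj[OF S(1,3) xy(3) nz(2)] by blast
    then obtain k where k: "k \<in> carrier R" "x \<^bold>+ h y = k \<^bold>* x" by (auto simp: pspan_iff)
    then have "x \<^bold>+ h y = k \<^bold>* x \<^bold>+ h \<^bold>0" using c by simp
    then show False using dec_unique[OF xy(1,2) XS(5)[OF k(1) xy(1)] XS(3)] xy by blast
  qed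
  have "t (x \<^bold>+ h y) \<in> pspan R M (h x \<^bold>+ (inv a \<otimes> b) \<^bold>* H y)" using pspan_normalize[OF _ _ ab(1) a0 ab(2)] ab xy by simp
  then show ?thesis using xy ab a0 b0 by (intro exI[of _ "inv a \<otimes> b"]) (simp add: scl_def R.integral_iff)
qed

lemma scl_unfold:
  assumes "x \<in> X" "y \<in> X" "k \<in> carrier R"
  shows "h x \<^bold>+ k \<^bold>* H y = k \<^bold>* y \<^bold>+ h (x \<^bold>+ (k \<otimes> \<gamma>) \<^bold>* y)"
proof -
  have "h (x \<^bold>+ (k \<otimes> \<gamma>) \<^bold>* y) = h x \<^bold>+ (k \<otimes> \<gamma>) \<^bold>* h y"
    using hD(2)[OF assms(1) XS(5)[OF _ assms(2)]] hD(3)[OF _ assms(2)] assms \<gamma>(1) by simp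
  then show ?thesis using assms XD(4) \<gamma>(1) by (simp add: \<eta>_def smult_r_distr smult_assoc1 M.a_ac)
qed

text \<open>The scale factor of \<open>t\<close> on the line joining \<open>x\<close> and \<open>h y\<close> is computed by intersecting
  images of planes, in each of the two variables.\<close>

lemma scl_right_indep:
  assumes s: "scl x y k" "scl x y' k'" and i: "y' \<notin> pspan R M y" shows "k = k'"
proof -
  have x: "x \<in> X" "x \<noteq> \<^bold>0" and y: "y \<in> X" "y \<noteq> \<^bold>0" "x \<perp> h y" and y': "y' \<in> X" "y' \<noteq> \<^bold>0" "x \<perp> h y'"
    and k: "k \<in> carrier R" "k' \<in> carrier R"
    and t1: "t (x \<^bold>+ h y) \<in> pspan R M (h x \<^bold>+ k \<^bold>* H y)" "t (x \<^bold>+ h y') \<in> pspan R M (h x \<^bold>+ k' \<^bold>* H y')"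
    using s by (auto simp: scl_def)
  have c: "x \<in> carrier M" "y \<in> carrier M" "y' \<in> carrier M" using x y y' XD by auto
  have sX: "y \<^bold>+ y' \<in> X" using XS y y' by blast
  have hs: "h (y \<^bold>+ y') = h y \<^bold>+ h y'" using hD y y' by blast
  let ?z = "x \<^bold>+ h (y \<^bold>+ y')"
  have xo: "x \<perp> h (y \<^bold>+ y')" using orth_add y y' hs c by simp
  have zS: "?z \<in> S" "?z \<noteq> \<^bold>0" using sum_S[OF x(1) sX xo] sum_nz[OF x(1) sX] x by auto
  have z1: "?z = (x \<^bold>+ h y) \<^bold>+ h y'" "?z = (x \<^bold>+ h y') \<^bold>+ h y" using hs c y y' by (simp_all add: M.a_ac)
  have sp: "u \<^bold>+ v \<in> span2 u v" if "u \<in> carrier M" "v \<in> carrier M" for u v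
    using that span2_gen[of u v] subspD(4)[OF subsp_span2] by blast
  have ls: "u \<^bold>+ h v \<perp> h w" if "u \<in> X" "v \<in> X" "w \<in> X" "u \<perp> h w" for u v w
    using that orth_commute[of "u \<^bold>+ h v" "h w"] orth_commute[of u "h w"] orth_h[of w v] orth_add[of "h w" u "h v"] XD(4) by simp
  have "t ?z \<in> span2 (t (x \<^bold>+ h y)) (t (h y'))"
    using t_line[OF sum_S[OF x(1) y(1,3)] h_S[OF y'(1)] sum_nz[OF x(1) y(1)] dec(5)[OF y'(1,2)] ls[OF x(1) y(1) y'(1,3)] _ zS(2)]
      sp[of "x \<^bold>+ h y" "h y'"] z1(1) x y y' c by simp
  also have "\<dots> \<subseteq> span2 (h x \<^bold>+ k \<^bold>* H y) (H y')" using span2_cong[OF t1(1) \<gamma>(2)[OF y'(1,2)]] x y y' k by simp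
  finally obtain a b where ab: "a \<in> carrier R" "b \<in> carrier R" "t ?z = a \<^bold>* (h x \<^bold>+ k \<^bold>* H y) \<^bold>+ b \<^bold>* H y'" by (auto simp: span2_iff)
  have "t ?z \<in> span2 (t (x \<^bold>+ h y')) (t (h y))"
    using t_line[OF sum_S[OF x(1) y'(1,3)] h_S[OF y(1)] sum_nz[OF x(1) y'(1)] dec(5)[OF y(1,2)] ls[OF x(1) y'(1) y(1,3)] _ zS(2)]
      sp[of "x \<^bold>+ h y'" "h y"] z1(2) x y y' c by simp
  also have "\<dots> \<subseteq> span2 (h x \<^bold>+ k' \<^bold>* H y') (H y)" using span2_cong[OF t1(2) \<gamma>(2)[OF y(1,2)]] x y y' k by simp
  finally obtain a' b' where ab': "a' \<in> carrier R" "b' \<in> carrier R" "t ?z = a' \<^bold>* (h x \<^bold>+ k' \<^bold>* H y') \<^bold>+ b' \<^bold>* H y" by (auto simp: span2_iff)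
  have s0: "y \<^bold>+ y' \<noteq> \<^bold>0"
    using subsp_add_iff(1)[OF subsp_pspan[OF c(2)] pspan_self[OF c(2)] c(3)] i subspD(3)[OF subsp_pspan[OF c(2)]] by auto
  have "t ?z \<in> span2 (t x) (t (h (y \<^bold>+ y')))"
    using t_line[OF _ h_S[OF sX] x(2) dec(5)[OF sX s0] xo sp zS(2)] x XD c sX by simp
  also have "\<dots> \<subseteq> span2 (h x) (H (y \<^bold>+ y'))" using span2_cong[OF t_h[OF x] \<gamma>(2)[OF sX s0]] x sX by simp
  finally obtain d e where de: "d \<in> carrier R" "e \<in> carrier R" "t ?z = d \<^bold>* h x \<^bold>+ e \<^bold>* H (y \<^bold>+ y')" by (auto simp: span2_iff)
  note g = \<gamma>(1)
  \<comment> \<open>The image of \<open>x + h y + h y'\<close>, reached along three lines, is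
    expanded in the decomposition by \<open>X\<close> and its image under \<open>h\<close>.
    Uniqueness of coordinates gives \<open>a k = e = b = a' k'\<close> and
    \<open>a = a'\<close>.\<close>
  have 1: "t ?z = ((a \<otimes> k) \<^bold>* y \<^bold>+ b \<^bold>* y') \<^bold>+ h (a \<^bold>* x \<^bold>+ ((a \<otimes> k \<otimes> \<gamma>) \<^bold>* y \<^bold>+ (b \<otimes> \<gamma>) \<^bold>* y'))"
    unfolding ab(3) using ab k g x y y' c comb_in
    by (simp add: \<eta>_def hD h_comb XS smult_r_distr smult_assoc1 M.a_ac)
  have 2: "t ?z = (b' \<^bold>* y \<^bold>+ (a' \<otimes> k') \<^bold>* y') \<^bold>+ h (a' \<^bold>* x \<^bold>+ ((b' \<otimes> \<gamma>) \<^bold>* y \<^bold>+ (a' \<otimes> k' \<otimes> \<gamma>) \<^bold>* y'))"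
    unfolding ab'(3) using ab' k g x y y' c comb_in
    by (simp add: \<eta>_def hD h_comb XS smult_r_distr smult_assoc1 M.a_ac)
  have 3: "t ?z = (e \<^bold>* y \<^bold>+ e \<^bold>* y') \<^bold>+ h (d \<^bold>* x \<^bold>+ ((e \<otimes> \<gamma>) \<^bold>* y \<^bold>+ (e \<otimes> \<gamma>) \<^bold>* y'))"
    unfolding de(3) using de k g x y y' c comb_in
    by (simp add: \<eta>_def hD h_comb XS smult_r_distr smult_assoc1 M.a_ac)
  have in1: "a \<^bold>* x \<^bold>+ ((a \<otimes> k \<otimes> \<gamma>) \<^bold>* y \<^bold>+ (b \<otimes> \<gamma>) \<^bold>* y') \<in> X" "(a \<otimes> k) \<^bold>* y \<^bold>+ b \<^bold>* y' \<in> X"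
    "a' \<^bold>* x \<^bold>+ ((b' \<otimes> \<gamma>) \<^bold>* y \<^bold>+ (a' \<otimes> k' \<otimes> \<gamma>) \<^bold>* y') \<in> X" "b' \<^bold>* y \<^bold>+ (a' \<otimes> k') \<^bold>* y' \<in> X"
    "d \<^bold>* x \<^bold>+ ((e \<otimes> \<gamma>) \<^bold>* y \<^bold>+ (e \<otimes> \<gamma>) \<^bold>* y') \<in> X" "e \<^bold>* y \<^bold>+ e \<^bold>* y' \<in> X"
    using ab ab' de k g x y y' XS by simp_all
  note u12 = dec_unique[OF in1(2,1) in1(4,3) trans[OF 1[symmetric] 2]]
    and u13 = dec_unique[OF in1(2,1) in1(6,5) trans[OF 1[symmetric] 3]]
  have A: "a \<otimes> k = b' \<and> b = a' \<otimes> k'"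
    using indep2[OF c(2,3) y(2) i R.m_closed[OF ab(1) k(1)] ab(2) ab'(2) R.m_closed[OF ab'(1) k(2)]] u12 by blast
  have B: "a \<otimes> k = e \<and> b = e"
    using indep2[OF c(2,3) y(2) i R.m_closed[OF ab(1) k(1)] ab(2) de(2,2)] u13 by blast
  have "a \<^bold>* x = a' \<^bold>* x"
  proof -
    have "a \<^bold>* x \<^bold>+ ((a \<otimes> k \<otimes> \<gamma>) \<^bold>* y \<^bold>+ (b \<otimes> \<gamma>) \<^bold>* y') = a' \<^bold>* x \<^bold>+ ((a \<otimes> k \<otimes> \<gamma>) \<^bold>* y \<^bold>+ (b \<otimes> \<gamma>) \<^bold>* y')"
      using u12 A by simp
    then show ?thesis using ab ab' k g c by simp
  qed
  then have aa: "a = a'" using smult_pspan_unique[OF c(1) x(2)] ab ab' by blast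
  have a0: "a \<noteq> \<zero>"
  proof
    assume "a = \<zero>"
    then have "t ?z = \<^bold>0" using ab B k x y y' by simp
    then show False using t_nz[OF zS] by blast
  qed
  show ?thesis using A B aa a0 ab k R.m_lcancel[of a k k'] by simp
qed

lemma scl_left_indep:
  assumes s: "scl x y k" "scl x' y k'" and i: "x' \<notin> pspan R M x" shows "k = k'"
proof -
  have x: "x \<in> X" "x \<noteq> \<^bold>0" and x': "x' \<in> X" "x' \<noteq> \<^bold>0" and y: "y \<in> X" "y \<noteq> \<^bold>0" "x \<perp> h y" "x' \<perp> h y"
    and k: "k \<in> carrier R" "k' \<in> carrier R"
    and t1: "t (x \<^bold>+ h y) \<in> pspan R M (h x \<^bold>+ k \<^bold>* H y)" "t (x' \<^bold>+ h y) \<in> pspan R M (h x' \<^bold>+ k' \<^bold>* H y)"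
    using s by (auto simp: scl_def)
  have c: "x \<in> carrier M" "x' \<in> carrier M" "y \<in> carrier M" using x y x' XD by auto
  have sX: "x \<^bold>+ x' \<in> X" using XS x x' by blast
  have hs: "h (x \<^bold>+ x') = h x \<^bold>+ h x'" using hD x x' by blast
  let ?z = "(x \<^bold>+ x') \<^bold>+ h y"
  have xo: "x \<^bold>+ x' \<perp> h y"
    using orth_add[of "h y" x x'] y orth_commute[of x "h y"] orth_commute[of x' "h y"] orth_commute[of "x \<^bold>+ x'" "h y"] c by simp
  have s0: "x \<^bold>+ x' \<noteq> \<^bold>0"
    using subsp_add_iff(1)[OF subsp_pspan[OF c(1)] pspan_self[OF c(1)] c(2)] i subspD(3)[OF subsp_pspan[OF c(1)]] by auto
  have zS: "?z \<in> S" "?z \<noteq> \<^bold>0" using sum_S[OF sX y(1) xo] sum_nz[OF sX y(1)] y by auto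
  have z1: "?z = (x \<^bold>+ h y) \<^bold>+ x'" "?z = (x' \<^bold>+ h y) \<^bold>+ x" using c y by (simp_all add: M.a_ac)
  have sp: "u \<^bold>+ v \<in> span2 u v" if "u \<in> carrier M" "v \<in> carrier M" for u v
    using that span2_gen[of u v] subspD(4)[OF subsp_span2] by blast
  have ls: "u \<^bold>+ h v \<perp> w" if "u \<in> X" "v \<in> X" "w \<in> X" "w \<perp> h v" for u v w
    using that orth_commute[of "u \<^bold>+ h v" w] XD(3)[of w u] orth_add[of w u "h v"] XD(4) by simp
  have S: "x \<in> S" "x' \<in> S" using x x' XD by blast+
  have "t ?z \<in> span2 (t (x \<^bold>+ h y)) (t x')"
    using t_line[OF sum_S[OF x(1) y(1,3)] S(2) sum_nz[OF x(1) y(1)] x'(2) ls[OF x(1) y(1) x'(1) y(4)] _ zS(2)]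
      sp[of "x \<^bold>+ h y" x'] z1(1) x y x' c by simp
  also have "\<dots> \<subseteq> span2 (h x \<^bold>+ k \<^bold>* H y) (h x')" using span2_cong[OF t1(1) t_h[OF x']] x y x' k by simp
  finally obtain a b where ab: "a \<in> carrier R" "b \<in> carrier R" "t ?z = a \<^bold>* (h x \<^bold>+ k \<^bold>* H y) \<^bold>+ b \<^bold>* h x'" by (auto simp: span2_iff)
  have "t ?z \<in> span2 (t (x' \<^bold>+ h y)) (t x)"
    using t_line[OF sum_S[OF x'(1) y(1,4)] S(1) sum_nz[OF x'(1) y(1)] x(2) ls[OF x'(1) y(1) x(1) y(3)] _ zS(2)]
      sp[of "x' \<^bold>+ h y" x] z1(2) x y x' c by simp
  also have "\<dots> \<subseteq> span2 (h x' \<^bold>+ k' \<^bold>* H y) (h x)" using span2_cong[OF t1(2) t_h[OF x]] x y x' k by simp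
  finally obtain a' b' where ab': "a' \<in> carrier R" "b' \<in> carrier R" "t ?z = a' \<^bold>* (h x' \<^bold>+ k' \<^bold>* H y) \<^bold>+ b' \<^bold>* h x" by (auto simp: span2_iff)
  have "t ?z \<in> span2 (t (x \<^bold>+ x')) (t (h y))"
    using t_line[OF _ h_S[OF y(1)] s0 dec(5)[OF y(1,2)] xo sp zS(2)] XD sX c y by simp
  also have "\<dots> \<subseteq> span2 (h (x \<^bold>+ x')) (H y)" using span2_cong[OF t_h[OF sX s0] \<gamma>(2)[OF y(1,2)]] y sX by simp
  finally obtain d e where de: "d \<in> carrier R" "e \<in> carrier R" "t ?z = d \<^bold>* h (x \<^bold>+ x') \<^bold>+ e \<^bold>* H y" by (auto simp: span2_iff)
  note g = \<gamma>(1)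
  have 1: "t ?z = (a \<otimes> k) \<^bold>* y \<^bold>+ h ((a \<^bold>* x \<^bold>+ b \<^bold>* x') \<^bold>+ (a \<otimes> k \<otimes> \<gamma>) \<^bold>* y)"
    unfolding ab(3) using ab k g x y x' c comb_in
    by (simp add: \<eta>_def hD h_comb XS smult_r_distr smult_assoc1 M.a_ac)
  have 2: "t ?z = (a' \<otimes> k') \<^bold>* y \<^bold>+ h ((b' \<^bold>* x \<^bold>+ a' \<^bold>* x') \<^bold>+ (a' \<otimes> k' \<otimes> \<gamma>) \<^bold>* y)"
    unfolding ab'(3) using ab' k g x y x' c comb_in
    by (simp add: \<eta>_def hD h_comb XS smult_r_distr smult_assoc1 M.a_ac)
  have 3: "t ?z = e \<^bold>* y \<^bold>+ h ((d \<^bold>* x \<^bold>+ d \<^bold>* x') \<^bold>+ (e \<otimes> \<gamma>) \<^bold>* y)"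
    unfolding de(3) using de k g x y x' c comb_in
    by (simp add: \<eta>_def hD h_comb XS smult_r_distr smult_assoc1 M.a_ac)
  have in1: "(a \<^bold>* x \<^bold>+ b \<^bold>* x') \<^bold>+ (a \<otimes> k \<otimes> \<gamma>) \<^bold>* y \<in> X" "(a \<otimes> k) \<^bold>* y \<in> X"
    "(b' \<^bold>* x \<^bold>+ a' \<^bold>* x') \<^bold>+ (a' \<otimes> k' \<otimes> \<gamma>) \<^bold>* y \<in> X" "(a' \<otimes> k') \<^bold>* y \<in> X"
    "(d \<^bold>* x \<^bold>+ d \<^bold>* x') \<^bold>+ (e \<otimes> \<gamma>) \<^bold>* y \<in> X" "e \<^bold>* y \<in> X"
    using ab ab' de k g x y x' XS by simp_all
  note u12 = dec_unique[OF in1(2,1) in1(4,3) trans[OF 1[symmetric] 2]]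
    and u13 = dec_unique[OF in1(2,1) in1(6,5) trans[OF 1[symmetric] 3]]
  have A: "a \<otimes> k = a' \<otimes> k'" using smult_pspan_unique[OF c(3) y(2) _ _ conjunct1[OF u12]] ab ab' k by simp
  have B: "a \<otimes> k = e" using smult_pspan_unique[OF c(3) y(2) _ _ conjunct1[OF u13]] ab de k by simp
  have "a \<^bold>* x \<^bold>+ b \<^bold>* x' = b' \<^bold>* x \<^bold>+ a' \<^bold>* x'"
  proof -
    have "(a \<^bold>* x \<^bold>+ b \<^bold>* x') \<^bold>+ (a \<otimes> k \<otimes> \<gamma>) \<^bold>* y = (b' \<^bold>* x \<^bold>+ a' \<^bold>* x') \<^bold>+ (a \<otimes> k \<otimes> \<gamma>) \<^bold>* y"
      using u12 A by simp
    then show ?thesis using ab ab' k g c by simp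
  qed
  then have E: "a = b' \<and> b = a'" using indep2[OF c(1,2) x(2) i ab(1,2) ab'(2,1)] by blast
  have "a \<^bold>* x \<^bold>+ b \<^bold>* x' = d \<^bold>* x \<^bold>+ d \<^bold>* x'"
  proof -
    have "(a \<^bold>* x \<^bold>+ b \<^bold>* x') \<^bold>+ (a \<otimes> k \<otimes> \<gamma>) \<^bold>* y = (d \<^bold>* x \<^bold>+ d \<^bold>* x') \<^bold>+ (a \<otimes> k \<otimes> \<gamma>) \<^bold>* y"
      using u13 B by simp
    then show ?thesis using ab de k g c by simp
  qed
  then have F: "a = d \<and> b = d" using indep2[OF c(1,2) x(2) i ab(1,2) de(1,1)] by blast
  have a0: "a \<noteq> \<zero>"
  proof
    assume "a = \<zero>"
    then have "t ?z = \<^bold>0" using ab F k x y x' by simp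
    then show False using t_nz[OF zS] by blast
  qed
  have "a' = a" using E F by metis
  then show ?thesis using A a0 ab k R.m_lcancel[of a k k'] by simp
qed

text \<open>The perp of \<open>u\<close> cuts \<open>X\<close> in dimension at least
  \<open>n - 1\<close>, which exceeds the dimension of the point of \<open>y\<close>.\<close>

lemma perp_avoid:
  assumes "W = X \<inter> perp {u}" "u \<in> carrier M" "y \<in> X" shows "\<exists>z\<in>W. z \<notin> pspan R M y"
proof -
  obtain k where k: "dim k W" "n \<le> Suc k" using dim_perp1[OF X(2) assms(2)] assms(1) by blast
  have yc: "y \<in> carrier M" using assms XD by blast
  obtain l where "l \<le> 2" "dim l (span2 y y)" using dim_span2_le yc by blast
  then show ?thesis using dim_less[of l "span2 y y" k W] k rank span2_self[OF yc] by auto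
qed

text \<open>Dependent \<open>y\<close> and \<open>y'\<close> are compared through a \<open>z\<close>
  independent of each of them, with \<open>h z\<close> orthogonal to \<open>x\<close>.\<close>

lemma scl_right:
  assumes s: "scl x y k" "scl x y' k'" shows "k = k'"
proof (cases "y' \<in> pspan R M y")
  case False then show ?thesis using scl_right_indep s by blast
next
  case True
  have x: "x \<in> X" "x \<noteq> \<^bold>0" and y: "y \<in> X" "y \<noteq> \<^bold>0" and y': "y' \<in> X" "y' \<noteq> \<^bold>0" using s by (auto simp: scl_def)
  have c: "x \<in> carrier M" "y \<in> carrier M" using x y XD by auto
  obtain z where z: "z \<in> X" "h x \<perp> z" "z \<notin> pspan R M y" using perp_avoid[OF refl, of "h x" y] x y by (auto simp: perp_def)
  have z0: "z \<noteq> \<^bold>0" using z subspD(3)[OF subsp_pspan[OF c(2)]] by blast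
  have "x \<perp> h z" using z orth_h_sym x orth_commute[of "h x" z] XD(4) by simp
  then obtain b where b: "scl x z b" using scl_ex x z z0 by blast
  have "z \<notin> pspan R M y'" using z(3) pspan_eq[OF True y'(2) c(2)] by simp
  then show ?thesis using scl_right_indep[OF s(1) b z(3)] scl_right_indep[OF s(2) b] by simp
qed

lemma scl_left:
  assumes s: "scl x y k" "scl x' y k'" shows "k = k'"
proof (cases "x' \<in> pspan R M x")
  case False then show ?thesis using scl_left_indep s by blast
next
  case True
  have x: "x \<in> X" "x \<noteq> \<^bold>0" and y: "y \<in> X" "y \<noteq> \<^bold>0" and x': "x' \<in> X" "x' \<noteq> \<^bold>0" using s by (auto simp: scl_def)
  have c: "x \<in> carrier M" "y \<in> carrier M" using x y XD by auto
  obtain z where z: "z \<in> X" "h y \<perp> z" "z \<notin> pspan R M x" using perp_avoid[OF refl, of "h y" x] x y by (auto simp: perp_def)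
  have z0: "z \<noteq> \<^bold>0" using z subspD(3)[OF subsp_pspan[OF c(1)]] by blast
  have "z \<perp> h y" using z y orth_commute[of "h y" z] XD(4) by simp
  then obtain b where b: "scl z y b" using scl_ex y z z0 by blast
  have "z \<notin> pspan R M x'" using z(3) pspan_eq[OF True x'(2) c(1)] by simp
  then show ?thesis using scl_left_indep[OF s(1) b z(3)] scl_left_indep[OF s(2) b] by simp
qed

text \<open>A nonzero \<open>z\<close> in \<open>X\<close> with \<open>h z\<close> orthogonal to
  both \<open>x\<close> and \<open>x'\<close> exists because \<open>n - 2 > 0\<close>. The factor
  passes from \<open>x, y\<close> to \<open>x, z\<close>, then to \<open>x', z\<close>, and then to
  \<open>x', y'\<close>.\<close>

lemma scl_unique:
  assumes s: "scl x y k" "scl x' y' k'" shows "k = k'"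
proof -
  have x: "x \<in> X" "x \<noteq> \<^bold>0" and x': "x' \<in> X" "x' \<noteq> \<^bold>0" using s by (auto simp: scl_def)
  have c: "h x \<in> carrier M" "h x' \<in> carrier M" using x x' by auto
  obtain l where l: "dim l (X \<inter> perp {h x})" "n \<le> Suc l" using dim_perp1[OF X(2) c(1)] by blast
  obtain m where m: "dim m (X \<inter> perp {h x} \<inter> perp {h x'})" "l \<le> Suc m" using dim_perp1[OF l(1) c(2)] by blast
  obtain z where z: "z \<in> X" "h x \<perp> z" "h x' \<perp> z" "z \<noteq> \<^bold>0"
    using dim_less[of 0 "{\<^bold>0}" m] m l rank by (auto simp: perp_def)
  have "x \<perp> h z" "x' \<perp> h z"
    using z orth_h_sym x x' orth_commute[of "h x" z] orth_commute[of "h x'" z] XD(4) by simp_all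
  then obtain b b' where b: "scl x z b" "scl x' z b'" using scl_ex x x' z by blast
  have "k = b" "b = b'" "b' = k'" using scl_right s b scl_left by blast+
  then show ?thesis by simp
qed

lemma scale_ex: "\<exists>k\<in>carrier R. k \<noteq> \<zero> \<and>
  (\<forall>x\<in>X. \<forall>y\<in>X. x \<noteq> \<^bold>0 \<longrightarrow> y \<noteq> \<^bold>0 \<longrightarrow> x \<perp> h y \<longrightarrow> t (x \<^bold>+ h y) \<in> pspan R M (h x \<^bold>+ k \<^bold>* H y))"
proof -
  obtain e where e: "e \<in> X" "e \<noteq> \<^bold>0" using dim_less[of 0 "{\<^bold>0}" n X] X rank by auto
  obtain k where k: "scl e e k" "k \<noteq> \<zero>" using scl_ex[OF e(1,1) e(2,2) orth_h_self[OF e(1)]] by blast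
  have "t (x \<^bold>+ h y) \<in> pspan R M (h x \<^bold>+ k \<^bold>* H y)" if xy: "x \<in> X" "y \<in> X" "x \<noteq> \<^bold>0" "y \<noteq> \<^bold>0" "x \<perp> h y" for x y
  proof -
    obtain b where b: "scl x y b" using scl_ex[OF xy] by blast
    then show ?thesis using scl_unique[OF k(1) b] by (simp add: scl_def)
  qed
  then show ?thesis using k by (intro bexI[of _ k]) (auto simp: scl_def)
qed

text \<open>\<open>g\<close> maps \<open>x + h y\<close> to
  \<open>h x + k H y = k y + h (x + k \<gamma> y)\<close>. In coordinates it sends
  \<open>(x, y)\<close> to \<open>(k y, x + k \<gamma> y)\<close>, whose square is
  \<open>k \<gamma>\<close> times the map plus \<open>k\<close> times the identity; hence
  \<open>\<mu> = k \<gamma>\<close> and \<open>\<kappa> = k\<close>. Since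
  \<open>q (x + h y) = f x (h y)\<close>, and this expression is alternating in \<open>x\<close> and
  \<open>y\<close>, the identities for \<open>q\<close> and \<open>f\<close> follow by
  expansion.\<close>

lemma hyperbolic_lift_dec:
  obtains g \<mu> \<kappa> where "linear_on (carrier M) g" "\<mu> \<in> carrier R" "\<kappa> \<in> carrier R"
    "\<And>z. z \<in> S \<Longrightarrow> z \<noteq> \<^bold>0 \<Longrightarrow> t z \<in> pspan R M (g z)"
    "\<And>z. z \<in> carrier M \<Longrightarrow> g (g z) = \<mu> \<^bold>* g z \<^bold>+ \<kappa> \<^bold>* z"
    "\<And>z. z \<in> carrier M \<Longrightarrow> q (g z) = \<ominus> (\<kappa> \<otimes> q z)"
    "\<And>z. z \<in> carrier M \<Longrightarrow> f z (g z) = \<mu> \<otimes> q z"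
proof -
  obtain k where k: "k \<in> carrier R" "k \<noteq> \<zero>"
    "\<And>x y. x \<in> X \<Longrightarrow> y \<in> X \<Longrightarrow> x \<noteq> \<^bold>0 \<Longrightarrow> y \<noteq> \<^bold>0 \<Longrightarrow> x \<perp> h y \<Longrightarrow> t (x \<^bold>+ h y) \<in> pspan R M (h x \<^bold>+ k \<^bold>* H y)"
    using scale_ex by blast
  note gm = \<gamma>(1)
  define P where "P z = (SOME p. fst p \<in> X \<and> snd p \<in> X \<and> z = fst p \<^bold>+ h (snd p))" for z
  have P: "fst (P z) \<in> X" "snd (P z) \<in> X" "z = fst (P z) \<^bold>+ h (snd (P z))" if zc: "z \<in> carrier M" for z
  proof -
    obtain x y where "x \<in> X" "y \<in> X" "z = x \<^bold>+ h y" using dec(3)[OF zc] by blast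
    then have "\<exists>p. fst p \<in> X \<and> snd p \<in> X \<and> z = fst p \<^bold>+ h (snd p)" by (intro exI[of _ "(x, y)"]) simp
    from someI_ex[OF this] show "fst (P z) \<in> X" "snd (P z) \<in> X" "z = fst (P z) \<^bold>+ h (snd (P z))"
      unfolding P_def by blast+
  qed
  have Pxy: "P (x \<^bold>+ h y) = (x, y)" if "x \<in> X" "y \<in> X" for x y
    using P[of "x \<^bold>+ h y"] dec_unique[of x y "fst (P (x \<^bold>+ h y))" "snd (P (x \<^bold>+ h y))"] that XD(4)
    by (metis M.a_closed h_carrier prod.collapse)
  define g where "g z = k \<^bold>* snd (P z) \<^bold>+ h (fst (P z) \<^bold>+ (k \<otimes> \<gamma>) \<^bold>* snd (P z))" for z
  have gxy: "g (x \<^bold>+ h y) = k \<^bold>* y \<^bold>+ h (x \<^bold>+ (k \<otimes> \<gamma>) \<^bold>* y)" if "x \<in> X" "y \<in> X" for x y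
    using Pxy[OF that] by (simp add: g_def)
  have zE: "\<exists>x\<in>X. \<exists>y\<in>X. z = x \<^bold>+ h y" if "z \<in> carrier M" for z using P[OF that] by blast
  have Xc: "x \<in> carrier M" if "x \<in> X" for x using that XD(4) by blast
  have inX: "x \<^bold>+ (k \<otimes> \<gamma>) \<^bold>* y \<in> X" "k \<^bold>* y \<in> X" if "x \<in> X" "y \<in> X" for x y using that XS k(1) gm by simp_all
  have lin: "linear_on (carrier M) g"
    unfolding linear_on_def
  proof (intro conjI ballI)
    fix z assume "z \<in> carrier M"
    then obtain x y where z: "x \<in> X" "y \<in> X" "z = x \<^bold>+ h y" using zE by blast
    then show "g z \<in> carrier M" using gxy inX Xc k by simp
  next
    fix z z' assume "z \<in> carrier M" "z' \<in> carrier M"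
    then obtain x y x' y' where z: "x \<in> X" "y \<in> X" "z = x \<^bold>+ h y" and z': "x' \<in> X" "y' \<in> X" "z' = x' \<^bold>+ h y'"
      using zE by meson
    have "z \<^bold>+ z' = (x \<^bold>+ x') \<^bold>+ h (y \<^bold>+ y')" using z z' Xc by (simp add: hD M.a_ac)
    then have "g (z \<^bold>+ z') = k \<^bold>* (y \<^bold>+ y') \<^bold>+ h ((x \<^bold>+ x') \<^bold>+ (k \<otimes> \<gamma>) \<^bold>* (y \<^bold>+ y'))"
      using gxy[of "x \<^bold>+ x'" "y \<^bold>+ y'"] z z' XS by simp
    also have "\<dots> = g z \<^bold>+ g z'"
      using z z' Xc k gm gxy XS by (simp add: hD smult_r_distr M.a_ac)
    finally show "g (z \<^bold>+ z') = g z \<^bold>+ g z'" .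
  next
    fix c z assume c: "c \<in> carrier R" and "z \<in> carrier M"
    then obtain x y where z: "x \<in> X" "y \<in> X" "z = x \<^bold>+ h y" using zE by blast
    have "c \<^bold>* z = c \<^bold>* x \<^bold>+ h (c \<^bold>* y)" using z c Xc by (simp add: hD smult_r_distr)
    then have "g (c \<^bold>* z) = k \<^bold>* (c \<^bold>* y) \<^bold>+ h (c \<^bold>* x \<^bold>+ (k \<otimes> \<gamma>) \<^bold>* (c \<^bold>* y))"
      using gxy z c XS by simp
    also have "\<dots> = c \<^bold>* g z"
      using z Xc k gm gxy c XS by (simp add: hD smult_r_distr smult_assoc1[symmetric] R.m_ac)
    finally show "g (c \<^bold>* z) = c \<^bold>* g z" .
  qed
  have ff: "f u v = \<zero>" if "u \<in> X" "v \<in> X" for u v using orth_f XD that by blast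
  have fhh: "f (h u) (h v) = \<zero>" if "u \<in> X" "v \<in> X" for u v using orth_f orth_h that by simp
  have qX: "q x = \<zero>" if "x \<in> X" for x using XD(2) S_q that by blast
  have qh: "q (h x) = \<zero>" if "x \<in> X" for x using h_S S_q that by blast
  have qz: "q (x \<^bold>+ h y) = f x (h y)" if "x \<in> X" "y \<in> X" for x y
    using that Xc by (simp add: q_add qX qh)
  have fself: "f x (h x) = \<zero>" if "x \<in> X" for x using orth_f orth_h_self that Xc by simp
  \<comment> \<open>Polarised domesticity on \<open>X\<close>: the bilinear form
    \<open>f x (h y)\<close> is alternating.\<close>
  have fskew: "f y (h x) = \<ominus> f x (h y)" if "x \<in> X" "y \<in> X" for x y
  proof -
    have "f (x \<^bold>+ y) (h (x \<^bold>+ y)) = f x (h x) \<oplus> f y (h x) \<oplus> (f x (h y) \<oplus> f y (h y))"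
      using that Xc by (simp add: hD f_add_l f_add_r)
    moreover have "f (x \<^bold>+ y) (h (x \<^bold>+ y)) = \<zero>" using fself XS that by blast
    ultimately have "f y (h x) \<oplus> f x (h y) = \<zero>" using fself that Xc by simp
    then show ?thesis using that Xc by (intro R.minus_equality[symmetric]) simp_all
  qed
  have repr: "t z \<in> pspan R M (g z)" if zz: "z \<in> S" "z \<noteq> \<^bold>0" for z
  proof -
    obtain x y where z: "x \<in> X" "y \<in> X" "z = x \<^bold>+ h y" using zE[OF S_carrier[OF zz(1)]] by blast
    have "q z = \<zero>" using zz(1) unfolding S_q by simp
    then have "f x (h y) = \<zero>" using qz[OF z(1,2)] z(3) by simp
    then have o: "x \<perp> h y" using orth_f z Xc by simp
    have gz: "g z = h x \<^bold>+ k \<^bold>* H y" using gxy z scl_unfold k by simp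
    \<comment> \<open>\<open>scale_ex\<close> speaks of pairs with both coordinates nonzero. If one
      coordinate vanishes, \<open>z\<close> lies in \<open>X\<close> or in its image, where
      \<open>t_h\<close> and \<open>\<gamma>\<close> describe \<open>t\<close>.\<close>
    consider "x = \<^bold>0" "y \<noteq> \<^bold>0" | "x \<noteq> \<^bold>0" "y = \<^bold>0" | "x \<noteq> \<^bold>0" "y \<noteq> \<^bold>0"
      using z zz(2) by (metis h0 M.l_zero M.zero_closed)
    then show ?thesis
    proof cases
      case 1
      then have "g z = k \<^bold>* H y" using gz z(2) k(1) by simp
      then show ?thesis using 1 \<gamma>(2)[OF z(2)] z pspan_smult[OF k(1,2), of "H y"] by simp
    next
      case 2 then show ?thesis using gz t_h[OF z(1)] z Xc k(1) by (simp add: \<eta>_def gm)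
    next
      case 3 then show ?thesis using gz k(3)[OF z(1,2) _ _ o] z by simp
    qed
  qed
  have "g (g z) = (k \<otimes> \<gamma>) \<^bold>* g z \<^bold>+ k \<^bold>* z \<and> q (g z) = \<ominus> (k \<otimes> q z) \<and> f z (g z) = (k \<otimes> \<gamma>) \<otimes> q z"
    if zz: "z \<in> carrier M" for z
  proof -
    obtain x y where z: "x \<in> X" "y \<in> X" "z = x \<^bold>+ h y" using zE zz by blast
    let ?w = "x \<^bold>+ (k \<otimes> \<gamma>) \<^bold>* y"
    have w: "?w \<in> X" "k \<^bold>* y \<in> X" using inX z by auto
    have gz: "g z = k \<^bold>* y \<^bold>+ h ?w" using gxy z by simp
    have c: "x \<in> carrier M" "y \<in> carrier M" "?w \<in> carrier M" using z w Xc by auto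
    have "g (g z) = k \<^bold>* ?w \<^bold>+ h (k \<^bold>* y \<^bold>+ (k \<otimes> \<gamma>) \<^bold>* ?w)" using gz gxy[OF w(2,1)] by simp
    also have "h (k \<^bold>* y \<^bold>+ (k \<otimes> \<gamma>) \<^bold>* ?w) = k \<^bold>* h y \<^bold>+ (k \<otimes> \<gamma>) \<^bold>* h ?w"
      using h_comb[OF z(2) w(1)] k(1) gm by simp
    also have "k \<^bold>* ?w \<^bold>+ (k \<^bold>* h y \<^bold>+ (k \<otimes> \<gamma>) \<^bold>* h ?w) = (k \<otimes> \<gamma>) \<^bold>* g z \<^bold>+ k \<^bold>* z"
      unfolding gz unfolding z(3) using z w c k(1) gm by (simp add: smult_r_distr smult_assoc1[symmetric] R.m_ac M.a_ac)
    finally have 1: "g (g z) = (k \<otimes> \<gamma>) \<^bold>* g z \<^bold>+ k \<^bold>* z" .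
    have hw: "h ?w = h x \<^bold>+ (k \<otimes> \<gamma>) \<^bold>* h y" using hD z k gm XS by simp
    have "q (g z) = f (k \<^bold>* y) (h ?w)" using gz qz[OF w(2,1)] by simp
    also have "\<dots> = k \<otimes> f y (h x)"
      unfolding hw using z c k(1) gm fself[OF z(2)] by (simp add: f_add_r f_smult_l f_smult_r)
    finally have 2: "q (g z) = \<ominus> (k \<otimes> q z)" using fskew[OF z(1,2)] z qz k(1) c by (simp add: R.r_minus)
    have hy: "f (h y) (k \<^bold>* y) = \<zero>" using f_sym[of "h y" y] fself[OF z(2)] z c k(1) by (simp add: f_smult_r)
    have "f z (g z) = f x (h ?w)"
      unfolding gz unfolding z(3) using z w c k(1) hy ff[OF z(1) w(2)] fhh[OF z(2) w(1)] by (simp add: f_add_l f_add_r)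
    also have "\<dots> = (k \<otimes> \<gamma>) \<otimes> f x (h y)"
      unfolding hw using z c k(1) gm fself[OF z(1)] by (simp add: f_add_r f_smult_r)
    finally show ?thesis using 1 2 qz z by simp
  qed
  then show ?thesis using that[OF lin, of "k \<otimes> \<gamma>" k] repr k(1) gm by simp
qed

end

context hyp begin

lemma hyperbolic_lift:
  obtains g \<mu> \<kappa> where "linear_on (carrier M) g" "\<mu> \<in> carrier R" "\<kappa> \<in> carrier R"
    "\<And>z. z \<in> S \<Longrightarrow> z \<noteq> \<^bold>0 \<Longrightarrow> t z \<in> pspan R M (g z)"
    "\<And>z. z \<in> carrier M \<Longrightarrow> g (g z) = \<mu> \<^bold>* g z \<^bold>+ \<kappa> \<^bold>* z"
    "\<And>z. z \<in> carrier M \<Longrightarrow> q (g z) = \<ominus> (\<kappa> \<otimes> q z)"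
    "\<And>z. z \<in> carrier M \<Longrightarrow> f z (g z) = \<mu> \<otimes> q z"
proof -
  obtain X where X: "tsub X" "dim n X" "opp X" using ex_opp_max .
  obtain e where e: "e \<in> X" "e \<noteq> \<^bold>0" using dim_less[of 0 "{\<^bold>0}" n X] X rank by auto
  then obtain v0 where v0: "v0 \<in> X" "v0 \<noteq> \<^bold>0" "\<not> e \<perp> t v0" using X(3) unfolding opp_def by blast
  have XS: "X \<subseteq> S" using tsubD(2)[OF X(1)] by blast
  have n3: "3 \<le> n" using rank by simp
  obtain h where h: "linear_on X h" "\<And>x. x \<in> X \<Longrightarrow> x \<noteq> \<^bold>0 \<Longrightarrow> t x \<in> pspan R M (h x)"
    using induced_linear[OF tsubD(1)[OF X(1)] XS X(2) n3 t_span_tsub[OF X(1)] e(1) v0] by blast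
  interpret hyp_dec R M S orth N n M0 t f q X h
    by unfold_locales (use X h in auto)
  show ?thesis using hyperbolic_lift_dec that by blast
qed

end

section \<open>The quadratic extension\<close>

text \<open>The quotient of the polynomial ring in \<open>T\<close> by
  \<open>T^2 - \<mu> T - \<kappa>\<close>, with the pair \<open>(a, b)\<close> standing for
  \<open>a + b T\<close>.\<close>

definition quad_ring :: "('a, 'b) ring_scheme \<Rightarrow> 'a \<Rightarrow> 'a \<Rightarrow> ('a \<times> 'a) ring" where
  "quad_ring R \<mu> \<kappa> = \<lparr>carrier = carrier R \<times> carrier R,
     mult = (\<lambda>x y. (fst x \<otimes>\<^bsub>R\<^esub> fst y \<oplus>\<^bsub>R\<^esub> \<kappa> \<otimes>\<^bsub>R\<^esub> (snd x \<otimes>\<^bsub>R\<^esub> snd y),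
       fst x \<otimes>\<^bsub>R\<^esub> snd y \<oplus>\<^bsub>R\<^esub> snd x \<otimes>\<^bsub>R\<^esub> fst y \<oplus>\<^bsub>R\<^esub> \<mu> \<otimes>\<^bsub>R\<^esub> (snd x \<otimes>\<^bsub>R\<^esub> snd y))),
     one = (\<one>\<^bsub>R\<^esub>, \<zero>\<^bsub>R\<^esub>), zero = (\<zero>\<^bsub>R\<^esub>, \<zero>\<^bsub>R\<^esub>),
     add = (\<lambda>x y. (fst x \<oplus>\<^bsub>R\<^esub> fst y, snd x \<oplus>\<^bsub>R\<^esub> snd y))\<rparr>"

lemmas quad_ring_simps [simp] = quad_ring_def [THEN arg_cong, of carrier, simplified]
  quad_ring_def [THEN arg_cong, of mult, simplified] quad_ring_def [THEN arg_cong, of one, simplified]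
  quad_ring_def [THEN arg_cong, of zero, simplified] quad_ring_def [THEN arg_cong, of add, simplified]

lemma quad_ring_cring:
  fixes R (structure)
  assumes "cring R" "\<mu> \<in> carrier R" "\<kappa> \<in> carrier R" shows "cring (quad_ring R \<mu> \<kappa>)"
proof -
  interpret cring R by fact
  note mk = assms(2,3)
  show ?thesis
  proof (rule cringI)
    show "abelian_group (quad_ring R \<mu> \<kappa>)"
    proof (rule abelian_groupI)
      fix x assume x: "x \<in> carrier (quad_ring R \<mu> \<kappa>)"
      show "\<exists>y\<in>carrier (quad_ring R \<mu> \<kappa>). y \<oplus>\<^bsub>quad_ring R \<mu> \<kappa>\<^esub> x = \<zero>\<^bsub>quad_ring R \<mu> \<kappa>\<^esub>"
        by (rule bexI[of _ "(\<ominus> fst x, \<ominus> snd x)"]) (use x in \<open>auto simp: l_neg\<close>)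
    qed (auto simp: a_ac)
    show "comm_monoid (quad_ring R \<mu> \<kappa>)"
    proof (rule comm_monoidI)
      fix x y z assume "x \<in> carrier (quad_ring R \<mu> \<kappa>)" "y \<in> carrier (quad_ring R \<mu> \<kappa>)" "z \<in> carrier (quad_ring R \<mu> \<kappa>)"
      then obtain a b c d e f where *: "x = (a, b)" "y = (c, d)" "z = (e, f)"
        "a \<in> carrier R" "b \<in> carrier R" "c \<in> carrier R" "d \<in> carrier R" "e \<in> carrier R" "f \<in> carrier R"
        by auto
      show "x \<otimes>\<^bsub>quad_ring R \<mu> \<kappa>\<^esub> y \<otimes>\<^bsub>quad_ring R \<mu> \<kappa>\<^esub> z = x \<otimes>\<^bsub>quad_ring R \<mu> \<kappa>\<^esub> (y \<otimes>\<^bsub>quad_ring R \<mu> \<kappa>\<^esub> z)"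
        using * mk by (simp add: l_distr r_distr a_ac m_ac)
      show "x \<otimes>\<^bsub>quad_ring R \<mu> \<kappa>\<^esub> y = y \<otimes>\<^bsub>quad_ring R \<mu> \<kappa>\<^esub> x"
        using * mk by (simp add: a_ac m_ac)
    qed (use mk in auto)
    fix x y z assume "x \<in> carrier (quad_ring R \<mu> \<kappa>)" "y \<in> carrier (quad_ring R \<mu> \<kappa>)" "z \<in> carrier (quad_ring R \<mu> \<kappa>)"
    then obtain a b c d e f where *: "x = (a, b)" "y = (c, d)" "z = (e, f)"
      "a \<in> carrier R" "b \<in> carrier R" "c \<in> carrier R" "d \<in> carrier R" "e \<in> carrier R" "f \<in> carrier R"
      by auto
    show "(x \<oplus>\<^bsub>quad_ring R \<mu> \<kappa>\<^esub> y) \<otimes>\<^bsub>quad_ring R \<mu> \<kappa>\<^esub> z = x \<otimes>\<^bsub>quad_ring R \<mu> \<kappa>\<^esub> z \<oplus>\<^bsub>quad_ring R \<mu> \<kappa>\<^esub> y \<otimes>\<^bsub>quad_ring R \<mu> \<kappa>\<^esub> z"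
      using * mk by (simp add: l_distr r_distr a_ac m_ac)
  qed
qed

text \<open>The inverse of \<open>a + b T\<close> is its conjugate \<open>a + \<mu> b - b T\<close>
  divided by the norm \<open>a^2 + \<mu> a b - \<kappa> b^2\<close>. A vanishing norm with
  \<open>b\<close> nonzero would make \<open>- a / b\<close> a root of the polynomial.\<close>

lemma quad_ring_field:
  fixes R (structure)
  assumes "field R" and mk: "\<mu> \<in> carrier R" "\<kappa> \<in> carrier R"
    and irr: "\<And>b. b \<in> carrier R \<Longrightarrow> b \<otimes>\<^bsub>R\<^esub> b \<noteq> \<mu> \<otimes>\<^bsub>R\<^esub> b \<oplus>\<^bsub>R\<^esub> \<kappa>"
  shows "field (quad_ring R \<mu> \<kappa>)"
proof -
  interpret field R by fact
  interpret Q: cring "quad_ring R \<mu> \<kappa>" using quad_ring_cring[OF is_cring mk] .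
  show ?thesis
  proof (rule Q.cring_fieldI2)
    show "\<zero>\<^bsub>quad_ring R \<mu> \<kappa>\<^esub> \<noteq> \<one>\<^bsub>quad_ring R \<mu> \<kappa>\<^esub>" by simp
    fix x assume x: "x \<in> carrier (quad_ring R \<mu> \<kappa>)" "x \<noteq> \<zero>\<^bsub>quad_ring R \<mu> \<kappa>\<^esub>"
    then obtain a b where ab: "x = (a, b)" "a \<in> carrier R" "b \<in> carrier R" by auto
    let ?N = "a \<otimes> a \<oplus> \<mu> \<otimes> (a \<otimes> b) \<ominus> \<kappa> \<otimes> (b \<otimes> b)"
    have N0: "?N \<noteq> \<zero>"
    proof (cases "b = \<zero>")
      case True then show ?thesis using ab x mk by (simp add: integral_iff a_minus_def)
    next
      case False
      let ?c = "\<ominus> (a \<otimes> inv b)"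
      have ib: "inv b \<in> carrier R" "inv b \<otimes> b = \<one>" using False ab by (simp_all add: field_Units)
      have c: "?c \<in> carrier R" using ib ab by simp
      have a: "a = \<ominus> ?c \<otimes> b" using ib ab by (simp add: m_assoc)
      have "?N = (?c \<otimes> ?c \<ominus> (\<mu> \<otimes> ?c \<oplus> \<kappa>)) \<otimes> (b \<otimes> b)"
      proof -
        have "(\<ominus> c \<otimes> b) \<otimes> (\<ominus> c \<otimes> b) \<oplus> \<mu> \<otimes> ((\<ominus> c \<otimes> b) \<otimes> b) \<ominus> \<kappa> \<otimes> (b \<otimes> b) =
          (c \<otimes> c \<ominus> (\<mu> \<otimes> c \<oplus> \<kappa>)) \<otimes> (b \<otimes> b)" if "c \<in> carrier R" for c
          using that ab(3) mk by (simp add: a_minus_def l_distr r_distr minus_add r_minus l_minus m_ac a_ac)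
        from this[OF c] show ?thesis using a by simp
      qed
      moreover have "?c \<otimes> ?c \<ominus> (\<mu> \<otimes> ?c \<oplus> \<kappa>) \<noteq> \<zero>" using irr[OF c] c mk by simp
      ultimately show ?thesis using False ab c mk by (simp add: integral_iff)
    qed
    have Nc: "?N \<in> carrier R" "inv ?N \<in> carrier R" "inv ?N \<otimes> ?N = \<one>" using N0 ab mk by (simp_all add: field_Units)
    let ?y = "(inv ?N \<otimes> (a \<oplus> \<mu> \<otimes> b), \<ominus> (inv ?N \<otimes> b))"
    have "x \<otimes>\<^bsub>quad_ring R \<mu> \<kappa>\<^esub> ?y = (\<one>, \<zero>)"
    proof -
      have "a \<otimes> (i \<otimes> (a \<oplus> \<mu> \<otimes> b)) \<oplus> \<kappa> \<otimes> (b \<otimes> (\<ominus> (i \<otimes> b))) = i \<otimes> ?N"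
        "a \<otimes> (\<ominus> (i \<otimes> b)) \<oplus> b \<otimes> (i \<otimes> (a \<oplus> \<mu> \<otimes> b)) \<oplus> \<mu> \<otimes> (b \<otimes> (\<ominus> (i \<otimes> b))) = \<zero>" if i: "i \<in> carrier R" for i
      proof -
        show "a \<otimes> (i \<otimes> (a \<oplus> \<mu> \<otimes> b)) \<oplus> \<kappa> \<otimes> (b \<otimes> (\<ominus> (i \<otimes> b))) = i \<otimes> ?N"
          using ab mk i by (simp add: a_minus_def l_distr r_distr r_minus l_minus m_ac a_ac)
        have "a \<otimes> (\<ominus> (i \<otimes> b)) \<oplus> b \<otimes> (i \<otimes> (a \<oplus> \<mu> \<otimes> b)) \<oplus> \<mu> \<otimes> (b \<otimes> (\<ominus> (i \<otimes> b))) =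
          (\<ominus> (a \<otimes> (i \<otimes> b)) \<oplus> a \<otimes> (i \<otimes> b)) \<oplus> (\<mu> \<otimes> (i \<otimes> (b \<otimes> b)) \<oplus> \<ominus> (\<mu> \<otimes> (i \<otimes> (b \<otimes> b))))"
          using ab mk i by (simp add: r_distr r_minus l_minus m_ac a_ac)
        then show "a \<otimes> (\<ominus> (i \<otimes> b)) \<oplus> b \<otimes> (i \<otimes> (a \<oplus> \<mu> \<otimes> b)) \<oplus> \<mu> \<otimes> (b \<otimes> (\<ominus> (i \<otimes> b))) = \<zero>"
          using ab mk i by (simp add: l_neg r_neg)
      qed
      from this[OF Nc(2)] show ?thesis using ab Nc by simp
    qed
    then show "\<exists>y\<in>carrier (quad_ring R \<mu> \<kappa>). x \<otimes>\<^bsub>quad_ring R \<mu> \<kappa>\<^esub> y = \<one>\<^bsub>quad_ring R \<mu> \<kappa>\<^esub>"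
      using ab Nc mk by (intro bexI[of _ ?y]) simp_all
  qed
qed

lemma quadratic_extension_quad_ring:
  fixes R (structure)
  assumes "field R" and mk: "\<mu> \<in> carrier R" "\<kappa> \<in> carrier R" and L: "field (quad_ring R \<mu> \<kappa>)"
  shows "quadratic_extension R (quad_ring R \<mu> \<kappa>)"
proof -
  interpret field R by fact
  interpret Q: field "quad_ring R \<mu> \<kappa>" using L .
  let ?h = "\<lambda>a. (a, \<zero>)"
  let ?K = "?h ` carrier R"
  have h: "?h \<in> ring_hom R (quad_ring R \<mu> \<kappa>)"
    by (rule ring_hom_memI) (use mk in auto)
  \<comment> \<open>The extension is built up by two line extensions over the copy of the base
    field, by \<open>(1, 0)\<close> and then by \<open>(0, 1)\<close>.\<close>
  have "Q.dimension (Suc 0) ?K (Q.line_extension ?K (\<one>, \<zero>) {\<zero>\<^bsub>quad_ring R \<mu> \<kappa>\<^esub>})"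
    by (rule Q.Suc_dim[OF _ _ Q.zero_dim]) simp_all
  moreover have "Q.line_extension ?K (\<one>, \<zero>) {\<zero>\<^bsub>quad_ring R \<mu> \<kappa>\<^esub>} = ?K"
  proof -
    have "u \<in> Q.line_extension ?K (\<one>, \<zero>) {\<zero>\<^bsub>quad_ring R \<mu> \<kappa>\<^esub>} \<longleftrightarrow> u \<in> ?K" for u
      unfolding Q.line_extension_mem_iff using mk by auto
    then show ?thesis by blast
  qed
  ultimately have "Q.dimension (Suc (Suc 0)) ?K (Q.line_extension ?K (\<zero>, \<one>) ?K)"
    by (intro Q.Suc_dim) auto
  moreover have "Q.line_extension ?K (\<zero>, \<one>) ?K = carrier (quad_ring R \<mu> \<kappa>)"
  proof -
    have "u \<in> Q.line_extension ?K (\<zero>, \<one>) ?K \<longleftrightarrow> u \<in> carrier (quad_ring R \<mu> \<kappa>)" for u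
    proof
      assume "u \<in> Q.line_extension ?K (\<zero>, \<one>) ?K"
      then show "u \<in> carrier (quad_ring R \<mu> \<kappa>)" unfolding Q.line_extension_mem_iff using mk by auto
    next
      assume "u \<in> carrier (quad_ring R \<mu> \<kappa>)"
      then show "u \<in> Q.line_extension ?K (\<zero>, \<one>) ?K"
        unfolding Q.line_extension_mem_iff using mk
        by (intro bexI[of _ "?h (snd u)"] bexI[of _ "?h (fst u)"]) (auto simp: prod_eq_iff)
    qed
    then show ?thesis by blast
  qed
  ultimately show ?thesis using L h unfolding quadratic_extension_def numeral_2_eq_2 by auto
qed

text \<open>The same additive group, on which \<open>T\<close> acts as \<open>g\<close>.\<close>

definition quad_mod :: "('a, 'c, 'd) module_scheme \<Rightarrow> ('c \<Rightarrow> 'c) \<Rightarrow> ('a \<times> 'a, 'c) module" where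
  "quad_mod M g = \<lparr>carrier = carrier M, mult = undefined, one = undefined, zero = \<zero>\<^bsub>M\<^esub>, add = add M,
     smult = (\<lambda>c v. fst c \<odot>\<^bsub>M\<^esub> v \<oplus>\<^bsub>M\<^esub> snd c \<odot>\<^bsub>M\<^esub> g v)\<rparr>"

lemmas quad_mod_simps [simp] = quad_mod_def [THEN arg_cong, of carrier, simplified]
  quad_mod_def [THEN arg_cong, of zero, simplified] quad_mod_def [THEN arg_cong, of add, simplified]
  quad_mod_def [THEN arg_cong, of smult, simplified]

locale quad = vspace +
  fixes g :: "'c \<Rightarrow> 'c" and \<mu> \<kappa> :: 'a
  assumes g: "linear_on (carrier M) g" and \<mu> [simp]: "\<mu> \<in> carrier R" and \<kappa> [simp]: "\<kappa> \<in> carrier R"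
    and gg: "v \<in> carrier M \<Longrightarrow> g (g v) = \<mu> \<^bold>* g v \<^bold>+ \<kappa> \<^bold>* v"
    and irred: "b \<in> carrier R \<Longrightarrow> b \<otimes> b \<noteq> \<mu> \<otimes> b \<oplus> \<kappa>"
begin

lemma g_closed [simp]: "v \<in> carrier M \<Longrightarrow> g v \<in> carrier M"
  and g_add [simp]: "u \<in> carrier M \<Longrightarrow> v \<in> carrier M \<Longrightarrow> g (u \<^bold>+ v) = g u \<^bold>+ g v"
  and g_smult [simp]: "c \<in> carrier R \<Longrightarrow> v \<in> carrier M \<Longrightarrow> g (c \<^bold>* v) = c \<^bold>* g v"
  and g_zero [simp]: "g \<^bold>0 = \<^bold>0"
  using linear_onD[OF g] linear_on_zero[OF g subsp_carrier] by blast+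

abbreviation Lring where "Lring \<equiv> quad_ring R \<mu> \<kappa>"
abbreviation Lmod where "Lmod \<equiv> quad_mod M g"

lemma Lring_field: "field Lring"
  using quad_ring_field[OF R.field_axioms \<mu> \<kappa> irred] by blast

lemma Lmod_vspace: "vspace Lring Lmod"
proof -
  have F: "field Lring" by (rule Lring_field)
  then have C: "cring Lring" by (simp add: field_def domain_def)
  have "module Lring Lmod"
  proof (rule moduleI[OF C])
    show "abelian_group Lmod"
    proof (rule abelian_groupI)
      fix x assume "x \<in> carrier Lmod"
      then show "\<exists>y\<in>carrier Lmod. y \<oplus>\<^bsub>Lmod\<^esub> x = \<zero>\<^bsub>Lmod\<^esub>" by (intro bexI[of _ "\<ominus>\<^bsub>M\<^esub> x"]) (auto simp: M.l_neg)
    qed (auto simp: M.a_ac)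
    show "(a \<otimes>\<^bsub>Lring\<^esub> b) \<odot>\<^bsub>Lmod\<^esub> x = a \<odot>\<^bsub>Lmod\<^esub> (b \<odot>\<^bsub>Lmod\<^esub> x)"
      if "a \<in> carrier Lring" "b \<in> carrier Lring" "x \<in> carrier Lmod" for a b x
    proof -
      obtain p q r s where *: "a = (p, q)" "b = (r, s)" "p \<in> carrier R" "q \<in> carrier R" "r \<in> carrier R" "s \<in> carrier R"
        using \<open>a \<in> carrier Lring\<close> \<open>b \<in> carrier Lring\<close> by auto
      show ?thesis using * \<open>x \<in> carrier Lmod\<close> by (simp add: gg vec_simps R.m_ac)
    qed
  qed (auto simp: vec_simps)
  then show ?thesis using F by (simp add: vspace_def)
qed

end

section \<open>Linear algebra over the quadratic extension\<close>

sublocale quad \<subseteq> L: vspace "quad_ring R \<mu> \<kappa>" "quad_mod M g"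
  by (rule Lmod_vspace)

context quad begin

lemma L_pspan: assumes "v \<in> carrier M" shows "pspan Lring Lmod v = span2 v (g v)"
  by (intro equalityI subsetI) (auto simp: L.pspan_iff span2_iff)

lemma L_subsp_iff: "L.subsp U \<longleftrightarrow> subsp U \<and> (\<forall>u\<in>U. g u \<in> U)"
proof
  assume U: "L.subsp U"
  have c: "U \<subseteq> carrier M" using L.subspD(1)[OF U] by simp
  have s: "a \<^bold>* u \<^bold>+ b \<^bold>* g u \<in> U" if "a \<in> carrier R" "b \<in> carrier R" "u \<in> U" for a b u
    using L.subspD(5)[OF U _ that(3), of "(a, b)"] that by simp
  have "subsp U"
  proof (rule subspI)
    show "a \<^bold>* u \<in> U" if "a \<in> carrier R" "u \<in> U" for a u using s[of a \<zero> u] that c by (auto simp: subset_iff)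
  qed (use L.subspD[OF U] c in auto)
  moreover have "g u \<in> U" if "u \<in> U" for u using s[of \<zero> \<one> u] that c by (auto simp: subset_iff)
  ultimately show "subsp U \<and> (\<forall>u\<in>U. g u \<in> U)" by blast
next
  assume U: "subsp U \<and> (\<forall>u\<in>U. g u \<in> U)"
  show "L.subsp U" by (rule L.subspI) (use subspD[OF conjunct1[OF U]] U in auto)
qed

lemma L_ext: assumes "subsp U" "v \<in> carrier M" shows "L.ext U v = ext (ext U v) (g v)"
proof (intro equalityI subsetI)
  have c: "w \<in> carrier M" if "w \<in> U" for w using subspD(2)[OF assms(1) that] .
  fix x
  { assume "x \<in> L.ext U v"
    then obtain w a where w: "w \<in> U" "a \<in> carrier Lring" "x = w \<^bold>+ (fst a \<^bold>* v \<^bold>+ snd a \<^bold>* g v)"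
      by (auto simp: L.ext_def)
    then have "x = (w \<^bold>+ fst a \<^bold>* v) \<^bold>+ snd a \<^bold>* g v" using c assms by (auto simp: M.a_assoc)
    then show "x \<in> ext (ext U v) (g v)" using w extI by auto }
  { assume "x \<in> ext (ext U v) (g v)"
    then obtain w a b where w: "w \<in> U" "a \<in> carrier R" "b \<in> carrier R" "x = (w \<^bold>+ a \<^bold>* v) \<^bold>+ b \<^bold>* g v"
      by (auto simp: ext_def)
    then have "x = w \<^bold>+ (a, b) \<odot>\<^bsub>Lmod\<^esub> v" using c assms by (auto simp: M.a_assoc)
    then show "x \<in> L.ext U v" using w L.extI[of w U "(a, b)" v] by simp }
qed

text \<open>If \<open>g v = u + a v\<close> with \<open>u\<close> in the invariant \<open>U\<close>,
  applying \<open>g\<close> once more and comparing modulo \<open>U\<close> gives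
  \<open>a^2 = \<mu> a + \<kappa>\<close>, against irreducibility. Hence adjoining one vector over
  the quadratic extension adds exactly two dimensions over \<open>R\<close>.\<close>

lemma g_notin:
  assumes U: "subsp U" "\<And>u. u \<in> U \<Longrightarrow> g u \<in> U" and v: "v \<in> carrier M" "v \<notin> U"
  shows "g v \<notin> ext U v"
proof
  assume "g v \<in> ext U v"
  then obtain u a where u: "u \<in> U" "a \<in> carrier R" "g v = u \<^bold>+ a \<^bold>* v" by (meson extE)
  have uc: "u \<in> carrier M" using subspD(2)[OF U(1) u(1)] .
  let ?c = "a \<otimes> a \<ominus> (\<mu> \<otimes> a \<oplus> \<kappa>)"
  have "g (g v) = g u \<^bold>+ a \<^bold>* g v" using arg_cong[OF u(3), of g] u uc v by simp
  then have "g (g v) = g u \<^bold>+ a \<^bold>* (u \<^bold>+ a \<^bold>* v)" using arg_cong[OF u(3), of "\<lambda>w. g u \<^bold>+ a \<^bold>* w"] by (rule trans)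
  moreover have "g (g v) = \<mu> \<^bold>* (u \<^bold>+ a \<^bold>* v) \<^bold>+ \<kappa> \<^bold>* v"
    using gg[OF v(1)] arg_cong[OF u(3), of "\<lambda>w. \<mu> \<^bold>* w \<^bold>+ \<kappa> \<^bold>* v"] by (rule trans)
  ultimately have "(g u \<^bold>+ a \<^bold>* u) \<^bold>+ (a \<otimes> a) \<^bold>* v = \<mu> \<^bold>* u \<^bold>+ (\<mu> \<otimes> a \<oplus> \<kappa>) \<^bold>* v"
    using u uc v by (simp add: smult_r_distr smult_l_distr smult_assoc1 M.a_assoc)
  moreover have "g u \<^bold>+ a \<^bold>* u \<in> U" "\<mu> \<^bold>* u \<in> U" using U u subspD(4,5)[OF U(1)] by simp_all
  ultimately have "a \<otimes> a = \<mu> \<otimes> a \<oplus> \<kappa>"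
    using ext_unique[OF U(1) v, of "g u \<^bold>+ a \<^bold>* u" "\<mu> \<^bold>* u" "a \<otimes> a" "\<mu> \<otimes> a \<oplus> \<kappa>"] u by simp
  then show False using irred u by blast
qed

lemma g_pspan: "v \<in> carrier M \<Longrightarrow> v \<noteq> \<^bold>0 \<Longrightarrow> g v \<notin> pspan R M v"
  using g_notin[OF subsp_zero, of v] by (simp add: pspan_ext)

lemma \<kappa>_nonzero: "\<kappa> \<noteq> \<zero>" using irred[of \<zero>] by auto

text \<open>The quadratic relation reads \<open>g (g - \<mu>) = \<kappa>\<close>, with
  \<open>\<kappa>\<close> nonzero.\<close>

lemma g_inverse: "v \<in> carrier M \<Longrightarrow> g (inv \<kappa> \<^bold>* (g v \<^bold>+ \<ominus> \<mu> \<^bold>* v)) = v"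
  using \<kappa>_nonzero minus_cancel[of "\<kappa> \<^bold>* v" "g v" \<mu>] by (simp add: gg M.a_comm)

lemma g_nonzero: assumes "v \<in> carrier M" "v \<noteq> \<^bold>0" shows "g v \<noteq> \<^bold>0"
  using g_pspan[OF assms] subspD(3)[OF subsp_pspan[OF assms(1)]] by metis

lemma L_dim: "L.dim k U \<Longrightarrow> dim (2 * k) U"
proof (induction rule: L.dimx.induct)
  case (dimx_Suc k U v)
  have "L.subsp U" using dimx_Suc.hyps(1) L.dim_subsp by simp
  then have U: "subsp U" "\<And>u. u \<in> U \<Longrightarrow> g u \<in> U" by (auto simp: L_subsp_iff)
  have v: "v \<in> carrier M" using dimx_Suc by simp
  have "dim (Suc (Suc (2 * k))) (ext (ext U v) (g v))"
    using dimx.dimx_Suc[OF dimx.dimx_Suc[OF dimx_Suc.IH v dimx_Suc.hyps(3)]] g_notin[OF U v dimx_Suc.hyps(3)] v by simp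
  then show ?case using L_ext[OF U(1) v] by simp
qed simp

lemma L_dim_ex: assumes N: "dim N (carrier M)" and U: "L.subsp U" shows "\<exists>k. L.dim k U"
proof -
  have "L.dim l W \<Longrightarrow> W \<subseteq> U \<Longrightarrow> \<exists>k. L.dim k U" for l W
  proof (induction "N - l" arbitrary: l W rule: less_induct)
    case less
    show ?case
    proof (cases "W = U")
      case False
      then obtain v where v: "v \<in> U" "v \<notin> W" using less.prems by blast
      have W: "L.subsp W" using L.dim_subsp less.prems(1) by simp
      have d: "L.dim (Suc l) (L.ext W v)" using L.dimx_Suc[OF less.prems(1) L.subspD(2)[OF U v(1)] v(2)] .
      have s: "L.ext W v \<subseteq> U" using L.ext_least[OF U less.prems(2) v(1)] .
      have "2 * Suc l \<le> N" using dim_le[OF N L_dim[OF d]] s L.subspD(1)[OF U] by auto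
      then have "N - Suc l < N - l" by simp
      then show ?thesis using less.hyps[OF _ d s] by blast
    qed (use less.prems in blast)
  qed
  from this[OF L.dimx_0] show ?thesis using L.subspD(3)[OF U] by simp
qed

end

text \<open>\<open>g_adj\<close> speaks of orthogonal pairs only. In the symplectic case
  \<open>g\<close> is self-adjoint, whereas in the hyperbolic case
  \<open>f (g u) v = \<mu> f u v - f u (g v)\<close>, which is adjointness up to sign just where
  \<open>\<mu> f u v\<close> vanishes.\<close>

locale polg = polr + quad +
  assumes g_S: "v \<in> S \<Longrightarrow> g v \<in> S" and g_orth: "v \<in> S \<Longrightarrow> v \<perp> g v"
    and g_adj: "u \<in> carrier M \<Longrightarrow> v \<in> carrier M \<Longrightarrow> u \<perp> v \<Longrightarrow> u \<perp> g v \<longleftrightarrow> g u \<perp> v"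
begin

text \<open>By \<open>g_adj\<close> and the quadratic relation of \<open>g\<close>, these two
  conditions already make the span of \<open>u\<close> and \<open>g u\<close> orthogonal to the span
  of \<open>v\<close> and \<open>g v\<close>.\<close>

definition orthL where "orthL u v \<longleftrightarrow> u \<perp> v \<and> u \<perp> g v"

lemma orthL_sym: assumes "u \<in> carrier M" "v \<in> carrier M" "orthL u v" shows "orthL v u"
  using assms g_adj[of u v] orth_commute[of u v] orth_commute[of "g u" v] by (simp add: orthL_def)

lemma orthL_perp: "v \<in> carrier M \<Longrightarrow> x \<in> carrier M \<Longrightarrow> orthL x v \<longleftrightarrow> v \<in> perp {x} \<inter> perp {g x}"
  using g_adj[of x v] by (auto simp: orthL_def perp_def)

lemma orthL_g: assumes "x \<in> carrier M" "v \<in> carrier M" "orthL x v" shows "orthL x (g v)"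
  using assms by (simp add: orthL_def gg orth_add orth_smult)

lemma orthL_scale:
  assumes "x \<in> carrier M" "v \<in> carrier M" "orthL x v" "a \<in> carrier R" "b \<in> carrier R"
  shows "orthL x (a \<^bold>* v \<^bold>+ b \<^bold>* g v)"
  using assms orthL_g[OF assms(1-3)] by (simp add: orthL_def orth_add orth_smult)

lemma subsp_orthL: "x \<in> carrier M \<Longrightarrow> subsp (perp {x} \<inter> perp {g x})"
  using subsp_Int subsp_perp by simp

lemma span2_g_inv: "v \<in> carrier M \<Longrightarrow> w \<in> span2 v (g v) \<Longrightarrow> g w \<in> span2 v (g v)"
  using L_subsp_iff[of "span2 v (g v)"] L.subsp_pspan[of v] L_pspan by simp

text \<open>Let \<open>?T\<close> be the span of \<open>v\<close> over the extension, and
  \<open>?P\<close> the set of vectors orthogonal to \<open>x\<close> in the sense of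
  \<open>orthL\<close>. They meet only in zero, since both are invariant under \<open>g\<close> and
  \<open>v\<close> is not in \<open>?P\<close>. By dimension, \<open>?P\<close> meets the
  three-dimensional span of \<open>?T\<close> and \<open>u\<close> in a nonzero vector, whose
  coefficient at \<open>u\<close> is therefore nonzero.\<close>

lemma orthL_solve:
  assumes u: "u \<in> carrier M" and v: "v \<in> carrier M" and x: "x \<in> carrier M" and n: "\<not> orthL x v"
  shows "\<exists>w\<in>span2 v (g v). orthL x (u \<^bold>+ w)"
proof -
  let ?T = "span2 v (g v)" and ?P = "perp {x} \<inter> perp {g x}"
  have P: "subsp ?P" using subsp_orthL x by blast
  have T: "subsp ?T" using v by auto
  have Tc: "w \<in> carrier M" if "w \<in> ?T" for w using subspD(2)[OF T that] .
  have v0: "v \<noteq> \<^bold>0" using n x by (auto simp: orthL_def)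
  have dT: "dim 2 ?T" using dim_span2[OF v _ v0 g_pspan[OF v v0]] v by simp
  have TP: "w = \<^bold>0" if w: "w \<in> ?T" "w \<in> ?P" for w
  proof (rule ccontr)
    assume w0: "w \<noteq> \<^bold>0"
    have "g w \<in> ?T" using span2_g_inv v w by blast
    then have Tw: "?T = span2 w (g w)" using dim_2_span2[OF dT w(1)] w0 g_pspan[OF Tc[OF w(1)]] by blast
    have "orthL x w" using orthL_perp[OF Tc[OF w(1)] x] w by simp
    then have "orthL x (g w)" using orthL_g x Tc w by blast
    then have "g w \<in> ?P" using orthL_perp[of "g w" x] x Tc w by simp
    then have "?T \<subseteq> ?P" using span2_least[OF P w(2)] Tw by simp
    then have "v \<in> ?P" using span2_gen[of v "g v"] v by auto
    then show False using n orthL_perp[OF v x] by simp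
  qed
  show ?thesis
  proof (cases "u \<in> ?T")
    case True
    have "u \<^bold>+ \<ominus> \<one> \<^bold>* u = \<^bold>0" using u by (simp add: M.r_neg)
    moreover have "\<ominus> \<one> \<^bold>* u \<in> ?T" using subspD(5)[OF T _ True, of "\<ominus> \<one>"] by (simp del: smult_minus_one)
    ultimately show ?thesis using x by (intro bexI[of _ "\<ominus> \<one> \<^bold>* u"]) (simp_all add: orthL_def)
  next
    case False
    have dY: "dim 3 (ext ?T u)" using dimx_Suc[OF dT u False] by (simp add: numeral_3_eq_3)
    obtain k where k: "dim k (ext ?T u \<inter> perp {x})" "3 \<le> Suc k" using dim_perp1[OF dY x] by blast
    obtain l where l: "dim l (ext ?T u \<inter> perp {x} \<inter> perp {g x})" "k \<le> Suc l"
      using dim_perp1[OF k(1), of "g x"] x by auto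
    obtain y where y: "y \<in> ext ?T u" "y \<in> ?P" "y \<noteq> \<^bold>0" using dim_less[of 0 "{\<^bold>0}" l] l k by auto
    obtain w d where wd: "w \<in> ?T" "d \<in> carrier R" "y = w \<^bold>+ d \<^bold>* u" using y(1) by (meson extE)
    have d0: "d \<noteq> \<zero>" using TP y wd Tc u by auto
    let ?w = "inv d \<^bold>* w"
    have wT: "?w \<in> ?T" using subspD(5)[OF T _ wd(1)] wd d0 by simp
    have "inv d \<^bold>* y \<in> ?P" using subspD(5)[OF P _ y(2)] wd d0 by simp
    moreover have "inv d \<^bold>* y = u \<^bold>+ ?w" using wd d0 u Tc by (simp add: smult_r_distr M.a_comm)
    ultimately have "orthL x (u \<^bold>+ ?w)" using orthL_perp[of "u \<^bold>+ ?w" x] x u Tc[OF wT] by simp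
    then show ?thesis using wT by blast
  qed
qed

lemma L_pol: "pol Lring Lmod S orthL"
proof (intro pol.intro L.vspace_axioms pol_axioms.intro)
  show "a \<odot>\<^bsub>Lmod\<^esub> v \<in> S" if "a \<in> carrier Lring" "v \<in> S" for a v
  proof -
    have "fst a \<^bold>* v \<perp> snd a \<^bold>* g v"
      using g_orth[OF that(2)] orth_smult orth_commute[of "fst a \<^bold>* v" "snd a \<^bold>* g v"] orth_commute[of v "snd a \<^bold>* g v"]
        that by auto
    then show ?thesis using S_add S_smult g_S that by auto
  qed
  show "u \<oplus>\<^bsub>Lmod\<^esub> v \<in> S" if "u \<in> S" "v \<in> S" "orthL u v" for u v using S_add that by (simp add: orthL_def)
  show "orthL v v" if "v \<in> S" for v using S_self g_orth that by (simp add: orthL_def)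
  show "\<exists>c\<in>carrier Lring. z \<oplus>\<^bsub>Lmod\<^esub> c \<odot>\<^bsub>Lmod\<^esub> u \<in> S" if uz: "u \<in> S" "z \<in> carrier Lmod" "\<not> orthL u z" for u z
  proof (cases "u \<perp> z")
    case False
    then obtain c where c: "c \<in> carrier R" "z \<^bold>+ c \<^bold>* u \<in> S" using S_lift uz by auto
    then show ?thesis using uz by (intro bexI[of _ "(c, \<zero>)"]) auto
  next
    \<comment> \<open>Here \<open>u\<close> gives nothing, being orthogonal to \<open>z\<close>, but
      \<open>g u\<close> is not orthogonal to \<open>z\<close>; the scalar is
      \<open>c T\<close>.\<close>
    case True
    then have "\<not> g u \<perp> z" using uz g_adj[of u z] by (simp add: orthL_def)
    then obtain c where c: "c \<in> carrier R" "z \<^bold>+ c \<^bold>* g u \<in> S" using S_lift[OF g_S[OF uz(1)]] uz by auto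
    then show ?thesis using uz by (intro bexI[of _ "(\<zero>, c)"]) auto
  qed
  show "v = \<zero>\<^bsub>Lmod\<^esub>" if "v \<in> S" "\<And>w. w \<in> carrier Lmod \<Longrightarrow> orthL v w" for v
    using S_rad[of v] that by (simp add: orthL_def)
  show "orthL v u" if "u \<in> carrier Lmod" "v \<in> carrier Lmod" "orthL u v" for u v using orthL_sym that by simp
  show "orthL u (v \<oplus>\<^bsub>Lmod\<^esub> w)" if "u \<in> carrier Lmod" "v \<in> carrier Lmod" "w \<in> carrier Lmod" "orthL u v" "orthL u w" for u v w
    using that orth_add by (simp add: orthL_def)
  show "orthL u (a \<odot>\<^bsub>Lmod\<^esub> v)" if "a \<in> carrier Lring" "u \<in> carrier Lmod" "v \<in> carrier Lmod" "orthL u v" for a u v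
    using that orthL_scale[of u v "fst a" "snd a"] by auto
  show "\<exists>c\<in>carrier Lring. orthL x (u \<oplus>\<^bsub>Lmod\<^esub> c \<odot>\<^bsub>Lmod\<^esub> v)"
    if c: "u \<in> carrier Lmod" "v \<in> carrier Lmod" "x \<in> carrier Lmod" "\<not> orthL x v" for u v x
  proof -
    obtain w where w: "w \<in> span2 v (g v)" "orthL x (u \<^bold>+ w)" using orthL_solve[of u v x] c by auto
    then have "w \<in> pspan Lring Lmod v" using L_pspan c by simp
    then show ?thesis using w(2) by (auto simp: pspan_def)
  qed
qed auto

end

sublocale polg \<subseteq> LP: pol "quad_ring R \<mu> \<kappa>" "quad_mod M g" S orthL
  by (rule L_pol)

context polg begin

lemma L_tsub_iff: "LP.tsub U \<longleftrightarrow> tsub U \<and> (\<forall>u\<in>U. g u \<in> U)"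
  unfolding LP.tsub_def tsub_def L_subsp_iff orthL_def by blast

text \<open>A vector orthogonal to a \<open>g\<close>-invariant \<open>U\<close> is orthogonal to it
  in the sense of \<open>orthL\<close> too, by \<open>g_adj\<close>. As dimensions over the
  extension are half of those over \<open>R\<close>, the rank is halved.\<close>

lemma L_maxtsub: assumes U: "LP.maxtsub U" shows "maxtsub U"
  unfolding maxtsub_def
proof (intro conjI ballI impI)
  have U': "tsub U" "\<And>u. u \<in> U \<Longrightarrow> g u \<in> U" using U by (auto simp: LP.maxtsub_def L_tsub_iff)
  show "tsub U" by fact
  fix v assume v: "v \<in> S" "\<forall>u\<in>U. u \<perp> v"
  have "orthL u v" if "u \<in> U" for u
    using g_adj[of u v] v U' that tsubD(4)[OF U'(1)] by (simp add: orthL_def)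
  then show "v \<in> U" using U v by (simp add: LP.maxtsub_def)
qed

lemma L_polar_space: assumes n: "n = 2 * m" shows "polar_space m LP.geo"
proof -
  obtain k where k: "L.dim k (carrier Lmod)" using L_dim_ex[OF finV L.subsp_carrier] by blast
  obtain U where U: "LP.maxtsub U" using LP.maxtsub_extend[OF k LP.tsub_zero] by blast
  then have tU: "LP.tsub U" by (simp add: LP.maxtsub_def)
  obtain l where l: "L.dim l U" using L_dim_ex[OF finV] tU LP.tsubD(1) by blast
  have "2 * l = n" using dim_unique[OF L_dim[OF l] maxtsub_dim[OF L_maxtsub[OF U]]] .
  then have "L.dim m U" using l n by simp
  moreover have "k' \<le> m" if "LP.tsub W" "L.dim k' W" for W k'
    using tsub_dim_le[OF _ L_dim[OF that(2)]] that(1) n by (simp add: L_tsub_iff)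
  ultimately show ?thesis using LP.polar_space_geo[OF k _ tU] by blast
qed

end

section \<open>Polar spaces modelled by vectors\<close>

lemma geometry_iso_inv:
  assumes "geometry_iso \<phi> G H" "blocks G \<subseteq> Pow (points G)"
  shows "geometry_iso (inv_into (points G) \<phi>) H G"
proof -
  interpret giso \<phi> G H using assms by (simp add: giso_def)
  have "(\<lambda>b. inv_into (points G) \<phi> ` b) ` blocks H = (\<lambda>b. inv_into (points G) \<phi> ` \<phi> ` b) ` blocks G"
    unfolding blocks_image[symmetric] by (simp add: image_comp)
  also have "\<dots> = (\<lambda>b. b) ` blocks G"
    by (rule image_cong[OF refl]) (use inv_into_image_cancel[OF inj] blocks_sub in blast)
  finally show ?thesis using bij_betw_inv_into[OF bij] by (simp add: geometry_iso_def)
qed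

locale polar_model = polr +
  fixes \<Delta> :: "'p geometry" and \<phi> :: "'p \<Rightarrow> 'c set" and \<theta> :: "'p \<Rightarrow> 'p"
  assumes rank4: "n \<ge> 4" and phi: "geometry_iso \<phi> \<Delta> geo" and blocks_Delta: "blocks \<Delta> \<subseteq> Pow (points \<Delta>)"
    and coll: "collineation \<Delta> \<theta>" and domestic: "point_domestic \<Delta> \<theta>"
    and nofix_pt: "\<And>x. x \<in> points \<Delta> \<Longrightarrow> \<theta> x \<noteq> x"
begin

sublocale D: giso \<phi> \<Delta> geo by unfold_locales (rule phi blocks_Delta)+
sublocale C: giso \<theta> \<Delta> \<Delta> by unfold_locales (use coll blocks_Delta in \<open>simp_all add: collineation_def\<close>)

section \<open>The collineation on vectors\<close>

definition T where "T = \<phi> \<circ> (\<theta> \<circ> inv_into (points \<Delta>) \<phi>)"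

lemma T_phi: "x \<in> points \<Delta> \<Longrightarrow> T (\<phi> x) = \<phi> (\<theta> x)"
  by (simp add: T_def inv_into_f_f[OF D.inj])

lemma T_iso: "geometry_iso T geo geo"
  unfolding T_def
  by (intro geometry_iso_comp[OF _ phi] geometry_iso_comp[OF geometry_iso_inv[OF phi blocks_Delta]])
    (rule C.iso)

sublocale TT: giso T geo geo by unfold_locales (rule T_iso blocks_geo)+

definition t where "t v = (SOME w. w \<in> S \<and> w \<noteq> \<^bold>0 \<and> T (pspan R M v) = pspan R M w)"

lemma pt_in: "v \<in> S \<Longrightarrow> v \<noteq> \<^bold>0 \<Longrightarrow> pspan R M v \<in> points geo"
  by (auto simp: geo_simps pts_def)

lemma t: assumes "v \<in> S" "v \<noteq> \<^bold>0" shows "t v \<in> S" "t v \<noteq> \<^bold>0" "T (pspan R M v) = pspan R M (t v)"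
proof -
  have "T (pspan R M v) \<in> points geo" using pt_in[OF assms] TT.points_image by blast
  then have "\<exists>w. w \<in> S \<and> w \<noteq> \<^bold>0 \<and> T (pspan R M v) = pspan R M w" by (auto simp: geo_simps pts_def)
  from someI_ex[OF this] show "t v \<in> S" "t v \<noteq> \<^bold>0" "T (pspan R M v) = pspan R M (t v)"
    unfolding t_def by blast+
qed

lemma t_pspan_iff:
  assumes "u \<in> S" "u \<noteq> \<^bold>0" "v \<in> S" "v \<noteq> \<^bold>0" shows "t v \<in> pspan R M (t u) \<longleftrightarrow> v \<in> pspan R M u"
proof -
  have *: "y \<in> pspan R M x \<longleftrightarrow> pspan R M y = pspan R M x" if "x \<in> S" "y \<in> S" "y \<noteq> \<^bold>0" for x y
    using pspan_eq[OF _ that(3), of x] pspan_self[of y] S_carrier that by metis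
  have "T (pspan R M v) = T (pspan R M u) \<longleftrightarrow> pspan R M v = pspan R M u"
    using inj_on_eq_iff[OF TT.inj pt_in pt_in] assms by blast
  then show ?thesis using * t assms by simp
qed

lemma t_line_image:
  assumes uv: "u \<in> S" "v \<in> S" "u \<noteq> \<^bold>0" "v \<noteq> \<^bold>0" "u \<perp> v" "v \<notin> pspan R M u"
  shows "T ` pts (span2 u v) = pts (span2 (t u) (t v))"
proof -
  have "pts (span2 u v) \<in> blocks geo" using block_span2 uv by blast
  then have "T ` pts (span2 u v) \<in> blocks geo" using TT.blocks_image by blast
  then obtain U where U: "tsub U" "dim 2 U" "T ` pts (span2 u v) = pts U" by (auto simp: geo_simps)
  have "pspan R M u \<in> pts (span2 u v)" "pspan R M v \<in> pts (span2 u v)"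
    using span2_gen[of u v] uv by (auto simp: pts_def)
  then have "pspan R M (t u) \<in> pts U" "pspan R M (t v) \<in> pts U" using U(3) t uv by (metis imageI)+
  then have tU: "t u \<in> U" "t v \<in> U"
    using pts_iff[OF tsubD(1)[OF U(1)], of "t u"] pts_iff[OF tsubD(1)[OF U(1)], of "t v"]
      t(1,2)[OF uv(1,3)] t(1,2)[OF uv(2,4)] by simp_all
  have "t v \<notin> pspan R M (t u)" using t_pspan_iff[OF uv(1,3,2,4)] uv(6) by simp
  then have "U = span2 (t u) (t v)" using dim_2_span2[OF U(2) tU t(2)[OF uv(1,3)]] by blast
  then show ?thesis using U by simp
qed

lemma span2_dep: "u \<in> carrier M \<Longrightarrow> v \<in> pspan R M u \<Longrightarrow> span2 u v = pspan R M u"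
  unfolding span2_def by (rule ext_absorb) auto

text \<open>The two inclusions \<open>t_line\<close> and \<open>t_onto\<close> come from
  \<open>t_line_image\<close>; dependent \<open>u\<close> and \<open>v\<close> span no line and are
  treated separately. Domesticity and the absence of fixed points are carried over through
  \<open>\<phi>\<close>.\<close>

lemma t_dom: "dom R M S orth N n M0 t"
proof unfold_locales
  show "t v \<in> S" "t v \<noteq> \<^bold>0" if "v \<in> S" "v \<noteq> \<^bold>0" for v using t that by auto
  show "t (a \<^bold>* v) \<in> pspan R M (t v)" if "v \<in> S" "v \<noteq> \<^bold>0" "a \<in> carrier R" "a \<noteq> \<zero>" for a v
    using t_pspan_iff[OF that(1,2), of "a \<^bold>* v"] that S_smult by (auto simp: pspan_iff)
  show "(t u \<perp> t v) = (u \<perp> v)" if "u \<in> S" "v \<in> S" "u \<noteq> \<^bold>0" "v \<noteq> \<^bold>0" for u v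
    using TT.collinear_iff[OF pt_in pt_in, of u v] collinear_geo[of u v] collinear_geo[of "t u" "t v"] t that by simp
  show "t v \<in> pspan R M (t u) \<Longrightarrow> v \<in> pspan R M u" if "u \<in> S" "v \<in> S" "u \<noteq> \<^bold>0" "v \<noteq> \<^bold>0" for u v
    using t_pspan_iff that by blast
  show "n \<ge> 4" by (rule rank4)
  show "t w \<in> span2 (t u) (t v)"
    if uv: "u \<in> S" "v \<in> S" "u \<noteq> \<^bold>0" "v \<noteq> \<^bold>0" "u \<perp> v" and w: "w \<in> span2 u v" "w \<noteq> \<^bold>0" for u v w
  proof -
    have wS: "w \<in> S" using tsubD(2)[OF tsub_span2] uv w by blast
    show ?thesis
    proof (cases "v \<in> pspan R M u")
      case True
      then have "w \<in> pspan R M u" using span2_dep w uv by simp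
      then have "t w \<in> pspan R M (t u)" using t_pspan_iff uv wS w by blast
      then show ?thesis using pspan_subset[OF subsp_span2 span2_gen(1), of "t u" "t v"] t uv by auto
    next
      case False
      have "pspan R M w \<in> pts (span2 u v)" using w by (auto simp: pts_def)
      then have "pspan R M (t w) \<in> pts (span2 (t u) (t v))" using t_line_image[OF uv False] t[OF wS w(2)] by (metis imageI)
      then show ?thesis using pts_iff[OF subsp_span2] t uv wS w by auto
    qed
  qed
  show "\<exists>x\<in>span2 u v. x \<noteq> \<^bold>0 \<and> w \<in> pspan R M (t x)"
    if uv: "u \<in> S" "v \<in> S" "u \<noteq> \<^bold>0" "v \<noteq> \<^bold>0" "u \<perp> v" and w: "w \<in> span2 (t u) (t v)" "w \<noteq> \<^bold>0" for u v w
  proof (cases "v \<in> pspan R M u")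
    case True
    then have "w \<in> pspan R M (t u)" using span2_dep w uv t t_pspan_iff by auto
    then show ?thesis using span2_gen(1)[of u v] uv by auto
  next
    case False
    have "pspan R M w \<in> T ` pts (span2 u v)" using w t_line_image[OF uv False] by (auto simp: pts_def)
    then obtain x where x: "x \<in> span2 u v" "x \<noteq> \<^bold>0" "pspan R M w = T (pspan R M x)" by (auto simp: pts_def)
    have "x \<in> S" using tsubD(2)[OF tsub_span2] uv x by blast
    then have "pspan R M w = pspan R M (t x)" using t x by simp
    moreover have "w \<in> carrier M" using subspD(2)[OF subsp_span2 w(1)] t(1) uv by simp
    ultimately show ?thesis using x pspan_self[of w] by auto
  qed
  fix v assume v: "v \<in> S" "v \<noteq> \<^bold>0"
  have "pspan R M v \<in> \<phi> ` points \<Delta>" using pt_in[OF v] D.points_image by simp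
  then obtain x where x: "x \<in> points \<Delta>" "\<phi> x = pspan R M v" by auto
  have fx: "\<phi> (\<theta> x) = pspan R M (t v)" using T_phi[OF x(1)] x t[OF v] by simp
  have tx: "\<theta> x \<in> points \<Delta>" using x C.points_image by blast
  have "collinear \<Delta> x (\<theta> x)" using domestic x by (auto simp: point_domestic_def opposite_points_def)
  then have "collinear geo (pspan R M v) (pspan R M (t v))" using D.collinear_iff[OF x(1) tx] x fx by simp
  then show "v \<perp> t v" using collinear_geo t v by simp
  show "t v \<notin> pspan R M v"
  proof
    assume "t v \<in> pspan R M v"
    then have "pspan R M (t v) = pspan R M v" using pspan_eq t v by simp
    then have "\<phi> (\<theta> x) = \<phi> x" using fx x by simp
    then show False using inj_onD[OF D.inj _ tx x(1)] nofix_pt x by blast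
  qed
qed

sublocale dom R M S orth N n M0 t by (rule t_dom)

lemma t_surj': assumes "w \<in> S" "w \<noteq> \<^bold>0" shows "\<exists>v\<in>S. v \<noteq> \<^bold>0 \<and> w \<in> pspan R M (t v)"
proof -
  have "pspan R M w \<in> T ` points geo" using pt_in[OF assms] TT.points_image by simp
  then obtain x where x: "x \<in> points geo" "T x = pspan R M w" by auto
  then obtain v where v: "v \<in> S" "v \<noteq> \<^bold>0" "x = pspan R M v" by (auto simp: geo_simps pts_def)
  then have "pspan R M w = pspan R M (t v)" using t x by simp
  then show ?thesis using v pspan_self[of w] assms by auto
qed

lemma singular_model:
  assumes X: "singular_subspace \<Delta> X"
  obtains U k where "tsub U" "dim k U" "\<phi> ` X = pts U" "X \<subseteq> points \<Delta>" "proj_dim \<Delta> X = int k - 1"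
proof -
  have sub: "X \<subseteq> points \<Delta>" using X by (simp add: singular_subspace_def geom_subspace_def)
  then obtain U where U: "tsub U" "\<phi> ` X = pts U" using X D.singular_iff[OF sub] unfolding singular_geo by blast
  obtain k where k: "dim k U" using fin_dim tsubD(1)[OF U(1)] by blast
  show ?thesis using that[OF U(1) k U(2) sub] proj_dim_geo(1)[OF U(1) k] D.proj_dim_image[OF sub] U by simp
qed

lemma singular_from_model:
  assumes U: "tsub U" "dim k U"
  obtains X where "singular_subspace \<Delta> X" "\<phi> ` X = pts U" "X \<subseteq> points \<Delta>" "proj_dim \<Delta> X = int k - 1"
proof -
  have "pts U \<subseteq> points geo" using tsubD(2)[OF U(1)] by (auto simp: geo_simps pts_def)
  then obtain X where X: "X \<subseteq> points \<Delta>" "pts U = \<phi> ` X" using D.surjE by blast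
  have "singular_subspace \<Delta> X" using D.singular_iff[OF X(1)] singular_geo U X by auto
  then show ?thesis using that X proj_dim_geo(1)[OF U] D.proj_dim_image[OF X(1)] by simp
qed

text \<open>The equality of dimensions is automatic for a collineation. What remains says that every
  point of \<open>X\<close> is noncollinear with the image of some point of \<open>X\<close>, of
  which \<open>opp\<close> is the contrapositive for vectors.\<close>

lemma opposite_iff:
  assumes U: "tsub U" and X: "\<phi> ` X = pts U" "X \<subseteq> points \<Delta>"
  shows "opposite_subspaces \<Delta> X (\<theta> ` X) \<longleftrightarrow> opp U"
proof -
  have pd: "proj_dim \<Delta> X = proj_dim \<Delta> (\<theta> ` X)" using C.proj_dim_image X by simp
  have rep: "\<exists>u\<in>U. u \<noteq> \<^bold>0 \<and> \<phi> x = pspan R M u" if "x \<in> X" for x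
  proof -
    have "\<phi> x \<in> pts U" using X that by blast
    then show ?thesis by (auto simp: pts_def)
  qed
  have rep': "\<exists>x\<in>X. \<phi> x = pspan R M u" if "u \<in> U" "u \<noteq> \<^bold>0" for u
  proof -
    have "pspan R M u \<in> \<phi> ` X" using X that by (auto simp: pts_def)
    then show ?thesis by auto
  qed
  have col: "collinear \<Delta> x (\<theta> y) \<longleftrightarrow> u \<perp> t v"
    if "x \<in> X" "y \<in> X" "u \<in> U" "v \<in> U" "u \<noteq> \<^bold>0" "v \<noteq> \<^bold>0" "\<phi> x = pspan R M u" "\<phi> y = pspan R M v" for x y u v
  proof -
    have pts: "x \<in> points \<Delta>" "\<theta> y \<in> points \<Delta>" "y \<in> points \<Delta>" using that X C.points_image by blast+
    have S: "u \<in> S" "v \<in> S" using that tsubD(2)[OF U] by blast+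
    have "\<phi> (\<theta> y) = pspan R M (t v)" using T_phi[OF pts(3)] that t S by simp
    then show ?thesis using D.collinear_iff[OF pts(1,2)] collinear_geo[of u "t v"] that S t by simp
  qed
  show ?thesis
  proof
    assume o: "opposite_subspaces \<Delta> X (\<theta> ` X)"
    show "opp U" unfolding opp_def
    proof (intro ballI impI)
      fix v assume v: "v \<in> U" "\<forall>x\<in>U. x \<noteq> \<^bold>0 \<longrightarrow> v \<perp> t x"
      show "v = \<^bold>0"
      proof (rule ccontr)
        assume v0: "v \<noteq> \<^bold>0"
        then obtain x where x: "x \<in> X" "\<phi> x = pspan R M v" using rep' v by blast
        then obtain y where y: "y \<in> X" "\<not> collinear \<Delta> x (\<theta> y)"
          using o by (auto simp: opposite_subspaces_def opposite_points_def)
        obtain u where u: "u \<in> U" "u \<noteq> \<^bold>0" "\<phi> y = pspan R M u" using rep y by blast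
        show False using col[OF x(1) y(1) v(1) u(1) v0 u(2) x(2) u(3)] y v u by blast
      qed
    qed
  next
    assume o: "opp U"
    have "\<exists>y\<in>\<theta> ` X. opposite_points \<Delta> x y" if x: "x \<in> X" for x
    proof -
      obtain v where v: "v \<in> U" "v \<noteq> \<^bold>0" "\<phi> x = pspan R M v" using rep x by blast
      then obtain u where u: "u \<in> U" "u \<noteq> \<^bold>0" "\<not> v \<perp> t u" using o unfolding opp_def by blast
      obtain y where y: "y \<in> X" "\<phi> y = pspan R M u" using rep' u by blast
      have "\<not> collinear \<Delta> x (\<theta> y)" using col[OF x y(1) v(1) u(1) v(2) u(2) v(3) y(2)] u by blast
      then show ?thesis using y by (auto simp: opposite_points_def)
    qed
    then show "opposite_subspaces \<Delta> X (\<theta> ` X)" using pd by (simp add: opposite_subspaces_def)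
  qed
qed

lemma diagram: "opposition_diagram_2 n \<Delta> \<theta>"
  unfolding opposition_diagram_2_def
proof (intro ballI iffI)
  fix k assume "k \<in> {1..n}"
  assume "\<exists>X. singular_subspace \<Delta> X \<and> proj_dim \<Delta> X = int k - 1 \<and> opposite_subspaces \<Delta> X (\<theta> ` X)"
  then obtain X where X: "singular_subspace \<Delta> X" "proj_dim \<Delta> X = int k - 1" "opposite_subspaces \<Delta> X (\<theta> ` X)"
    by blast
  obtain U l where U: "tsub U" "dim l U" "\<phi> ` X = pts U" "X \<subseteq> points \<Delta>" "proj_dim \<Delta> X = int l - 1"
    using singular_model[OF X(1)] .
  have "l = k" using X U by simp
  then show "even k" using opp_even[OF U(1,2)] opposite_iff[OF U(1,3,4)] X by simp
next
  fix k assume k: "k \<in> {1..n}" "even k"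
  then obtain j where j: "k = 2 * j" by blast
  then obtain U where U: "tsub U" "dim k U" "opp U" using ex_opp[of j] k by auto
  obtain X where X: "singular_subspace \<Delta> X" "\<phi> ` X = pts U" "X \<subseteq> points \<Delta>" "proj_dim \<Delta> X = int k - 1"
    using singular_from_model[OF U(1,2)] .
  show "\<exists>X. singular_subspace \<Delta> X \<and> proj_dim \<Delta> X = int k - 1 \<and> opposite_subspaces \<Delta> X (\<theta> ` X)"
    using X opposite_iff[OF U(1) X(2,3)] U by blast
qed

end

section \<open>The fixed structure as a polar space over the quadratic extension\<close>

locale polar_model_lift = polar_model + polg +
  assumes lift: "z \<in> S \<Longrightarrow> z \<noteq> \<^bold>0 \<Longrightarrow> t z \<in> pspan R M (g z)"
begin

lemma T_g: "z \<in> S \<Longrightarrow> z \<noteq> \<^bold>0 \<Longrightarrow> T (pspan R M z) = pspan R M (g z)"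
  using lift t pspan_eq[of "t z" "g z"] by simp

lemma fixed_iff:
  assumes U: "tsub U" and X: "\<phi> ` X = pts U" "X \<subseteq> points \<Delta>"
  shows "\<theta> ` X = X \<longleftrightarrow> (\<forall>u\<in>U. g u \<in> U)"
proof -
  have tX: "\<theta> ` X \<subseteq> points \<Delta>" using X C.points_image by blast
  have "\<phi> ` \<theta> ` X = (\<lambda>x. T (\<phi> x)) ` X" unfolding image_image using T_phi X by (intro image_cong) auto
  then have "\<phi> ` \<theta> ` X = T ` pts U" using X by (simp add: image_image[symmetric])
  then have eq: "\<theta> ` X = X \<longleftrightarrow> T ` pts U = pts U" using D.image_eq_iff[OF tX X(2)] X by simp
  note UD = tsubD[OF U] and US = subspD[OF tsubD(1)[OF U]]
  show ?thesis unfolding eq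
  proof
    assume e: "T ` pts U = pts U"
    show "\<forall>u\<in>U. g u \<in> U"
    proof
      fix u assume u: "u \<in> U"
      show "g u \<in> U"
      proof (cases "u = \<^bold>0")
        case False
        have "pspan R M u \<in> pts U" using u False by (auto simp: pts_def)
        then have "pspan R M (g u) \<in> pts U" using e T_g[of u] UD(2)[OF u] False by (metis imageI)
        then show ?thesis using pts_iff[OF UD(1)] g_nonzero False UD(4)[OF u] by simp
      qed (use u in simp)
    qed
  next
    assume gU: "\<forall>u\<in>U. g u \<in> U"
    show "T ` pts U = pts U"
    proof
      show "T ` pts U \<subseteq> pts U"
        using T_g UD gU g_nonzero by (auto simp: pts_def)
      show "pts U \<subseteq> T ` pts U"
      proof
        fix y assume "y \<in> pts U"
        then obtain u where u: "u \<in> U" "u \<noteq> \<^bold>0" "y = pspan R M u" by (auto simp: pts_def)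
        \<comment> \<open>The preimage of \<open>u\<close> under \<open>g\<close>, from
          \<open>g_inverse\<close>; it stays in \<open>U\<close> because \<open>U\<close> is
          invariant.\<close>
        let ?w = "inv \<kappa> \<^bold>* (g u \<^bold>+ \<ominus> \<mu> \<^bold>* u)"
        have w: "?w \<in> U" using US u gU \<kappa>_nonzero by simp
        have gw: "g ?w = u" using g_inverse UD u by blast
        then have w0: "?w \<noteq> \<^bold>0" using u g_zero by metis
        have "T (pspan R M ?w) = y" using T_g[OF UD(2)[OF w] w0] gw u by simp
        then show "y \<in> T ` pts U" using w w0 unfolding pts_def by blast
      qed
    qed
  qed
qed

text \<open>The set of vectors on the line \<open>l\<close>. For a fixed line this is a
  \<open>g\<close>-invariant plane, that is, a point over the quadratic extension.\<close>

definition \<chi> where "\<chi> l = \<Union> (\<phi> ` l)"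

lemma Union_pts: assumes "subsp U" "u \<in> U" "u \<noteq> \<^bold>0" shows "\<Union> (pts U) = U"
proof (intro equalityI subsetI)
  fix x assume "x \<in> \<Union> (pts U)"
  then show "x \<in> U" using pspan_subset[OF assms(1)] by (auto simp: pts_def)
next
  fix x assume x: "x \<in> U"
  show "x \<in> \<Union> (pts U)"
  proof (cases "x = \<^bold>0")
    case True
    have "\<^bold>0 \<in> pspan R M u" using subspD(3)[OF subsp_pspan] subspD(2)[OF assms(1,2)] by blast
    then show ?thesis using True assms by (auto simp: pts_def)
  next
    case False then show ?thesis using x pspan_self subspD(2)[OF assms(1) x] by (auto simp: pts_def)
  qed
qed

lemma fixed_line_model:
  assumes l: "l \<in> fixed_lines \<Delta> \<theta>"
  obtains v where "v \<in> S" "v \<noteq> \<^bold>0" "\<phi> ` l = pts (span2 v (g v))" "\<chi> l = span2 v (g v)" "l \<subseteq> points \<Delta>"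
proof -
  have lb: "l \<in> blocks \<Delta>" "\<theta> ` l = l" using l by (auto simp: fixed_lines_def)
  then have sub: "l \<subseteq> points \<Delta>" using blocks_Delta by blast
  have "\<phi> ` l \<in> blocks geo" using D.block_iff[OF sub] lb by blast
  then obtain U where U: "tsub U" "dim 2 U" "\<phi> ` l = pts U" by (auto simp: geo_simps)
  have gU: "\<forall>u\<in>U. g u \<in> U" using fixed_iff[OF U(1,3) sub] lb by blast
  obtain v where v: "v \<in> U" "v \<noteq> \<^bold>0" using dim_less[of 0 "{\<^bold>0}" 2 U] U by auto
  have vc: "v \<in> carrier M" "v \<in> S" using tsubD[OF U(1)] v by auto
  have Ue: "U = span2 v (g v)" using dim_2_span2[OF U(2) v(1) _ v(2) g_pspan[OF vc(1) v(2)]] gU v by blast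
  have "\<chi> l = U" unfolding \<chi>_def U(3) using Union_pts tsubD(1)[OF U(1)] v by blast
  then show ?thesis using that[OF vc(2) v(2)] U Ue sub by simp
qed

lemma chi_points: "l \<in> fixed_lines \<Delta> \<theta> \<Longrightarrow> \<phi> ` l = pts (\<chi> l)"
  using fixed_line_model[of l] by metis

lemma LP_points: "points LP.geo = {span2 v (g v) | v. v \<in> S \<and> v \<noteq> \<^bold>0}"
  unfolding LP.geo_simps LP.pts_def using L_pspan by (auto simp: image_def)

lemma chi_bij: "bij_betw \<chi> (fixed_lines \<Delta> \<theta>) (points LP.geo)"
proof (rule bij_betw_imageI)
  show "inj_on \<chi> (fixed_lines \<Delta> \<theta>)"
  proof (rule inj_onI)
    fix l l' assume l: "l \<in> fixed_lines \<Delta> \<theta>" "l' \<in> fixed_lines \<Delta> \<theta>" "\<chi> l = \<chi> l'"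
    have "l \<subseteq> points \<Delta>" "l' \<subseteq> points \<Delta>" using fixed_line_model l by metis+
    then show "l = l'" using D.image_eq_iff chi_points l by metis
  qed
  show "\<chi> ` fixed_lines \<Delta> \<theta> = points LP.geo"
  proof (intro equalityI subsetI)
    fix p assume "p \<in> \<chi> ` fixed_lines \<Delta> \<theta>"
    then obtain l where l: "l \<in> fixed_lines \<Delta> \<theta>" "p = \<chi> l" by blast
    obtain v where "v \<in> S" "v \<noteq> \<^bold>0" "\<phi> ` l = pts (span2 v (g v))" "\<chi> l = span2 v (g v)" "l \<subseteq> points \<Delta>"
      using fixed_line_model[OF l(1)] .
    then show "p \<in> points LP.geo" unfolding LP_points l(2) by auto
  next
    fix p assume "p \<in> points LP.geo"
    then obtain v where v: "v \<in> S" "v \<noteq> \<^bold>0" "p = span2 v (g v)" unfolding LP_points by auto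
    have vc: "v \<in> carrier M" using v by simp
    have gS: "g v \<in> S" "v \<perp> g v" using g_S g_orth v by blast+
    have b: "pts p \<in> blocks geo" using block_span2[OF v(1) gS v(2) g_pspan[OF vc v(2)]] v by simp
    then have "pts p \<subseteq> points geo" using blocks_geo by blast
    then obtain l where l: "l \<subseteq> points \<Delta>" "pts p = \<phi> ` l" using D.surjE by blast
    have "l \<in> blocks \<Delta>" using D.block_iff[OF l(1)] b l by simp
    moreover have "tsub p" using tsub_span2[OF v(1) gS] v by simp
    then have "\<theta> ` l = l" using fixed_iff[of p l] l v span2_g_inv[OF vc] by simp
    moreover have "\<chi> l = p" unfolding \<chi>_def l(2)[symmetric]
      using Union_pts[OF subsp_span2[OF vc g_closed[OF vc]] span2_gen(1)[OF vc g_closed[OF vc]] v(2)] v(3) by simp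
    ultimately show "p \<in> \<chi> ` fixed_lines \<Delta> \<theta>" by (auto simp: fixed_lines_def)
  qed
qed

text \<open>The points are the fixed lines themselves and not subspaces of vectors, which makes
  \<open>singular_geometry \<Gamma>\<close> equal to the fixed structure and not merely isomorphic
  to it. The lines are pulled back along \<open>\<chi>\<close>.\<close>

definition \<Gamma> where
  "\<Gamma> = \<lparr>points = fixed_lines \<Delta> \<theta>, blocks = {b. b \<subseteq> fixed_lines \<Delta> \<theta> \<and> \<chi> ` b \<in> blocks LP.geo}\<rparr>"

lemma Gamma_points: "points \<Gamma> = fixed_lines \<Delta> \<theta>" by (simp add: \<Gamma>_def)

lemma Gamma_blocks: "blocks \<Gamma> \<subseteq> Pow (points \<Gamma>)" by (auto simp: \<Gamma>_def)

lemma chi_iso: "geometry_iso \<chi> \<Gamma> LP.geo"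
proof -
  have "b \<in> (\<lambda>b. \<chi> ` b) ` blocks \<Gamma>" if "b \<in> blocks LP.geo" for b
  proof -
    have "b \<subseteq> \<chi> ` fixed_lines \<Delta> \<theta>" using LP.blocks_geo that chi_bij by (auto simp: bij_betw_def)
    then obtain c where "c \<subseteq> fixed_lines \<Delta> \<theta>" "b = \<chi> ` c" by (meson subset_imageE)
    then show ?thesis using that by (auto simp: \<Gamma>_def)
  qed
  then have "(\<lambda>b. \<chi> ` b) ` blocks \<Gamma> = blocks LP.geo" by (auto simp: \<Gamma>_def)
  then show ?thesis using chi_bij by (simp add: geometry_iso_def Gamma_points)
qed

lemma line_subset_iff:
  assumes U: "tsub U" "\<forall>u\<in>U. g u \<in> U" and X: "\<phi> ` X = pts U" "X \<subseteq> points \<Delta>" and l: "l \<in> fixed_lines \<Delta> \<theta>"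
  shows "l \<subseteq> X \<longleftrightarrow> \<chi> l \<in> LP.pts U"
proof -
  obtain v where v: "v \<in> S" "v \<noteq> \<^bold>0" "\<phi> ` l = pts (span2 v (g v))" "\<chi> l = span2 v (g v)" "l \<subseteq> points \<Delta>"
    using fixed_line_model[OF l] .
  have vc: "v \<in> carrier M" "subsp (span2 v (g v))" using v by auto
  have "l \<subseteq> X \<longleftrightarrow> pts (span2 v (g v)) \<subseteq> pts U" using D.image_subset_iff'[OF v(5) X(2)] v X by simp
  also have "\<dots> \<longleftrightarrow> span2 v (g v) \<subseteq> U" using pts_subset_iff[OF vc(2) tsubD(1)[OF U(1)]] .
  also have "\<dots> \<longleftrightarrow> v \<in> U" using span2_gen[of v "g v"] span2_least[OF tsubD(1)[OF U(1)]] vc U by auto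
  also have "\<dots> \<longleftrightarrow> \<chi> l \<in> LP.pts U"
    using LP.pts_iff[of U v] L_subsp_iff[of U] U tsubD(1)[OF U(1)] v vc L_pspan by simp
  finally show ?thesis .
qed

text \<open>Fixed singular subspaces are the \<open>g\<close>-invariant singular ones by
  \<open>fixed_iff\<close>, and these are the singular subspaces over the extension by
  \<open>L_tsub_iff\<close>. By \<open>line_subset_iff\<close> the fixed lines inside such a
  subspace are its points over the extension.\<close>

lemma fixed_structure_Gamma: "fixed_structure \<Delta> \<theta> = singular_geometry \<Gamma>"
proof -
  interpret G: giso \<chi> \<Gamma> LP.geo using chi_iso Gamma_blocks by (simp add: giso_def)
  let ?F = "fixed_lines \<Delta> \<theta>"
  have sing: "A = {l \<in> ?F. \<chi> l \<in> LP.pts U} \<Longrightarrow> LP.tsub U \<Longrightarrow> singular_subspace \<Gamma> A" for A U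
  proof -
    assume A: "A = {l \<in> ?F. \<chi> l \<in> LP.pts U}" and U: "LP.tsub U"
    have "LP.pts U \<subseteq> \<chi> ` ?F" using LP.pts_mono[of U S] U LP.tsubD(2) chi_bij by (auto simp: bij_betw_def LP.geo_simps)
    then have "\<chi> ` A = LP.pts U" using A by auto
    then show "singular_subspace \<Gamma> A" using G.singular_iff[of A] A LP.singular_geo U by (auto simp: Gamma_points)
  qed
  have "(\<exists>X. A = {l \<in> ?F. l \<subseteq> X} \<and> singular_subspace \<Delta> X \<and> \<theta> ` X = X) \<longleftrightarrow> singular_subspace \<Gamma> A" for A
  proof
    assume "\<exists>X. A = {l \<in> ?F. l \<subseteq> X} \<and> singular_subspace \<Delta> X \<and> \<theta> ` X = X"
    then obtain X where X: "A = {l \<in> ?F. l \<subseteq> X}" "singular_subspace \<Delta> X" "\<theta> ` X = X" by blast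
    obtain U k where U: "tsub U" "dim k U" "\<phi> ` X = pts U" "X \<subseteq> points \<Delta>" using singular_model[OF X(2)] by metis
    have gU: "\<forall>u\<in>U. g u \<in> U" using fixed_iff[OF U(1,3,4)] X by blast
    have "A = {l \<in> ?F. \<chi> l \<in> LP.pts U}" using X(1) line_subset_iff[OF U(1) gU U(3,4)] by blast
    then show "singular_subspace \<Gamma> A" using sing L_tsub_iff U gU by blast
  next
    assume A: "singular_subspace \<Gamma> A"
    then have AF: "A \<subseteq> ?F" by (simp add: singular_subspace_def geom_subspace_def Gamma_points)
    then obtain U where U: "LP.tsub U" "\<chi> ` A = LP.pts U"
      using G.singular_iff[of A] A LP.singular_geo by (auto simp: Gamma_points)
    then have U': "tsub U" "\<forall>u\<in>U. g u \<in> U" using L_tsub_iff by auto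
    obtain k where k: "dim k U" using fin_dim tsubD(1)[OF U'(1)] by blast
    obtain X where X: "singular_subspace \<Delta> X" "\<phi> ` X = pts U" "X \<subseteq> points \<Delta>" using singular_from_model[OF U'(1) k] by metis
    have "\<chi> l \<in> LP.pts U \<longleftrightarrow> l \<in> A" if "l \<in> ?F" for l
      unfolding U(2)[symmetric] using G.mem_image_iff[of l A] that AF by (simp add: Gamma_points)
    then have "A = {l \<in> ?F. l \<subseteq> X}" using line_subset_iff[OF U' X(2,3)] AF by blast
    moreover have "\<theta> ` X = X" using fixed_iff[OF U'(1) X(2,3)] U' by blast
    ultimately show "\<exists>X. A = {l \<in> ?F. l \<subseteq> X} \<and> singular_subspace \<Delta> X \<and> \<theta> ` X = X" using X by blast
  qed
  then show ?thesis by (simp add: fixed_structure_def singular_geometry_def Gamma_points)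
qed

lemma Gamma_polar_space: "n = 2 * m \<Longrightarrow> polar_space m \<Gamma>"
  using giso.polar_space_transport[of \<chi> \<Gamma> LP.geo m] L_polar_space chi_iso Gamma_blocks by (simp add: giso_def)

end

section \<open>Coordinates\<close>

lemma coord_simps [simp]:
  "carrier (coord_space R I) = I \<rightarrow>\<^sub>E carrier R" "zero (coord_space R I) = (\<lambda>i\<in>I. \<zero>\<^bsub>R\<^esub>)"
  "add (coord_space R I) = (\<lambda>u v. \<lambda>i\<in>I. u i \<oplus>\<^bsub>R\<^esub> v i)"
  "smult (coord_space R I) = (\<lambda>c v. \<lambda>i\<in>I. c \<otimes>\<^bsub>R\<^esub> v i)"
  by (simp_all add: coord_space_def)

lemma coord_vspace: "field R \<Longrightarrow> vspace R (coord_space R I)"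
  using coord_space_module[of R I] by (simp add: vspace_def field_def domain_def)

lemma dim_coord_subspace:
  assumes "field R" "finite J" "J \<subseteq> I"
  shows "vspace.dimx R (coord_space R I) {\<zero>\<^bsub>coord_space R I\<^esub>} (card J)
    {v \<in> I \<rightarrow>\<^sub>E carrier R. \<forall>i\<in>I - J. v i = \<zero>\<^bsub>R\<^esub>}"
proof -
  let ?C = "coord_space R I"
  interpret V: vspace R ?C using coord_vspace assms by blast
  have R0: "\<zero>\<^bsub>R\<^esub> \<in> carrier R" "\<one>\<^bsub>R\<^esub> \<in> carrier R" by auto
  let ?W = "\<lambda>J. {v \<in> I \<rightarrow>\<^sub>E carrier R. \<forall>i\<in>I - J. v i = \<zero>\<^bsub>R\<^esub>}"
  show ?thesis using assms(2,3)
  proof (induction J rule: finite_induct)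
    case empty
    have "?W {} = {\<zero>\<^bsub>?C\<^esub>}" by (auto simp: fun_eq_iff PiE_iff extensional_def)
    then show ?case unfolding card.empty V.dimx_0_iff .
  next
    case (insert j J)
    let ?e = "\<lambda>i\<in>I. if i = j then \<one>\<^bsub>R\<^esub> else \<zero>\<^bsub>R\<^esub>"
    have e: "?e \<in> carrier ?C" by auto
    have ne: "?e \<notin> ?W J" using insert by auto
    have "V.ext (?W J) ?e = ?W (insert j J)"
    proof (intro equalityI subsetI)
      fix v assume "v \<in> V.ext (?W J) ?e"
      then obtain w a where w: "w \<in> ?W J" "a \<in> carrier R" "v = w \<oplus>\<^bsub>?C\<^esub> a \<odot>\<^bsub>?C\<^esub> ?e" by (meson V.extE)
      have "v \<in> carrier ?C" using w e by (auto simp: PiE_iff)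
      moreover have "v i = \<zero>\<^bsub>R\<^esub>" if "i \<in> I - insert j J" for i using that w by simp
      ultimately show "v \<in> ?W (insert j J)" by simp
    next
      fix v assume v: "v \<in> ?W (insert j J)"
      let ?w = "\<lambda>i\<in>I. if i = j then \<zero>\<^bsub>R\<^esub> else v i"
      have w: "?w \<in> ?W J" using v by (auto simp: PiE_iff)
      have vj: "v j \<in> carrier R" using v insert by (auto simp: PiE_iff)
      have "v = ?w \<oplus>\<^bsub>?C\<^esub> v j \<odot>\<^bsub>?C\<^esub> ?e"
        using v insert by (auto simp: fun_eq_iff PiE_iff extensional_def)
      then show "v \<in> V.ext (?W J) ?e" using V.extI[OF w vj, of ?e] by (simp only:)
    qed
    then show ?case using V.dimx_Suc[OF insert.IH e ne] insert by simp
  qed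
qed

lemma dim_coord:
  assumes "field R" "finite I"
  shows "vspace.dimx R (coord_space R I) {\<zero>\<^bsub>coord_space R I\<^esub>} (card I) (carrier (coord_space R I))"
  using dim_coord_subspace[OF assms subset_refl] by simp

text \<open>The index set is left free, since the symplectic spaces are indexed from 1 and the
  Hermitian ones from 0.\<close>

definition coord_map ::
  "('a, 'b) ring_scheme \<Rightarrow> int set \<Rightarrow> ('a, 'c, 'd) module_scheme \<Rightarrow> 'c set \<Rightarrow> ((int \<Rightarrow> 'a) \<Rightarrow> 'c) \<Rightarrow> bool" where
  "coord_map R J M W \<psi> \<longleftrightarrow> bij_betw \<psi> (J \<rightarrow>\<^sub>E carrier R) W \<and>
     (\<forall>u\<in>J \<rightarrow>\<^sub>E carrier R. \<forall>v\<in>J \<rightarrow>\<^sub>E carrier R. \<psi> (u \<oplus>\<^bsub>coord_space R J\<^esub> v) = \<psi> u \<oplus>\<^bsub>M\<^esub> \<psi> v) \<and>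
     (\<forall>c\<in>carrier R. \<forall>u\<in>J \<rightarrow>\<^sub>E carrier R. \<psi> (c \<odot>\<^bsub>coord_space R J\<^esub> u) = c \<odot>\<^bsub>M\<^esub> \<psi> u)"

context vspace begin

lemma coord_map_ex:
  assumes "dim k W" "finite J" "card J = k" shows "\<exists>\<psi>. coord_map R J M W \<psi>"
  using assms
proof (induction arbitrary: J rule: dimx.induct)
  case dimx_0
  then have "J = {}" by simp
  then show ?case by (intro exI[of _ "\<lambda>_. \<^bold>0"]) (simp add: coord_map_def bij_betw_def)
next
  case (dimx_Suc k W v)
  have W: "subsp W" using dim_subsp dimx_Suc.hyps(1) .
  note v = dimx_Suc.hyps(2,3)
  have "J \<noteq> {}" using dimx_Suc.prems by auto
  then obtain j where j: "j \<in> J" by blast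
  let ?J = "J - {j}"
  have "finite ?J" "card ?J = k" using dimx_Suc.prems j by auto
  then obtain \<psi> where \<psi>: "coord_map R ?J M W \<psi>" using dimx_Suc.IH by blast
  let ?P = "?J \<rightarrow>\<^sub>E carrier R" and ?Q = "J \<rightarrow>\<^sub>E carrier R"
  have \<psi>D: "bij_betw \<psi> ?P W" "\<And>u w. u \<in> ?P \<Longrightarrow> w \<in> ?P \<Longrightarrow> \<psi> (\<lambda>i\<in>?J. u i \<oplus> w i) = \<psi> u \<^bold>+ \<psi> w"
    "\<And>c u. c \<in> carrier R \<Longrightarrow> u \<in> ?P \<Longrightarrow> \<psi> (\<lambda>i\<in>?J. c \<otimes> u i) = c \<^bold>* \<psi> u"
    using \<psi> by (simp_all add: coord_map_def)
  have res: "restrict u ?J \<in> ?P" "u j \<in> carrier R" if "u \<in> ?Q" for u using that j by (auto simp: PiE_iff)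
  have \<psi>W: "\<psi> u \<in> W" "\<psi> u \<in> carrier M" if "u \<in> ?P" for u
    using \<psi>D(1) that subspD(2)[OF W] by (auto simp: bij_betw_def)
  let ?\<psi> = "\<lambda>u. \<psi> (restrict u ?J) \<^bold>+ u j \<^bold>* v"
  have "bij_betw ?\<psi> ?Q (ext W v)"
  proof (rule bij_betw_imageI)
    show "inj_on ?\<psi> ?Q"
    proof (rule inj_onI)
      fix u w assume u: "u \<in> ?Q" and w: "w \<in> ?Q" and e: "?\<psi> u = ?\<psi> w"
      have "\<psi> (restrict u ?J) = \<psi> (restrict w ?J) \<and> u j = w j"
        using ext_unique[OF W v \<psi>W(1)[OF res(1)[OF u]] \<psi>W(1)[OF res(1)[OF w]] res(2)[OF u] res(2)[OF w] e] .
      then have r: "restrict u ?J = restrict w ?J" "u j = w j"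
        using inj_onD[OF bij_betw_imp_inj_on[OF \<psi>D(1)] _ res(1)[OF u] res(1)[OF w]] by auto
      show "u = w"
      proof
        fix i show "u i = w i"
        proof (cases "i \<in> ?J")
          case True then show ?thesis using fun_cong[OF r(1), of i] by simp
        next
          case False then show ?thesis using r(2) u w by (cases "i = j") (auto simp: PiE_iff extensional_def)
        qed
      qed
    qed
    show "?\<psi> ` ?Q = ext W v"
    proof (intro equalityI subsetI)
      fix x assume "x \<in> ?\<psi> ` ?Q"
      then obtain u where u: "u \<in> ?Q" "x = ?\<psi> u" by blast
      then show "x \<in> ext W v" using extI[OF \<psi>W(1)[OF res(1)[OF u(1)]] res(2)[OF u(1)]] by simp
    next
      fix x assume "x \<in> ext W v"
      then obtain w a where w: "w \<in> W" "a \<in> carrier R" "x = w \<^bold>+ a \<^bold>* v" by (meson extE)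
      obtain u where u: "u \<in> ?P" "w = \<psi> u" using w \<psi>D(1) by (auto simp: bij_betw_def)
      let ?u = "\<lambda>i\<in>J. if i = j then a else u i"
      have "?u \<in> ?Q" using u w j by (auto simp: PiE_iff)
      moreover have "restrict ?u ?J = u" using u by (auto simp: fun_eq_iff PiE_iff extensional_def)
      then have "?\<psi> ?u = x" using u w j by simp
      ultimately show "x \<in> ?\<psi> ` ?Q" by (metis (no_types, lifting) imageI)
    qed
  qed
  moreover have "?\<psi> (\<lambda>i\<in>J. u i \<oplus> w i) = ?\<psi> u \<^bold>+ ?\<psi> w" if u: "u \<in> ?Q" and w: "w \<in> ?Q" for u w
  proof -
    have "restrict (\<lambda>i\<in>J. u i \<oplus> w i) ?J = (\<lambda>i\<in>?J. restrict u ?J i \<oplus> restrict w ?J i)" by (auto simp: fun_eq_iff)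
    then have "\<psi> (restrict (\<lambda>i\<in>J. u i \<oplus> w i) ?J) = \<psi> (restrict u ?J) \<^bold>+ \<psi> (restrict w ?J)"
      using \<psi>D(2)[OF res(1)[OF u] res(1)[OF w]] by simp
    then show ?thesis using \<psi>W(2)[OF res(1)] res(2) u w v j by (simp add: smult_l_distr M.a_ac)
  qed
  moreover have "?\<psi> (\<lambda>i\<in>J. c \<otimes> u i) = c \<^bold>* ?\<psi> u" if c: "c \<in> carrier R" and u: "u \<in> ?Q" for c u
  proof -
    have "restrict (\<lambda>i\<in>J. c \<otimes> u i) ?J = (\<lambda>i\<in>?J. c \<otimes> restrict u ?J i)" by (auto simp: fun_eq_iff)
    then have "\<psi> (restrict (\<lambda>i\<in>J. c \<otimes> u i) ?J) = c \<^bold>* \<psi> (restrict u ?J)"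
      using \<psi>D(3)[OF c res(1)[OF u]] by simp
    then show ?thesis using \<psi>W(2)[OF res(1)] res(2) u c v j by (simp add: smult_r_distr smult_assoc1)
  qed
  ultimately have "coord_map R J M (ext W v) ?\<psi>" by (simp add: coord_map_def)
  then show ?case by blast
qed

subsection \<open>Projective lines\<close>

definition all_pts where "all_pts U = pspan R M ` (U - {\<^bold>0})"

lemma pg_points_eq: "pg_points R M = all_pts (carrier M)"
  by (simp add: pg_points_def all_pts_def)

lemma pspan_set_add:
  assumes "u \<in> carrier M" "v \<in> carrier M" shows "pspan R M u <+>\<^bsub>M\<^esub> pspan R M v = span2 u v"
proof (intro equalityI subsetI)
  fix x
  { assume "x \<in> pspan R M u <+>\<^bsub>M\<^esub> pspan R M v" then obtain p q where "p \<in> pspan R M u" "q \<in> pspan R M v" "x = p \<^bold>+ q" unfolding set_add_mem by blast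
    then show "x \<in> span2 u v" unfolding span2_iff pspan_iff by blast }
  { assume "x \<in> span2 u v"
    then obtain a b where "a \<in> carrier R" "b \<in> carrier R" "x = a \<^bold>* u \<^bold>+ b \<^bold>* v" by (auto simp: span2_iff)
    moreover then have "a \<^bold>* u \<in> pspan R M u" "b \<^bold>* v \<in> pspan R M v" by (auto simp: pspan_def)
    ultimately show "x \<in> pspan R M u <+>\<^bsub>M\<^esub> pspan R M v" unfolding set_add_mem by blast }
qed

lemma pg_lines_eq: "pg_lines R M = {all_pts U | U. dim 2 U}"
proof -
  have *: "{p \<in> pg_points R M. p \<subseteq> U} = all_pts U" if U: "subsp U" for U
    using pspan_subset[OF U] pspan_self subspD(2)[OF U] unfolding pg_points_eq all_pts_def by blast
  show ?thesis
  proof (intro equalityI subsetI)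
    fix l assume "l \<in> pg_lines R M"
    then obtain u v where uv: "u \<in> carrier M" "v \<in> carrier M" "u \<noteq> \<^bold>0" "v \<noteq> \<^bold>0" "pspan R M u \<noteq> pspan R M v"
      "l = {p \<in> pg_points R M. p \<subseteq> pspan R M u <+>\<^bsub>M\<^esub> pspan R M v}"
      unfolding pg_lines_def pg_points_eq all_pts_def by blast
    have "v \<notin> pspan R M u" using pspan_eq uv by blast
    then have "dim 2 (span2 u v)" using dim_span2 uv by blast
    then show "l \<in> {all_pts U | U. dim 2 U}" using uv *[of "span2 u v"] pspan_set_add[of u v] subsp_span2 by auto
  next
    fix l assume "l \<in> {all_pts U | U. dim 2 U}"
    then obtain U where U: "dim 2 U" "l = all_pts U" by blast
    obtain u v where uv: "u \<in> carrier M" "v \<in> carrier M" "u \<noteq> \<^bold>0" "v \<notin> pspan R M u" "U = span2 u v"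
      using dim_2E[OF U(1)] .
    have v0: "v \<noteq> \<^bold>0" using uv subspD(3)[OF subsp_pspan[OF uv(1)]] by blast
    have ne: "pspan R M u \<noteq> pspan R M v" using uv pspan_self[of v] by blast
    have "l = {p \<in> pg_points R M. p \<subseteq> pspan R M u <+>\<^bsub>M\<^esub> pspan R M v}"
      using U(2) uv *[of U] dim_subsp[OF U(1)] pspan_set_add[of u v] by simp
    moreover have "pspan R M u \<in> pg_points R M" "pspan R M v \<in> pg_points R M"
      using uv v0 by (auto simp: pg_points_def)
    ultimately show "l \<in> pg_lines R M" using ne unfolding pg_lines_def by blast
  qed
qed

lemma Union_all_pts: assumes "dim 2 U" shows "\<Union> (all_pts U) = U"
proof (intro equalityI subsetI)
  have U: "subsp U" using dim_subsp[OF assms] .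
  fix x
  { assume "x \<in> \<Union> (all_pts U)" then show "x \<in> U" using pspan_subset[OF U] by (auto simp: all_pts_def) }
  { assume x: "x \<in> U"
    obtain u where u: "u \<in> U" "u \<noteq> \<^bold>0" using dim_less[of 0 "{\<^bold>0}" 2 U] assms by auto
    show "x \<in> \<Union> (all_pts U)"
    proof (cases "x = \<^bold>0")
      case True
      have "\<^bold>0 \<in> pspan R M u" using subspD(3)[OF subsp_pspan] subspD(2)[OF U u(1)] by blast
      then show ?thesis using True u by (auto simp: all_pts_def)
    next
      case False then show ?thesis using x pspan_self subspD(2)[OF U x] by (auto simp: all_pts_def)
    qed }
qed

lemma isotropic_blocks:
  "blocks (isotropic_geometry R M f) = {all_pts U | U. dim 2 U \<and> (\<forall>u\<in>U. \<forall>v\<in>U. f u v = \<zero>)}"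
proof -
  have "(\<forall>u\<in>\<Union> (all_pts U). \<forall>v\<in>\<Union> (all_pts U). f u v = \<zero>) \<longleftrightarrow> (\<forall>u\<in>U. \<forall>v\<in>U. f u v = \<zero>)" if "dim 2 U" for U
    by (simp only: Union_all_pts[OF that])
  then show ?thesis unfolding isotropic_geometry_def geometry.simps pg_lines_eq by blast
qed

lemma dim_image:
  fixes C :: "('a, 'e, 'f) module_scheme"
  assumes C: "vspace R C" and \<psi>: "bij_betw \<psi> (carrier C) (carrier M)"
    and lin: "\<And>u v. u \<in> carrier C \<Longrightarrow> v \<in> carrier C \<Longrightarrow> \<psi> (u \<oplus>\<^bsub>C\<^esub> v) = \<psi> u \<^bold>+ \<psi> v"
      "\<And>c u. c \<in> carrier R \<Longrightarrow> u \<in> carrier C \<Longrightarrow> \<psi> (c \<odot>\<^bsub>C\<^esub> u) = c \<^bold>* \<psi> u"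
    and d: "vspace.dimx R C {\<zero>\<^bsub>C\<^esub>} k U"
  shows "dim k (\<psi> ` U)"
proof -
  interpret C: vspace R C by fact
  have c: "\<psi> u \<in> carrier M" if "u \<in> carrier C" for u using \<psi> that by (auto simp: bij_betw_def)
  have z: "\<psi> \<zero>\<^bsub>C\<^esub> = \<^bold>0" using lin(2)[of \<zero> "\<zero>\<^bsub>C\<^esub>"] c[of "\<zero>\<^bsub>C\<^esub>"] by simp
  show ?thesis using d
  proof (induction rule: C.dimx.induct)
    case dimx_0 then show ?case using z by simp
  next
    case (dimx_Suc k W v)
    have W: "W \<subseteq> carrier C" using C.subspD(1)[OF C.dim_subsp[OF dimx_Suc.hyps(1)]] .
    have "\<psi> v \<notin> \<psi> ` W" using \<psi> dimx_Suc.hyps W by (auto simp: bij_betw_def dest: inj_onD)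
    moreover have "\<psi> ` C.ext W v = ext (\<psi> ` W) (\<psi> v)"
    proof (intro equalityI subsetI)
      fix x assume "x \<in> \<psi> ` C.ext W v"
      then obtain w a where w: "w \<in> W" "a \<in> carrier R" "x = \<psi> (w \<oplus>\<^bsub>C\<^esub> a \<odot>\<^bsub>C\<^esub> v)" by (auto simp: C.ext_def)
      then have "x = \<psi> w \<^bold>+ a \<^bold>* \<psi> v" using lin W dimx_Suc.hyps by auto
      then show "x \<in> ext (\<psi> ` W) (\<psi> v)" using w extI by blast
    next
      fix x assume "x \<in> ext (\<psi> ` W) (\<psi> v)"
      then obtain w a where w: "w \<in> W" "a \<in> carrier R" "x = \<psi> w \<^bold>+ a \<^bold>* \<psi> v" by (auto simp: ext_def)
      then have "x = \<psi> (w \<oplus>\<^bsub>C\<^esub> a \<odot>\<^bsub>C\<^esub> v)" using lin W dimx_Suc.hyps by auto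
      then show "x \<in> \<psi> ` C.ext W v" using w C.extI by blast
    qed
    ultimately show ?case using dimx.dimx_Suc[OF dimx_Suc.IH c] dimx_Suc.hyps by simp
  qed
qed

text \<open>The families of polar spaces are defined with coordinate spaces, while the space over
  the extension is the old group with a new scalar action; a coordinate map transfers its
  form.\<close>

lemma isotropic_geometry_iso:
  assumes \<psi>: "coord_map R J M (carrier M) \<psi>"
  shows "geometry_iso (\<lambda>x. \<psi> ` x) (isotropic_geometry R (coord_space R J) (\<lambda>u v. f (\<psi> u) (\<psi> v)))
    (isotropic_geometry R M f)"
proof -
  let ?C = "coord_space R J"
  let ?f = "\<lambda>u v. f (\<psi> u) (\<psi> v)"
  interpret C: vspace R ?C using coord_vspace R.field_axioms by blast
  have b: "bij_betw \<psi> (carrier ?C) (carrier M)"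
    and lin: "\<And>u v. u \<in> carrier ?C \<Longrightarrow> v \<in> carrier ?C \<Longrightarrow> \<psi> (u \<oplus>\<^bsub>?C\<^esub> v) = \<psi> u \<^bold>+ \<psi> v"
      "\<And>c u. c \<in> carrier R \<Longrightarrow> u \<in> carrier ?C \<Longrightarrow> \<psi> (c \<odot>\<^bsub>?C\<^esub> u) = c \<^bold>* \<psi> u"
    using \<psi> unfolding coord_map_def coord_simps(1) by blast+
  have inj: "inj_on \<psi> (carrier ?C)" and surj: "\<psi> ` carrier ?C = carrier M" using b by (auto simp: bij_betw_def)
  have z: "\<psi> \<zero>\<^bsub>?C\<^esub> = \<^bold>0" using lin(2)[of \<zero> "\<zero>\<^bsub>?C\<^esub>"] surj C.M.zero_closed by (metis C.smult_l_null R.zero_closed imageI smult_l_null)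
  have sp: "\<psi> ` pspan R ?C u = pspan R M (\<psi> u)" if "u \<in> carrier ?C" for u
  proof -
    have "\<psi> ` {c \<odot>\<^bsub>?C\<^esub> u | c. c \<in> carrier R} = (\<lambda>c. \<psi> (c \<odot>\<^bsub>?C\<^esub> u)) ` carrier R" by blast
    also have "\<dots> = (\<lambda>c. c \<^bold>* \<psi> u) ` carrier R" by (rule image_cong[OF refl]) (use lin(2) that in blast)
    finally show ?thesis unfolding pspan_def by blast
  qed
  have pt: "(\<lambda>x. \<psi> ` x) ` C.all_pts U = all_pts (\<psi> ` U)" if U: "U \<subseteq> carrier ?C" for U
  proof -
    have "(\<lambda>x. \<psi> ` x) ` C.all_pts U = (\<lambda>u. pspan R M (\<psi> u)) ` (U - {\<zero>\<^bsub>?C\<^esub>})"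
      unfolding C.all_pts_def image_image by (rule image_cong[OF refl]) (use sp U in blast)
    also have "\<dots> = pspan R M ` \<psi> ` (U - {\<zero>\<^bsub>?C\<^esub>})" by (simp add: image_image)
    also have "\<psi> ` (U - {\<zero>\<^bsub>?C\<^esub>}) = \<psi> ` U - {\<^bold>0}"
      using inj_on_image_set_diff[OF inj, of U "{\<zero>\<^bsub>?C\<^esub>}"] U z C.M.zero_closed by auto
    finally show ?thesis by (simp add: all_pts_def)
  qed
  have sub: "x \<subseteq> carrier ?C" if "x \<in> pg_points R ?C" for x
    using that C.subspD(1)[OF C.subsp_pspan] by (auto simp del: coord_simps simp: pg_points_def)
  have injI: "inj_on (\<lambda>x. \<psi> ` x) (pg_points R ?C)"
    by (rule inj_onI) (use inj_on_image_eq_iff[OF inj] sub in blast)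
  have P: "(\<lambda>x. \<psi> ` x) ` pg_points R ?C = pg_points R M"
    unfolding C.pg_points_eq pg_points_eq using pt[OF subset_refl] surj by simp
  have pts: "bij_betw (\<lambda>x. \<psi> ` x) (points (isotropic_geometry R ?C ?f)) (points (isotropic_geometry R M f))"
  proof (rule bij_betw_imageI)
    show "inj_on (\<lambda>x. \<psi> ` x) (points (isotropic_geometry R ?C ?f))"
      by (rule inj_on_subset[OF injI]) (auto simp: isotropic_geometry_def)
    show "(\<lambda>x. \<psi> ` x) ` points (isotropic_geometry R ?C ?f) = points (isotropic_geometry R M f)"
    proof (intro equalityI subsetI)
      fix y assume "y \<in> (\<lambda>x. \<psi> ` x) ` points (isotropic_geometry R ?C ?f)"
      then obtain x where x: "x \<in> pg_points R ?C" "\<forall>u\<in>x. \<forall>v\<in>x. ?f u v = \<zero>" "y = \<psi> ` x"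
        unfolding isotropic_geometry_def geometry.simps by blast
      then have "y \<in> pg_points R M" using P by blast
      then show "y \<in> points (isotropic_geometry R M f)"
        unfolding isotropic_geometry_def geometry.simps using x(2,3) by blast
    next
      fix y assume "y \<in> points (isotropic_geometry R M f)"
      then have y: "y \<in> pg_points R M" "\<forall>u\<in>y. \<forall>v\<in>y. f u v = \<zero>"
        unfolding isotropic_geometry_def geometry.simps by blast+
      then obtain x where x: "x \<in> pg_points R ?C" "y = \<psi> ` x" unfolding P[symmetric] by blast
      then show "y \<in> (\<lambda>x. \<psi> ` x) ` points (isotropic_geometry R ?C ?f)"
        unfolding isotropic_geometry_def geometry.simps using y(2) by blast
    qed
  qed
  have dU: "dim 2 (\<psi> ` U)" if "C.dim 2 U" for U using dim_image[OF C.vspace_axioms b lin that] .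
  have dW: "\<exists>U. C.dim 2 U \<and> W = \<psi> ` U" if W: "dim 2 W" for W
  proof -
    obtain u v where uv: "u \<in> carrier M" "v \<in> carrier M" "u \<noteq> \<^bold>0" "v \<notin> pspan R M u" "W = span2 u v" using dim_2E[OF W] .
    have "u \<in> \<psi> ` carrier ?C" "v \<in> \<psi> ` carrier ?C" unfolding surj by fact+
    then obtain u' v' where u': "u' \<in> carrier ?C" "\<psi> u' = u" "v' \<in> carrier ?C" "\<psi> v' = v" by blast
    have "v' \<notin> pspan R ?C u'" using uv(4) sp[OF u'(1)] u' by (metis imageI)
    moreover have "u' \<noteq> \<zero>\<^bsub>?C\<^esub>" using uv u' z by auto
    ultimately have d: "C.dim 2 (C.span2 u' v')" using C.dim_span2 u' by blast
    have "u \<in> \<psi> ` C.span2 u' v'" "v \<in> \<psi> ` C.span2 u' v'" using C.span2_gen[OF u'(1,3)] u' by blast+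
    then have "\<psi> ` C.span2 u' v' = W" using dim_2_span2[OF dU[OF d]] uv by metis
    then show ?thesis using d by blast
  qed
  have "(\<lambda>b. (\<lambda>x. \<psi> ` x) ` b) ` blocks (isotropic_geometry R ?C ?f) = blocks (isotropic_geometry R M f)"
  proof (intro equalityI subsetI)
    fix l assume "l \<in> (\<lambda>b. (\<lambda>x. \<psi> ` x) ` b) ` blocks (isotropic_geometry R ?C ?f)"
    then obtain U where U: "C.dim 2 U" "\<forall>u\<in>U. \<forall>v\<in>U. ?f u v = \<zero>" "l = (\<lambda>x. \<psi> ` x) ` C.all_pts U"
      unfolding C.isotropic_blocks by blast
    have "l = all_pts (\<psi> ` U)" using U pt C.subspD(1)[OF C.dim_subsp[OF U(1)]] by simp
    moreover have "\<forall>u\<in>\<psi> ` U. \<forall>v\<in>\<psi> ` U. f u v = \<zero>" using U(2) by blast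
    ultimately show "l \<in> blocks (isotropic_geometry R M f)"
      unfolding isotropic_blocks using dU[OF U(1)] by blast
  next
    fix l assume "l \<in> blocks (isotropic_geometry R M f)"
    then obtain W where W: "dim 2 W" "\<forall>u\<in>W. \<forall>v\<in>W. f u v = \<zero>" "l = all_pts W"
      unfolding isotropic_blocks by blast
    obtain U where U: "C.dim 2 U" "W = \<psi> ` U" using dW[OF W(1)] by blast
    have "l = (\<lambda>x. \<psi> ` x) ` C.all_pts U" using W U pt C.subspD(1)[OF C.dim_subsp[OF U(1)]] by simp
    moreover have "C.all_pts U \<in> blocks (isotropic_geometry R ?C ?f)"
      unfolding C.isotropic_blocks using U W by blast
    ultimately show "l \<in> (\<lambda>b. (\<lambda>x. \<psi> ` x) ` b) ` blocks (isotropic_geometry R ?C ?f)" by blast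
  qed
  then show ?thesis using pts by (simp add: geometry_iso_def)
qed

lemma isotropic_blocks_sub:
  "blocks (isotropic_geometry R M f) \<subseteq> Pow (points (isotropic_geometry R M f))"
proof -
  have "all_pts U \<subseteq> {x \<in> pg_points R M. \<forall>u\<in>x. \<forall>v\<in>x. f u v = \<zero>}"
    if "dim 2 U" "\<forall>u\<in>\<Union> (all_pts U). \<forall>v\<in>\<Union> (all_pts U). f u v = \<zero>" for U
    using that subspD(1)[OF dim_subsp[OF that(1)]] unfolding pg_points_eq by (auto simp: all_pts_def)
  then show ?thesis unfolding isotropic_geometry_def geometry.simps pg_lines_eq by blast
qed

end

section \<open>Polar spaces as isotropic geometries and quadrics\<close>

context pol begin

lemma pts_all_pts: "pts U = all_pts U" by (simp add: pts_def all_pts_def)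

text \<open>\<open>S\<close> may be smaller than the set of isotropic vectors of \<open>f\<close>;
  the mixed polar spaces arise in this way.\<close>

lemma geo_eq_induced:
  assumes orth: "\<And>u v. u \<in> carrier M \<Longrightarrow> v \<in> carrier M \<Longrightarrow> u \<perp> v \<longleftrightarrow> f u v = \<zero>"
  shows "geo = induced_geometry (isotropic_geometry R M f) (pts S)"
    "geom_subspace (isotropic_geometry R M f) (pts S)"
proof -
  have sub: "tsub U \<longleftrightarrow> (\<forall>u\<in>U. \<forall>v\<in>U. f u v = \<zero>) \<and> pts U \<subseteq> pts S" if U: "dim 2 U" for U
  proof -
    have c: "u \<in> carrier M" if "u \<in> U" for u using subspD(2)[OF dim_subsp[OF U] that] .
    have "pts U \<subseteq> pts S \<longleftrightarrow> U \<subseteq> S"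
    proof
      assume *: "pts U \<subseteq> pts S"
      show "U \<subseteq> S"
      proof
        fix u assume u: "u \<in> U"
        show "u \<in> S"
        proof (cases "u = \<^bold>0")
          case False
          then have "pspan R M u \<in> pts S" using * u by (auto simp: pts_def)
          then show ?thesis using pts_S_iff[OF c[OF u] False] by simp
        qed simp
      qed
    qed (rule pts_mono)
    then show ?thesis using dim_subsp[OF U] orth c by (auto simp: tsub_def)
  qed
  have bl: "{pts U | U. tsub U \<and> dim 2 U} = {l \<in> blocks (isotropic_geometry R M f). l \<subseteq> pts S}"
    unfolding isotropic_blocks pts_all_pts[symmetric] using sub by blast
  then show "geo = induced_geometry (isotropic_geometry R M f) (pts S)"
    by (simp add: geo_def induced_geometry_def)
  show "geom_subspace (isotropic_geometry R M f) (pts S)"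
    unfolding geom_subspace_def
  proof (intro conjI ballI impI)
    have "f x y = \<zero>" if "u \<in> S" "x \<in> pspan R M u" "y \<in> pspan R M u" for u x y
      using tsubD(3)[OF tsub_pspan[OF that(1)] that(2,3)] tsubD(4)[OF tsub_pspan[OF that(1)]] that(2,3) orth by blast
    then show "pts S \<subseteq> points (isotropic_geometry R M f)"
      unfolding isotropic_geometry_def geometry.simps pg_points_eq pts_all_pts by (auto simp: all_pts_def)
    fix l assume l: "l \<in> blocks (isotropic_geometry R M f)" "\<exists>x\<in>l \<inter> pts S. \<exists>y\<in>l \<inter> pts S. x \<noteq> y"
    obtain U where U: "dim 2 U" "l = pts U" "\<forall>u\<in>U. \<forall>v\<in>U. f u v = \<zero>"
      using l(1) unfolding isotropic_blocks pts_all_pts by blast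
    obtain u v where uv: "pspan R M u \<in> l" "pspan R M v \<in> l" "u \<in> S" "v \<in> S" "u \<noteq> \<^bold>0" "v \<noteq> \<^bold>0"
      "pspan R M u \<noteq> pspan R M v" using l(2) by (auto simp: pts_def)
    have "u \<in> U" "v \<in> U" using uv U pts_iff[OF dim_subsp[OF U(1)]] by auto
    moreover have "v \<notin> pspan R M u" using uv pspan_eq[of v u] by auto
    ultimately have Ue: "U = span2 u v" using dim_2_span2[OF U(1)] uv by blast
    have "u \<perp> v" using orth U(3) \<open>u \<in> U\<close> \<open>v \<in> U\<close> uv by simp
    then have "tsub U" using tsub_span2 uv Ue by simp
    then show "l \<subseteq> pts S" using U pts_mono tsubD(2) by blast
  qed
qed

lemma geo_eq_isotropic:
  assumes orth: "\<And>u v. u \<in> carrier M \<Longrightarrow> v \<in> carrier M \<Longrightarrow> u \<perp> v \<longleftrightarrow> f u v = \<zero>"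
    and S: "S = {v \<in> carrier M. f v v = \<zero>}"
  shows "geo = isotropic_geometry R M f"
proof -
  have "points (isotropic_geometry R M f) \<subseteq> pts S"
  proof
    fix x assume "x \<in> points (isotropic_geometry R M f)"
    then obtain u where u: "u \<in> carrier M" "u \<noteq> \<^bold>0" "x = pspan R M u" "\<forall>u\<in>x. \<forall>v\<in>x. f u v = \<zero>"
      unfolding isotropic_geometry_def geometry.simps pg_points_eq by (auto simp: all_pts_def)
    have "u \<in> S" using u pspan_self[of u] unfolding S by auto
    then show "x \<in> pts S" using u by (auto simp: pts_def)
  qed
  moreover have "pts S \<subseteq> points (isotropic_geometry R M f)"
    using geo_eq_induced(2)[of f] orth by (simp add: geom_subspace_def)
  ultimately have p: "points (isotropic_geometry R M f) = pts S" by blast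
  have "{l \<in> blocks (isotropic_geometry R M f). l \<subseteq> pts S} = blocks (isotropic_geometry R M f)"
    using isotropic_blocks_sub[of f] p by auto
  then show ?thesis using geo_eq_induced(1)[of f] orth p by (simp add: induced_geometry_def)
qed

text \<open>A line of the quadric is only known to consist of singular points. The assumption
  \<open>sum\<close> makes its vectors orthogonal to each other.\<close>

lemma geo_eq_quadric:
  assumes S: "S = {v \<in> carrier M. q v = \<zero>}"
    and sum: "\<And>u v. u \<in> S \<Longrightarrow> v \<in> S \<Longrightarrow> u \<^bold>+ v \<in> S \<Longrightarrow> u \<perp> v"
  shows "geo = quadric R M q"
proof -
  have pS: "{pspan R M v | v. v \<in> carrier M - {\<^bold>0} \<and> q v = \<zero>} = pts S"
    unfolding pts_def S by auto
  have "tsub U \<longleftrightarrow> pts U \<subseteq> pts S" if U: "dim 2 U" for U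
  proof
    assume "tsub U" then show "pts U \<subseteq> pts S" using pts_mono tsubD(2) by blast
  next
    note s = dim_subsp[OF U]
    assume *: "pts U \<subseteq> pts S"
    have US: "u \<in> S" if u: "u \<in> U" for u
    proof (cases "u = \<^bold>0")
      case False
      then have "pspan R M u \<in> pts S" using * u by (auto simp: pts_def)
      then show ?thesis using pts_S_iff[OF subspD(2)[OF s u] False] by simp
    qed simp
    then have "u \<perp> v" if "u \<in> U" "v \<in> U" for u v using sum subspD(4)[OF s] that by blast
    then show "tsub U" using US s by (auto simp: tsub_def)
  qed
  then have "{pts U | U. tsub U \<and> dim 2 U} = {l \<in> pg_lines R M. l \<subseteq> pts S}"
    unfolding pg_lines_eq pts_all_pts[symmetric] by auto
  then show ?thesis unfolding quadric_def pS geo_def induced_geometry_def by simp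
qed

end

section \<open>Forms over the quadratic extension\<close>

context vspace begin

lemma coord_mapD:
  assumes "coord_map R J M (carrier M) \<psi>"
  shows "u \<in> carrier (coord_space R J) \<Longrightarrow> \<psi> u \<in> carrier M"
    "u \<in> carrier (coord_space R J) \<Longrightarrow> v \<in> carrier (coord_space R J) \<Longrightarrow> \<psi> (u \<oplus>\<^bsub>coord_space R J\<^esub> v) = \<psi> u \<^bold>+ \<psi> v"
    "c \<in> carrier R \<Longrightarrow> u \<in> carrier (coord_space R J) \<Longrightarrow> \<psi> (c \<odot>\<^bsub>coord_space R J\<^esub> u) = c \<^bold>* \<psi> u"
    "w \<in> carrier M \<Longrightarrow> \<exists>u\<in>carrier (coord_space R J). \<psi> u = w"
    "inj_on \<psi> (carrier (coord_space R J))" "\<psi> \<zero>\<^bsub>coord_space R J\<^esub> = \<^bold>0"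
proof -
  have b: "bij_betw \<psi> (carrier (coord_space R J)) (carrier M)"
    using assms unfolding coord_map_def coord_simps(1) by blast
  then have img: "\<psi> ` carrier (coord_space R J) = carrier M" by (simp add: bij_betw_def)
  show c: "u \<in> carrier (coord_space R J) \<Longrightarrow> \<psi> u \<in> carrier M" for u unfolding img[symmetric] by (rule imageI)
  show "w \<in> carrier M \<Longrightarrow> \<exists>u\<in>carrier (coord_space R J). \<psi> u = w" unfolding img[symmetric] by blast
  show "inj_on \<psi> (carrier (coord_space R J))" using b by (rule bij_betw_imp_inj_on)
  show "u \<in> carrier (coord_space R J) \<Longrightarrow> v \<in> carrier (coord_space R J) \<Longrightarrow> \<psi> (u \<oplus>\<^bsub>coord_space R J\<^esub> v) = \<psi> u \<^bold>+ \<psi> v"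
    using assms unfolding coord_map_def coord_simps(1) by blast
  show s: "c \<in> carrier R \<Longrightarrow> u \<in> carrier (coord_space R J) \<Longrightarrow> \<psi> (c \<odot>\<^bsub>coord_space R J\<^esub> u) = c \<^bold>* \<psi> u" for c u
    using assms unfolding coord_map_def coord_simps(1) by blast
  interpret C: vspace R "coord_space R J" using coord_vspace R.field_axioms by blast
  have "\<psi> (\<zero> \<odot>\<^bsub>coord_space R J\<^esub> \<zero>\<^bsub>coord_space R J\<^esub>) = \<zero> \<^bold>* \<psi> \<zero>\<^bsub>coord_space R J\<^esub>"
    using s[OF R.zero_closed C.M.zero_closed] .
  then show "\<psi> \<zero>\<^bsub>coord_space R J\<^esub> = \<^bold>0"
    unfolding C.smult_l_null[OF C.M.zero_closed] smult_l_null[OF c[OF C.M.zero_closed]] .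
qed

lemma pull_sesquilinear:
  assumes "coord_map R J M (carrier M) \<psi>" "sesquilinear_form R M \<sigma> h"
  shows "sesquilinear_form R (coord_space R J) \<sigma> (\<lambda>u v. h (\<psi> u) (\<psi> v))"
  unfolding sesquilinear_form_def
proof (intro conjI ballI)
  note \<psi> = coord_mapD[OF assms(1)] and h = assms(2)[unfolded sesquilinear_form_def]
  fix u v assume u: "u \<in> carrier (coord_space R J)" and v: "v \<in> carrier (coord_space R J)"
  note uv = \<psi>(1)[OF u] \<psi>(1)[OF v]
  show "h (\<psi> u) (\<psi> v) \<in> carrier R" using h uv by blast
  { fix w assume w: "w \<in> carrier (coord_space R J)"
    note wc = \<psi>(1)[OF w]
    show "h (\<psi> (u \<oplus>\<^bsub>coord_space R J\<^esub> v)) (\<psi> w) = h (\<psi> u) (\<psi> w) \<oplus> h (\<psi> v) (\<psi> w)"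
      unfolding \<psi>(2)[OF u v] using h uv wc by blast
    show "h (\<psi> u) (\<psi> (v \<oplus>\<^bsub>coord_space R J\<^esub> w)) = h (\<psi> u) (\<psi> v) \<oplus> h (\<psi> u) (\<psi> w)"
      unfolding \<psi>(2)[OF v w] using h uv wc by blast }
  { fix c assume c: "c \<in> carrier R"
    show "h (\<psi> (c \<odot>\<^bsub>coord_space R J\<^esub> u)) (\<psi> v) = c \<otimes> h (\<psi> u) (\<psi> v)"
      unfolding \<psi>(3)[OF c u] using h uv c by blast
    show "h (\<psi> u) (\<psi> (c \<odot>\<^bsub>coord_space R J\<^esub> v)) = \<sigma> c \<otimes> h (\<psi> u) (\<psi> v)"
      unfolding \<psi>(3)[OF c v] using h uv c by blast }
qed

lemma pull_nondegenerate:
  assumes "coord_map R J M (carrier M) \<psi>" "nondegenerate R M h"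
  shows "nondegenerate R (coord_space R J) (\<lambda>u v. h (\<psi> u) (\<psi> v))"
  unfolding nondegenerate_def
proof (intro ballI impI)
  note \<psi> = coord_mapD[OF assms(1)]
  interpret C: vspace R "coord_space R J" using coord_vspace R.field_axioms by blast
  fix u assume u: "u \<in> carrier (coord_space R J)" "\<forall>v\<in>carrier (coord_space R J). h (\<psi> u) (\<psi> v) = \<zero>"
  have "h (\<psi> u) w = \<zero>" if w: "w \<in> carrier M" for w using \<psi>(4)[OF w] u(2) by metis
  then have "\<psi> u = \<^bold>0" using assms(2) \<psi>(1)[OF u(1)] unfolding nondegenerate_def by blast
  then have "\<psi> u = \<psi> \<zero>\<^bsub>coord_space R J\<^esub>" using \<psi>(6) by simp
  then show "u = \<zero>\<^bsub>coord_space R J\<^esub>" using inj_onD[OF \<psi>(5) _ u(1) C.M.zero_closed] by blast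
qed

lemma isomorphic_coord:
  assumes "coord_map R J M (carrier M) \<psi>" "geometry_iso \<chi> G (isotropic_geometry R M h)"
    "blocks G \<subseteq> Pow (points G)"
  shows "isomorphic G (isotropic_geometry R (coord_space R J) (\<lambda>u v. h (\<psi> u) (\<psi> v)))"
proof -
  interpret C: vspace R "coord_space R J" using coord_vspace R.field_axioms by blast
  show ?thesis
    using assms(3) geometry_iso_comp[OF assms(2) geometry_iso_inv[OF isotropic_geometry_iso[OF assms(1)] C.isotropic_blocks_sub]]
    unfolding isomorphic_def by blast
qed

end

lemma (in giso) induced_iso:
  assumes "X \<subseteq> points G" shows "geometry_iso \<phi> (induced_geometry G X) (induced_geometry H (\<phi> ` X))"
proof -
  have "bij_betw \<phi> X (\<phi> ` X)" using inj_on_subset[OF inj assms] by (simp add: bij_betw_def)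
  moreover have "(\<lambda>b. \<phi> ` b) ` {l \<in> blocks G. l \<subseteq> X} = {l \<in> blocks H. l \<subseteq> \<phi> ` X}"
  proof (intro equalityI subsetI)
    fix l assume "l \<in> (\<lambda>b. \<phi> ` b) ` {l \<in> blocks G. l \<subseteq> X}"
    then show "l \<in> {l \<in> blocks H. l \<subseteq> \<phi> ` X}" unfolding blocks_image[symmetric] by auto
  next
    fix l assume l: "l \<in> {l \<in> blocks H. l \<subseteq> \<phi> ` X}"
    then have "l \<in> (\<lambda>b. \<phi> ` b) ` blocks G" unfolding blocks_image by simp
    then obtain b where b: "b \<in> blocks G" "l = \<phi> ` b" by auto
    have "b \<subseteq> X" using image_subset_iff'[of b X] b l blocks_sub assms by blast
    then show "l \<in> (\<lambda>b. \<phi> ` b) ` {l \<in> blocks G. l \<subseteq> X}" using b by blast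
  qed
  ultimately show ?thesis by (simp add: geometry_iso_def induced_geometry_def)
qed

section \<open>Properties of a linear lift\<close>

context dom begin

lemma lift_in_S:
  assumes g: "linear_on (carrier M) g" and lift: "\<And>z. z \<in> S \<Longrightarrow> z \<noteq> \<^bold>0 \<Longrightarrow> t z \<in> pspan R M (g z)"
    and v: "v \<in> S"
  shows "g v \<in> S" "v \<perp> g v"
proof -
  have "g v \<in> S \<and> v \<perp> g v"
  proof (cases "v = \<^bold>0")
    case True then show ?thesis using linear_on_zero[OF g subsp_carrier] by simp
  next
    case False
    have tv: "t v \<in> S" "t v \<noteq> \<^bold>0" "v \<in> carrier M" "t v \<in> carrier M" using t_S t_nz v False by auto
    have "g v \<in> pspan R M (t v)" using pspan_sym[OF lift[OF v False] tv(2)] linear_onD(1)[OF g tv(3)] by blast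
    then show ?thesis
      using orth_pspan(1)[OF tv(3,4) dmst[OF v False]] tsubD(2)[OF tsub_pspan[OF tv(1)]] by blast
  qed
  then show "g v \<in> S" "v \<perp> g v" by blast+
qed

text \<open>A root of the quadratic polynomial of \<open>g\<close> would yield an eigenvector, hence a fixed point.\<close>

lemma lift_irreducible:
  assumes g: "linear_on (carrier M) g" and lift: "\<And>z. z \<in> S \<Longrightarrow> z \<noteq> \<^bold>0 \<Longrightarrow> t z \<in> pspan R M (g z)"
    and c: "\<mu> \<in> carrier R" "\<kappa> \<in> carrier R" and gg: "\<And>z. z \<in> carrier M \<Longrightarrow> g (g z) = \<mu> \<^bold>* g z \<^bold>+ \<kappa> \<^bold>* z"
    and b: "b \<in> carrier R"
  shows "b \<otimes> b \<noteq> \<mu> \<otimes> b \<oplus> \<kappa>"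
proof
  assume eq: "b \<otimes> b = \<mu> \<otimes> b \<oplus> \<kappa>"
  note gD = linear_onD[OF g]
  obtain v where v: "v \<in> M0" "v \<noteq> \<^bold>0" using dim_less[of 0 "{\<^bold>0}" n M0] M0 rank by auto
  have vS: "v \<in> S" "v \<in> carrier M" using v M0 tsubD[of M0] by (auto simp: maxtsub_def)
  note gS = lift_in_S[OF g lift vS(1)]
  have no: "g w \<noteq> d \<^bold>* w" if w: "w \<in> S" "w \<noteq> \<^bold>0" and d: "d \<in> carrier R" for w d
  proof
    assume "g w = d \<^bold>* w"
    then have "g w \<in> pspan R M w" using d by (auto simp: pspan_iff)
    then have "t w \<in> pspan R M w" using pspan_trans[OF lift[OF w]] w by simp
    then show False using nofix[OF w] by blast
  qed
  \<comment> \<open>A root \<open>b\<close> factors the polynomial as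
    \<open>(X - b) (X + ?d)\<close>, so \<open>(g - b) (g + ?d)\<close> vanishes. Either
    \<open>?w = g v + ?d v\<close> is an eigenvector for \<open>b\<close>, or it is zero and
    \<open>v\<close> is an eigenvector for \<open>- ?d\<close>.\<close>
  let ?d = "b \<ominus> \<mu>"
  let ?w = "g v \<^bold>+ ?d \<^bold>* v"
  have "g v \<perp> ?d \<^bold>* v" using orth_smult orth_commute[of v "g v"] gS vS b c by simp
  then have wS: "?w \<in> S" using S_add[OF gS(1) S_smult] vS b c by simp
  have "g ?w = (\<mu> \<oplus> ?d) \<^bold>* g v \<^bold>+ \<kappa> \<^bold>* v"
    using gD vS b c gg by (simp add: smult_l_distr M.a_ac)
  also have "\<mu> \<oplus> ?d = b" using b c by (simp add: a_minus_def R.a_lcomm[of \<mu> b "\<ominus> \<mu>"] R.r_neg)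
  also have "\<kappa> = b \<otimes> ?d"
  proof -
    have "b \<otimes> ?d = b \<otimes> b \<ominus> \<mu> \<otimes> b" using b c by (simp add: a_minus_def R.r_distr R.r_minus R.m_comm)
    also have "\<dots> = \<kappa>" unfolding eq using b c by (simp add: a_minus_def R.a_comm R.a_lcomm R.r_neg)
    finally show ?thesis by simp
  qed
  also have "b \<^bold>* g v \<^bold>+ (b \<otimes> ?d) \<^bold>* v = b \<^bold>* ?w" using gD vS b c by (simp add: smult_r_distr smult_assoc1)
  finally have gw: "g ?w = b \<^bold>* ?w" .
  then have "?w = \<^bold>0" using no[OF wS _ b] by blast
  then have "g v = \<ominus> ?d \<^bold>* v" using minus_cancel[of "g v" v ?d] gD(1) vS b c by simp
  then show False using no[OF vS(1) v(2), of "\<ominus> ?d"] b c by simp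
qed

end

context polar_model_lift begin

lemma Ldim_n: assumes "dim (2 * n) (carrier M)" shows "L.dim n (carrier Lmod)"
proof -
  obtain k where k: "L.dim k (carrier Lmod)" using L_dim_ex[OF finV L.subsp_carrier] by blast
  then have "k = n" using dim_unique[OF assms, of "2 * k"] L_dim[OF k] by simp
  then show ?thesis using k by simp
qed

end

subsection \<open>Hyperbolic polar spaces\<close>

locale hyp_model = polar_model +
  fixes f :: "'c \<Rightarrow> 'c \<Rightarrow> 'a" and q :: "'c \<Rightarrow> 'a"
  assumes f_closed [simp]: "u \<in> carrier M \<Longrightarrow> v \<in> carrier M \<Longrightarrow> f u v \<in> carrier R"
    and f_add_l: "u \<in> carrier M \<Longrightarrow> v \<in> carrier M \<Longrightarrow> w \<in> carrier M \<Longrightarrow> f (u \<^bold>+ v) w = f u w \<oplus> f v w"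
    and f_add_r: "u \<in> carrier M \<Longrightarrow> v \<in> carrier M \<Longrightarrow> w \<in> carrier M \<Longrightarrow> f u (v \<^bold>+ w) = f u v \<oplus> f u w"
    and f_smult_l: "c \<in> carrier R \<Longrightarrow> u \<in> carrier M \<Longrightarrow> v \<in> carrier M \<Longrightarrow> f (c \<^bold>* u) v = c \<otimes> f u v"
    and f_smult_r: "c \<in> carrier R \<Longrightarrow> u \<in> carrier M \<Longrightarrow> v \<in> carrier M \<Longrightarrow> f u (c \<^bold>* v) = c \<otimes> f u v"
    and orth_f: "u \<in> carrier M \<Longrightarrow> v \<in> carrier M \<Longrightarrow> u \<perp> v \<longleftrightarrow> f u v = \<zero>"
    and finV2: "dim (2 * n) (carrier M)"
    and S_q: "S = {v \<in> carrier M. q v = \<zero>}"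
    and q_closed [simp]: "v \<in> carrier M \<Longrightarrow> q v \<in> carrier R"
    and q_add: "u \<in> carrier M \<Longrightarrow> v \<in> carrier M \<Longrightarrow> q (u \<^bold>+ v) = q u \<oplus> q v \<oplus> f u v"
    and f_sym: "u \<in> carrier M \<Longrightarrow> v \<in> carrier M \<Longrightarrow> f u v = f v u"
    and f_diag: "v \<in> carrier M \<Longrightarrow> f v v = q v \<oplus> q v"
    and f_nondeg: "u \<in> carrier M \<Longrightarrow> (\<And>v. v \<in> carrier M \<Longrightarrow> f u v = \<zero>) \<Longrightarrow> u = \<^bold>0"
begin

lemma is_hyp: "hyp R M S orth N n M0 t f q"
  by unfold_locales
    (simp_all add: f_add_l f_add_r f_smult_l f_smult_r orth_f finV2 q_add f_sym t_surj' S_q[symmetric] del: One_nat_def)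

end

locale hyp_model_lift = hyp_model +
  fixes g :: "'c \<Rightarrow> 'c" and \<mu> \<kappa> :: 'a
  assumes lin: "linear_on (carrier M) g" and mk: "\<mu> \<in> carrier R" "\<kappa> \<in> carrier R"
    and t_g: "z \<in> S \<Longrightarrow> z \<noteq> \<^bold>0 \<Longrightarrow> t z \<in> pspan R M (g z)"
    and g_g: "z \<in> carrier M \<Longrightarrow> g (g z) = \<mu> \<^bold>* g z \<^bold>+ \<kappa> \<^bold>* z"
    and q_g: "z \<in> carrier M \<Longrightarrow> q (g z) = \<ominus> (\<kappa> \<otimes> q z)"
    and f_g: "z \<in> carrier M \<Longrightarrow> f z (g z) = \<mu> \<otimes> q z"
begin

lemma gD [simp]: "v \<in> carrier M \<Longrightarrow> g v \<in> carrier M"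
    "u \<in> carrier M \<Longrightarrow> v \<in> carrier M \<Longrightarrow> g (u \<^bold>+ v) = g u \<^bold>+ g v"
    "c \<in> carrier R \<Longrightarrow> v \<in> carrier M \<Longrightarrow> g (c \<^bold>* v) = c \<^bold>* g v"
  using linear_onD[OF lin] by blast+

lemma add_cancel_left: "a \<in> carrier R \<Longrightarrow> b \<in> carrier R \<Longrightarrow> c \<in> carrier R \<Longrightarrow> a \<oplus> b = a \<oplus> c \<Longrightarrow> b = c"
  by simp

text \<open>Polarisation of \<open>f z (g z) = \<mu> q z\<close>.\<close>

lemma f_adj: assumes "u \<in> carrier M" "v \<in> carrier M" shows "f u (g v) \<oplus> f v (g u) = \<mu> \<otimes> f u v"
proof -
  have "f (u \<^bold>+ v) (g (u \<^bold>+ v)) = \<mu> \<otimes> q (u \<^bold>+ v)" using f_g[of "u \<^bold>+ v"] assms by simp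
  moreover have "f (u \<^bold>+ v) (g (u \<^bold>+ v)) = (\<mu> \<otimes> q u \<oplus> \<mu> \<otimes> q v) \<oplus> (f u (g v) \<oplus> f v (g u))"
    using assms f_g[of u] f_g[of v] mk by (simp add: f_add_l f_add_r R.a_ac)
  moreover have "\<mu> \<otimes> q (u \<^bold>+ v) = (\<mu> \<otimes> q u \<oplus> \<mu> \<otimes> q v) \<oplus> \<mu> \<otimes> f u v"
    using assms mk by (simp add: q_add R.r_distr)
  ultimately have e: "(\<mu> \<otimes> q u \<oplus> \<mu> \<otimes> q v) \<oplus> (f u (g v) \<oplus> f v (g u)) = (\<mu> \<otimes> q u \<oplus> \<mu> \<otimes> q v) \<oplus> \<mu> \<otimes> f u v"
    by (simp only:)
  show ?thesis by (rule add_cancel_left[OF _ _ _ e]) (use assms mk in simp_all)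
qed

text \<open>Polarisation of \<open>q (g z) = - \<kappa> q z\<close>.\<close>

lemma f_gg: assumes "u \<in> carrier M" "v \<in> carrier M" shows "f (g u) (g v) = \<ominus> (\<kappa> \<otimes> f u v)"
proof -
  have "q (g u \<^bold>+ g v) = \<ominus> (\<kappa> \<otimes> q (u \<^bold>+ v))" using q_g[of "u \<^bold>+ v"] assms by simp
  moreover have "q (g u \<^bold>+ g v) = (\<ominus> (\<kappa> \<otimes> q u) \<oplus> \<ominus> (\<kappa> \<otimes> q v)) \<oplus> f (g u) (g v)"
    using q_add[of "g u" "g v"] q_g assms by simp
  moreover have "\<ominus> (\<kappa> \<otimes> q (u \<^bold>+ v)) = (\<ominus> (\<kappa> \<otimes> q u) \<oplus> \<ominus> (\<kappa> \<otimes> q v)) \<oplus> \<ominus> (\<kappa> \<otimes> f u v)"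
    using assms mk by (simp add: q_add R.r_distr R.minus_add)
  ultimately have e: "(\<ominus> (\<kappa> \<otimes> q u) \<oplus> \<ominus> (\<kappa> \<otimes> q v)) \<oplus> f (g u) (g v) =
    (\<ominus> (\<kappa> \<otimes> q u) \<oplus> \<ominus> (\<kappa> \<otimes> q v)) \<oplus> \<ominus> (\<kappa> \<otimes> f u v)" by (simp only:)
  show ?thesis by (rule add_cancel_left[OF _ _ _ e]) (use assms mk in simp_all)
qed

lemma f_g_left: assumes "u \<in> carrier M" "v \<in> carrier M" shows "f (g u) v = \<mu> \<otimes> f u v \<ominus> f u (g v)"
proof -
  have "f v (g u) \<oplus> f u (g v) = \<mu> \<otimes> f u v" using f_adj[OF assms] assms by (simp add: R.a_comm)
  then have "f v (g u) = \<mu> \<otimes> f u v \<ominus> f u (g v)"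
    using assms mk by (metis R.add.inv_solve_right' R.minus_eq gD(1) f_closed R.m_closed)
  then show ?thesis using f_sym[of "g u" v] assms by simp
qed

sublocale PL: polar_model_lift R M S orth N n M0 \<Delta> \<phi> \<theta> g \<mu> \<kappa>
proof unfold_locales
  show "linear_on (carrier M) g" by (rule lin)
  show "b \<otimes> b \<noteq> \<mu> \<otimes> b \<oplus> \<kappa>" if "b \<in> carrier R" for b
    using lift_irreducible[OF lin t_g mk g_g that] by blast
  show "g v \<in> S" "v \<perp> g v" if "v \<in> S" for v using lift_in_S[OF lin t_g that] by blast+
  show "(u \<perp> g v) = (g u \<perp> v)" if c: "u \<in> carrier M" "v \<in> carrier M" and o: "u \<perp> v" for u v
  proof -
    have "f u v = \<zero>" using o orth_f c by blast
    then have "f (g u) v = \<ominus> f u (g v)" using f_g_left[OF c] mk c by (simp add: a_minus_def)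
    then show ?thesis using orth_f c by simp
  qed
qed (use mk g_g t_g in auto)

text \<open>The conjugation of the extension over \<open>R\<close>, which exchanges the roots
  \<open>T\<close> and \<open>\<mu> - T\<close>. It is the identity exactly when
  \<open>\<mu>\<close> and 2 are both zero.\<close>

abbreviation \<sigma> where "\<sigma> x \<equiv> (fst x \<oplus> \<mu> \<otimes> snd x, \<ominus> snd x)"

text \<open>Consider a form \<open>A + f u v T\<close> with \<open>T\<close>-component
  \<open>f\<close>. Linearity in \<open>u\<close> over the extension requires the
  \<open>T\<close>-component of its product with \<open>T\<close>, namely
  \<open>A + \<mu> f u v\<close>, to be \<open>f (g u) v\<close>. By \<open>f_g_left\<close> this
  forces \<open>A = - f u (g v)\<close>.\<close>

definition h0 where "h0 u v = (\<ominus> f u (g v), f u v)"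

lemma h0_closed: "u \<in> carrier M \<Longrightarrow> v \<in> carrier M \<Longrightarrow> h0 u v \<in> carrier PL.Lring"
  by (simp add: h0_def)

lemma h0_orth: "u \<in> carrier M \<Longrightarrow> v \<in> carrier M \<Longrightarrow> PL.orthL u v \<longleftrightarrow> h0 u v = \<zero>\<^bsub>PL.Lring\<^esub>"
  using orth_f by (auto simp: PL.orthL_def h0_def)

lemma h0_sesquilinear: "sesquilinear_form PL.Lring PL.Lmod \<sigma> h0"
  unfolding sesquilinear_form_def
proof (intro conjI ballI)
  fix u v assume uv: "u \<in> carrier PL.Lmod" "v \<in> carrier PL.Lmod"
  then have c: "u \<in> carrier M" "v \<in> carrier M" by auto
  show "h0 u v \<in> carrier PL.Lring" using h0_closed c by blast
  { fix w assume "w \<in> carrier PL.Lmod"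
    then have w: "w \<in> carrier M" by simp
    show "h0 (u \<oplus>\<^bsub>PL.Lmod\<^esub> v) w = h0 u w \<oplus>\<^bsub>PL.Lring\<^esub> h0 v w"
      using c w by (simp add: h0_def f_add_l R.minus_add)
    show "h0 u (v \<oplus>\<^bsub>PL.Lmod\<^esub> w) = h0 u v \<oplus>\<^bsub>PL.Lring\<^esub> h0 u w"
      using c w by (simp add: h0_def f_add_r R.minus_add) }
  { fix x assume "x \<in> carrier PL.Lring"
    then obtain a b where x: "x = (a, b)" "a \<in> carrier R" "b \<in> carrier R" by auto
    show "h0 (x \<odot>\<^bsub>PL.Lmod\<^esub> u) v = x \<otimes>\<^bsub>PL.Lring\<^esub> h0 u v"
      unfolding x(1) using x c mk
      by (simp add: h0_def f_add_l f_smult_l f_gg f_g_left[OF c] a_minus_def R.r_distr R.minus_add R.r_minus R.m_ac R.a_ac)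
    show "h0 u (x \<odot>\<^bsub>PL.Lmod\<^esub> v) = \<sigma> x \<otimes>\<^bsub>PL.Lring\<^esub> h0 u v"
    proof -
      let ?A = "f u (g v)" and ?B = "f u v"
      have AB: "?A \<in> carrier R" "?B \<in> carrier R" using c by auto
      have "\<ominus> f u (g (a \<^bold>* v \<^bold>+ b \<^bold>* g v)) = \<ominus> (a \<otimes> ?A \<oplus> b \<otimes> (\<mu> \<otimes> ?A \<oplus> \<kappa> \<otimes> ?B))"
        using x c mk by (simp add: f_add_r f_smult_r g_g)
      also have "\<dots> = (a \<oplus> \<mu> \<otimes> b) \<otimes> (\<ominus> ?A) \<oplus> \<kappa> \<otimes> ((\<ominus> b) \<otimes> ?B)"
        using x AB mk by (simp add: R.l_distr R.r_distr R.minus_add R.r_minus R.l_minus R.m_ac R.a_ac)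
      finally have 1: "\<ominus> f u (g (a \<^bold>* v \<^bold>+ b \<^bold>* g v)) = \<dots>" .
      have "(a \<oplus> \<mu> \<otimes> b) \<otimes> ?B \<oplus> (\<ominus> b) \<otimes> (\<ominus> ?A) \<oplus> \<mu> \<otimes> ((\<ominus> b) \<otimes> ?B) =
        (a \<otimes> ?B \<oplus> b \<otimes> ?A) \<oplus> (\<mu> \<otimes> (b \<otimes> ?B) \<oplus> \<ominus> (\<mu> \<otimes> (b \<otimes> ?B)))"
        using x AB mk by (simp add: R.l_distr R.r_distr R.minus_add R.r_minus R.l_minus R.m_ac R.a_ac)
      also have "\<dots> = f u (a \<^bold>* v \<^bold>+ b \<^bold>* g v)"
        using x c mk by (simp add: f_add_r f_smult_r R.r_neg)
      finally have 2: "f u (a \<^bold>* v \<^bold>+ b \<^bold>* g v) = (a \<oplus> \<mu> \<otimes> b) \<otimes> ?B \<oplus> (\<ominus> b) \<otimes> (\<ominus> ?A) \<oplus> \<mu> \<otimes> ((\<ominus> b) \<otimes> ?B)" by simp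
      show ?thesis unfolding x(1) using 1 2 by (simp add: h0_def)
    qed }
qed

lemma h0_nondegenerate: "u \<in> carrier M \<Longrightarrow> (\<And>v. v \<in> carrier M \<Longrightarrow> h0 u v = \<zero>\<^bsub>PL.Lring\<^esub>) \<Longrightarrow> u = \<^bold>0"
  using f_nondeg[of u] by (simp add: h0_def)

lemma sigma_sigma: "x \<in> carrier PL.Lring \<Longrightarrow> \<sigma> (\<sigma> x) = x"
  using mk by (auto simp: R.a_assoc R.r_minus R.r_neg)

lemma sigma_iso: "\<sigma> \<in> ring_iso PL.Lring PL.Lring"
  unfolding ring_iso_def
proof (rule CollectI, rule conjI)
  show "\<sigma> \<in> ring_hom PL.Lring PL.Lring"
  proof (rule ring_hom_memI)
    fix x y assume "x \<in> carrier PL.Lring" "y \<in> carrier PL.Lring"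
    then obtain a b c d where xy: "x = (a, b)" "y = (c, d)" "a \<in> carrier R" "b \<in> carrier R" "c \<in> carrier R" "d \<in> carrier R" by auto
    show "\<sigma> (x \<oplus>\<^bsub>PL.Lring\<^esub> y) = \<sigma> x \<oplus>\<^bsub>PL.Lring\<^esub> \<sigma> y"
      using xy mk by (simp add: R.r_distr R.minus_add R.a_ac)
    have "\<ominus> (a \<otimes> d \<oplus> b \<otimes> c \<oplus> \<mu> \<otimes> (b \<otimes> d)) =
      (a \<oplus> \<mu> \<otimes> b) \<otimes> \<ominus> d \<oplus> \<ominus> b \<otimes> (c \<oplus> \<mu> \<otimes> d) \<oplus> \<mu> \<otimes> (\<ominus> b \<otimes> \<ominus> d)"
    proof -
      have "(a \<oplus> \<mu> \<otimes> b) \<otimes> \<ominus> d \<oplus> \<ominus> b \<otimes> (c \<oplus> \<mu> \<otimes> d) \<oplus> \<mu> \<otimes> (\<ominus> b \<otimes> \<ominus> d) =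
        \<ominus> (a \<otimes> d \<oplus> b \<otimes> c \<oplus> \<mu> \<otimes> (b \<otimes> d)) \<oplus> (\<ominus> (\<mu> \<otimes> (b \<otimes> d)) \<oplus> \<mu> \<otimes> (b \<otimes> d))"
        using xy mk by (simp add: R.l_distr R.r_distr R.minus_add R.r_minus R.l_minus R.m_ac R.a_ac)
      then show ?thesis using xy mk by (simp add: R.l_neg)
    qed
    moreover have "(a \<oplus> \<mu> \<otimes> b) \<otimes> (c \<oplus> \<mu> \<otimes> d) \<oplus> \<kappa> \<otimes> (\<ominus> b \<otimes> \<ominus> d) =
      a \<otimes> c \<oplus> \<kappa> \<otimes> (b \<otimes> d) \<oplus> \<mu> \<otimes> (a \<otimes> d \<oplus> b \<otimes> c \<oplus> \<mu> \<otimes> (b \<otimes> d))"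
      using xy mk by (simp add: R.l_distr R.r_distr R.r_minus R.l_minus R.m_ac R.a_ac)
    ultimately show "\<sigma> (x \<otimes>\<^bsub>PL.Lring\<^esub> y) = \<sigma> x \<otimes>\<^bsub>PL.Lring\<^esub> \<sigma> y" using xy by simp
  qed (use mk in auto)
  show "bij_betw \<sigma> (carrier PL.Lring) (carrier PL.Lring)"
  proof (rule bij_betw_byWitness[where f' = \<sigma>])
    show "\<forall>x\<in>carrier PL.Lring. \<sigma> (\<sigma> x) = x" using sigma_sigma by blast
    then show "\<forall>x\<in>carrier PL.Lring. \<sigma> (\<sigma> x) = x" .
  qed (use mk in auto)
qed

text \<open>The form \<open>h0\<close> is skew-Hermitian; multiplying it by \<open>\<delta> = t - \<sigma> t\<close>, where \<open>t = (0, 1)\<close>, makes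
  it Hermitian.\<close>

definition \<delta> where "\<delta> = (\<ominus> \<mu>, \<one> \<oplus> \<one>)"

definition h where "h u v = \<delta> \<otimes>\<^bsub>PL.Lring\<^esub> h0 u v"

lemma delta_closed: "\<delta> \<in> carrier PL.Lring" using mk by (simp add: \<delta>_def)

lemma h_formula:
  assumes "u \<in> carrier M" "v \<in> carrier M"
  shows "h u v = (\<mu> \<otimes> f u (g v) \<oplus> (\<kappa> \<otimes> f u v \<oplus> \<kappa> \<otimes> f u v), \<mu> \<otimes> f u v \<ominus> (f u (g v) \<oplus> f u (g v)))"
proof -
  let ?A = "f u (g v)" and ?B = "f u v"
  have AB: "?A \<in> carrier R" "?B \<in> carrier R" using assms by auto
  have "\<ominus> \<mu> \<otimes> ?B \<oplus> (\<one> \<oplus> \<one>) \<otimes> \<ominus> ?A \<oplus> \<mu> \<otimes> ((\<one> \<oplus> \<one>) \<otimes> ?B) =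
    (\<ominus> (\<mu> \<otimes> ?B) \<oplus> \<mu> \<otimes> ?B) \<oplus> (\<mu> \<otimes> ?B \<oplus> \<ominus> (?A \<oplus> ?A))"
    using AB mk by (simp add: R.l_distr R.r_distr R.minus_add R.r_minus R.l_minus R.a_ac)
  also have "\<dots> = \<mu> \<otimes> ?B \<ominus> (?A \<oplus> ?A)" using AB mk by (simp add: R.l_neg a_minus_def)
  finally show ?thesis
    using AB mk by (simp add: h_def h0_def \<delta>_def R.l_distr R.r_distr R.r_minus R.l_minus)
qed

text \<open>Behind the comparison of components are \<open>h0 v u = - \<sigma> (h0 u v)\<close> and
  \<open>\<sigma> \<delta> = - \<delta>\<close>.\<close>

lemma h_hermitian: assumes "u \<in> carrier M" "v \<in> carrier M" shows "h v u = \<sigma> (h u v)"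
proof -
  let ?A = "f u (g v)" and ?B = "f u v"
  have AB: "?A \<in> carrier R" "?B \<in> carrier R" using assms by auto
  have vu: "f v u = ?B" "f v (g u) = \<mu> \<otimes> ?B \<ominus> ?A"
    using f_sym[OF assms(2,1)] f_sym[OF assms(2) gD(1)[OF assms(1)]] f_g_left[OF assms] by simp_all
  have 1: "\<mu> \<otimes> (\<mu> \<otimes> ?B \<ominus> ?A) \<oplus> (\<kappa> \<otimes> ?B \<oplus> \<kappa> \<otimes> ?B) =
    \<mu> \<otimes> ?A \<oplus> (\<kappa> \<otimes> ?B \<oplus> \<kappa> \<otimes> ?B) \<oplus> \<mu> \<otimes> (\<mu> \<otimes> ?B \<ominus> (?A \<oplus> ?A))"
  proof -
    have "\<mu> \<otimes> ?A \<oplus> (\<kappa> \<otimes> ?B \<oplus> \<kappa> \<otimes> ?B) \<oplus> \<mu> \<otimes> (\<mu> \<otimes> ?B \<ominus> (?A \<oplus> ?A)) =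
      (\<mu> \<otimes> ?A \<oplus> \<ominus> (\<mu> \<otimes> ?A)) \<oplus> (\<mu> \<otimes> (\<mu> \<otimes> ?B \<ominus> ?A) \<oplus> (\<kappa> \<otimes> ?B \<oplus> \<kappa> \<otimes> ?B))"
      using AB mk by (simp add: a_minus_def R.r_distr R.minus_add R.r_minus R.a_ac)
    then show ?thesis using AB mk by (simp add: R.r_neg)
  qed
  have 2: "\<mu> \<otimes> ?B \<ominus> ((\<mu> \<otimes> ?B \<ominus> ?A) \<oplus> (\<mu> \<otimes> ?B \<ominus> ?A)) = \<ominus> (\<mu> \<otimes> ?B \<ominus> (?A \<oplus> ?A))"
  proof -
    have "\<mu> \<otimes> ?B \<ominus> ((\<mu> \<otimes> ?B \<ominus> ?A) \<oplus> (\<mu> \<otimes> ?B \<ominus> ?A)) =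
      (\<mu> \<otimes> ?B \<oplus> \<ominus> (\<mu> \<otimes> ?B)) \<oplus> \<ominus> (\<mu> \<otimes> ?B \<ominus> (?A \<oplus> ?A))"
      using AB mk by (simp add: a_minus_def R.minus_add R.a_ac)
    then show ?thesis using AB mk by (simp add: R.r_neg)
  qed
  show ?thesis unfolding h_formula[OF assms] h_formula[OF assms(2,1)] vu using 1 2 by simp
qed

lemma L_ring_facts:
  "x \<in> carrier PL.Lring \<Longrightarrow> y \<in> carrier PL.Lring \<Longrightarrow> z \<in> carrier PL.Lring \<Longrightarrow>
    x \<otimes>\<^bsub>PL.Lring\<^esub> (y \<otimes>\<^bsub>PL.Lring\<^esub> z) = y \<otimes>\<^bsub>PL.Lring\<^esub> (x \<otimes>\<^bsub>PL.Lring\<^esub> z)"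
  "x \<in> carrier PL.Lring \<Longrightarrow> y \<in> carrier PL.Lring \<Longrightarrow> z \<in> carrier PL.Lring \<Longrightarrow>
    x \<otimes>\<^bsub>PL.Lring\<^esub> (y \<oplus>\<^bsub>PL.Lring\<^esub> z) = x \<otimes>\<^bsub>PL.Lring\<^esub> y \<oplus>\<^bsub>PL.Lring\<^esub> x \<otimes>\<^bsub>PL.Lring\<^esub> z"
  "x \<in> carrier PL.Lring \<Longrightarrow> y \<in> carrier PL.Lring \<Longrightarrow> x \<otimes>\<^bsub>PL.Lring\<^esub> y \<in> carrier PL.Lring"
  "x \<in> carrier PL.Lring \<Longrightarrow> y \<in> carrier PL.Lring \<Longrightarrow> x \<noteq> \<zero>\<^bsub>PL.Lring\<^esub> \<Longrightarrow>
    x \<otimes>\<^bsub>PL.Lring\<^esub> y = \<zero>\<^bsub>PL.Lring\<^esub> \<longleftrightarrow> y = \<zero>\<^bsub>PL.Lring\<^esub>"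
proof -
  show "x \<otimes>\<^bsub>PL.Lring\<^esub> y = \<zero>\<^bsub>PL.Lring\<^esub> \<longleftrightarrow> y = \<zero>\<^bsub>PL.Lring\<^esub>"
    if "x \<in> carrier PL.Lring" "y \<in> carrier PL.Lring" "x \<noteq> \<zero>\<^bsub>PL.Lring\<^esub>"
    using PL.L.R.integral_iff[OF that(1,2)] that(3) by (simp only: simp_thms)
qed (rule PL.L.R.m_lcomm PL.L.R.r_distr PL.L.R.m_closed; assumption)+

lemma h_sesquilinear: "sesquilinear_form PL.Lring PL.Lmod \<sigma> h"
proof -
  note s = h0_sesquilinear[unfolded sesquilinear_form_def]
  have sc: "\<sigma> x \<in> carrier PL.Lring" if "x \<in> carrier PL.Lring" for x using that mk by auto
  show ?thesis
    unfolding sesquilinear_form_def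
  proof (intro conjI ballI)
    fix u v assume uv: "u \<in> carrier PL.Lmod" "v \<in> carrier PL.Lmod"
    have c0: "h0 u v \<in> carrier PL.Lring" using s uv by blast
    show "h u v \<in> carrier PL.Lring" unfolding h_def by (rule L_ring_facts(3)[OF delta_closed c0])
    { fix w assume w: "w \<in> carrier PL.Lmod"
      have c: "h0 u w \<in> carrier PL.Lring" "h0 v w \<in> carrier PL.Lring" using s uv w by blast+
      have "h0 (u \<oplus>\<^bsub>PL.Lmod\<^esub> v) w = h0 u w \<oplus>\<^bsub>PL.Lring\<^esub> h0 v w" using s uv w by blast
      then show "h (u \<oplus>\<^bsub>PL.Lmod\<^esub> v) w = h u w \<oplus>\<^bsub>PL.Lring\<^esub> h v w"
        unfolding h_def using L_ring_facts(2)[OF delta_closed c] by (simp only:)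
      have "h0 u (v \<oplus>\<^bsub>PL.Lmod\<^esub> w) = h0 u v \<oplus>\<^bsub>PL.Lring\<^esub> h0 u w" using s uv w by blast
      then show "h u (v \<oplus>\<^bsub>PL.Lmod\<^esub> w) = h u v \<oplus>\<^bsub>PL.Lring\<^esub> h u w"
        unfolding h_def using L_ring_facts(2)[OF delta_closed c0 c(1)] by (simp only:) }
    { fix x assume x: "x \<in> carrier PL.Lring"
      have "h0 (x \<odot>\<^bsub>PL.Lmod\<^esub> u) v = x \<otimes>\<^bsub>PL.Lring\<^esub> h0 u v" using s uv x by blast
      then show "h (x \<odot>\<^bsub>PL.Lmod\<^esub> u) v = x \<otimes>\<^bsub>PL.Lring\<^esub> h u v"
        unfolding h_def using L_ring_facts(1)[OF delta_closed x c0] by (simp only:)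
      have "h0 u (x \<odot>\<^bsub>PL.Lmod\<^esub> v) = \<sigma> x \<otimes>\<^bsub>PL.Lring\<^esub> h0 u v" using s uv x by blast
      then show "h u (x \<odot>\<^bsub>PL.Lmod\<^esub> v) = \<sigma> x \<otimes>\<^bsub>PL.Lring\<^esub> h u v"
        unfolding h_def using L_ring_facts(1)[OF delta_closed sc[OF x] c0] by (simp only:) }
  qed
qed

lemma hyperbolic_result:
  "\<exists>(F :: ('a \<times> 'a) ring) m \<Gamma>. field F \<and> m \<ge> 2 \<and>
    (minimal_hermitian_polar_space F m \<Gamma> \<or> mixed_polar_space F m \<Gamma>) \<and>
    fixed_structure \<Delta> \<theta> = singular_geometry \<Gamma>"
proof -
  obtain m where m: "n = 2 * m" using even_rank by blast
  have m2: "m \<ge> 2" using rank4 m by simp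
  note PS = PL.Gamma_polar_space[OF m]
  have Ld: "PL.L.dim n (carrier PL.Lmod)" using PL.Ldim_n[OF finV2] .
  have nd0: "nondegenerate PL.Lring PL.Lmod h0"
    unfolding nondegenerate_def using h0_nondegenerate by simp
  show ?thesis
  \<comment> \<open>The exceptional case is exactly \<open>\<delta> = 0\<close>, where the multiple
    \<open>h\<close> of \<open>h0\<close> is zero.\<close>
  proof (cases "\<mu> = \<zero> \<and> \<one> \<oplus> \<one> = \<zero>")
    case False
    then have d0: "\<delta> \<noteq> \<zero>\<^bsub>PL.Lring\<^esub>" using mk by (auto simp: \<delta>_def)
    have hz: "h u v = \<zero>\<^bsub>PL.Lring\<^esub> \<longleftrightarrow> h0 u v = \<zero>\<^bsub>PL.Lring\<^esub>" if "u \<in> carrier M" "v \<in> carrier M" for u v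
      unfolding h_def using L_ring_facts(4)[OF delta_closed h0_closed[OF that] d0] .
    have orth: "PL.orthL u v \<longleftrightarrow> h u v = \<zero>\<^bsub>PL.Lring\<^esub>" if "u \<in> carrier PL.Lmod" "v \<in> carrier PL.Lmod" for u v
      using that hz h0_orth by simp
    \<comment> \<open>The value is \<open>h0 v v = - \<mu> q v + 2 q v T\<close>, which detects the
      vanishing of \<open>q v\<close> as long as \<open>\<mu>\<close> or 2 is nonzero.\<close>
    have "h0 v v = \<zero>\<^bsub>PL.Lring\<^esub> \<longleftrightarrow> q v = \<zero>" if v: "v \<in> carrier M" for v
    proof
      assume "q v = \<zero>" then show "h0 v v = \<zero>\<^bsub>PL.Lring\<^esub>" using v mk by (simp add: h0_def f_g f_diag)
    next
      assume "h0 v v = \<zero>\<^bsub>PL.Lring\<^esub>"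
      then have "\<mu> \<otimes> q v = \<zero>" "q v \<oplus> q v = \<zero>" using v mk by (simp_all add: h0_def f_g f_diag)
      moreover have "q v \<oplus> q v = (\<one> \<oplus> \<one>) \<otimes> q v" using v by (simp add: R.l_distr)
      ultimately show "q v = \<zero>" using False v mk by (auto simp: R.integral_iff)
    qed
    then have S': "S = {v \<in> carrier PL.Lmod. h v v = \<zero>\<^bsub>PL.Lring\<^esub>}" unfolding S_q using hz by auto
    have geo: "PL.LP.geo = isotropic_geometry PL.Lring PL.Lmod h"
      using PL.LP.geo_eq_isotropic[of h] orth S' by blast
    \<comment> \<open>A minimal Hermitian space has ambient projective dimension
      \<open>2 m - 1\<close>, which fits because the vector dimension over the extension is
      \<open>n = 2 m\<close>.\<close>
    let ?J = "{0..2 * int m - 1}"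
    have "card ?J = n" using m by simp
    then obtain \<psi> where \<psi>: "coord_map PL.Lring ?J PL.Lmod (carrier PL.Lmod) \<psi>"
      using PL.L.coord_map_ex[OF Ld, of ?J] by auto
    let ?h = "\<lambda>u v. h (\<psi> u) (\<psi> v)"
    have "(\<zero>, \<one>) \<in> carrier PL.Lring" "\<sigma> (\<zero>, \<one>) \<noteq> (\<zero>, \<one>)"
    proof -
      show "(\<zero>, \<one>) \<in> carrier PL.Lring" by simp
      show "\<sigma> (\<zero>, \<one>) \<noteq> (\<zero>, \<one>)"
      proof
        assume "\<sigma> (\<zero>, \<one>) = (\<zero>, \<one>)"
        then have "\<mu> = \<zero>" "\<ominus> \<one> = \<one>" using mk by simp_all
        then have "\<one> \<oplus> \<one> = \<zero>" using R.l_neg[OF R.one_closed] by simp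
        then show False using False \<open>\<mu> = \<zero>\<close> by blast
      qed
    qed
    then have fi: "field_involution PL.Lring \<sigma>"
      unfolding field_involution_def using sigma_iso sigma_sigma by blast
    have "hermitian_form PL.Lring (coord_space PL.Lring ?J) \<sigma> ?h"
      unfolding hermitian_form_def
    proof (intro conjI ballI)
      show "sesquilinear_form PL.Lring (coord_space PL.Lring ?J) \<sigma> ?h"
        using PL.L.pull_sesquilinear[OF \<psi> h_sesquilinear] .
      fix u v assume "u \<in> carrier (coord_space PL.Lring ?J)" "v \<in> carrier (coord_space PL.Lring ?J)"
      then have "\<psi> u \<in> carrier M" "\<psi> v \<in> carrier M" using PL.L.coord_mapD(1)[OF \<psi>] by simp_all
      then show "h (\<psi> v) (\<psi> u) = \<sigma> (h (\<psi> u) (\<psi> v))" by (rule h_hermitian)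
    qed
    moreover have "nondegenerate PL.Lring PL.Lmod h"
      unfolding nondegenerate_def using h0_nondegenerate hz by simp
    then have "nondegenerate PL.Lring (coord_space PL.Lring ?J) ?h" using PL.L.pull_nondegenerate[OF \<psi>] by blast
    moreover have "isomorphic PL.\<Gamma> (isotropic_geometry PL.Lring (coord_space PL.Lring ?J) ?h)"
      by (rule PL.L.isomorphic_coord[OF \<psi> _ PL.Gamma_blocks]) (use PL.chi_iso geo in simp)
    ultimately have "minimal_hermitian_polar_space PL.Lring m PL.\<Gamma>"
      unfolding minimal_hermitian_polar_space_def hermitian_polar_space_def Let_def using PS fi by blast
    then show ?thesis using PL.Lring_field m2 PL.fixed_structure_Gamma by blast
  next
    case True
    have neg: "\<ominus> a = a" if a: "a \<in> carrier R" for a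
    proof -
      have "a \<oplus> a = (\<one> \<oplus> \<one>) \<otimes> a" using a by (simp add: R.l_distr)
      then have "a \<oplus> a = \<zero>" using True a by simp
      then show ?thesis using a R.minus_equality by blast
    qed
    \<comment> \<open>Conjugation is trivial and signs disappear here, so the skew-Hermitian form
      \<open>h0\<close> is bilinear and alternating.\<close>
    have sid: "\<sigma> x = x" if "x \<in> carrier PL.Lring" for x using that neg True by auto
    have sesq: "sesquilinear_form PL.Lring PL.Lmod (\<lambda>c. c) h0"
      using h0_sesquilinear by (simp only: sesquilinear_form_def sid ball_triv simp_thms cong: ball_cong)
    have orth: "PL.orthL u v \<longleftrightarrow> h0 u v = \<zero>\<^bsub>PL.Lring\<^esub>" if "u \<in> carrier PL.Lmod" "v \<in> carrier PL.Lmod" for u v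
      using that h0_orth by simp
    have alt: "h0 v v = \<zero>\<^bsub>PL.Lring\<^esub>" if v: "v \<in> carrier M" for v
    proof -
      have "q v \<oplus> q v = \<zero>" using neg[of "q v"] R.l_neg[of "q v"] v by simp
      then show ?thesis using v mk True by (simp add: h0_def f_g f_diag)
    qed
    let ?I = "isotropic_geometry PL.Lring PL.Lmod h0"
    have geo: "PL.LP.geo = induced_geometry ?I (PL.LP.pts S)" "geom_subspace ?I (PL.LP.pts S)"
      using PL.LP.geo_eq_induced[of h0] orth by blast+
    let ?J = "{1..2 * int m}"
    have "card ?J = n" using m by simp
    then obtain \<psi> where \<psi>: "coord_map PL.Lring ?J PL.Lmod (carrier PL.Lmod) \<psi>"
      using PL.L.coord_map_ex[OF Ld, of ?J] by auto
    let ?h = "\<lambda>u v. h0 (\<psi> u) (\<psi> v)"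
    let ?W = "isotropic_geometry PL.Lring (coord_space PL.Lring ?J) ?h"
    interpret C: vspace PL.Lring "coord_space PL.Lring ?J" using coord_vspace PL.Lring_field by blast
    interpret G: giso "\<lambda>x. \<psi> ` x" ?W ?I
      using PL.L.isotropic_geometry_iso[OF \<psi>, of h0] C.isotropic_blocks_sub by (simp add: giso_def)
    have af: "alternating_form PL.Lring (coord_space PL.Lring ?J) ?h"
      unfolding alternating_form_def
      using PL.L.pull_sesquilinear[OF \<psi> sesq] alt PL.L.coord_mapD(1)[OF \<psi>] by simp
    have sym: "symplectic_polar_space PL.Lring m ?W"
    proof -
      have "geometry_iso (\<lambda>x. x) ?W ?W" by (simp add: geometry_iso_def bij_betw_def)
      then have "isomorphic ?W ?W" using C.isotropic_blocks_sub unfolding isomorphic_def by blast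
      then show ?thesis unfolding symplectic_polar_space_def Let_def
        using af PL.L.pull_nondegenerate[OF \<psi> nd0] by blast
    qed
    have SI: "PL.LP.pts S \<subseteq> points ?I" using geo(2) by (simp add: geom_subspace_def)
    then obtain X where X: "X \<subseteq> points ?W" "PL.LP.pts S = (\<lambda>x. \<psi> ` x) ` X" using G.surjE by blast
    have gX: "geom_subspace ?W X" using G.geom_subspace_iff[OF X(1)] geo(2) X by simp
    \<comment> \<open>If every vector were singular, \<open>q\<close> and with it the polar form
      \<open>f\<close> would vanish, against nondegeneracy.\<close>
    have neW: "X \<noteq> points ?W"
    proof
      assume "X = points ?W"
      then have eq: "PL.LP.pts S = points ?I" using G.points_image X by simp
      have "carrier M \<subseteq> S"
      proof
        fix v assume v: "v \<in> carrier M"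
        show "v \<in> S"
        proof (cases "v = \<^bold>0")
          case False
          have "pspan PL.Lring PL.Lmod v \<in> points ?I"
          proof -
            have "h0 x y = \<zero>\<^bsub>PL.Lring\<^esub>" if xy: "x \<in> pspan PL.Lring PL.Lmod v" "y \<in> pspan PL.Lring PL.Lmod v" for x y
            proof -
              have ov: "PL.orthL v v" using orth[of v v] alt v by simp
              have vL: "v \<in> carrier PL.Lmod" using v by simp
              have yc: "y \<in> carrier PL.Lmod" "x \<in> carrier PL.Lmod"
                using xy PL.L.subspD(2)[OF PL.L.subsp_pspan[OF vL]] by blast+
              have "PL.orthL v y" using PL.LP.orth_pspan(1)[OF vL vL ov xy(2)] .
              then have "PL.orthL y v" using PL.LP.orth_sym[OF vL yc(1)] by blast
              then have "PL.orthL y x" using PL.LP.orth_pspan(1)[OF yc(1) vL _ xy(1)] by blast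
              then show ?thesis using orth[OF yc(2,1)] PL.LP.orth_sym[OF yc] by blast
            qed
            moreover have "pspan PL.Lring PL.Lmod v \<in> pg_points PL.Lring PL.Lmod"
              using v False by (auto simp: pg_points_def)
            ultimately show ?thesis unfolding isotropic_geometry_def by simp
          qed
          then have "pspan PL.Lring PL.Lmod v \<in> PL.LP.pts S" using eq by simp
          then show ?thesis using PL.LP.pts_S_iff[of v] v False by simp
        qed simp
      qed
      then have qz: "q v = \<zero>" if "v \<in> carrier M" for v using that S_q by blast
      obtain v where v: "v \<in> M0" "v \<noteq> \<^bold>0" using dim_less[of 0 "{\<^bold>0}" n M0] M0 rank by auto
      have vc: "v \<in> carrier M" using v M0 tsubD(4) by (auto simp: maxtsub_def)
      have "f v w = \<zero>" if w: "w \<in> carrier M" for w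
        using q_add[OF vc w] qz vc w by simp
      then show False using f_nondeg[OF vc] v by blast
    qed
    have iso: "isomorphic PL.\<Gamma> (induced_geometry ?W X)"
    proof -
      have "geometry_iso (\<lambda>x. \<psi> ` x) (induced_geometry ?W X) (induced_geometry ?I (PL.LP.pts S))"
        using G.induced_iso[OF X(1)] X(2) by simp
      moreover have "blocks (induced_geometry ?W X) \<subseteq> Pow (points (induced_geometry ?W X))"
        by (auto simp: induced_geometry_def)
      ultimately show ?thesis
        using geometry_iso_comp[OF _ geometry_iso_inv, of PL.\<chi> PL.\<Gamma> "induced_geometry ?I (PL.LP.pts S)"
            "\<lambda>x. \<psi> ` x" "induced_geometry ?W X"] PL.chi_iso geo(1) PL.Gamma_blocks
        unfolding isomorphic_def by auto
    qed
    have "\<one>\<^bsub>PL.Lring\<^esub> \<oplus>\<^bsub>PL.Lring\<^esub> \<one>\<^bsub>PL.Lring\<^esub> = \<zero>\<^bsub>PL.Lring\<^esub>" using True by simp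
    then have "mixed_polar_space PL.Lring m PL.\<Gamma>"
      unfolding mixed_polar_space_def using PS sym gX neW iso by blast
    then show ?thesis using PL.Lring_field m2 PL.fixed_structure_Gamma by blast
  qed
qed

end

lemma (in hyp_model) hyperbolic_conclusion:
  "\<exists>(F :: ('a \<times> 'a) ring) m \<Gamma>. field F \<and> m \<ge> 2 \<and>
    (minimal_hermitian_polar_space F m \<Gamma> \<or> mixed_polar_space F m \<Gamma>) \<and>
    fixed_structure \<Delta> \<theta> = singular_geometry \<Gamma>"
proof -
  interpret H: hyp R M S orth N n M0 t f q by (rule is_hyp)
  obtain g \<mu> \<kappa> where g: "linear_on (carrier M) g" "\<mu> \<in> carrier R" "\<kappa> \<in> carrier R"
    "\<And>z. z \<in> S \<Longrightarrow> z \<noteq> \<^bold>0 \<Longrightarrow> t z \<in> pspan R M (g z)"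
    "\<And>z. z \<in> carrier M \<Longrightarrow> g (g z) = \<mu> \<^bold>* g z \<^bold>+ \<kappa> \<^bold>* z"
    "\<And>z. z \<in> carrier M \<Longrightarrow> q (g z) = \<ominus> (\<kappa> \<otimes> q z)"
    "\<And>z. z \<in> carrier M \<Longrightarrow> f z (g z) = \<mu> \<otimes> q z"
    using H.hyperbolic_lift by blast
  interpret hyp_model_lift R M S orth N n M0 \<Delta> \<phi> \<theta> f q g \<mu> \<kappa>
    by unfold_locales (use g in auto)
  show ?thesis by (rule hyperbolic_result)
qed

subsection \<open>Symplectic polar spaces\<close>

locale symp_model = polar_model +
  fixes f :: "'c \<Rightarrow> 'c \<Rightarrow> 'a"
  assumes f_closed [simp]: "u \<in> carrier M \<Longrightarrow> v \<in> carrier M \<Longrightarrow> f u v \<in> carrier R"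
    and f_add_l: "u \<in> carrier M \<Longrightarrow> v \<in> carrier M \<Longrightarrow> w \<in> carrier M \<Longrightarrow> f (u \<^bold>+ v) w = f u w \<oplus> f v w"
    and f_add_r: "u \<in> carrier M \<Longrightarrow> v \<in> carrier M \<Longrightarrow> w \<in> carrier M \<Longrightarrow> f u (v \<^bold>+ w) = f u v \<oplus> f u w"
    and f_smult_l: "c \<in> carrier R \<Longrightarrow> u \<in> carrier M \<Longrightarrow> v \<in> carrier M \<Longrightarrow> f (c \<^bold>* u) v = c \<otimes> f u v"
    and f_smult_r: "c \<in> carrier R \<Longrightarrow> u \<in> carrier M \<Longrightarrow> v \<in> carrier M \<Longrightarrow> f u (c \<^bold>* v) = c \<otimes> f u v"
    and orth_f: "u \<in> carrier M \<Longrightarrow> v \<in> carrier M \<Longrightarrow> u \<perp> v \<longleftrightarrow> f u v = \<zero>"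
    and finV2: "dim (2 * n) (carrier M)"
    and S_all: "S = carrier M" and f_alt: "v \<in> carrier M \<Longrightarrow> f v v = \<zero>"
begin

lemma is_symp: "symp R M S orth N n M0 t f"
  by unfold_locales
    (fact f_closed f_add_l f_add_r f_smult_l f_smult_r orth_f finV2 t_surj' S_all f_alt)+

lemma symplectic_conclusion:
  "\<exists>(L :: ('a \<times> 'a) ring) m \<Gamma>. quadratic_extension R L \<and> m \<ge> 2 \<and>
    symplectic_polar_space L m \<Gamma> \<and> fixed_structure \<Delta> \<theta> = singular_geometry \<Gamma>"
proof -
  interpret H: symp R M S orth N n M0 t f by (rule is_symp)
  obtain g \<kappa> where g: "linear_on (carrier M) g" "\<kappa> \<in> carrier R"
    "\<And>z. z \<in> carrier M \<Longrightarrow> z \<noteq> \<^bold>0 \<Longrightarrow> t z \<in> pspan R M (g z)"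
    "\<And>z. z \<in> carrier M \<Longrightarrow> g (g z) = \<kappa> \<^bold>* z"
    "\<And>u v. u \<in> carrier M \<Longrightarrow> v \<in> carrier M \<Longrightarrow> f u (g v) = f (g u) v"
    using H.symplectic_lift by blast
  note gD = linear_onD[OF g(1)]
  have lift: "t z \<in> pspan R M (g z)" if "z \<in> S" "z \<noteq> \<^bold>0" for z using g(3) that S_all by blast
  have gg: "g (g z) = \<zero> \<^bold>* g z \<^bold>+ \<kappa> \<^bold>* z" if "z \<in> carrier M" for z using g(2,4) gD(1) that by simp
  interpret PL: polar_model_lift R M S orth N n M0 \<Delta> \<phi> \<theta> g "\<zero>" \<kappa>
  proof unfold_locales
    show "b \<otimes> b \<noteq> \<zero> \<otimes> b \<oplus> \<kappa>" if "b \<in> carrier R" for b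
      using lift_irreducible[OF g(1) lift R.zero_closed g(2) gg that] by blast
    show "g v \<in> S" "v \<perp> g v" if "v \<in> S" for v using lift_in_S[OF g(1) lift that] by blast+
    show "(u \<perp> g v) = (g u \<perp> v)" if "u \<in> carrier M" "v \<in> carrier M" for u v
      using orth_f g(5) gD(1) that by simp
  qed (use g gg lift in auto)
  obtain m where m: "n = 2 * m" using even_rank by blast
  have m2: "m \<ge> 2" using rank4 m by simp
  \<comment> \<open>Again the form over the extension with \<open>T\<close>-component
    \<open>f\<close>. With \<open>\<mu> = 0\<close> and \<open>g\<close> self-adjoint, the other
    component is \<open>f u (g v)\<close> without a sign, and domesticity makes the form
    alternating.\<close>
  define h where "h u v = (f u (g v), f u v)" for u v
  have orth: "PL.orthL u v \<longleftrightarrow> h u v = \<zero>\<^bsub>PL.Lring\<^esub>" if "u \<in> carrier PL.Lmod" "v \<in> carrier PL.Lmod" for u v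
    using that orth_f gD(1) by (auto simp: PL.orthL_def h_def)
  have alt: "h v v = \<zero>\<^bsub>PL.Lring\<^esub>" if v: "v \<in> carrier M" for v
    using PL.g_orth[of v] orth_f[OF v gD(1)[OF v]] f_alt v S_all by (simp add: h_def)
  have sesq: "sesquilinear_form PL.Lring PL.Lmod (\<lambda>c. c) h"
    unfolding sesquilinear_form_def
  proof (intro conjI ballI)
    fix u v assume uv: "u \<in> carrier PL.Lmod" "v \<in> carrier PL.Lmod"
    then have c: "u \<in> carrier M" "v \<in> carrier M" by auto
    show "h u v \<in> carrier PL.Lring" using c gD(1) by (simp add: h_def)
    { fix w assume "w \<in> carrier PL.Lmod"
      then have w: "w \<in> carrier M" by simp
      show "h (u \<oplus>\<^bsub>PL.Lmod\<^esub> v) w = h u w \<oplus>\<^bsub>PL.Lring\<^esub> h v w"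
        using c w gD(1) by (simp add: h_def f_add_l)
      show "h u (v \<oplus>\<^bsub>PL.Lmod\<^esub> w) = h u v \<oplus>\<^bsub>PL.Lring\<^esub> h u w"
        using c w gD(1,2) by (simp add: h_def f_add_r) }
    { fix x assume "x \<in> carrier PL.Lring"
      then obtain a b where x: "x = (a, b)" "a \<in> carrier R" "b \<in> carrier R" by auto
      have ggf: "f (g u) (g v) = \<kappa> \<otimes> f u v" using g(5)[of u "g v"] g(2,4) gD(1) c by (simp add: f_smult_r)
      show "h (x \<odot>\<^bsub>PL.Lmod\<^esub> u) v = x \<otimes>\<^bsub>PL.Lring\<^esub> h u v"
        unfolding x(1) using x c g(2) gD(1) ggf g(5)[OF c, symmetric]
        by (simp add: h_def f_add_l f_smult_l R.m_ac R.a_ac)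
      show "h u (x \<odot>\<^bsub>PL.Lmod\<^esub> v) = x \<otimes>\<^bsub>PL.Lring\<^esub> h u v"
        unfolding x(1) using x c g(2,4) gD
        by (simp add: h_def f_add_r f_smult_r R.m_ac R.a_ac) }
  qed
  have nd: "nondegenerate PL.Lring PL.Lmod h"
    unfolding nondegenerate_def
  proof (intro ballI impI)
    fix u assume u: "u \<in> carrier PL.Lmod" "\<forall>v\<in>carrier PL.Lmod. h u v = \<zero>\<^bsub>PL.Lring\<^esub>"
    then have "f u v = \<zero>" if "v \<in> carrier M" for v using that by (simp add: h_def)
    then show "u = \<zero>\<^bsub>PL.Lmod\<^esub>" using S_rad[of u] orth_f u(1) S_all by simp
  qed
  have S': "S = {v \<in> carrier PL.Lmod. h v v = \<zero>\<^bsub>PL.Lring\<^esub>}" using alt S_all by auto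
  have geo: "PL.LP.geo = isotropic_geometry PL.Lring PL.Lmod h"
    using PL.LP.geo_eq_isotropic[of h] orth S' by blast
  let ?J = "{1..2 * int m}"
  have "card ?J = n" using m by simp
  then obtain \<psi> where \<psi>: "coord_map PL.Lring ?J PL.Lmod (carrier PL.Lmod) \<psi>"
    using PL.L.coord_map_ex[OF PL.Ldim_n[OF finV2], of ?J] by auto
  let ?h = "\<lambda>u v. h (\<psi> u) (\<psi> v)"
  have "alternating_form PL.Lring (coord_space PL.Lring ?J) ?h"
    unfolding alternating_form_def
    using PL.L.pull_sesquilinear[OF \<psi> sesq] alt PL.L.coord_mapD(1)[OF \<psi>] by simp
  moreover have "nondegenerate PL.Lring (coord_space PL.Lring ?J) ?h" using PL.L.pull_nondegenerate[OF \<psi> nd] .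
  moreover have "isomorphic PL.\<Gamma> (isotropic_geometry PL.Lring (coord_space PL.Lring ?J) ?h)"
    by (rule PL.L.isomorphic_coord[OF \<psi> _ PL.Gamma_blocks]) (use PL.chi_iso geo in simp)
  ultimately have "symplectic_polar_space PL.Lring m PL.\<Gamma>"
    unfolding symplectic_polar_space_def Let_def by blast
  then show ?thesis
    using quadratic_extension_quad_ring[OF R.field_axioms R.zero_closed g(2) PL.Lring_field] m2 PL.fixed_structure_Gamma
    by blast
qed

end

section \<open>The split polar spaces\<close>

text \<open>Every new vector \<open>v\<close> cuts the perp properly: otherwise
  \<open>perp_perp\<close> would put \<open>v\<close> into \<open>U\<close> up to the radical, and
  the radical vanishes when all vectors are singular.\<close>

lemma (in pol) dim_perp_exact:
  assumes "dim N (carrier M)" "S = carrier M" "dim k U"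
  shows "\<exists>e. dim e (perp U) \<and> e + k = N"
  using assms(3)
proof (induction rule: dimx.induct)
  case dimx_0
  have "perp {\<^bold>0} = carrier M" by (auto simp: perp_def)
  then show ?case using assms(1) by (intro exI[of _ N]) simp
next
  case (dimx_Suc k U v)
  have U: "subsp U" using dim_subsp[OF dimx_Suc.hyps(1)] .
  note v = dimx_Suc.hyps(2)
  obtain e where e: "dim e (perp U)" "e + k = N" using dimx_Suc.IH by blast
  obtain e' where e': "dim e' (perp U \<inter> perp {v})" "e \<le> Suc e'" using dim_perp1[OF e(1) v] by blast
  have "e' \<noteq> e"
  proof
    assume "e' = e"
    then have "perp U \<inter> perp {v} = perp U" using dim_eq[OF _ e(1)] e'(1) by blast
    then have "v \<perp> z" if "z \<in> perp U" for z using that by (auto simp: perp_def)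
    then obtain x r where xr: "x \<in> U" "r \<in> carrier M" "v = x \<^bold>+ r" "\<forall>z\<in>carrier M. r \<perp> z"
      using perp_perp[OF dimx_Suc.hyps(1) v] by blast
    have "r = \<^bold>0" using S_rad[of r] xr assms(2) by blast
    then show False using xr dimx_Suc.hyps(3) subspD(2)[OF U] by simp
  qed
  moreover have "e' \<le> e" using dim_le[OF e(1) e'(1)] by blast
  ultimately have "e' + Suc k = N" using e e' by linarith
  then show ?case using e'(1) unfolding perp_ext[OF U v] by blast
qed

text \<open>When all vectors are singular, maximality says \<open>perp U = U\<close>, and the
  dimensions of \<open>U\<close> and its perp add up to \<open>N\<close>.\<close>

lemma (in pol) maxtsub_dim_half:
  assumes "dim N (carrier M)" "S = carrier M" "maxtsub U" "dim k U"
  shows "2 * k = N"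
proof -
  have "perp U = U"
  proof (intro equalityI subsetI)
    show "v \<in> U" if "v \<in> perp U" for v
      using that assms(2) assms(3)[unfolded maxtsub_def] unfolding perp_def by blast
    have U: "tsub U" using assms(3) unfolding maxtsub_def by blast
    show "v \<in> perp U" if "v \<in> U" for v
      using tsubD(3,4)[OF U] that unfolding perp_def by blast
  qed
  moreover obtain e where "dim e (perp U)" "e + k = N" using dim_perp_exact[OF assms(1,2,4)] by blast
  ultimately show ?thesis using dim_unique[OF assms(4), of e] by simp
qed

text \<open>Reflexivity of \<open>f\<close> covers the alternating and the symmetric case at
  once.\<close>

locale bilinear_space = vspace +
  fixes S :: "'c set" and f :: "'c \<Rightarrow> 'c \<Rightarrow> 'a"
  assumes f_closed [simp]: "u \<in> carrier M \<Longrightarrow> v \<in> carrier M \<Longrightarrow> f u v \<in> carrier R"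
    and f_add_l: "u \<in> carrier M \<Longrightarrow> v \<in> carrier M \<Longrightarrow> w \<in> carrier M \<Longrightarrow> f (u \<^bold>+ v) w = f u w \<oplus> f v w"
    and f_add_r: "u \<in> carrier M \<Longrightarrow> v \<in> carrier M \<Longrightarrow> w \<in> carrier M \<Longrightarrow> f u (v \<^bold>+ w) = f u v \<oplus> f u w"
    and f_smult_l: "c \<in> carrier R \<Longrightarrow> u \<in> carrier M \<Longrightarrow> v \<in> carrier M \<Longrightarrow> f (c \<^bold>* u) v = c \<otimes> f u v"
    and f_smult_r: "c \<in> carrier R \<Longrightarrow> u \<in> carrier M \<Longrightarrow> v \<in> carrier M \<Longrightarrow> f u (c \<^bold>* v) = c \<otimes> f u v"
    and f_refl: "u \<in> carrier M \<Longrightarrow> v \<in> carrier M \<Longrightarrow> f u v = \<zero> \<Longrightarrow> f v u = \<zero>"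
    and S_sub: "S \<subseteq> carrier M" and S_zero: "\<^bold>0 \<in> S"
    and S_smult: "a \<in> carrier R \<Longrightarrow> v \<in> S \<Longrightarrow> a \<^bold>* v \<in> S"
    and S_add: "u \<in> S \<Longrightarrow> v \<in> S \<Longrightarrow> f u v = \<zero> \<Longrightarrow> u \<^bold>+ v \<in> S"
    and S_self: "v \<in> S \<Longrightarrow> f v v = \<zero>"
    and S_lift: "u \<in> S \<Longrightarrow> z \<in> carrier M \<Longrightarrow> f u z \<noteq> \<zero> \<Longrightarrow> \<exists>c\<in>carrier R. z \<^bold>+ c \<^bold>* u \<in> S"
    and S_rad: "v \<in> S \<Longrightarrow> (\<And>w. w \<in> carrier M \<Longrightarrow> f v w = \<zero>) \<Longrightarrow> v = \<^bold>0"
begin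

sublocale P: pol R M S "\<lambda>u v. f u v = \<zero>"
proof unfold_locales
  show "\<exists>c\<in>carrier R. f x (u \<^bold>+ c \<^bold>* v) = \<zero>"
    if c: "u \<in> carrier M" "v \<in> carrier M" "x \<in> carrier M" and nz: "f x v \<noteq> \<zero>" for u v x
  proof -
    let ?c = "\<ominus> (f x u \<otimes> inv f x v)"
    have "f x (u \<^bold>+ ?c \<^bold>* v) = f x u \<oplus> \<ominus> (f x u \<otimes> (inv f x v \<otimes> f x v))"
      using c nz by (simp add: f_add_r f_smult_r R.l_minus R.m_assoc del: inv_mult)
    also have "\<dots> = \<zero>" using c nz by (simp add: R.r_neg)
    finally show ?thesis using c nz by (intro bexI[of _ ?c]) simp_all
  qed
  show "f u (v \<^bold>+ w) = \<zero>" if "u \<in> carrier M" "v \<in> carrier M" "w \<in> carrier M" "f u v = \<zero>" "f u w = \<zero>" for u v w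
    using f_add_r[OF that(1-3)] that(4,5) by simp
  show "f u (a \<^bold>* v) = \<zero>" if "a \<in> carrier R" "u \<in> carrier M" "v \<in> carrier M" "f u v = \<zero>" for a u v
    using f_smult_r[OF that(1-3)] that(1,4) by simp
qed (fact S_sub S_zero S_smult S_add S_self S_lift S_rad f_refl)+

end

locale setting =
  fixes K :: "('a, 'b) ring_scheme" (structure) and \<Delta> :: "'p geometry" and \<theta> :: "'p \<Rightarrow> 'p" and n :: nat
  assumes field_K: "field K" and n4: "n \<ge> 4" and coll: "collineation \<Delta> \<theta>"
    and domestic: "point_domestic \<Delta> \<theta>" and nofix: "\<forall>x\<in>points \<Delta>. \<theta> x \<noteq> x"
begin

lemma symplectic_case:
  assumes "symplectic_polar_space K n \<Delta>"
  shows "even n \<and> opposition_diagram_2 n \<Delta> \<theta> \<and>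
    (\<exists>(L :: ('a \<times> 'a) ring) m \<Gamma>. quadratic_extension K L \<and> m \<ge> 2 \<and>
       symplectic_polar_space L m \<Gamma> \<and> fixed_structure \<Delta> \<theta> = singular_geometry \<Gamma>)"
proof -
  let ?V = "coord_space K {1..2 * int n}"
  obtain f where f: "alternating_form K ?V f" "nondegenerate K ?V f" "isomorphic \<Delta> (isotropic_geometry K ?V f)"
    using assms unfolding symplectic_polar_space_def Let_def by blast
  obtain \<phi> where \<phi>: "geometry_iso \<phi> \<Delta> (isotropic_geometry K ?V f)" and bl: "blocks \<Delta> \<subseteq> Pow (points \<Delta>)"
    using f(3) unfolding isomorphic_def by blast
  interpret V: vspace K ?V using coord_vspace[OF field_K] .
  note ff = f(1)[unfolded alternating_form_def sesquilinear_form_def]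
  have alt: "f v v = \<zero>" if "v \<in> carrier ?V" for v using ff that by blast
  have cl: "f u v \<in> carrier K" if "u \<in> carrier ?V" "v \<in> carrier ?V" for u v using ff that by blast
  have al: "f (u \<oplus>\<^bsub>?V\<^esub> v) w = f u w \<oplus> f v w"
    if "u \<in> carrier ?V" "v \<in> carrier ?V" "w \<in> carrier ?V" for u v w using ff that by blast
  have ar: "f u (v \<oplus>\<^bsub>?V\<^esub> w) = f u v \<oplus> f u w"
    if "u \<in> carrier ?V" "v \<in> carrier ?V" "w \<in> carrier ?V" for u v w using ff that by blast
  have sl: "f (c \<odot>\<^bsub>?V\<^esub> u) v = c \<otimes> f u v"
    if "c \<in> carrier K" "u \<in> carrier ?V" "v \<in> carrier ?V" for c u v using ff that by blast
  have sr: "f u (c \<odot>\<^bsub>?V\<^esub> v) = c \<otimes> f u v"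
    if "c \<in> carrier K" "u \<in> carrier ?V" "v \<in> carrier ?V" for c u v using ff that by blast
  have refl: "f v u = \<zero>" if c: "u \<in> carrier ?V" "v \<in> carrier ?V" and o: "f u v = \<zero>" for u v
  proof -
    have uv: "u \<oplus>\<^bsub>?V\<^esub> v \<in> carrier ?V" using V.M.add.m_closed[OF c] .
    have "\<zero> = f (u \<oplus>\<^bsub>?V\<^esub> v) (u \<oplus>\<^bsub>?V\<^esub> v)" using alt[OF uv] by simp
    also have "\<dots> = (f u u \<oplus> f u v) \<oplus> (f v u \<oplus> f v v)"
      unfolding al[OF c uv] ar[OF c(1) c] ar[OF c(2) c] ..
    also have "\<dots> = f v u" unfolding o alt[OF c(1)] alt[OF c(2)] using cl[OF c(2,1)] by simp
    finally show ?thesis by simp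
  qed
  interpret F: bilinear_space K ?V "carrier ?V" f
  proof (unfold_locales, goal_cases)
    \<comment> \<open>Every vector is singular here, so the multiple of \<open>u\<close> can be
      zero.\<close>
    case (12 u z)
    have "z \<oplus>\<^bsub>?V\<^esub> \<zero> \<odot>\<^bsub>?V\<^esub> u \<in> carrier ?V"
      by (intro V.M.add.m_closed V.smult_closed V.R.zero_closed 12)
    then show ?case using V.R.zero_closed by blast
  next
    case (13 v) then show ?case using f(2) unfolding nondegenerate_def by blast
  qed (fact cl al ar sl sr refl alt | rule subset_refl V.M.zero_closed V.smult_closed V.M.add.m_closed; assumption?)+
  have "card {1..2 * int n} = 2 * n" by simp
  then have dV: "V.dim (2 * n) (carrier ?V)" using dim_coord[OF field_K, of "{1..2 * int n}"] by simp
  obtain M0 where M0: "F.P.maxtsub M0" using F.P.maxtsub_extend[OF dV F.P.tsub_zero] by blast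
  obtain k where k: "V.dim k M0" using V.dim_mono[OF dV _ V.subspD(1)] F.P.tsubD(1) M0
    unfolding F.P.maxtsub_def by blast
  have "2 * k = 2 * n" using F.P.maxtsub_dim_half[OF dV HOL.refl M0 k] .
  then have dM: "V.dim n M0" using k by simp
  have "carrier ?V = {v \<in> carrier ?V. f v v = \<zero>}" using alt by blast
  then have geo: "F.P.geo = isotropic_geometry K ?V f" using F.P.geo_eq_isotropic[of f] by blast
  interpret X: polar_model K ?V "carrier ?V" "\<lambda>u v. f u v = \<zero>" "2 * n" n M0 \<Delta> \<phi> \<theta>
    by unfold_locales (use dV M0 dM n4 \<phi> bl coll domestic nofix geo in \<open>simp_all del: coord_simps\<close>)
  interpret Y: symp_model K ?V "carrier ?V" "\<lambda>u v. f u v = \<zero>" "2 * n" n M0 \<Delta> \<phi> \<theta> f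
    by unfold_locales (rule HOL.refl | fact cl al ar sl sr alt dV)+
  show ?thesis using X.even_rank X.diagram Y.symplectic_conclusion by blast
qed

end

section \<open>Parabolic and hyperbolic quadrics in coordinates\<close>

locale coord_quadric = field R for R (structure) +
  fixes I :: "int set" and n :: nat
  assumes I: "I = {- int n..int n} \<or> I = {- int n..int n} - {0}"
begin

abbreviation V where "V \<equiv> coord_space R I"

sublocale V: vspace R V by (rule coord_vspace[OF field_axioms])

text \<open>The coordinate at 0, or zero if the index set omits it, so that one computation serves
  both quadrics.\<close>

definition z where "z v = (if 0 \<in> I then v 0 else \<zero>)" for v :: "int \<Rightarrow> 'a"
definition s where "s u v = (\<Oplus>i\<in>{1..int n}. u (- i) \<otimes> v i)" for u v :: "int \<Rightarrow> 'a"
definition q where "q v = s v v \<ominus> z v \<otimes> z v"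
text \<open>The polarisation of \<open>q\<close>. In characteristic 2 the part with \<open>z\<close>
  cancels, so on the parabolic quadric the vectors with only a coordinate at 0 form the
  radical.\<close>

definition f where "f u v = (s u v \<oplus> s v u) \<ominus> (z u \<otimes> z v \<oplus> z u \<otimes> z v)"

lemma in_I: "i \<in> {1..int n} \<Longrightarrow> i \<in> I" "i \<in> {1..int n} \<Longrightarrow> - i \<in> I"
  using I by auto

lemma coord_closed: "v \<in> carrier V \<Longrightarrow> i \<in> I \<Longrightarrow> v i \<in> carrier R" by (auto simp: PiE_iff)

lemma s_closed [simp]: "u \<in> carrier V \<Longrightarrow> v \<in> carrier V \<Longrightarrow> s u v \<in> carrier R"
  unfolding s_def using coord_closed in_I by (intro finsum_closed) blast

lemma z_closed [simp]: "v \<in> carrier V \<Longrightarrow> z v \<in> carrier R"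
  using coord_closed by (simp add: z_def)

lemma z_add: "u \<in> carrier V \<Longrightarrow> v \<in> carrier V \<Longrightarrow> z (u \<oplus>\<^bsub>V\<^esub> v) = z u \<oplus> z v"
  by (simp add: z_def)

lemma z_smult: "c \<in> carrier R \<Longrightarrow> z (c \<odot>\<^bsub>V\<^esub> u) = c \<otimes> z u"
  by (simp add: z_def)

lemma s_add:
  assumes "u \<in> carrier V" "v \<in> carrier V" "w \<in> carrier V"
  shows "s (u \<oplus>\<^bsub>V\<^esub> v) w = s u w \<oplus> s v w" "s u (v \<oplus>\<^bsub>V\<^esub> w) = s u v \<oplus> s u w"
proof -
  note c = coord_closed[OF assms(1)] coord_closed[OF assms(2)] coord_closed[OF assms(3)]
  have "s (u \<oplus>\<^bsub>V\<^esub> v) w = (\<Oplus>i\<in>{1..int n}. u (- i) \<otimes> w i \<oplus> v (- i) \<otimes> w i)"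
    unfolding s_def by (rule finsum_cong') (use c in_I in \<open>auto simp: l_distr\<close>)
  also have "\<dots> = s u w \<oplus> s v w" unfolding s_def by (rule finsum_addf) (use c in_I in auto)
  finally show "s (u \<oplus>\<^bsub>V\<^esub> v) w = s u w \<oplus> s v w" .
  have "s u (v \<oplus>\<^bsub>V\<^esub> w) = (\<Oplus>i\<in>{1..int n}. u (- i) \<otimes> v i \<oplus> u (- i) \<otimes> w i)"
    unfolding s_def by (rule finsum_cong') (use c in_I in \<open>auto simp: r_distr\<close>)
  also have "\<dots> = s u v \<oplus> s u w" unfolding s_def by (rule finsum_addf) (use c in_I in auto)
  finally show "s u (v \<oplus>\<^bsub>V\<^esub> w) = s u v \<oplus> s u w" .
qed

lemma s_smult:
  assumes "c \<in> carrier R" "u \<in> carrier V" "v \<in> carrier V"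
  shows "s (c \<odot>\<^bsub>V\<^esub> u) v = c \<otimes> s u v" "s u (c \<odot>\<^bsub>V\<^esub> v) = c \<otimes> s u v"
proof -
  note cc = coord_closed[OF assms(2)] coord_closed[OF assms(3)]
  have "c \<otimes> s u v = (\<Oplus>i\<in>{1..int n}. c \<otimes> (u (- i) \<otimes> v i))"
    unfolding s_def by (rule finsum_rdistr) (use assms(1) cc in_I in auto)
  also have "\<dots> = s (c \<odot>\<^bsub>V\<^esub> u) v"
    unfolding s_def by (rule finsum_cong') (use assms(1) cc in_I in \<open>auto simp: m_assoc\<close>)
  finally show "s (c \<odot>\<^bsub>V\<^esub> u) v = c \<otimes> s u v" by simp
  have "c \<otimes> s u v = (\<Oplus>i\<in>{1..int n}. c \<otimes> (u (- i) \<otimes> v i))"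
    unfolding s_def by (rule finsum_rdistr) (use assms(1) cc in_I in auto)
  also have "\<dots> = s u (c \<odot>\<^bsub>V\<^esub> v)"
    unfolding s_def by (rule finsum_cong') (use assms(1) cc in_I in \<open>auto simp: m_lcomm\<close>)
  finally show "s u (c \<odot>\<^bsub>V\<^esub> v) = c \<otimes> s u v" by simp
qed

definition e where "e j = (\<lambda>i\<in>I. if i = j then \<one> else \<zero>)" for j :: int

lemma e_closed: "e j \<in> carrier V" by (auto simp: e_def)

lemma s_e:
  assumes u: "u \<in> carrier V" and j: "j \<in> {1..int n}"
  shows "s u (e j) = u (- j)" "s (e j) u = \<zero>" "s u (e (- j)) = \<zero>" "s (e (- j)) u = u j"
proof -
  note c = coord_closed[OF u]
  have "s u (e j) = (\<Oplus>i\<in>{1..int n}. if j = i then u (- i) else \<zero>)"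
    unfolding s_def by (rule finsum_cong') (use c in_I in \<open>auto simp: e_def\<close>)
  also have "\<dots> = u (- j)" by (rule finsum_singleton) (use j c in_I in auto)
  finally show "s u (e j) = u (- j)" .
  have "s (e (- j)) u = (\<Oplus>i\<in>{1..int n}. if j = i then u i else \<zero>)"
    unfolding s_def by (rule finsum_cong') (use c in_I in \<open>auto simp: e_def\<close>)
  also have "\<dots> = u j" by (rule finsum_singleton) (use j c in_I in auto)
  finally show "s (e (- j)) u = u j" .
  have "s (e j) u = (\<Oplus>i\<in>{1..int n}. \<zero>)"
    unfolding s_def by (rule finsum_cong') (use j c in_I in \<open>auto simp: e_def\<close>)
  then show "s (e j) u = \<zero>" by simp
  have "s u (e (- j)) = (\<Oplus>i\<in>{1..int n}. \<zero>)"
    unfolding s_def by (rule finsum_cong') (use j c in_I in \<open>auto simp: e_def\<close>)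
  then show "s u (e (- j)) = \<zero>" by simp
qed

lemma z_e: "j \<noteq> 0 \<Longrightarrow> z (e j) = \<zero>" by (simp add: z_def e_def)

lemma f_e:
  assumes u: "u \<in> carrier V" and j: "j \<in> {1..int n}"
  shows "f u (e j) = u (- j)" "f u (e (- j)) = u j"
  using s_e[OF assms] z_e[of j] z_e[of "- j"] j coord_closed[OF u] in_I[OF j] z_closed[OF u]
  by (simp_all add: f_def a_minus_def del: coord_simps)

lemma q_closed: "v \<in> carrier V \<Longrightarrow> q v \<in> carrier R" by (simp add: q_def del: coord_simps)

lemma f_closed: "u \<in> carrier V \<Longrightarrow> v \<in> carrier V \<Longrightarrow> f u v \<in> carrier R"
  by (simp add: f_def del: coord_simps)

lemma f_sym: "u \<in> carrier V \<Longrightarrow> v \<in> carrier V \<Longrightarrow> f u v = f v u"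
  by (simp add: f_def a_comm[of "s u v"] m_comm[of "z u"] del: coord_simps)

lemma f_add_r:
  assumes "u \<in> carrier V" "v \<in> carrier V" "w \<in> carrier V" shows "f u (v \<oplus>\<^bsub>V\<^esub> w) = f u v \<oplus> f u w"
  using assms by (simp add: f_def s_add z_add a_minus_def minus_add r_distr a_ac del: coord_simps)

lemma f_smult_r:
  assumes "c \<in> carrier R" "u \<in> carrier V" "v \<in> carrier V" shows "f u (c \<odot>\<^bsub>V\<^esub> v) = c \<otimes> f u v"
  using assms by (simp add: f_def s_smult z_smult a_minus_def minus_add r_distr r_minus m_lcomm del: coord_simps)

lemma f_add_l:
  assumes "u \<in> carrier V" "v \<in> carrier V" "w \<in> carrier V" shows "f (u \<oplus>\<^bsub>V\<^esub> v) w = f u w \<oplus> f v w"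
  using f_add_r[OF assms(3,1,2)] f_sym[OF _ assms(3)] assms V.M.add.m_closed[OF assms(1,2)] by (simp del: coord_simps)

lemma f_smult_l:
  assumes "c \<in> carrier R" "u \<in> carrier V" "v \<in> carrier V" shows "f (c \<odot>\<^bsub>V\<^esub> u) v = c \<otimes> f u v"
  using f_smult_r[OF assms(1,3,2)] f_sym[OF _ assms(3)] assms V.smult_closed[OF assms(1,2)] by (simp del: coord_simps)

lemma f_diag: "v \<in> carrier V \<Longrightarrow> f v v = q v \<oplus> q v"
  by (simp add: f_def q_def a_minus_def minus_add a_ac del: coord_simps)

lemma q_add:
  assumes "u \<in> carrier V" "v \<in> carrier V" shows "q (u \<oplus>\<^bsub>V\<^esub> v) = q u \<oplus> q v \<oplus> f u v"
  using assms
  by (simp add: q_def f_def s_add z_add a_minus_def minus_add r_distr l_distr m_comm[of "z v" "z u"] a_ac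
      del: coord_simps)

lemma q_smult: assumes "c \<in> carrier R" "v \<in> carrier V" shows "q (c \<odot>\<^bsub>V\<^esub> v) = c \<otimes> (c \<otimes> q v)"
  using assms by (simp add: q_def s_smult z_smult a_minus_def r_distr r_minus m_ac del: coord_simps)

definition S where "S = {v \<in> carrier V. q v = \<zero>}"

lemma S_D: assumes "v \<in> S" shows "v \<in> carrier V" "q v = \<zero>"
  using assms unfolding S_def by blast+

lemma zero_coord: assumes "v \<in> carrier V" "\<And>j. j \<in> {1..int n} \<Longrightarrow> v j = \<zero>" "\<And>j. j \<in> {1..int n} \<Longrightarrow> v (- j) = \<zero>"
    "z v = \<zero>" shows "v = \<zero>\<^bsub>V\<^esub>"
proof
  fix i
  consider "i \<notin> I" | "i = 0" "i \<in> I" | "i \<in> {1..int n}" | "- i \<in> {1..int n}" using I by force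
  then show "v i = \<zero>\<^bsub>V\<^esub> i"
  proof cases
    case 1 then show ?thesis using assms(1) by (auto simp: PiE_iff extensional_def)
  next
    case 2 then show ?thesis using assms(4) by (simp add: z_def)
  next
    case 3 then show ?thesis using assms(2) in_I(1) by simp
  next
    case 4 then show ?thesis using assms(3)[of "- i"] in_I(2)[of "- i"] by simp
  qed
qed

text \<open>With all negative coordinates zero, the sum in \<open>q v\<close> disappears, which
  leaves the negative of the square of \<open>z v\<close>.\<close>

lemma z_from_q:
  assumes v: "v \<in> S" and "\<And>j. j \<in> {1..int n} \<Longrightarrow> v (- j) = \<zero>" shows "z v = \<zero>"
proof -
  have c: "v \<in> carrier V" "q v = \<zero>" using v by (auto simp del: coord_simps simp: S_def)
  have "s v v = (\<Oplus>i\<in>{1..int n}. \<zero>)"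
    unfolding s_def by (rule finsum_cong') (use assms(2) coord_closed[OF c(1)] in_I in auto)
  then have "\<ominus> (z v \<otimes> z v) = \<zero>" using c z_closed[OF c(1)] by (simp add: q_def a_minus_def del: coord_simps)
  then show ?thesis using z_closed[OF c(1)] V.minus_nonzero[of "z v \<otimes> z v"] by (simp add: integral_iff del: coord_simps)
qed

sublocale F: bilinear_space R V S f
proof (unfold_locales, goal_cases)
  case (1 u v) then show ?case by (rule f_closed)
next
  case (2 u v w) then show ?case by (rule f_add_l)
next
  case (3 u v w) then show ?case by (rule f_add_r)
next
  case (4 c u v) then show ?case by (rule f_smult_l)
next
  case (5 c u v) then show ?case by (rule f_smult_r)
next
  case (6 u v) then show ?case using f_sym by metis
next
  case 7 show ?case by (auto simp del: coord_simps simp: S_def)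
next
  case 8
  have "q (\<zero> \<odot>\<^bsub>V\<^esub> \<zero>\<^bsub>V\<^esub>) = \<zero>"
    using q_smult[OF zero_closed V.M.zero_closed] q_closed[OF V.M.zero_closed] by simp
  then have "q \<zero>\<^bsub>V\<^esub> = \<zero>" unfolding V.smult_l_null[OF V.M.zero_closed] .
  then show ?case using V.M.zero_closed by (simp add: S_def del: coord_simps)
next
  case (9 a v) then show ?case using q_smult V.smult_closed by (simp add: S_def del: coord_simps)
next
  case (10 u v)
  then have c: "u \<in> carrier V" "v \<in> carrier V" "q u = \<zero>" "q v = \<zero>" by (auto simp del: coord_simps simp: S_def)
  show ?case using q_add[OF c(1,2)] V.M.add.m_closed[OF c(1,2)] c 10 by (simp add: S_def del: coord_simps)
next
  case (11 v) then show ?case using f_diag by (simp add: S_def del: coord_simps)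
next
  case (12 u x)
  then have u: "u \<in> carrier V" "q u = \<zero>" and x: "x \<in> carrier V" "f u x \<noteq> \<zero>" by (auto simp del: coord_simps simp: S_def)
  have fc: "f u x \<in> carrier R" "q x \<in> carrier R" using f_closed q_closed u x by blast+
  \<comment> \<open>The solution of \<open>q (x + c u) = q x + c f u x = 0\<close>, where
    \<open>q u = 0\<close> is used.\<close>
  let ?c = "\<ominus> (q x \<otimes> inv f u x)"
  have cc: "?c \<in> carrier R" using fc x by simp
  note cu = V.smult_closed[OF cc u(1)]
  have "q (x \<oplus>\<^bsub>V\<^esub> ?c \<odot>\<^bsub>V\<^esub> u) = q x \<oplus> ?c \<otimes> f u x"
    using q_add[OF x(1) cu] q_smult[OF cc u(1)] u cc fc f_smult_r[OF cc x(1) u(1)] f_sym[OF x(1) u(1)] by simp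
  also have "\<dots> = q x \<oplus> \<ominus> (q x \<otimes> (inv f u x \<otimes> f u x))" using fc x by (simp add: l_minus m_assoc del: V.inv_mult)
  also have "\<dots> = \<zero>" using fc x by (simp add: r_neg)
  finally show ?case using cc V.M.add.m_closed[OF x(1) cu] unfolding S_def by blast
next
  \<comment> \<open>Orthogonality to the unit vectors removes every coordinate except the one at 0;
    that one is removed by \<open>q v = 0\<close>, also in characteristic 2.\<close>
  case (13 v)
  then have c: "v \<in> carrier V" by (auto simp del: coord_simps simp: S_def)
  have "v (- j) = \<zero>" "v j = \<zero>" if "j \<in> {1..int n}" for j
    using f_e[OF c that] 13(2)[OF e_closed] by simp_all
  then show ?case using zero_coord[OF c] z_from_q[OF 13(1)] by blast
qed

definition M0 where "M0 = {v \<in> I \<rightarrow>\<^sub>E carrier R. \<forall>i\<in>I - {1..int n}. v i = \<zero>}"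

lemma dim_M0: "V.dim n M0"
  using dim_coord_subspace[OF field_axioms, of "{1..int n}" I] in_I(1) by (simp add: M0_def subset_iff)

lemma M0_simps: assumes "v \<in> M0" shows "v \<in> carrier V" "j \<in> {1..int n} \<Longrightarrow> v (- j) = \<zero>" "z v = \<zero>"
  using assms in_I by (auto simp: M0_def z_def)

lemma M0_s: assumes "u \<in> M0" "v \<in> carrier V" shows "s u v = \<zero>"
proof -
  have "s u v = (\<Oplus>i\<in>{1..int n}. \<zero>)"
    unfolding s_def by (rule finsum_cong') (use M0_simps(2)[OF assms(1)] coord_closed[OF assms(2)] in_I in auto)
  then show ?thesis by simp
qed

text \<open>A singular \<open>v\<close> orthogonal to the positive unit vectors has no negative
  coordinates, and then \<open>q v = 0\<close> removes the coordinate at 0.\<close>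

lemma maxtsub_M0: "F.P.maxtsub M0"
  unfolding F.P.maxtsub_def F.P.tsub_def
proof (intro conjI ballI impI subsetI)
  show "V.subsp M0" using V.dim_subsp[OF dim_M0] .
  show "u \<in> S" if u: "u \<in> M0" for u
  proof -
    have "q u = \<zero>"
      using M0_simps(3)[OF u] M0_s[OF u M0_simps(1)[OF u]] by (simp add: q_def a_minus_def del: coord_simps)
    then show ?thesis using M0_simps(1)[OF u] unfolding S_def by blast
  qed
  show "f u v = \<zero>" if uv: "u \<in> M0" "v \<in> M0" for u v
    using M0_simps(1,3)[OF uv(1)] M0_simps(1,3)[OF uv(2)] M0_s[OF uv(1)] M0_s[OF uv(2)]
    by (simp add: f_def a_minus_def del: coord_simps)
  fix v assume v: "v \<in> S" "\<forall>u\<in>M0. f u v = \<zero>"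
  have c: "v \<in> carrier V" using S_D(1)[OF v(1)] .
  have neg: "v (- j) = \<zero>" if j: "j \<in> {1..int n}" for j
  proof -
    have "e j \<in> M0" using j by (auto simp: M0_def e_def)
    then have "f (e j) v = \<zero>" using v by blast
    then show ?thesis using f_e(1)[OF c j] f_sym[OF c e_closed] by simp
  qed
  have zv: "z v = \<zero>" using z_from_q[OF v(1) neg] .
  have "v i = \<zero>" if i: "i \<in> I - {1..int n}" for i
  proof -
    consider "i = 0" "0 \<in> I" | "- i \<in> {1..int n}" using I i by force
    then show ?thesis
    proof cases
      case 1 then show ?thesis using zv by (simp add: z_def)
    next
      case 2 then show ?thesis using neg[of "- i"] by simp
    qed
  qed
  then show "v \<in> M0" using c by (simp add: M0_def)
qed

lemma S_sum: "u \<in> S \<Longrightarrow> v \<in> S \<Longrightarrow> u \<oplus>\<^bsub>V\<^esub> v \<in> S \<Longrightarrow> f u v = \<zero>"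
  using q_add[of u v] f_closed[of u v] S_D[of u] S_D[of v] S_D[of "u \<oplus>\<^bsub>V\<^esub> v"] by (simp del: coord_simps)

lemma geo: "F.P.geo = quadric R V q"
  using F.P.geo_eq_quadric[of q] S_sum S_def by blast

lemma finite_I: "finite I" using I by auto

lemma dim_V: "V.dim (card I) (carrier V)" using dim_coord[OF field_axioms finite_I] .

end

section \<open>Exclusion of the parabolic spaces, and the hyperbolic case\<close>

context setting begin

lemma no_parabolic: "\<not> parabolic_polar_space K n \<Delta>"
proof
  assume par: "parabolic_polar_space K n \<Delta>"
  let ?I = "{- int n..int n}"
  interpret Q: coord_quadric K ?I n using field_K by (simp add: coord_quadric_def coord_quadric_axioms_def)
  have q: "(\<lambda>v. (\<Oplus>i\<in>{1..int n}. v (- i) \<otimes> v i) \<ominus> v 0 \<otimes> v 0) = Q.q"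
    by (simp add: fun_eq_iff Q.q_def Q.s_def Q.z_def)
  obtain \<phi> where \<phi>: "geometry_iso \<phi> \<Delta> Q.F.P.geo" and bl: "blocks \<Delta> \<subseteq> Pow (points \<Delta>)"
    using par unfolding parabolic_polar_space_def q Q.geo isomorphic_def by blast
  have "card ?I = 2 * n + 1" by simp
  then have dV: "Q.V.dim (2 * n + 1) (carrier Q.V)" using Q.dim_V by simp
  interpret X: polar_model K Q.V Q.S "\<lambda>u v. Q.f u v = \<zero>" "2 * n + 1" n Q.M0 \<Delta> \<phi> \<theta>
    by unfold_locales (use dV Q.maxtsub_M0 Q.dim_M0 n4 \<phi> bl coll domestic nofix in \<open>simp_all del: coord_simps\<close>)
  show False using X.odd_dim_impossible[OF dV Q.S_sum] .
qed

lemma hyperbolic_case: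
  assumes "hyperbolic_polar_space K n \<Delta>"
  shows "even n \<and> opposition_diagram_2 n \<Delta> \<theta> \<and>
    (\<exists>(F :: ('a \<times> 'a) ring) m \<Gamma>. field F \<and> m \<ge> 2 \<and>
       (minimal_hermitian_polar_space F m \<Gamma> \<or> mixed_polar_space F m \<Gamma>) \<and>
       fixed_structure \<Delta> \<theta> = singular_geometry \<Gamma>)"
proof -
  let ?I = "{- int n..int n} - {0}"
  interpret Q: coord_quadric K ?I n using field_K by (simp add: coord_quadric_def coord_quadric_axioms_def)
  have q: "Q.q v = (\<Oplus>i\<in>{1..int n}. v (- i) \<otimes> v i)" if "v \<in> carrier Q.V" for v
    using Q.s_closed[OF that that] by (simp add: Q.q_def Q.s_def Q.z_def a_minus_def)
  \<comment> \<open>\<open>Q.q\<close> has been simplified to the plain sum on the carrier only,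
    which is all that \<open>quadric\<close> looks at.\<close>
  have quad: "quadric K Q.V (\<lambda>v. \<Oplus>i\<in>{1..int n}. v (- i) \<otimes> v i) = quadric K Q.V Q.q"
  proof -
    have "v \<in> carrier Q.V - {\<zero>\<^bsub>Q.V\<^esub>} \<and> (\<Oplus>i\<in>{1..int n}. v (- i) \<otimes> v i) = \<zero> \<longleftrightarrow>
      v \<in> carrier Q.V - {\<zero>\<^bsub>Q.V\<^esub>} \<and> Q.q v = \<zero>" for v
    proof (cases "v \<in> carrier Q.V")
      case True show ?thesis unfolding q[OF True] by (rule HOL.refl)
    next
      case False then show ?thesis by blast
    qed
    then show ?thesis unfolding quadric_def by (simp only:)
  qed
  obtain \<phi> where \<phi>: "geometry_iso \<phi> \<Delta> Q.F.P.geo" and bl: "blocks \<Delta> \<subseteq> Pow (points \<Delta>)"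
    using assms unfolding hyperbolic_polar_space_def quad Q.geo isomorphic_def by blast
  have "card ?I = 2 * n" by (simp add: card_Diff_singleton_if)
  then have dV: "Q.V.dim (2 * n) (carrier Q.V)" using Q.dim_V by simp
  interpret X: polar_model K Q.V Q.S "\<lambda>u v. Q.f u v = \<zero>" "2 * n" n Q.M0 \<Delta> \<phi> \<theta>
    by unfold_locales (use dV Q.maxtsub_M0 Q.dim_M0 n4 \<phi> bl coll domestic nofix in \<open>simp_all del: coord_simps\<close>)
  have nd: "u = \<zero>\<^bsub>Q.V\<^esub>" if u: "u \<in> carrier Q.V" and o: "\<And>v. v \<in> carrier Q.V \<Longrightarrow> Q.f u v = \<zero>" for u
  proof (rule Q.zero_coord[OF u])
    show "u j = \<zero>" "u (- j) = \<zero>" if "j \<in> {1..int n}" for j using Q.f_e[OF u that] o[OF Q.e_closed] by simp_all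
    show "Q.z u = \<zero>" by (simp add: Q.z_def)
  qed
  interpret Y: hyp_model K Q.V Q.S "\<lambda>u v. Q.f u v = \<zero>" "2 * n" n Q.M0 \<Delta> \<phi> \<theta> Q.f Q.q
  proof unfold_locales
    show "u = \<zero>\<^bsub>Q.V\<^esub>" if "u \<in> carrier Q.V" "\<And>v. v \<in> carrier Q.V \<Longrightarrow> Q.f u v = \<zero>" for u
      using that by (rule nd)
  qed (rule HOL.refl | fact Q.f_closed Q.f_add_l Q.f_add_r Q.f_smult_l Q.f_smult_r dV Q.S_def Q.q_closed Q.q_add Q.f_sym Q.f_diag)+
  show ?thesis using X.even_rank X.diagram Y.hyperbolic_conclusion by blast
qed

end

theorem theorem6:
  fixes K :: "('a, 'b) ring_scheme"
    and \<Delta> :: "'p geometry"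
    and \<theta> :: "'p \<Rightarrow> 'p"
    and n :: nat
  assumes "field K"
    and "n \<ge> 4"
    and "split_polar_space K n \<Delta>"
    and "collineation \<Delta> \<theta>"
    and "point_domestic \<Delta> \<theta>"
    and "\<forall>x\<in>points \<Delta>. \<theta> x \<noteq> x"
  shows "even n \<and>
    (symplectic_polar_space K n \<Delta> \<and> opposition_diagram_2 n \<Delta> \<theta> \<and>
       (\<exists>(L :: ('a \<times> 'a) ring) m \<Gamma>. quadratic_extension K L \<and> m \<ge> 2 \<and>
          symplectic_polar_space L m \<Gamma> \<and> fixed_structure \<Delta> \<theta> = singular_geometry \<Gamma>)
     \<or>
     hyperbolic_polar_space K n \<Delta> \<and> opposition_diagram_2 n \<Delta> \<theta> \<and>
       (\<exists>(F :: ('a \<times> 'a) ring) m \<Gamma>. field F \<and> m \<ge> 2 \<and>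
          (minimal_hermitian_polar_space F m \<Gamma> \<or> mixed_polar_space F m \<Gamma>) \<and>
          fixed_structure \<Delta> \<theta> = singular_geometry \<Gamma>)) \<and>
    points (fixed_structure \<Delta> \<theta>) = {l \<in> blocks \<Delta>. \<theta> ` l = l}"
proof -
  interpret setting K \<Delta> \<theta> n using assms by (simp add: setting_def)
  have "points (fixed_structure \<Delta> \<theta>) = {l \<in> blocks \<Delta>. \<theta> ` l = l}"
    by (simp add: fixed_structure_def fixed_lines_def)
  moreover from assms(3) no_parabolic consider "symplectic_polar_space K n \<Delta>" | "hyperbolic_polar_space K n \<Delta>"
    unfolding split_polar_space_def by blast
  then have "even n \<and> (symplectic_polar_space K n \<Delta> \<and> opposition_diagram_2 n \<Delta> \<theta> \<and>
       (\<exists>(L :: ('a \<times> 'a) ring) m \<Gamma>. quadratic_extension K L \<and> m \<ge> 2 \<and>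
          symplectic_polar_space L m \<Gamma> \<and> fixed_structure \<Delta> \<theta> = singular_geometry \<Gamma>)
     \<or>
     hyperbolic_polar_space K n \<Delta> \<and> opposition_diagram_2 n \<Delta> \<theta> \<and>
       (\<exists>(F :: ('a \<times> 'a) ring) m \<Gamma>. field F \<and> m \<ge> 2 \<and>
          (minimal_hermitian_polar_space F m \<Gamma> \<or> mixed_polar_space F m \<Gamma>) \<and>
          fixed_structure \<Delta> \<theta> = singular_geometry \<Gamma>))"
  proof cases
    case 1 then show ?thesis using symplectic_case[OF 1] by (intro conjI disjI1) simp_all
  next
    case 2 then show ?thesis using hyperbolic_case[OF 2] by (intro conjI disjI2) simp_all
  qed
  ultimately show ?thesis by blast
qed

end
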